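(* Let $H\in(1/2,1)$ and $F=Z_1^{H,3}$. Fix an integer $m\ge1$ and real functions $h_1,\ldots,h_m\in C_c^\infty(0,1)$ that are orthonormal in $L^2(0,1)$. Set $Q_i=D_{h_i}F$, $1\le i\le m$. Then $(Q_1,\ldots,Q_m)$ has a bounded continuous density $\rho_m$ on $\mathbb R^m$. More precisely, let $N>2m$ be an integer, and for $u=(u_1,\ldots,u_m)$ in the unit sphere $\mathbb S^{m-1}\subset\mathbb R^m$ write $h_u=\sum_{i=1}^mu_ih_i$. If $s_N(A_{h_u})$ denotes the $N$-th singular value of the Hilbert--Schmidt operator $A_{h_u}$ (defined in the context), then \[ c_{m,N}:=\min_{u\in\mathbb S^{m-1}}s_N(A_{h_u})>0, \] and \[ \|\rho_m\|_\infty\le\frac{\pi^{m/2}}{(2\pi)^m(6c_{m,N})^m}\,\frac{\Gamma(N/4-m/2)}{\Gamma(N/4)}, \] where $\Gamma$ is the Euler Gamma function.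
   Context: Let $B=(B(h),h\in\mathfrak H)$ be an isonormal Gaussian process over $\mathfrak H=L^2(\mathbb R)$. $I_q$ denotes the multiple Wiener--It\^o integral of order $q$ with respect to $B$, and $D$ the Malliavin derivative; for $F=I_q(f)$ with symmetric $f\in L^2(\mathbb R^q)$, $D_rF=qI_{q-1}(f(\cdot,r))$, $r\in\mathbb R$. Fix $H\in(1/2,1)$ and put $H_0=1+\frac{H-1}{3}$, $\alpha=2-2H_0=\frac{2(1-H)}3\in(0,1/3)$, $\beta=\frac{1+\alpha}{2}=\frac32-H_0\in(1/2,2/3)$. Write $x_+^{-\beta}=x^{-\beta}$ for $x>0$ and $0$ for $x\le 0$. The third-order Hermite process at time one is $F=Z_1^{H,3}=I_3(f_\alpha)$ with \[ f_\alpha(x_1,x_2,x_3)=c_H\int_0^1\prod_{j=1}^3(s-x_j)_+^{-\beta}\,ds, \] where $c_H>0$ is chosen so that $\mathbb E[F^2]=1$. For real $h\in C_c^\infty(0,1)$, $D_hF=\langle DF,h\rangle_{L^2([0,1])}=\int_0^1h(r)D_rF\,dr$. Put $a_h(s)=\int_0^s h(r)(s-r)^{-\beta}\,dr$, $0<s<1$, and \[ k_h(y,z)=c_H\int_0^1a_h(s)(s-y)_+^{-\beta}(s-z)_+^{-\beta}\,ds,\qquad y,z\in\mathbb R, \] a symmetric element of $L^2(\mathbb R^2)$; one has $D_hF=3I_2(k_h)$. $A_h$ is the Hilbert--Schmidt operator on $L^2(\mathbb R)$ with kernel $k_h$. Singular values are listed in non-increasing order, repeated with multiplicity, $s_1\ge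 s_2\ge\cdots$. *)

theory Defs
  imports "HOL-Probability.Probability"
begin

section \<open>Square-integrable functions\<close>

text \<open>Elements of \<open>L\<^sup>2\<close> are represented by functions; equality in \<open>L\<^sup>2\<close> is equality almost everywhere.\<close>

definition sq_integrable :: "'x measure \<Rightarrow> ('x \<Rightarrow> real) \<Rightarrow> bool" where
  "sq_integrable \<mu> f \<longleftrightarrow> f \<in> borel_measurable \<mu> \<and> integrable \<mu> (\<lambda>x. (f x)\<^sup>2)"

abbreviation L2_real :: "(real \<Rightarrow> real) set" where
  "L2_real \<equiv> {f. sq_integrable lborel f}"

definition L2_tendsto :: "'x measure \<Rightarrow> (nat \<Rightarrow> 'x \<Rightarrow> real) \<Rightarrow> ('x \<Rightarrow> real) \<Rightarrow> bool" where
  "L2_tendsto \<mu> f g \<longleftrightarrow> (\<lambda>n. \<integral>\<^sup>+ x. ennreal ((f n x - g x)\<^sup>2) \<partial>\<mu>) \<longlonglongrightarrow> 0"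

section \<open>Isonormal Gaussian process over \<open>L\<^sup>2(\<real>)\<close>\<close>

definition centered_gaussian :: "'a measure \<Rightarrow> ('a \<Rightarrow> real) \<Rightarrow> bool" where
  "centered_gaussian M X \<longleftrightarrow>
     X \<in> borel_measurable M \<and>
     ((\<exists>\<sigma>>0. distributed M lborel X (\<lambda>x. ennreal (normal_density 0 \<sigma> x))) \<or>
      (AE \<omega> in M. X \<omega> = 0))"

text \<open>\<open>B h\<close> is meaningful only for \<open>h \<in> L2_real\<close>. The covariance identity forces \<open>B h = B g\<close>
  almost surely whenever \<open>h = g\<close> almost everywhere.\<close>

definition isonormal :: "'a measure \<Rightarrow> ((real \<Rightarrow> real) \<Rightarrow> 'a \<Rightarrow> real) \<Rightarrow> bool" where
  "isonormal M B \<longleftrightarrow>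
     (\<forall>(n::nat) (c :: nat \<Rightarrow> real) h. (\<forall>i<n. h i \<in> L2_real) \<longrightarrow>
        centered_gaussian M (\<lambda>\<omega>. \<Sum>i<n. c i * B (h i) \<omega>)) \<and>
     (\<forall>h\<in>L2_real. B h \<in> borel_measurable M) \<and>
     (\<forall>h\<in>L2_real. \<forall>g\<in>L2_real.
        (\<integral>\<omega>. B h \<omega> * B g \<omega> \<partial>M) = (\<integral>x. h x * g x \<partial>lborel))"

section \<open>Multiple Wiener--Ito integrals\<close>

text \<open>The integral is first defined on linear combinations of indicators of products
  \<open>A\<^bsub>i\<^sub>1\<^esub> \<times> \<dots> \<times> A\<^bsub>i\<^sub>q\<^esub>\<close> with pairwise distinct indices, where the \<open>A\<^sub>i\<close> are disjoint of
  finite measure, and then extended by \<open>L\<^sup>2\<close>-continuity. Points of \<open>\<real>\<^sup>q\<close> are functions on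
  \<open>{..<q}\<close>.\<close>

definition leb_pow :: "nat \<Rightarrow> (nat \<Rightarrow> real) measure" where
  "leb_pow q = (\<Pi>\<^sub>M j\<in>{..<q}. lborel)"

definition distinct_indices :: "nat \<Rightarrow> nat \<Rightarrow> (nat \<Rightarrow> nat) set" where
  "distinct_indices q n = {\<iota> \<in> {..<q} \<rightarrow>\<^sub>E {..<n}. inj_on \<iota> {..<q}}"

definition elem_family :: "nat \<Rightarrow> (nat \<Rightarrow> real set) \<Rightarrow> bool" where
  "elem_family n A \<longleftrightarrow>
     (\<forall>i<n. A i \<in> sets lborel \<and> emeasure lborel (A i) < \<infinity>) \<and> disjoint_family_on A {..<n}"

definition elem_fun ::
  "nat \<Rightarrow> nat \<Rightarrow> (nat \<Rightarrow> real set) \<Rightarrow> ((nat \<Rightarrow> nat) \<Rightarrow> real) \<Rightarrow> (nat \<Rightarrow> real) \<Rightarrow> real" where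
  "elem_fun q n A a x =
     (\<Sum>\<iota>\<in>distinct_indices q n. a \<iota> * (\<Prod>j<q. indicator (A (\<iota> j)) (x j)))"

definition elem_integral ::
  "((real \<Rightarrow> real) \<Rightarrow> 'a \<Rightarrow> real) \<Rightarrow> nat \<Rightarrow> nat \<Rightarrow> (nat \<Rightarrow> real set) \<Rightarrow> ((nat \<Rightarrow> nat) \<Rightarrow> real)
    \<Rightarrow> 'a \<Rightarrow> real" where
  "elem_integral B q n A a \<omega> =
     (\<Sum>\<iota>\<in>distinct_indices q n. a \<iota> * (\<Prod>j<q. B (indicator (A (\<iota> j))) \<omega>))"

text \<open>\<open>X\<close> is a version of \<open>I\<^sub>q(f)\<close>.\<close>

definition is_wiener_ito ::
  "'a measure \<Rightarrow> ((real \<Rightarrow> real) \<Rightarrow> 'a \<Rightarrow> real) \<Rightarrow> nat \<Rightarrow> ((nat \<Rightarrow> real) \<Rightarrow> real)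
    \<Rightarrow> ('a \<Rightarrow> real) \<Rightarrow> bool" where
  "is_wiener_ito M B q f X \<longleftrightarrow>
     sq_integrable (leb_pow q) f \<and> sq_integrable M X \<and>
     (\<exists>n A a. (\<forall>k. elem_family (n k) (A k)) \<and>
        L2_tendsto (leb_pow q) (\<lambda>k. elem_fun q (n k) (A k) (a k)) f \<and>
        L2_tendsto M (\<lambda>k. elem_integral B q (n k) (A k) (a k)) X)"

section \<open>Malliavin derivative\<close>

text \<open>A list \<open>[(c\<^sub>1, hs\<^sub>1), \<dots>]\<close> encodes the polynomial functional
  \<open>\<Sum>\<^sub>k c\<^sub>k \<Prod>\<^bsub>h \<in> hs\<^sub>k\<^esub> B(h)\<close>; its derivative is obtained from the Leibniz rule and
  \<open>D\<^sub>r B(h) = h(r)\<close>. The Malliavin derivative is the closure of this operator from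
  \<open>L\<^sup>2(\<Omega>)\<close> to \<open>L\<^sup>2(\<Omega> \<times> \<real>)\<close>.\<close>

type_synonym poly_functional = "(real \<times> (real \<Rightarrow> real) list) list"

definition poly_fun ::
  "((real \<Rightarrow> real) \<Rightarrow> 'a \<Rightarrow> real) \<Rightarrow> poly_functional \<Rightarrow> 'a \<Rightarrow> real" where
  "poly_fun B p \<omega> = (\<Sum>(c, hs)\<leftarrow>p. c * (\<Prod>h\<leftarrow>hs. B h \<omega>))"

definition poly_deriv ::
  "((real \<Rightarrow> real) \<Rightarrow> 'a \<Rightarrow> real) \<Rightarrow> poly_functional \<Rightarrow> 'a \<times> real \<Rightarrow> real" where
  "poly_deriv B p = (\<lambda>(\<omega>, r). \<Sum>(c, hs)\<leftarrow>p.
     c * (\<Sum>j<length hs. (\<Prod>l\<in>{..<length hs} - {j}. B (hs ! l) \<omega>) * (hs ! j) r))"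

text \<open>\<open>F\<close> is in the domain of the Malliavin derivative and \<open>(\<omega>, r) \<mapsto> DF (\<omega>, r)\<close> is a jointly
  measurable version of \<open>D\<^sub>r F (\<omega>)\<close>.\<close>

definition is_malliavin_deriv ::
  "'a measure \<Rightarrow> ((real \<Rightarrow> real) \<Rightarrow> 'a \<Rightarrow> real) \<Rightarrow> ('a \<Rightarrow> real) \<Rightarrow> ('a \<times> real \<Rightarrow> real) \<Rightarrow> bool" where
  "is_malliavin_deriv M B F DF \<longleftrightarrow>
     sq_integrable M F \<and> sq_integrable (M \<Otimes>\<^sub>M lborel) DF \<and>
     (\<exists>p :: nat \<Rightarrow> poly_functional.
        (\<forall>n. \<forall>(c, hs) \<in> set (p n). set hs \<subseteq> L2_real) \<and>
        L2_tendsto M (\<lambda>n. poly_fun B (p n)) F \<and>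
        L2_tendsto (M \<Otimes>\<^sub>M lborel) (\<lambda>n. poly_deriv B (p n)) DF)"

definition dir_deriv :: "('a \<times> real \<Rightarrow> real) \<Rightarrow> (real \<Rightarrow> real) \<Rightarrow> 'a \<Rightarrow> real" where
  "dir_deriv DF h \<omega> = (LINT r:{0..1}|lborel. h r * DF (\<omega>, r))"

section \<open>Singular values of integral operators on \<open>L\<^sup>2(\<real>)\<close>\<close>

definition kernel_op :: "(real \<Rightarrow> real \<Rightarrow> real) \<Rightarrow> (real \<Rightarrow> real) \<Rightarrow> real \<Rightarrow> real" where
  "kernel_op k f y = (\<integral>z. k y z * f z \<partial>lborel)"

text \<open>The eigenspace of \<open>A\<^sup>*A\<close> for the eigenvalue \<open>\<mu>\<close>, where \<open>A\<close> has kernel \<open>k\<close>; the adjoint has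
  the transposed kernel since everything is real.\<close>

definition AstarA_eigenspace :: "(real \<Rightarrow> real \<Rightarrow> real) \<Rightarrow> real \<Rightarrow> (real \<Rightarrow> real) set" where
  "AstarA_eigenspace k \<mu> =
     {f \<in> L2_real. AE z in lborel. kernel_op (\<lambda>z y. k y z) (kernel_op k f) z = \<mu> * f z}"

definition L2_dim :: "(real \<Rightarrow> real) set \<Rightarrow> nat \<Rightarrow> bool" where
  "L2_dim E d \<longleftrightarrow>
     (\<exists>e :: nat \<Rightarrow> real \<Rightarrow> real. (\<forall>i<d. e i \<in> E) \<and>
        (\<forall>i<d. \<forall>j<d. (\<integral>x. e i x * e j x \<partial>lborel) = (if i = j then 1 else 0)) \<and>
        (\<forall>f\<in>E. \<exists>c :: nat \<Rightarrow> real. AE x in lborel. f x = (\<Sum>i<d. c i * e i x)))"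

text \<open>Non-increasing listing, with multiplicity, of the square roots of the eigenvalues of \<open>A\<^sup>*A\<close>.
  The condition on all \<open>t > 0\<close> determines the sequence: after the positive singular values, if they
  are finitely many, it is constantly \<open>0\<close>.\<close>

definition is_singular_seq :: "(real \<Rightarrow> real \<Rightarrow> real) \<Rightarrow> (nat \<Rightarrow> real) \<Rightarrow> bool" where
  "is_singular_seq k s \<longleftrightarrow>
     decseq s \<and> (\<forall>n. 0 \<le> s n) \<and>
     (\<forall>t>0. finite {n. s n = t} \<and> L2_dim (AstarA_eigenspace k (t\<^sup>2)) (card {n. s n = t}))"

text \<open>The singular values are numbered from \<open>1\<close>, the listing from \<open>0\<close>.\<close>

definition singular_value :: "(real \<Rightarrow> real \<Rightarrow> real) \<Rightarrow> nat \<Rightarrow> real" where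
  "singular_value k N = (THE s. is_singular_seq k s) (N - 1)"

section \<open>The third-order Hermite process at time one\<close>

definition hermite_H0 :: "real \<Rightarrow> real" where
  "hermite_H0 H = 1 + (H - 1) / 3"

definition hermite_alpha :: "real \<Rightarrow> real" where
  "hermite_alpha H = 2 - 2 * hermite_H0 H"

definition hermite_beta :: "real \<Rightarrow> real" where
  "hermite_beta H = (1 + hermite_alpha H) / 2"

definition pos_pow :: "real \<Rightarrow> real \<Rightarrow> real" where
  "pos_pow b x = (if 0 < x then x powr (- b) else 0)"

definition hermite_kernel :: "real \<Rightarrow> real \<Rightarrow> (nat \<Rightarrow> real) \<Rightarrow> real" where
  "hermite_kernel H c x =
     c * (LINT s:{0..1}|lborel. \<Prod>j<3. pos_pow (hermite_beta H) (s - x j))"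

definition test_function :: "(real \<Rightarrow> real) \<Rightarrow> bool" where
  "test_function h \<longleftrightarrow>
     (\<forall>k. (deriv ^^ k) h differentiable_on UNIV) \<and>
     compact (closure {x. h x \<noteq> 0}) \<and> closure {x. h x \<noteq> 0} \<subseteq> {0<..<1}"

definition a_fun :: "real \<Rightarrow> (real \<Rightarrow> real) \<Rightarrow> real \<Rightarrow> real" where
  "a_fun H h s = (LINT r:{0..s}|lborel. h r * (s - r) powr (- hermite_beta H))"

definition k_fun :: "real \<Rightarrow> real \<Rightarrow> (real \<Rightarrow> real) \<Rightarrow> real \<Rightarrow> real \<Rightarrow> real" where
  "k_fun H c h y z =
     c * (LINT s:{0..1}|lborel.
            a_fun H h s * pos_pow (hermite_beta H) (s - y) * pos_pow (hermite_beta H) (s - z))"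

end

theory Submission
  imports Defs "HOL-Probability.Probability" "HOL-Real_Asymp.Real_Asymp"
begin

text \<open>Each variable \<open>D\<^sub>h F\<close> lies in the second Wiener chaos: it equals \<open>3 I\<^sub>2(k\<^sub>h)\<close> with a symmetric kernel
\<open>k\<^sub>h\<close>. If \<open>l\<^sub>0, l\<^sub>1, \<dots>\<close> are the eigenvalues of the operator of \<open>k\<^sub>h\<close>, then \<open>D\<^sub>h F\<close> behaves like
\<open>\<Sum>j. 3 l\<^sub>j (X\<^sub>j\<^sup>2 - 1)\<close> with independent standard normal \<open>X\<^sub>j\<close>, and since
\<open>\<bar>E exp(i l X\<^sup>2)\<bar> = (1 + 4 l\<^sup>2)\<close> to the power \<open>- 1/4\<close>, every eigenvalue contributes a factor of decay
\<open>(1 + 36 \<theta>\<^sup>2 l\<^sub>j\<^sup>2)\<close> to the power \<open>- 1/4\<close> to the characteristic function at \<open>\<theta>\<close>. With \<open>N\<close> eigenvalues bounded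
away from \<open>0\<close>, uniformly over the unit sphere of directions \<open>u\<close>, the characteristic function of the vector is
at most \<open>(1 + (6 c \<bar>t\<bar>)\<^sup>2)\<close> to the power \<open>- N/4\<close>. This is integrable on \<open>m\<close>-space for \<open>N > 2 m\<close>; Fourier inversion
gives the density, and the integral of the bound is the stated quotient of Gamma values.

Three points need care.

The chaos representation: \<open>F\<close> is given only as a limit of elementary integrals and its derivative only as
a limit along some polynomial functionals. The derivatives of the elementary integrals
are finite sums of Wick products whose kernels converge to \<open>3 k\<^sub>h\<close> (\<open>chaos_kernel_error\<close>), so they are
Cauchy in mean square; closability of the derivative, obtained from Gaussian integration by parts
(\<open>derivative_closable\<close>), identifies their limit with \<open>D\<^sub>h F\<close>.

The decay: only finitely many eigenvectors are split off. The span of \<open>N\<close> eigenvectors is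
projected out of the approximating Wick sums; what is split off converges to \<open>\<Sum>j<N. l\<^sub>j (X\<^sub>j\<^sup>2 - 1)\<close>, and the rest
is independent of it and only contributes a factor of modulus at most one (\<open>char_bound_second_chaos\<close>).

The positive minimum: singular values are Lipschitz in the operator and the operator is linear in \<open>h\<close>, so the
minimum over the sphere is attained. It is positive because no \<open>A\<^sub>h\<close> with \<open>h \<noteq> 0\<close> has finite rank:
its quadratic form at \<open>f\<close> is \<open>c \<integral> a\<^sub>h (T f)\<^sup>2\<close> for a fractional integral operator \<open>T\<close>, the function \<open>a\<^sub>h\<close> keeps one sign on
some interval, and \<open>T\<close> maps suitable functions to arbitrarily many disjoint triangles inside that
interval (\<open>k_fun_form_definite\<close>).\<close>

(* these names also belong to facts about the gauge integral *)
lemmas integrable_bound = Bochner_Integration.integrable_bound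
  and integral_cong = Bochner_Integration.integral_cong
  and integral_sum = Bochner_Integration.integral_sum
  and integrable_sum = Bochner_Integration.integrable_sum
  and integrable_add = Bochner_Integration.integrable_add
  and integral_add = Bochner_Integration.integral_add
  and integral_diff = Bochner_Integration.integral_diff
  and integrable_diff = Bochner_Integration.integrable_diff
  and integral_nonneg = Bochner_Integration.integral_nonneg
  and integral_zero = Bochner_Integration.integral_zero

section \<open>The Hilbert space of square-integrable functions\<close>

text \<open>A partial equivalence: the functions that are not square-integrable belong to no class, so the quotient is \<open>L\<^sup>2(\<real>)\<close> itself.\<close>

definition l2_rel :: "(real \<Rightarrow> real) \<Rightarrow> (real \<Rightarrow> real) \<Rightarrow> bool" where
  "l2_rel f g \<longleftrightarrow> sq_integrable lborel f \<and> sq_integrable lborel g \<and> (AE x in lborel. f x = g x)"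

lemma sq_integrable_zero: "sq_integrable \<mu> (\<lambda>_. 0)"
  by (simp add: sq_integrable_def)

lemma sq_integrable_cmult: "sq_integrable \<mu> f \<Longrightarrow> sq_integrable \<mu> (\<lambda>x. c * f x)"
  by (auto simp: sq_integrable_def power_mult_distrib)

lemma sq_integrable_mult:
  assumes "sq_integrable \<mu> f" "sq_integrable \<mu> g"
  shows "integrable \<mu> (\<lambda>x. f x * g x)"
proof (rule integrable_bound[of \<mu> "\<lambda>x. (f x)\<^sup>2 + (g x)\<^sup>2"])
  show "integrable \<mu> (\<lambda>x. (f x)\<^sup>2 + (g x)\<^sup>2)" using assms by (auto simp: sq_integrable_def)
  show "(\<lambda>x. f x * g x) \<in> borel_measurable \<mu>" using assms by (auto simp: sq_integrable_def)
  have "\<bar>a * b\<bar> \<le> a\<^sup>2 + b\<^sup>2" for a b :: real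
  proof -
    have "2 * (\<bar>a\<bar> * \<bar>b\<bar>) \<le> \<bar>a\<bar>\<^sup>2 + \<bar>b\<bar>\<^sup>2"
      using sum_squares_bound[of "\<bar>a\<bar>" "\<bar>b\<bar>"] by (simp add: mult.assoc)
    moreover have "0 \<le> \<bar>a\<bar> * \<bar>b\<bar>" by simp
    ultimately have "\<bar>a\<bar> * \<bar>b\<bar> \<le> \<bar>a\<bar>\<^sup>2 + \<bar>b\<bar>\<^sup>2" by linarith
    then show ?thesis by (simp add: abs_mult)
  qed
  then show "AE x in \<mu>. norm (f x * g x) \<le> norm ((f x)\<^sup>2 + (g x)\<^sup>2)"
    by (simp add: abs_of_nonneg)
qed

lemma sq_integrable_add:
  assumes "sq_integrable \<mu> f" "sq_integrable \<mu> g"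
  shows "sq_integrable \<mu> (\<lambda>x. f x + g x)"
  using assms sq_integrable_mult[OF assms]
  unfolding sq_integrable_def power2_sum
  by (auto intro!: integrable_add simp: mult.assoc)

lemma sq_integrable_uminus: "sq_integrable \<mu> f \<Longrightarrow> sq_integrable \<mu> (\<lambda>x. - f x)"
  by (auto simp: sq_integrable_def)

lemma sq_integrable_diff:
  assumes "sq_integrable \<mu> f" "sq_integrable \<mu> g"
  shows "sq_integrable \<mu> (\<lambda>x. f x - g x)"
  using sq_integrable_add[OF assms(1) sq_integrable_uminus[OF assms(2)]] by simp

lemma sq_integrable_sum:
  assumes "\<And>i. i \<in> I \<Longrightarrow> sq_integrable \<mu> (f i)"
  shows "sq_integrable \<mu> (\<lambda>x. \<Sum>i\<in>I. f i x)"
  using assms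
  by (induction I rule: infinite_finite_induct) (auto simp: sq_integrable_zero sq_integrable_add)

lemma part_equivp_l2_rel: "part_equivp l2_rel"
proof (rule part_equivpI)
  show "\<exists>x. l2_rel x x"
    by (intro exI[of _ "\<lambda>_. 0"]) (simp add: l2_rel_def sq_integrable_zero)
  show "symp l2_rel" by (auto simp: symp_def l2_rel_def)
  show "transp l2_rel" by (auto simp: transp_def l2_rel_def)
qed

quotient_type l2 = "real \<Rightarrow> real" / partial: l2_rel
  by (rule part_equivp_l2_rel)

instantiation l2 :: real_vector
begin
lift_definition zero_l2 :: l2 is "\<lambda>_. 0" by (simp add: l2_rel_def sq_integrable_zero)
lift_definition plus_l2 :: "l2 \<Rightarrow> l2 \<Rightarrow> l2" is "\<lambda>f g x. f x + g x"
  by (auto simp: l2_rel_def sq_integrable_add)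
lift_definition uminus_l2 :: "l2 \<Rightarrow> l2" is "\<lambda>f x. - f x"
  by (auto simp: l2_rel_def sq_integrable_uminus)
lift_definition minus_l2 :: "l2 \<Rightarrow> l2 \<Rightarrow> l2" is "\<lambda>f g x. f x - g x"
  by (auto simp: l2_rel_def sq_integrable_diff)
lift_definition scaleR_l2 :: "real \<Rightarrow> l2 \<Rightarrow> l2" is "\<lambda>c f x. c * f x"
  by (auto simp: l2_rel_def sq_integrable_cmult)
instance
  by standard
    (transfer, auto simp: l2_rel_def algebra_simps
      intro!: sq_integrable_add sq_integrable_cmult sq_integrable_uminus sq_integrable_diff sq_integrable_zero)+
end

lift_definition l2_inner :: "l2 \<Rightarrow> l2 \<Rightarrow> real" is "\<lambda>f g. \<integral>x. f x * g x \<partial>lborel"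
  by (rule integral_cong_AE) (auto simp: l2_rel_def sq_integrable_def)

instantiation l2 :: real_inner
begin
definition inner_l2 :: "l2 \<Rightarrow> l2 \<Rightarrow> real" where "inner_l2 = l2_inner"
definition norm_l2 :: "l2 \<Rightarrow> real" where "norm_l2 f = sqrt (f \<bullet> f)"
definition sgn_l2 :: "l2 \<Rightarrow> l2" where "sgn_l2 x = inverse (norm x) *\<^sub>R x"
definition dist_l2 :: "l2 \<Rightarrow> l2 \<Rightarrow> real" where "dist_l2 f g = norm (f - g)"
definition uniformity_l2 :: "(l2 \<times> l2) filter" where
  "uniformity_l2 = (INF e\<in>{0<..}. principal {(x, y). dist x y < e})"
definition open_l2 :: "l2 set \<Rightarrow> bool" where
  "open_l2 U \<longleftrightarrow> (\<forall>x\<in>U. \<forall>\<^sub>F (x', y) in uniformity. x' = x \<longrightarrow> y \<in> U)"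
instance
proof
  fix x y z :: l2 and r :: real
  show "sgn x = x /\<^sub>R norm x" by (simp add: sgn_l2_def)
  show "dist x y = norm (x - y)" by (rule dist_l2_def)
  show "(uniformity :: (l2 \<times> l2) filter) = (INF e\<in>{0<..}. principal {(x, y). dist x y < e})"
    by (rule uniformity_l2_def)
  show "open U \<longleftrightarrow> (\<forall>x\<in>U. \<forall>\<^sub>F (x', y) in uniformity. x' = x \<longrightarrow> y \<in> U)" for U :: "l2 set"
    by (rule open_l2_def)
  show "norm x = sqrt (x \<bullet> x)" by (rule norm_l2_def)
  show "x \<bullet> y = y \<bullet> x" unfolding inner_l2_def by transfer (simp add: mult.commute)
  show "(x + y) \<bullet> z = x \<bullet> z + y \<bullet> z" unfolding inner_l2_def
    by transfer (auto simp: distrib_right l2_rel_def sq_integrable_mult)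
  show "(r *\<^sub>R x) \<bullet> y = r * (x \<bullet> y)" unfolding inner_l2_def
    by transfer (auto simp: mult.assoc l2_rel_def)
  show "0 \<le> x \<bullet> x" unfolding inner_l2_def by transfer simp
  show "(x \<bullet> x = 0) = (x = 0)" unfolding inner_l2_def
  proof transfer
    fix f assume f: "l2_rel f f"
    have "(\<integral>x. f x * f x \<partial>lborel) = 0 \<longleftrightarrow> (AE x in lborel. f x * f x = 0)"
      using f by (intro integral_nonneg_eq_0_iff_AE) (auto simp: l2_rel_def sq_integrable_mult)
    then show "((\<integral>x. f x * f x \<partial>lborel) = 0) = l2_rel f (\<lambda>_. 0)"
      using f by (auto simp: l2_rel_def sq_integrable_zero)
  qed
qed
end

definition l2_of :: "(real \<Rightarrow> real) \<Rightarrow> l2" where "l2_of = abs_l2"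
definition fun_of :: "l2 \<Rightarrow> real \<Rightarrow> real" where "fun_of = rep_l2"

lemma sq_integrable_fun_of [simp]: "sq_integrable lborel (fun_of F)"
  using Quotient3_rep_reflp[OF Quotient3_l2, of F] by (simp add: fun_of_def l2_rel_def)

lemma borel_measurable_fun_of [measurable]: "fun_of F \<in> borel_measurable borel"
  using sq_integrable_fun_of[of F] by (simp add: sq_integrable_def)

lemma l2_of_fun_of [simp]: "l2_of (fun_of F) = F"
  using Quotient3_abs_rep[OF Quotient3_l2] by (simp add: fun_of_def l2_of_def)

lemma l2_of_eq_iff:
  assumes "sq_integrable lborel f" "sq_integrable lborel g"
  shows "l2_of f = l2_of g \<longleftrightarrow> (AE x in lborel. f x = g x)"
  using Quotient3_rel[OF Quotient3_l2, of f g] assms by (auto simp: l2_of_def l2_rel_def)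

lemma fun_of_l2_of:
  assumes "sq_integrable lborel f"
  shows "AE x in lborel. fun_of (l2_of f) x = f x"
  using assms l2_of_eq_iff[of "fun_of (l2_of f)" f] by simp

lemma l2_of_zero: "l2_of (\<lambda>_. 0) = 0"
  by (simp add: l2_of_def zero_l2.abs_eq)

lemma l2_of_add:
  assumes "sq_integrable lborel f" "sq_integrable lborel g"
  shows "l2_of (\<lambda>x. f x + g x) = l2_of f + l2_of g"
  using assms by (simp add: l2_of_def plus_l2.abs_eq eq_onp_def l2_rel_def)

lemma l2_of_diff:
  assumes "sq_integrable lborel f" "sq_integrable lborel g"
  shows "l2_of (\<lambda>x. f x - g x) = l2_of f - l2_of g"
  using assms by (simp add: l2_of_def minus_l2.abs_eq eq_onp_def l2_rel_def)

lemma l2_of_scaleR: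
  assumes "sq_integrable lborel f"
  shows "l2_of (\<lambda>x. c * f x) = c *\<^sub>R l2_of f"
  using assms by (simp add: l2_of_def scaleR_l2.abs_eq eq_onp_def l2_rel_def)

lemma l2_of_sum:
  assumes "\<And>i. i \<in> I \<Longrightarrow> sq_integrable lborel (f i)"
  shows "l2_of (\<lambda>x. \<Sum>i\<in>I. f i x) = (\<Sum>i\<in>I. l2_of (f i))"
  using assms
  by (induction I rule: infinite_finite_induct) (auto simp: l2_of_zero l2_of_add sq_integrable_sum)

lemma inner_l2_of:
  assumes "sq_integrable lborel f" "sq_integrable lborel g"
  shows "l2_of f \<bullet> l2_of g = (\<integral>x. f x * g x \<partial>lborel)"
  using assms by (simp add: l2_of_def inner_l2_def l2_inner.abs_eq eq_onp_def l2_rel_def)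

lemma inner_l2_fun_of: "F \<bullet> G = (\<integral>x. fun_of F x * fun_of G x \<partial>lborel)"
  using inner_l2_of[of "fun_of F" "fun_of G"] by simp

lemma norm_l2_of:
  assumes "sq_integrable lborel f"
  shows "ennreal ((norm (l2_of f))\<^sup>2) = (\<integral>\<^sup>+x. ennreal ((f x)\<^sup>2) \<partial>lborel)"
  using assms by (simp add: power2_norm_eq_inner inner_l2_of nn_integral_eq_integral sq_integrable_def
      flip: power2_eq_square)

lemma sq_integrable_iff_nn_integral:
  "sq_integrable \<mu> f \<longleftrightarrow> f \<in> borel_measurable \<mu> \<and> (\<integral>\<^sup>+x. ennreal ((f x)\<^sup>2) \<partial>\<mu>) < \<infinity>"
  by (auto simp: sq_integrable_def integrable_iff_bounded)

text \<open>Riesz--Fischer for rapidly converging sequences: the weights \<open>2 ^ n\<close> in front of the squared increments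
keep their sum integrable, so the increments are dominated almost everywhere by a geometric sequence and the
pointwise limit exists.\<close>

lemma l2_summable_increments_convergent:
  fixes X :: "nat \<Rightarrow> l2"
  assumes X: "\<And>n. norm (X (Suc n) - X n) \<le> (1/2) ^ n"
  assumes C: "Cauchy X"
  shows "convergent X"
proof -
  define f where "f n = fun_of (X n)" for n
  have f [measurable]: "f n \<in> borel_measurable borel" for n by (simp add: f_def)
  have sq: "sq_integrable lborel (f n)" for n by (simp add: f_def)
  have Xf: "X n = l2_of (f n)" for n by (simp add: f_def)
  have dist: "ennreal ((norm (X m - X n))\<^sup>2) = (\<integral>\<^sup>+x. ennreal ((f m x - f n x)\<^sup>2) \<partial>lborel)" for m n
    by (simp add: Xf l2_of_diff[symmetric] sq norm_l2_of sq_integrable_diff)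
  define D where "D n x = ennreal (2 ^ n * (f (Suc n) x - f n x)\<^sup>2)" for n x
  have D [measurable]: "D n \<in> borel_measurable borel" for n unfolding D_def by measurable
  have intD: "(\<integral>\<^sup>+x. D n x \<partial>lborel) \<le> ennreal ((1/2) ^ n)" for n
  proof -
    have "(\<integral>\<^sup>+x. D n x \<partial>lborel) = ennreal (2 ^ n) * ennreal ((norm (X (Suc n) - X n))\<^sup>2)"
      by (simp add: D_def dist ennreal_mult nn_integral_cmult)
    also have "\<dots> \<le> ennreal (2 ^ n) * ennreal (((1/2) ^ n)\<^sup>2)"
      by (intro mult_left_mono ennreal_leI power_mono X) auto
    also have "\<dots> = ennreal ((1/2) ^ n)"
      by (simp add: ennreal_mult[symmetric] power2_eq_square power_mult_distrib[symmetric] mult.assoc[symmetric])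
    finally show ?thesis .
  qed
  have "(\<integral>\<^sup>+x. (\<Sum>n. D n x) \<partial>lborel) = (\<Sum>n. \<integral>\<^sup>+x. D n x \<partial>lborel)"
    by (rule nn_integral_suminf) simp
  also have "\<dots> \<le> (\<Sum>n. ennreal ((1/2) ^ n))" by (intro suminf_le intD summableI)
  also have "\<dots> = ennreal (\<Sum>n. (1/2) ^ n)" by (rule suminf_ennreal2) auto
  also have "\<dots> < \<infinity>" by simp
  finally have "(\<integral>\<^sup>+x. (\<Sum>n. D n x) \<partial>lborel) < \<infinity>" .
  then have "AE x in lborel. (\<Sum>n. D n x) \<noteq> \<infinity>"
    by (intro nn_integral_PInf_AE) auto
  then have conv: "AE x in lborel. convergent (\<lambda>n. f n x)"
  proof (rule AE_mp, intro AE_I2 impI)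
    fix x assume fin: "(\<Sum>n. D n x) \<noteq> \<infinity>"
    then obtain S where S: "(\<Sum>n. D n x) = ennreal S" "S \<ge> 0"
      by (cases "(\<Sum>n. D n x)") auto
    have bnd: "\<bar>f (Suc n) x - f n x\<bar> \<le> sqrt S * (sqrt (1/2)) ^ n" for n
    proof -
      have "D n x \<le> (\<Sum>n. D n x)"
        using sum_le_suminf[of "\<lambda>n. D n x" "{n}"] by (simp add: summableI)
      then have "2 ^ n * (f (Suc n) x - f n x)\<^sup>2 \<le> S"
        using S by (simp add: D_def)
      then have "(f (Suc n) x - f n x)\<^sup>2 \<le> S * (1/2) ^ n"
        by (simp add: field_simps)
      then have "sqrt ((f (Suc n) x - f n x)\<^sup>2) \<le> sqrt (S * (1/2) ^ n)"
        by (rule real_sqrt_le_mono)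
      then show ?thesis unfolding real_sqrt_abs by (simp add: real_sqrt_mult real_sqrt_power)
    qed
    have "summable (\<lambda>n. f (Suc n) x - f n x)"
    proof (rule summable_comparison_test'[where N = 0])
      show "summable (\<lambda>n. sqrt S * (sqrt (1/2)) ^ n)"
        by (intro summable_mult summable_geometric) (simp add: real_sqrt_divide)
      show "norm (f (Suc n) x - f n x) \<le> sqrt S * (sqrt (1/2)) ^ n" if "n \<ge> 0" for n
        using bnd[of n] by simp
    qed
    then have "convergent (\<lambda>n. \<Sum>i<n. (f (Suc i) x - f i x))"
      by (simp add: summable_iff_convergent)
    then have "convergent (\<lambda>n. f n x - f 0 x)"
      unfolding sum_lessThan_telescope[of "\<lambda>i. f i x"] .
    then have "convergent (\<lambda>n. (f n x - f 0 x) + f 0 x)"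
      by (rule convergent_add) (rule convergent_const)
    then show "convergent (\<lambda>n. f n x)" by simp
  qed
  define g where "g x = lim (\<lambda>n. f n x)" for x
  have g [measurable]: "g \<in> borel_measurable borel"
    unfolding g_def using f by (intro borel_measurable_lim_metric) simp
  have Fatou: "(\<integral>\<^sup>+x. ennreal ((g x - f n x)\<^sup>2) \<partial>lborel) \<le> ennreal (e\<^sup>2)"
    if e: "\<And>m. m \<ge> N \<Longrightarrow> norm (X m - X n) \<le> e" for n N e
  proof -
    have "(\<integral>\<^sup>+x. ennreal ((g x - f n x)\<^sup>2) \<partial>lborel)
        = (\<integral>\<^sup>+x. liminf (\<lambda>m. ennreal ((f m x - f n x)\<^sup>2)) \<partial>lborel)"
    proof (rule nn_integral_cong_AE, rule AE_mp[OF conv], rule AE_I2, rule impI)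
      fix x assume "convergent (\<lambda>n. f n x)"
      then have "(\<lambda>m. f m x) \<longlonglongrightarrow> g x" by (simp add: g_def convergent_LIMSEQ_iff)
      then have "(\<lambda>m. ennreal ((f m x - f n x)\<^sup>2)) \<longlonglongrightarrow> ennreal ((g x - f n x)\<^sup>2)"
        by (intro tendsto_ennrealI tendsto_intros)
      then show "ennreal ((g x - f n x)\<^sup>2) = liminf (\<lambda>m. ennreal ((f m x - f n x)\<^sup>2))"
        by (rule lim_imp_Liminf[OF trivial_limit_sequentially, symmetric])
    qed
    also have "\<dots> \<le> liminf (\<lambda>m. \<integral>\<^sup>+x. ennreal ((f m x - f n x)\<^sup>2) \<partial>lborel)"
      by (rule nn_integral_liminf) simp
    also have "\<dots> = liminf (\<lambda>m. ennreal ((norm (X m - X n))\<^sup>2))" by (simp add: dist)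
    also have "\<dots> \<le> ennreal (e\<^sup>2)"
    proof -
      have "liminf (\<lambda>m. ennreal ((norm (X m - X n))\<^sup>2)) \<le> liminf (\<lambda>m. ennreal (e\<^sup>2))"
        by (rule Liminf_mono) (auto simp: eventually_sequentially intro!: exI[of _ N] ennreal_leI power_mono e)
      then show ?thesis by (simp add: Liminf_const)
    qed
    finally show ?thesis .
  qed
  have Ceps: "\<exists>N. \<forall>m\<ge>N. \<forall>n\<ge>N. norm (X m - X n) \<le> e" if "e > 0" for e
    using C that unfolding Cauchy_def dist_norm by (meson less_imp_le)
  obtain N1 where N1: "\<forall>m\<ge>N1. \<forall>n\<ge>N1. norm (X m - X n) \<le> 1" using Ceps[of 1] by auto
  have "sq_integrable lborel (\<lambda>x. g x - f N1 x)"
    using Fatou[of N1 N1 1] N1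
    by (auto simp: sq_integrable_iff_nn_integral less_top[symmetric] top_unique)
  then have sqg: "sq_integrable lborel g"
    using sq_integrable_add[of lborel "\<lambda>x. g x - f N1 x" "f N1"] sq[of N1] by simp
  have "X \<longlonglongrightarrow> l2_of g"
  proof (rule LIMSEQ_I)
    fix r :: real assume r: "0 < r"
    obtain N where N: "\<forall>m\<ge>N. \<forall>n\<ge>N. norm (X m - X n) \<le> r / 2" using Ceps[of "r/2"] r by auto
    have "norm (X n - l2_of g) < r" if n: "n \<ge> N" for n
    proof -
      have "ennreal ((norm (l2_of g - X n))\<^sup>2) = (\<integral>\<^sup>+x. ennreal ((g x - f n x)\<^sup>2) \<partial>lborel)"
        by (simp add: Xf l2_of_diff[symmetric] sq sqg norm_l2_of sq_integrable_diff)
      also have "\<dots> \<le> ennreal ((r/2)\<^sup>2)" by (rule Fatou[of N]) (use N n in blast)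
      finally have "(norm (l2_of g - X n))\<^sup>2 \<le> (r/2)\<^sup>2"
        by (subst (asm) ennreal_le_iff) (rule zero_le_power2)
      then have "norm (l2_of g - X n) \<le> r / 2" by (rule power2_le_imp_le) (use r in simp)
      then show ?thesis using r by (simp add: norm_minus_commute)
    qed
    then show "\<exists>no. \<forall>n\<ge>no. norm (X n - l2_of g) < r" by blast
  qed
  then show ?thesis by (auto simp: convergent_def)
qed

instance l2 :: complete_space
proof
  fix X :: "nat \<Rightarrow> l2" assume C: "Cauchy X"
  have "\<exists>N. \<forall>m\<ge>N. \<forall>n\<ge>N. norm (X m - X n) < (1/2) ^ k" for k
    using C unfolding Cauchy_def dist_norm by simp
  then obtain N where N: "\<And>k m n. m \<ge> N k \<Longrightarrow> n \<ge> N k \<Longrightarrow> norm (X m - X n) < (1/2) ^ k" by metis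
  define r where "r = rec_nat (N 0) (\<lambda>k p. max (Suc p) (N (Suc k)))"
  have r0: "r 0 = N 0" and rS: "r (Suc k) = max (Suc (r k)) (N (Suc k))" for k by (auto simp: r_def)
  have mono: "strict_mono r" by (rule strict_monoI_Suc) (simp add: rS)
  have rN: "r k \<ge> N k" for k by (cases k) (auto simp: r0 rS)
  have "Cauchy (X \<circ> r)" using C mono by (rule Cauchy_subseq_Cauchy)
  moreover have "norm ((X \<circ> r) (Suc k) - (X \<circ> r) k) \<le> (1/2) ^ k" for k
  proof -
    have "N k \<le> r (Suc k)" using rN[of k] rS[of k] by linarith
    from N[OF this rN[of k]] show ?thesis by simp
  qed
  ultimately have "convergent (X \<circ> r)" by (intro l2_summable_increments_convergent) auto
  then obtain l where "(X \<circ> r) \<longlonglongrightarrow> l" by (auto simp: convergent_def)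
  then have "X \<longlonglongrightarrow> l" by (metis Cauchy_converges_subseq C mono)
  then show "convergent X" by (auto simp: convergent_def)
qed

section \<open>Spectral sequences of self-adjoint operators\<close>

text \<open>Dimension counting is done throughout with this lemma: among \<open>n + 1\<close> vectors some nontrivial
combination is orthogonal to \<open>n\<close> given ones.\<close>

lemma underdetermined_system:
  fixes a :: "nat \<Rightarrow> nat \<Rightarrow> real"
  shows "\<exists>c. (\<exists>j\<le>n. c j \<noteq> 0) \<and> (\<forall>i<n. (\<Sum>j\<le>n. c j * a i j) = 0)"
proof (induction n arbitrary: a)
  case 0
  show ?case by (intro exI[of _ "\<lambda>_. 1"]) auto
next
  case (Suc n)
  show ?case
  proof (cases "\<forall>i<Suc n. a i (Suc n) = 0")
    case True
    then show ?thesis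
      by (intro exI[of _ "\<lambda>j. if j = Suc n then 1 else 0"]) auto
  next
    case False
    then obtain p where p: "p < Suc n" "a p (Suc n) \<noteq> 0" by auto
    \<comment> \<open>eliminate the last unknown by means of equation \<open>p\<close>, and skip that equation\<close>
    define \<sigma> where "\<sigma> i = (if i < p then i else Suc i)" for i
    define b where "b i j = a (\<sigma> i) j - a (\<sigma> i) (Suc n) / a p (Suc n) * a p j" for i j
    obtain c where c: "\<exists>j\<le>n. c j \<noteq> 0" "\<forall>i<n. (\<Sum>j\<le>n. c j * b i j) = 0"
      using Suc.IH[of b] by blast
    define d where "d j = (if j = Suc n then - (\<Sum>j\<le>n. c j * a p j) / a p (Suc n) else c j)" for j
    have sum: "(\<Sum>j\<le>Suc n. d j * a i j)
        = (\<Sum>j\<le>n. c j * a i j) - a i (Suc n) / a p (Suc n) * (\<Sum>j\<le>n. c j * a p j)" for i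
    proof -
      have "(\<Sum>j\<le>n. d j * a i j) = (\<Sum>j\<le>n. c j * a i j)" by (intro sum.cong) (auto simp: d_def)
      then show ?thesis by (simp add: d_def)
    qed
    have "(\<Sum>j\<le>Suc n. d j * a i j) = 0" if i: "i < Suc n" for i
    proof (cases "i = p")
      case True then show ?thesis unfolding sum using p by simp
    next
      case False
      then obtain i' where i': "i' < n" "\<sigma> i' = i"
      proof (cases "i < p")
        case True then show ?thesis using p that[of i] by (simp add: \<sigma>_def)
      next
        case F: False
        then show ?thesis using False i that[of "i - 1"] by (auto simp: \<sigma>_def)
      qed
      have "(\<Sum>j\<le>n. c j * b i' j) = 0" using c i' by auto
      then show ?thesis
        unfolding sum by (simp add: b_def i' algebra_simps sum_subtractf sum_distrib_left)
    qed
    moreover obtain j where "j \<le> n" "c j \<noteq> 0" using c(1) by blast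
    then have "j \<le> Suc n" "d j \<noteq> 0" by (auto simp: d_def)
    ultimately show ?thesis by blast
  qed
qed

text \<open>Compactness in the form in which Hilbert--Schmidt operators provide it, as norm limits of operators of finite rank.\<close>

definition finite_rank_approx :: "('a::real_inner \<Rightarrow> 'a) \<Rightarrow> bool" where
  "finite_rank_approx A \<longleftrightarrow>
     (\<forall>\<epsilon>>0. \<exists>(n::nat) u v. \<forall>x. norm (A x - (\<Sum>i<n. (u i \<bullet> x) *\<^sub>R v i)) \<le> \<epsilon> * norm x)"

lemma compact_segment_multiples:
  fixes v :: "'a::real_inner"
  shows "compact ((\<lambda>c. c *\<^sub>R v) ` {-C..C})"
  by (intro compact_continuous_image continuous_intros) auto

lemma compact_bounded_combinations:
  fixes v :: "nat \<Rightarrow> 'a::real_inner"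
  shows "compact {x. \<exists>c. (\<forall>i<n. \<bar>c i\<bar> \<le> C i) \<and> x = (\<Sum>i<n. c i *\<^sub>R v i)}"
proof (induction n)
  case 0
  have "{x. \<exists>c. (\<forall>i<0. \<bar>c i\<bar> \<le> C i) \<and> x = (\<Sum>i<0. c i *\<^sub>R v i)} = {0}" by auto
  then show ?case by (simp only: compact_sing)
next
  case (Suc n)
  have "{x. \<exists>c. (\<forall>i<Suc n. \<bar>c i\<bar> \<le> C i) \<and> x = (\<Sum>i<Suc n. c i *\<^sub>R v i)}
      = {x + y |x y. x \<in> {x. \<exists>c. (\<forall>i<n. \<bar>c i\<bar> \<le> C i) \<and> x = (\<Sum>i<n. c i *\<^sub>R v i)} \<and>
           y \<in> (\<lambda>c. c *\<^sub>R v n) ` {- C n..C n}}" (is "?L = ?R")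
  proof
    show "?L \<subseteq> ?R"
    proof
      fix z assume "z \<in> ?L"
      then obtain c where c: "\<forall>i<Suc n. \<bar>c i\<bar> \<le> C i" and z: "z = (\<Sum>i<n. c i *\<^sub>R v i) + c n *\<^sub>R v n"
        by auto
      have "c n \<in> {- C n..C n}" using c by (auto simp: abs_le_iff)
      then have "c n *\<^sub>R v n \<in> (\<lambda>c. c *\<^sub>R v n) ` {- C n..C n}" by (rule imageI)
      moreover have "(\<Sum>i<n. c i *\<^sub>R v i) \<in> {x. \<exists>c. (\<forall>i<n. \<bar>c i\<bar> \<le> C i) \<and> x = (\<Sum>i<n. c i *\<^sub>R v i)}"
        using c less_SucI by blast
      ultimately show "z \<in> ?R" using z by blast
    qed
    show "?R \<subseteq> ?L"
    proof
      fix z assume "z \<in> ?R"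
      then obtain c d where c: "\<forall>i<n. \<bar>c i\<bar> \<le> C i" and d: "- C n \<le> d" "d \<le> C n"
        and z: "z = (\<Sum>i<n. c i *\<^sub>R v i) + d *\<^sub>R v n" by auto
      have "z = (\<Sum>i<Suc n. (c(n := d)) i *\<^sub>R v i)" by (simp add: z)
      moreover have "\<forall>i<Suc n. \<bar>(c(n := d)) i\<bar> \<le> C i" using c d by (auto simp: less_Suc_eq abs_le_iff)
      ultimately show "z \<in> ?L" by blast
    qed
  qed
  then show ?case using compact_sums[OF Suc compact_segment_multiples] by simp
qed

text \<open>A bounded sequence has a relatively compact image: the image lies within \<open>\<epsilon>\<close> of the compact set of bounded
combinations of finitely many vectors, hence is totally bounded.\<close>

lemma finite_rank_approx_subseq:
  fixes A :: "'a::{real_inner, complete_space} \<Rightarrow> 'a" and x :: "nat \<Rightarrow> 'a"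
  assumes A: "finite_rank_approx A" and x: "\<And>n. norm (x n) \<le> 1"
  shows "\<exists>r y. strict_mono r \<and> (\<lambda>n. A (x (r n))) \<longlonglongrightarrow> y"
proof -
  define S where "S = closure (A ` cball 0 1)"
  have "\<exists>K. finite K \<and> S \<subseteq> (\<Union>z\<in>K. ball z e)" if e: "e > 0" for e :: real
  proof -
    obtain n u v where R: "\<And>x. norm (A x - (\<Sum>i<(n::nat). (u i \<bullet> x) *\<^sub>R v i)) \<le> (e/4) * norm x"
      using A e unfolding finite_rank_approx_def by (metis zero_less_divide_iff zero_less_numeral)
    define T where "T = {x. \<exists>c. (\<forall>i<n. \<bar>c i\<bar> \<le> norm (u i)) \<and> x = (\<Sum>i<n. c i *\<^sub>R v i)}"
    have "compact T" unfolding T_def by (rule compact_bounded_combinations)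
    then obtain K where K: "finite K" "T \<subseteq> (\<Union>z\<in>K. ball z (e/4))"
      using e unfolding compact_eq_totally_bounded by (metis zero_less_divide_iff zero_less_numeral)
    have "A ` cball 0 1 \<subseteq> (\<Union>z\<in>K. cball z (e/2))"
    proof safe
      fix x :: 'a assume "x \<in> cball 0 1"
      then have nx: "norm x \<le> 1" by simp
      define y where "y = (\<Sum>i<n. (u i \<bullet> x) *\<^sub>R v i)"
      have "\<bar>u i \<bullet> x\<bar> \<le> norm (u i)" for i
        using Cauchy_Schwarz_ineq2[of "u i" x] mult_left_mono[OF nx, of "norm (u i)"] by simp
      then have "y \<in> T" unfolding T_def y_def mem_Collect_eq
        by (intro exI[of _ "\<lambda>i. u i \<bullet> x"] conjI allI impI refl)
      then obtain z where z: "z \<in> K" "dist z y < e/4" using K by auto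
      have "dist (A x) y \<le> (e/4) * norm x" using R[of x] by (simp add: y_def dist_norm)
      also have "\<dots> \<le> e/4" using mult_left_mono[OF nx, of "e/4"] e by simp
      finally have "dist (A x) y \<le> e/4" .
      then have "dist z (A x) \<le> e/2" using z(2) dist_triangle[of z "A x" y] by (simp add: dist_commute)
      then show "A x \<in> (\<Union>z\<in>K. cball z (e/2))" using z(1) by auto
    qed
    moreover have "closed (\<Union>z\<in>K. cball z (e/2))" using K by auto
    ultimately have "S \<subseteq> (\<Union>z\<in>K. cball z (e/2))" unfolding S_def by (rule closure_minimal)
    also have "\<dots> \<subseteq> (\<Union>z\<in>K. ball z e)" using e by (force simp: subset_iff)
    finally show ?thesis using K by blast
  qed
  then have "compact S"
    unfolding compact_eq_totally_bounded by (simp add: S_def complete_eq_closed)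
  then have seq: "seq_compact S" by (simp add: compact_eq_seq_compact_metric)
  have AS: "A (x n) \<in> S" for n
  proof -
    have "A (x n) \<in> A ` cball 0 1" using x by simp
    then show ?thesis unfolding S_def by (rule subsetD[OF closure_subset])
  qed
  show ?thesis using spec[OF seq[unfolded seq_compact_def], of "\<lambda>n. A (x n)"] AS
    by (auto simp: comp_def)
qed

lemma finite_rank_approx_deflate:
  assumes "finite_rank_approx A"
  shows "finite_rank_approx (\<lambda>x. A x - l *\<^sub>R (e \<bullet> x) *\<^sub>R e)"
  unfolding finite_rank_approx_def
proof (intro allI impI)
  fix \<epsilon> :: real assume "\<epsilon> > 0"
  then obtain n u v where R: "\<And>x. norm (A x - (\<Sum>i<(n::nat). (u i \<bullet> x) *\<^sub>R v i)) \<le> \<epsilon> * norm x"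
    using assms unfolding finite_rank_approx_def by blast
  have "(\<Sum>i<Suc n. ((u(n := e)) i \<bullet> x) *\<^sub>R (v(n := (-l) *\<^sub>R e)) i)
      = (\<Sum>i<n. (u i \<bullet> x) *\<^sub>R v i) - l *\<^sub>R (e \<bullet> x) *\<^sub>R e" for x
  proof -
    have "(\<Sum>i<n. ((u(n := e)) i \<bullet> x) *\<^sub>R (v(n := (-l) *\<^sub>R e)) i) = (\<Sum>i<n. (u i \<bullet> x) *\<^sub>R v i)"
      by (intro sum.cong) auto
    then show ?thesis by (simp add: mult.commute)
  qed
  then have "norm (A x - l *\<^sub>R (e \<bullet> x) *\<^sub>R e
      - (\<Sum>i<Suc n. ((u(n := e)) i \<bullet> x) *\<^sub>R (v(n := (-l) *\<^sub>R e)) i)) \<le> \<epsilon> * norm x" for x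
    using R[of x] by (simp add: algebra_simps)
  then show "\<exists>(n::nat) u v. \<forall>x. norm (A x - l *\<^sub>R (e \<bullet> x) *\<^sub>R e - (\<Sum>i<n. (u i \<bullet> x) *\<^sub>R v i)) \<le> \<epsilon> * norm x"
    by blast
qed

text \<open>A maximizing sequence \<open>x\<close> for the operator norm \<open>s\<close> satisfies \<open>A (A x) - s\<^sup>2 x \<longlonglongrightarrow> 0\<close>, and compactness turns its images
into an eigenvector of \<open>A\<^sup>2\<close> for \<open>s\<^sup>2\<close>. The factorization \<open>(A - s) (A + s)\<close> then yields one of \<open>A\<close> for \<open>s\<close> or \<open>- s\<close>.\<close>

lemma top_eigenvector:
  fixes A :: "'a::{real_inner, complete_space} \<Rightarrow> 'a"
  assumes lin: "bounded_linear A" and sym: "\<And>x y. A x \<bullet> y = x \<bullet> A y" and cpt: "finite_rank_approx A"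
  shows "\<exists>l e. \<bar>l\<bar> = onorm A \<and> A e = l *\<^sub>R e \<and> (if l = 0 then e = 0 else norm e = 1)"
proof (cases "onorm A = 0")
  case True
  then show ?thesis using linear_0[OF bounded_linear.linear[OF lin]] by (intro exI[of _ 0] exI[of _ 0]) (auto simp: linear_simps)
next
  case False
  interpret A: bounded_linear A by (rule lin)
  define s where "s = onorm A"
  have s: "s > 0" using False onorm_pos_le[OF lin] by (simp add: s_def)
  have le: "norm (A x) \<le> s * norm x" for x unfolding s_def by (rule onorm[OF lin])
  have "\<exists>x. norm x = 1 \<and> norm (A x) \<ge> s - s / (real n + 2)" for n
  proof (rule ccontr)
    assume "\<not> ?thesis"
    then have *: "norm (A x) < s - s / (real n + 2)" if "norm x = 1" for x using that by force
    have "norm (A x) \<le> (s - s / (real n + 2)) * norm x" for x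
    proof (cases "x = 0")
      case False
      then have "norm (A (x /\<^sub>R norm x)) < s - s / (real n + 2)" by (intro *) simp
      then show ?thesis using False by (simp add: A.scaleR field_simps)
    qed simp
    moreover have "0 \<le> s - s / (real n + 2)" using s by (simp add: field_simps)
    ultimately have "onorm A \<le> s - s / (real n + 2)" by (intro onorm_bound) auto
    then have "s \<le> s - s / (real n + 2)" by (simp add: s_def)
    moreover have "s / (real n + 2) > 0" using s by simp
    ultimately show False by simp
  qed
  then obtain x where x: "\<And>n. norm (x n) = 1" "\<And>n. norm (A (x n)) \<ge> s - s / (real n + 2)" by metis
  have "(\<lambda>n. norm (A (x n))) \<longlonglongrightarrow> s"
  proof (rule tendsto_sandwich)
    show "(\<lambda>n. s - s / (real n + 2)) \<longlonglongrightarrow> s" by real_asymp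
    show "(\<lambda>_. s) \<longlonglongrightarrow> s" by simp
  qed (use x le[of "x _"] in auto)
  obtain r y where r: "strict_mono r" and y: "(\<lambda>n. A (x (r n))) \<longlonglongrightarrow> y"
    using finite_rank_approx_subseq[OF cpt, of x] x by force
  have nA: "(\<lambda>n. norm (A (x (r n)))) \<longlonglongrightarrow> s"
    using LIMSEQ_subseq_LIMSEQ[OF \<open>(\<lambda>n. norm (A (x n))) \<longlonglongrightarrow> s\<close> r] by (simp add: comp_def)
  have bnd: "(norm (A (A (x n)) - s\<^sup>2 *\<^sub>R x n))\<^sup>2 \<le> s\<^sup>2 * (s\<^sup>2 - (norm (A (x n)))\<^sup>2)" for n
  proof -
    have xx: "x n \<bullet> x n = 1" using x(1)[of n] by (simp add: dot_square_norm)
    have "(norm (A (A (x n)) - s\<^sup>2 *\<^sub>R x n))\<^sup>2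
        = (norm (A (A (x n))))\<^sup>2 - 2 * s\<^sup>2 * (A (A (x n)) \<bullet> x n) + s\<^sup>2 * s\<^sup>2"
      unfolding power2_norm_eq_inner
      by (simp add: inner_diff_left inner_diff_right xx inner_commute[of "x n" "A (A (x n))"] right_diff_distrib power2_eq_square)
    also have "A (A (x n)) \<bullet> x n = (norm (A (x n)))\<^sup>2" unfolding sym power2_norm_eq_inner ..
    also have "(norm (A (A (x n))))\<^sup>2 \<le> s\<^sup>2 * (norm (A (x n)))\<^sup>2"
      using power_mono[OF le[of "A (x n)"], of 2] by (simp add: power_mult_distrib)
    finally show ?thesis by (simp add: algebra_simps)
  qed
  have "(\<lambda>n. s\<^sup>2 * (s\<^sup>2 - (norm (A (x (r n))))\<^sup>2)) \<longlonglongrightarrow> s\<^sup>2 * (s\<^sup>2 - s\<^sup>2)" by (intro tendsto_intros nA)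
  then have lim0: "(\<lambda>n. s\<^sup>2 * (s\<^sup>2 - (norm (A (x (r n))))\<^sup>2)) \<longlonglongrightarrow> 0" by simp
  have "(\<lambda>n. (norm (A (A (x (r n))) - s\<^sup>2 *\<^sub>R x (r n)))\<^sup>2) \<longlonglongrightarrow> 0"
    by (rule tendsto_sandwich[OF _ _ tendsto_const lim0]) (simp_all add: bnd)
  then have "(\<lambda>n. sqrt ((norm (A (A (x (r n))) - s\<^sup>2 *\<^sub>R x (r n)))\<^sup>2)) \<longlonglongrightarrow> sqrt 0"
    by (rule tendsto_real_sqrt)
  then have "(\<lambda>n. A (A (x (r n))) - s\<^sup>2 *\<^sub>R x (r n)) \<longlonglongrightarrow> 0"
    by (simp add: tendsto_norm_zero_iff)
  then have "(\<lambda>n. (1 / s\<^sup>2) *\<^sub>R (A (A (x (r n))) - (A (A (x (r n))) - s\<^sup>2 *\<^sub>R x (r n)))) \<longlonglongrightarrow> (1 / s\<^sup>2) *\<^sub>R (A y - 0)"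
    by (intro tendsto_intros A.tendsto y)
  then have xl: "(\<lambda>n. x (r n)) \<longlonglongrightarrow> (1 / s\<^sup>2) *\<^sub>R A y" using s by simp
  define z where "z = (1 / s\<^sup>2) *\<^sub>R A y"
  have Az: "A z = y" using LIMSEQ_unique[OF A.tendsto[OF xl] y] by (simp add: z_def)
  have AAz: "A (A z) = s\<^sup>2 *\<^sub>R z" unfolding Az using s by (simp add: z_def)
  have nz: "norm z = 1" 
  proof -
    have "(\<lambda>n. norm (x (r n))) \<longlonglongrightarrow> norm z" using tendsto_norm[OF xl] by (simp only: z_def)
    then show ?thesis by (simp add: x(1) LIMSEQ_const_iff)
  qed
  show ?thesis
  proof (cases "A z + s *\<^sub>R z = 0")
    case True
    then have "A z = (- s) *\<^sub>R z" by (simp add: eq_neg_iff_add_eq_0)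
    then show ?thesis using nz s by (intro exI[of _ "- s"] exI[of _ z]) (simp add: s_def)
  next
    case False
    define v where "v = A z + s *\<^sub>R z"
    have "A v = s *\<^sub>R v" by (simp add: v_def A.add A.scaleR AAz scaleR_add_right power2_eq_square)
    then have "A (v /\<^sub>R norm v) = s *\<^sub>R (v /\<^sub>R norm v)" by (simp add: A.scaleR)
    moreover have "norm (v /\<^sub>R norm v) = 1" using False by (simp add: v_def)
    ultimately show ?thesis using s by (intro exI[of _ s] exI[of _ "v /\<^sub>R norm v"]) (simp add: s_def)
  qed
qed

text \<open>The eigenvalues in decreasing modulus. When they are exhausted the sequence continues with zeros, whose
vectors need not be orthonormal; the last clause says that deflating \<open>n\<close> eigenvectors leaves norm at most \<open>\<bar>l n\<bar>\<close>.\<close>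

definition spectral_seq :: "('a::real_inner \<Rightarrow> 'a) \<Rightarrow> (nat \<Rightarrow> real) \<Rightarrow> (nat \<Rightarrow> 'a) \<Rightarrow> bool" where
  "spectral_seq A l e \<longleftrightarrow>
     decseq (\<lambda>n. \<bar>l n\<bar>) \<and> l \<longlonglongrightarrow> 0 \<and> (\<forall>n. A (e n) = l n *\<^sub>R e n) \<and>
     (\<forall>i j. l i \<noteq> 0 \<longrightarrow> e i \<bullet> e j = (if i = j then 1 else 0)) \<and>
     (\<forall>n x. norm (A x - (\<Sum>i<n. (l i * (e i \<bullet> x)) *\<^sub>R e i)) \<le> \<bar>l n\<bar> * norm x)"

text \<open>Top eigenvectors are removed one after the other. The moduli decrease to \<open>0\<close> because otherwise infinitely
many orthogonal images would stay a fixed distance apart, against compactness.\<close>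

theorem spectral_seq_exists:
  fixes A :: "'a::{real_inner, complete_space} \<Rightarrow> 'a"
  assumes lin: "bounded_linear A" and sym: "\<And>x y. A x \<bullet> y = x \<bullet> A y" and cpt: "finite_rank_approx A"
  shows "\<exists>l e. spectral_seq A l e"
proof -
  define top where "top T l e \<longleftrightarrow> \<bar>l\<bar> = onorm T \<and> T e = l *\<^sub>R e \<and> (if l = 0 then e = 0 else norm e = 1)"
    for T :: "'a \<Rightarrow> 'a" and l :: real and e :: 'a
  define good where "good T \<longleftrightarrow> bounded_linear T \<and> (\<forall>x y. T x \<bullet> y = x \<bullet> T y) \<and> finite_rank_approx T"
    for T :: "'a \<Rightarrow> 'a"
  obtain fl fe where pick: "\<And>T. good T \<Longrightarrow> top T (fl T) (fe T)"
    using top_eigenvector unfolding good_def top_def by metis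
  define defl where "defl T x = T x - fl T *\<^sub>R (fe T \<bullet> x) *\<^sub>R fe T" for T :: "'a \<Rightarrow> 'a" and x
  define T where "T n = (defl ^^ n) A" for n
  define l where "l n = fl (T n)" for n
  define e where "e n = fe (T n)" for n
  have T0: "T 0 = A" and TS: "T (Suc n) x = T n x - l n *\<^sub>R (e n \<bullet> x) *\<^sub>R e n" for n x
    by (simp_all add: T_def defl_def l_def e_def)
  have good: "good (T n)" for n
  proof (induction n)
    case 0 then show ?case using assms by (simp add: T0 good_def)
  next
    case (Suc n)
    have eq: "T (Suc n) = (\<lambda>x. T n x - l n *\<^sub>R (e n \<bullet> x) *\<^sub>R e n)" by (rule ext) (rule TS)
    have "bounded_linear (\<lambda>x. T n x - l n *\<^sub>R (e n \<bullet> x) *\<^sub>R e n)"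
      using Suc unfolding good_def
      by (intro bounded_linear_sub bounded_linear_const_scaleR bounded_linear_scaleR_const bounded_linear_inner_right) auto
    moreover have "(T n x - l n *\<^sub>R (e n \<bullet> x) *\<^sub>R e n) \<bullet> y = x \<bullet> (T n y - l n *\<^sub>R (e n \<bullet> y) *\<^sub>R e n)" for x y
      using Suc by (simp add: good_def inner_diff_left inner_diff_right inner_commute)
    ultimately show ?case
      using Suc finite_rank_approx_deflate by (auto simp: good_def eq)
  qed
  have top: "\<bar>l n\<bar> = onorm (T n)" "T n (e n) = l n *\<^sub>R e n" "l n = 0 \<Longrightarrow> e n = 0" "l n \<noteq> 0 \<Longrightarrow> norm (e n) = 1" for n
    using pick[OF good[of n]] by (auto simp: top_def l_def e_def split: if_splits)
  have lin: "bounded_linear (T n)" and symT: "T n x \<bullet> y = x \<bullet> T n y" for n x y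
    using good[of n] by (auto simp: good_def)
  have Tsum: "T n x = A x - (\<Sum>i<n. (l i * (e i \<bullet> x)) *\<^sub>R e i)" for n x
    by (induction n) (auto simp: T0 TS)
  have kill: "T n (e i) = 0 \<and> e i \<bullet> e n = 0" if "i < n" for i n
    using that
  proof (induction n arbitrary: i)
    case (Suc n)
    have kn: "T n (e i) = 0" "e i \<bullet> e n = 0" if "i < n" for i using Suc.IH that by auto
    have K: "T (Suc n) (e i) = 0" if "i < Suc n" for i
    proof (cases "i = n")
      case True
      then show ?thesis using top(2)[of n] top(4)[of n]
        by (cases "l n = 0") (auto simp: TS dot_square_norm)
    next
      case False
      then show ?thesis using kn[of i] that by (simp add: TS inner_commute)
    qed
    have "l (Suc n) * (e i \<bullet> e (Suc n)) = e i \<bullet> T (Suc n) (e (Suc n))" by (simp add: top(2))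
    also have "\<dots> = T (Suc n) (e i) \<bullet> e (Suc n)" by (simp add: symT)
    also have "\<dots> = 0" using K[OF Suc.prems] by simp
    finally show ?case using K[OF Suc.prems] top(3)[of "Suc n"] by auto
  qed simp
  have orth: "e i \<bullet> e j = (if i = j then 1 else 0)" if "l i \<noteq> 0" for i j
    using kill[of i j] kill[of j i] top(4)[OF that]
    by (cases i j rule: linorder_cases) (auto simp: inner_commute dot_square_norm)
  have Ae: "A (e n) = l n *\<^sub>R e n" for n
  proof -
    have "(\<Sum>i<n. (l i * (e i \<bullet> e n)) *\<^sub>R e i) = 0" using kill by (intro sum.neutral) auto
    then show ?thesis using Tsum[of n "e n"] top(2)[of n] by simp
  qed
  have dec: "decseq (\<lambda>n. \<bar>l n\<bar>)"
  proof (rule decseq_SucI)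
    fix n
    have "norm (T (Suc n) x) \<le> \<bar>l n\<bar> * norm x" for x
    proof -
      interpret bounded_linear "T n" by (rule lin)
      define y where "y = x - (e n \<bullet> x) *\<^sub>R e n"
      have "T (Suc n) x = T n y" by (simp add: y_def TS diff scaleR top(2))
      also have "norm \<dots> \<le> \<bar>l n\<bar> * norm y" unfolding top(1) by (rule onorm[OF lin])
      also have "(norm y)\<^sup>2 \<le> (norm x)\<^sup>2"
      proof (cases "e n = 0")
        case False
        then have "norm (e n) = 1" using top(3,4)[of n] by blast
        then have "e n \<bullet> e n = 1" by (simp add: dot_square_norm)
        then have "(norm y)\<^sup>2 = (norm x)\<^sup>2 - (e n \<bullet> x)\<^sup>2"
          unfolding y_def power2_norm_eq_inner
          by (simp add: inner_diff_left inner_diff_right inner_commute power2_eq_square)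
        then show ?thesis by simp
      qed (simp add: y_def)
      then have "norm y \<le> norm x" by (rule power2_le_imp_le) simp
      then have "\<bar>l n\<bar> * norm y \<le> \<bar>l n\<bar> * norm x" by (intro mult_left_mono) auto
      finally show ?thesis .
    qed
    then show "\<bar>l (Suc n)\<bar> \<le> \<bar>l n\<bar>" unfolding top(1)[of "Suc n"] by (intro onorm_bound) auto
  qed
  have "l \<longlonglongrightarrow> 0"
  proof (rule ccontr)
    assume "\<not> l \<longlonglongrightarrow> 0"
    then obtain d where d: "d > 0" "\<And>N. \<exists>n\<ge>N. \<bar>l n\<bar> \<ge> d" unfolding LIMSEQ_iff by (auto simp: not_less)
    have ld: "\<bar>l n\<bar> \<ge> d" for n using d(2)[of n] dec unfolding decseq_def by (meson order_trans)
    then have l0: "l n \<noteq> 0" for n using d(1) by (metis abs_zero not_less)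
    obtain r y where r: "strict_mono r" and y: "(\<lambda>n. A (e (r n))) \<longlonglongrightarrow> y"
      using finite_rank_approx_subseq[OF cpt, of e] top(4)[OF l0] by force
    have "Cauchy (\<lambda>n. A (e (r n)))" using y by (rule LIMSEQ_imp_Cauchy)
    then obtain N where N: "dist (A (e (r N))) (A (e (r (Suc N)))) < d"
      using d(1) unfolding Cauchy_def by (metis le_Suc_eq order_refl)
    have ne: "r N \<noteq> r (Suc N)" using r by (metis strict_mono_eq n_not_Suc_n)
    have "d\<^sup>2 \<le> (l (r N))\<^sup>2 + (l (r (Suc N)))\<^sup>2"
      using power_mono[OF ld[of "r N"], of 2] d(1) by (simp add: add_increasing2)
    also have "\<dots> = (dist (A (e (r N))) (A (e (r (Suc N)))))\<^sup>2"
      unfolding dist_norm power2_norm_eq_inner Ae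
      using orth[OF l0, of "r N"] orth[OF l0, of "r (Suc N)"] ne
      by (simp add: inner_diff_left inner_diff_right power2_eq_square)
    also have "\<dots> < d\<^sup>2" using N by (intro power_strict_mono) auto
    finally show False by simp
  qed
  moreover have "norm (A x - (\<Sum>i<n. (l i * (e i \<bullet> x)) *\<^sub>R e i)) \<le> \<bar>l n\<bar> * norm x" for n x
    using onorm[OF lin[of n], of x] by (simp add: Tsum top(1))
  ultimately show ?thesis using dec Ae orth unfolding spectral_seq_def by blast
qed

lemma orthonormal_combination_norm:
  fixes e :: "nat \<Rightarrow> 'a::real_inner"
  assumes "\<And>i j. i \<le> n \<Longrightarrow> j \<le> n \<Longrightarrow> e i \<bullet> e j = (if i = j then 1 else 0)"
  shows "(norm (\<Sum>i\<le>n. c i *\<^sub>R e i))\<^sup>2 = (\<Sum>i\<le>n. (c i)\<^sup>2)"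
proof -
  have "(norm (\<Sum>i\<le>n. c i *\<^sub>R e i))\<^sup>2 = (\<Sum>i\<le>n. \<Sum>j\<le>n. c i * (c j * (e i \<bullet> e j)))"
    unfolding power2_norm_eq_inner inner_sum_left inner_sum_right inner_scaleR_left inner_scaleR_right
      sum_distrib_left by (simp add: inner_commute)
  also have "\<dots> = (\<Sum>i\<le>n. \<Sum>j\<le>n. if i = j then (c i)\<^sup>2 else 0)"
    by (intro sum.cong) (auto simp: assms power2_eq_square)
  finally show ?thesis by simp
qed

text \<open>Weyl's inequality: among the first \<open>n + 1\<close> eigenvectors of \<open>A\<close> some combination is orthogonal to the first \<open>n\<close>
of \<open>A'\<close>; on it \<open>A\<close> expands by at least \<open>\<bar>l n\<bar>\<close> and \<open>A'\<close> by at most \<open>\<bar>l' n\<bar>\<close>.\<close>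

lemma spectral_seq_perturbation:
  assumes A: "spectral_seq A l e" "bounded_linear A" and A': "spectral_seq A' l' e'"
    and d: "\<And>x. norm (A x - A' x) \<le> d * norm x" and d0: "0 \<le> d"
  shows "\<bar>l n\<bar> \<le> \<bar>l' n\<bar> + d"
proof (cases "l n = 0")
  case True
  then show ?thesis using d0 by simp
next
  case False
  interpret bounded_linear A by (rule A(2))
  have dec: "\<bar>l n\<bar> \<le> \<bar>l i\<bar>" if "i \<le> n" for i using A(1) that by (simp add: spectral_seq_def decseq_def)
  then have l0: "l i \<noteq> 0" if "i \<le> n" for i using that False by (metis abs_le_zero_iff abs_zero)
  have orth: "e i \<bullet> e j = (if i = j then 1 else 0)" if "i \<le> n" for i j
    using A(1) l0[OF that] by (simp add: spectral_seq_def)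
  obtain c where c: "\<exists>j\<le>n. c j \<noteq> 0" "\<forall>i<n. (\<Sum>j\<le>n. c j * (e' i \<bullet> e j)) = 0"
    using underdetermined_system[of n "\<lambda>i j. e' i \<bullet> e j"] by blast
  define x where "x = (\<Sum>j\<le>n. c j *\<^sub>R e j)"
  have nx: "(norm x)\<^sup>2 = (\<Sum>j\<le>n. (c j)\<^sup>2)" unfolding x_def by (rule orthonormal_combination_norm) (rule orth)
  obtain j where j: "j \<le> n" "c j \<noteq> 0" using c(1) by blast
  have "0 < (c j)\<^sup>2" using j by simp
  also have "(c j)\<^sup>2 \<le> (\<Sum>j\<le>n. (c j)\<^sup>2)" by (rule member_le_sum) (use j in auto)
  finally have x0: "norm x > 0" unfolding nx[symmetric] by simp
  have "e' i \<bullet> x = 0" if "i < n" for i using c(2) that by (simp add: x_def inner_sum_right)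
  then have "(\<Sum>i<n. (l' i * (e' i \<bullet> x)) *\<^sub>R e' i) = 0" by (intro sum.neutral) simp
  moreover have "norm (A' x - (\<Sum>i<n. (l' i * (e' i \<bullet> x)) *\<^sub>R e' i)) \<le> \<bar>l' n\<bar> * norm x"
    using A' by (simp add: spectral_seq_def)
  ultimately have A'x: "norm (A' x) \<le> \<bar>l' n\<bar> * norm x" by simp
  have Ax: "A x = (\<Sum>j\<le>n. (c j * l j) *\<^sub>R e j)"
    using A(1) by (simp add: x_def sum scaleR spectral_seq_def)
  have "(\<bar>l n\<bar> * norm x)\<^sup>2 = (\<Sum>j\<le>n. (c j)\<^sup>2 * \<bar>l n\<bar>\<^sup>2)" by (simp add: power_mult_distrib nx sum_distrib_left mult.commute)
  also have "\<dots> \<le> (\<Sum>j\<le>n. (c j)\<^sup>2 * \<bar>l j\<bar>\<^sup>2)"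
    by (intro sum_mono mult_left_mono power_mono dec) auto
  also have "\<dots> = (norm (A x))\<^sup>2"
    unfolding Ax by (subst orthonormal_combination_norm) (auto simp: orth power_mult_distrib)
  finally have "\<bar>l n\<bar> * norm x \<le> norm (A x)" by (rule power2_le_imp_le) simp
  also have "\<dots> \<le> norm (A' x) + norm (A x - A' x)" using norm_triangle_sub[of "A x" "A' x"] by simp
  also have "\<dots> \<le> (\<bar>l' n\<bar> + d) * norm x" using A'x d[of x] by (simp add: distrib_right)
  finally show ?thesis using x0 by simp
qed

text \<open>If \<open>l n\<close> vanished, \<open>A\<close> would have rank at most \<open>n\<close> and its form would vanish on a nonzero vector of any space
of dimension \<open>n + 1\<close>.\<close>

lemma spectral_seq_nonzero:
  assumes A: "spectral_seq A l e"
    and f: "\<And>c. (\<exists>j\<le>n. c j \<noteq> 0) \<Longrightarrow> A (\<Sum>j\<le>n. c j *\<^sub>R f j) \<bullet> (\<Sum>j\<le>n. c j *\<^sub>R f j) \<noteq> 0"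
  shows "l n \<noteq> 0"
proof
  assume l: "l n = 0"
  obtain c where c: "\<exists>j\<le>n. c j \<noteq> 0" "\<forall>i<n. (\<Sum>j\<le>n. c j * (e i \<bullet> f j)) = 0"
    using underdetermined_system[of n "\<lambda>i j. e i \<bullet> f j"] by blast
  define x where "x = (\<Sum>j\<le>n. c j *\<^sub>R f j)"
  have ex: "e i \<bullet> x = 0" if "i < n" for i using c(2) that by (simp add: x_def inner_sum_right)
  have "norm (A x - (\<Sum>i<n. (l i * (e i \<bullet> x)) *\<^sub>R e i)) \<le> \<bar>l n\<bar> * norm x"
    using A by (simp add: spectral_seq_def)
  moreover have "(\<Sum>i<n. (l i * (e i \<bullet> x)) *\<^sub>R e i) = 0" by (intro sum.neutral) (simp add: ex)
  ultimately have "A x = 0" using l by simp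
  then show False using f[OF c(1)] by (simp add: x_def)
qed

text \<open>Eigenvectors of \<open>A\<^sup>2\<close> for \<open>t\<^sup>2\<close> are spanned by those \<open>e i\<close> with \<open>\<bar>l i\<bar> = t\<close>; so the multiplicity of the singular
value \<open>t\<close> can be read off from the spectral sequence.\<close>

lemma spectral_seq_square_eigenvector:
  assumes A: "spectral_seq A l e" "bounded_linear A" and sym: "\<And>x y. A x \<bullet> y = x \<bullet> A y"
    and t: "t > 0" and f: "A (A f) = t\<^sup>2 *\<^sub>R f"
  shows "f = (\<Sum>i\<in>{i. \<bar>l i\<bar> = t}. (e i \<bullet> f) *\<^sub>R e i)"
proof -
  interpret bounded_linear A by (rule A(2))
  have dec: "decseq (\<lambda>n. \<bar>l n\<bar>)" and lim: "l \<longlonglongrightarrow> 0" and Ae: "A (e n) = l n *\<^sub>R e n"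
    and orth: "l i \<noteq> 0 \<Longrightarrow> e i \<bullet> e j = (if i = j then 1 else 0)"
    and bnd: "norm (A x - (\<Sum>i<n. (l i * (e i \<bullet> x)) *\<^sub>R e i)) \<le> \<bar>l n\<bar> * norm x" for n i j x
    using A(1) by (auto simp: spectral_seq_def)
  obtain n where n: "\<bar>l n\<bar> < t" using lim t unfolding LIMSEQ_iff by force
  have sub: "{i. \<bar>l i\<bar> = t} \<subseteq> {..<n}"
  proof safe
    fix i assume "t = \<bar>l i\<bar>"
    then show "i < n" using n decseqD[OF dec, of n i] by (cases "i < n") auto
  qed
  have ef: "e i \<bullet> f = 0" if "\<bar>l i\<bar> \<noteq> t" for i
  proof -
    have "t\<^sup>2 * (e i \<bullet> f) = e i \<bullet> A (A f)" by (simp add: f)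
    also have "\<dots> = A (A (e i)) \<bullet> f" by (simp add: sym)
    also have "\<dots> = (l i)\<^sup>2 * (e i \<bullet> f)" by (simp add: Ae scaleR power2_eq_square)
    finally have "(t\<^sup>2 - (l i)\<^sup>2) * (e i \<bullet> f) = 0" by (simp add: algebra_simps)
    moreover have "t\<^sup>2 - (l i)\<^sup>2 \<noteq> 0" using that t by (auto simp: power2_eq_iff abs_if)
    ultimately show ?thesis by simp
  qed
  define S where "S = {i. \<bar>l i\<bar> = t}"
  have finS: "finite S" unfolding S_def using sub by (rule finite_subset) simp
  define g where "g = f - (\<Sum>i\<in>S. (e i \<bullet> f) *\<^sub>R e i)"
  have AAg: "A (A g) = t\<^sup>2 *\<^sub>R g"
  proof -
    have "l i * l i = t\<^sup>2" if "i \<in> S" for i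
      using that by (auto simp: S_def power2_eq_square)
    then have "(\<Sum>i\<in>S. (e i \<bullet> f) *\<^sub>R (l i * l i) *\<^sub>R e i) = (\<Sum>i\<in>S. (e i \<bullet> f) *\<^sub>R t\<^sup>2 *\<^sub>R e i)"
      by (intro sum.cong) auto
    moreover have "A (A (\<Sum>i\<in>S. (e i \<bullet> f) *\<^sub>R e i)) = (\<Sum>i\<in>S. (e i \<bullet> f) *\<^sub>R (l i * l i) *\<^sub>R e i)"
      by (simp add: sum scaleR Ae mult.assoc)
    moreover have "(\<Sum>i\<in>S. (e i \<bullet> f) *\<^sub>R t\<^sup>2 *\<^sub>R e i) = t\<^sup>2 *\<^sub>R (\<Sum>i\<in>S. (e i \<bullet> f) *\<^sub>R e i)"
      by (simp add: scaleR_sum_right mult.commute)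
    ultimately have "A (A (\<Sum>i\<in>S. (e i \<bullet> f) *\<^sub>R e i)) = t\<^sup>2 *\<^sub>R (\<Sum>i\<in>S. (e i \<bullet> f) *\<^sub>R e i)" by simp
    then show ?thesis by (simp add: g_def diff f scaleR_diff_right)
  qed
  have eg: "e i \<bullet> g = 0" for i
  proof (cases "i \<in> S")
    case True
    have "(\<Sum>j\<in>S. (e j \<bullet> f) * (e i \<bullet> e j)) = (\<Sum>j\<in>S. if i = j then e i \<bullet> f else 0)"
      using True t by (intro sum.cong refl) (auto simp: orth S_def)
    then show ?thesis using True finS by (simp add: g_def inner_diff_right inner_sum_right)
  next
    case False
    have "(\<Sum>j\<in>S. (e j \<bullet> f) * (e i \<bullet> e j)) = 0"
      using False t by (intro sum.neutral) (auto simp: S_def orth inner_commute[of "e i"])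
    then show ?thesis using False ef[of i] by (simp add: g_def inner_diff_right inner_sum_right S_def)
  qed
  have bound: "norm (A x) \<le> \<bar>l n\<bar> * norm x" if "\<And>i. e i \<bullet> x = 0" for x
    using bnd[of x n] that by simp
  have eAg: "e i \<bullet> A g = 0" for i using eg[of i] by (simp add: sym[symmetric] Ae)
  have "t\<^sup>2 * norm g = norm (A (A g))" by (simp add: AAg)
  also have "\<dots> \<le> \<bar>l n\<bar> * norm (A g)" by (rule bound[OF eAg])
  also have "\<dots> \<le> \<bar>l n\<bar> * (\<bar>l n\<bar> * norm g)" by (intro mult_left_mono bound eg) simp
  finally have "(t\<^sup>2 - \<bar>l n\<bar>\<^sup>2) * norm g \<le> 0" by (simp add: algebra_simps power2_eq_square)
  moreover have "\<bar>l n\<bar>\<^sup>2 < t\<^sup>2" using n by (intro power_strict_mono) auto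
  ultimately have "g = 0" by (simp add: mult_le_0_iff)
  then show ?thesis by (simp add: g_def S_def)
qed

section \<open>Integral operators and their singular values\<close>

lemma square_integral_mult_le:
  assumes f: "sq_integrable \<mu> f" and g: "sq_integrable \<mu> g"
  shows "(\<integral>x. f x * g x \<partial>\<mu>)\<^sup>2 \<le> (\<integral>x. (f x)\<^sup>2 \<partial>\<mu>) * (\<integral>x. (g x)\<^sup>2 \<partial>\<mu>)"
proof -
  have int: "integrable \<mu> (\<lambda>x. (f x)\<^sup>2)" "integrable \<mu> (\<lambda>x. (g x)\<^sup>2)"
    and m: "f \<in> borel_measurable \<mu>" "g \<in> borel_measurable \<mu>"
    using f g by (auto simp: sq_integrable_def)
  have I: "integrable \<mu> (\<lambda>x. \<bar>f x\<bar> * \<bar>g x\<bar>)"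
    using integrable_abs[OF sq_integrable_mult[OF f g]] by (simp add: abs_mult)
  have "(\<integral>\<^sup>+x. ennreal \<bar>f x\<bar> * ennreal \<bar>g x\<bar> \<partial>\<mu>)\<^sup>2
      \<le> (\<integral>\<^sup>+x. (ennreal \<bar>f x\<bar>)\<^sup>2 \<partial>\<mu>) * (\<integral>\<^sup>+x. (ennreal \<bar>g x\<bar>)\<^sup>2 \<partial>\<mu>)"
    by (rule Cauchy_Schwarz_nn_integral) (use m in auto)
  then have "ennreal ((\<integral>x. \<bar>f x\<bar> * \<bar>g x\<bar> \<partial>\<mu>)\<^sup>2) \<le> ennreal ((\<integral>x. (f x)\<^sup>2 \<partial>\<mu>) * (\<integral>x. (g x)\<^sup>2 \<partial>\<mu>))"
    by (simp add: ennreal_mult[symmetric] ennreal_power nn_integral_eq_integral I int)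
  then have 1: "(\<integral>x. \<bar>f x\<bar> * \<bar>g x\<bar> \<partial>\<mu>)\<^sup>2 \<le> (\<integral>x. (f x)\<^sup>2 \<partial>\<mu>) * (\<integral>x. (g x)\<^sup>2 \<partial>\<mu>)"
    by (subst (asm) ennreal_le_iff) (auto intro!: mult_nonneg_nonneg)
  have "\<bar>\<integral>x. f x * g x \<partial>\<mu>\<bar> \<le> (\<integral>x. \<bar>f x\<bar> * \<bar>g x\<bar> \<partial>\<mu>)"
    using integral_abs_bound[of \<mu> "\<lambda>x. f x * g x"] by (simp add: abs_mult)
  then have "\<bar>\<integral>x. f x * g x \<partial>\<mu>\<bar>\<^sup>2 \<le> (\<integral>x. \<bar>f x\<bar> * \<bar>g x\<bar> \<partial>\<mu>)\<^sup>2" by (rule power_mono) simp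
  then show ?thesis using 1 by simp
qed

abbreviation plane :: "(real \<times> real) measure" where "plane \<equiv> lborel \<Otimes>\<^sub>M lborel"

abbreviation sq_kernel :: "(real \<Rightarrow> real \<Rightarrow> real) \<Rightarrow> bool" where
  "sq_kernel k \<equiv> sq_integrable plane (\<lambda>(y, z). k y z)"

text \<open>The squared Hilbert--Schmidt norm.\<close>

definition kernel_norm2 :: "(real \<Rightarrow> real \<Rightarrow> real) \<Rightarrow> real" where
  "kernel_norm2 k = (\<integral>x. (case x of (y, z) \<Rightarrow> k y z)\<^sup>2 \<partial>plane)"

lemma kernel_norm2_nonneg: "0 \<le> kernel_norm2 k"
  by (simp add: kernel_norm2_def)

lemma sq_kernel_measurable:
  assumes "sq_kernel k" shows "(\<lambda>(y, z). k y z) \<in> borel_measurable plane"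
  using assms by (simp add: sq_integrable_def)

lemma sq_kernel_section_measurable:
  assumes "sq_kernel k" shows "(\<lambda>z. k y z) \<in> borel_measurable borel"
  using measurable_compose[OF measurable_Pair1'[of y lborel lborel] sq_kernel_measurable[OF assms]] by simp

lemma kernel_norm2_nn:
  assumes "sq_kernel k"
  shows "ennreal (kernel_norm2 k) = (\<integral>\<^sup>+y. \<integral>\<^sup>+z. ennreal ((k y z)\<^sup>2) \<partial>lborel \<partial>lborel)"
proof -
  have "ennreal (kernel_norm2 k) = (\<integral>\<^sup>+x. ennreal ((case x of (y, z) \<Rightarrow> k y z)\<^sup>2) \<partial>plane)"
    unfolding kernel_norm2_def using assms
    by (intro nn_integral_eq_integral[symmetric]) (auto simp: sq_integrable_def)
  also have "\<dots> = (\<integral>\<^sup>+y. \<integral>\<^sup>+z. ennreal ((k y z)\<^sup>2) \<partial>lborel \<partial>lborel)"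
    using sq_kernel_measurable[OF assms]
    by (subst lborel.nn_integral_fst[symmetric]) auto
  finally show ?thesis .
qed

lemma sq_kernel_section:
  assumes k: "sq_kernel k"
  shows "AE y in lborel. sq_integrable lborel (\<lambda>z. k y z)"
proof -
  have m: "(\<lambda>(y, z). ennreal ((k y z)\<^sup>2)) \<in> borel_measurable plane"
    using sq_kernel_measurable[OF k] by (simp add: case_prod_beta')
  have "(\<integral>\<^sup>+y. \<integral>\<^sup>+z. ennreal ((k y z)\<^sup>2) \<partial>lborel \<partial>lborel) \<noteq> \<infinity>"
    unfolding kernel_norm2_nn[OF k, symmetric] by simp
  moreover have "(\<lambda>y. \<integral>\<^sup>+z. ennreal ((k y z)\<^sup>2) \<partial>lborel) \<in> borel_measurable lborel"
    using lborel.borel_measurable_nn_integral[of "\<lambda>y z. ennreal ((k y z)\<^sup>2)" lborel] m by simp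
  ultimately have "AE y in lborel. (\<integral>\<^sup>+z. ennreal ((k y z)\<^sup>2) \<partial>lborel) \<noteq> \<infinity>"
    by (intro nn_integral_PInf_AE)
  then show ?thesis
    by eventually_elim (use sq_kernel_section_measurable[OF k] in \<open>auto simp: sq_integrable_iff_nn_integral less_top\<close>)
qed

lemma kernel_op_measurable:
  assumes k: "sq_kernel k" and [measurable]: "f \<in> borel_measurable borel"
  shows "kernel_op k f \<in> borel_measurable borel"
proof -
  have "(\<lambda>(y, z). k y z * f z) \<in> borel_measurable plane"
    using sq_kernel_measurable[OF k] by (simp add: case_prod_beta')
  then have "(\<lambda>y. \<integral>z. k y z * f z \<partial>lborel) \<in> borel_measurable lborel"
    using lborel.borel_measurable_lebesgue_integral[of "\<lambda>y z. k y z * f z" lborel] by simp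
  then show ?thesis by (simp add: kernel_op_def[abs_def])
qed

lemma kernel_op_bound:
  assumes k: "sq_kernel k" and f: "sq_integrable lborel f"
  shows "sq_integrable lborel (kernel_op k f)"
    and "(\<integral>\<^sup>+y. ennreal ((kernel_op k f y)\<^sup>2) \<partial>lborel) \<le> ennreal (kernel_norm2 k * (\<integral>x. (f x)\<^sup>2 \<partial>lborel))"
proof -
  let ?n = "\<integral>x. (f x)\<^sup>2 \<partial>lborel"
  have fm: "f \<in> borel_measurable borel" using f by (simp add: sq_integrable_def)
  note km = sq_kernel_measurable[OF k]
  have m: "(\<lambda>(y, z). ennreal ((k y z)\<^sup>2)) \<in> borel_measurable plane"
    using km by (simp add: case_prod_beta')
  have m2: "(\<lambda>y. \<integral>\<^sup>+z. ennreal ((k y z)\<^sup>2) \<partial>lborel) \<in> borel_measurable lborel"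
    using lborel.borel_measurable_nn_integral[of "\<lambda>y z. ennreal ((k y z)\<^sup>2)" lborel] m by simp
  have "(\<integral>\<^sup>+y. ennreal ((kernel_op k f y)\<^sup>2) \<partial>lborel)
      \<le> (\<integral>\<^sup>+y. (\<integral>\<^sup>+z. ennreal ((k y z)\<^sup>2) \<partial>lborel) * ennreal ?n \<partial>lborel)"
  proof (rule nn_integral_mono_AE, use sq_kernel_section[OF k] in eventually_elim)
    fix y assume y: "sq_integrable lborel (k y)"
    have "(kernel_op k f y)\<^sup>2 \<le> (\<integral>z. (k y z)\<^sup>2 \<partial>lborel) * ?n"
      unfolding kernel_op_def by (rule square_integral_mult_le[OF y f])
    then have "ennreal ((kernel_op k f y)\<^sup>2) \<le> ennreal (\<integral>z. (k y z)\<^sup>2 \<partial>lborel) * ennreal ?n"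
      by (simp add: ennreal_mult[symmetric])
    also have "ennreal (\<integral>z. (k y z)\<^sup>2 \<partial>lborel) = (\<integral>\<^sup>+z. ennreal ((k y z)\<^sup>2) \<partial>lborel)"
      using y by (intro nn_integral_eq_integral[symmetric]) (auto simp: sq_integrable_def)
    finally show "ennreal ((kernel_op k f y)\<^sup>2) \<le> (\<integral>\<^sup>+z. ennreal ((k y z)\<^sup>2) \<partial>lborel) * ennreal ?n" .
  qed
  also have "\<dots> = (\<integral>\<^sup>+y. \<integral>\<^sup>+z. ennreal ((k y z)\<^sup>2) \<partial>lborel \<partial>lborel) * ennreal ?n"
    by (rule nn_integral_multc[OF m2])
  also have "\<dots> = ennreal (kernel_norm2 k * ?n)"
    unfolding kernel_norm2_nn[OF k, symmetric] by (simp add: ennreal_mult kernel_norm2_nonneg)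
  finally show *: "(\<integral>\<^sup>+y. ennreal ((kernel_op k f y)\<^sup>2) \<partial>lborel) \<le> ennreal (kernel_norm2 k * ?n)" .
  show "sq_integrable lborel (kernel_op k f)"
    unfolding sq_integrable_iff_nn_integral using kernel_op_measurable[OF k fm] le_less_trans[OF *] by simp
qed

lemma kernel_op_cong_AE:
  assumes k: "sq_kernel k" and m: "f \<in> borel_measurable borel" "g \<in> borel_measurable borel"
    and "AE x in lborel. f x = g x"
  shows "kernel_op k f = kernel_op k g"
  unfolding kernel_op_def
  by (intro ext integral_cong_AE) (use assms sq_kernel_section_measurable[OF k] in auto)

definition l2_op :: "(real \<Rightarrow> real \<Rightarrow> real) \<Rightarrow> l2 \<Rightarrow> l2" where
  "l2_op k F = l2_of (kernel_op k (fun_of F))"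

lemma l2_op_l2_of:
  assumes k: "sq_kernel k" and f: "sq_integrable lborel f"
  shows "l2_op k (l2_of f) = l2_of (kernel_op k f)"
  unfolding l2_op_def
  by (subst kernel_op_cong_AE[OF k, of _ f]) (use f fun_of_l2_of[OF f] in \<open>auto simp: sq_integrable_def\<close>)

lemma norm_l2_op:
  assumes k: "sq_kernel k"
  shows "(norm (l2_op k F))\<^sup>2 \<le> kernel_norm2 k * (norm F)\<^sup>2"
proof -
  have "ennreal ((norm (l2_op k F))\<^sup>2) \<le> ennreal (kernel_norm2 k * (\<integral>x. (fun_of F x)\<^sup>2 \<partial>lborel))"
    unfolding l2_op_def norm_l2_of[OF kernel_op_bound(1)[OF k sq_integrable_fun_of]]
    by (rule kernel_op_bound(2)[OF k sq_integrable_fun_of])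
  moreover have "(\<integral>x. (fun_of F x)\<^sup>2 \<partial>lborel) = (norm F)\<^sup>2"
    unfolding power2_norm_eq_inner[of F] inner_l2_fun_of by (simp add: power2_eq_square)
  ultimately show ?thesis by (subst (asm) ennreal_le_iff) (simp_all add: kernel_norm2_nonneg)
qed

lemma l2_op_lincomb:
  assumes k: "sq_kernel k" and k': "sq_kernel k'"
  shows "l2_op (\<lambda>y z. a * k y z + b * k' y z) F = a *\<^sub>R l2_op k F + b *\<^sub>R l2_op k' F"
proof -
  let ?f = "fun_of F"
  have sq: "sq_kernel (\<lambda>y z. a * k y z + b * k' y z)"
    using sq_integrable_add[OF sq_integrable_cmult[OF k, of a] sq_integrable_cmult[OF k', of b]]
    by (simp add: case_prod_beta')
  have "AE y in lborel. kernel_op (\<lambda>y z. a * k y z + b * k' y z) ?f y = a * kernel_op k ?f y + b * kernel_op k' ?f y"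
    using sq_kernel_section[OF k] sq_kernel_section[OF k']
  proof eventually_elim
    case (elim y)
    then show ?case
      using sq_integrable_mult[OF elim(1) sq_integrable_fun_of[of F]] sq_integrable_mult[OF elim(2) sq_integrable_fun_of[of F]]
      by (simp add: kernel_op_def distrib_right mult.assoc)
  qed
  then have "l2_op (\<lambda>y z. a * k y z + b * k' y z) F = l2_of (\<lambda>y. a * kernel_op k ?f y + b * kernel_op k' ?f y)"
    unfolding l2_op_def
    by (subst l2_of_eq_iff) (auto intro!: sq_integrable_add sq_integrable_cmult kernel_op_bound(1) k k' sq)
  then show ?thesis
    by (simp add: l2_op_def l2_of_add l2_of_scaleR sq_integrable_cmult kernel_op_bound(1) k k')
qed

lemma bounded_linear_l2_op:
  assumes k: "sq_kernel k"
  shows "bounded_linear (l2_op k)"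
proof (rule bounded_linear_intro)
  have lin: "l2_op k (l2_of (\<lambda>x. a * f x + b * g x)) = a *\<^sub>R l2_op k (l2_of f) + b *\<^sub>R l2_op k (l2_of g)"
    if f: "sq_integrable lborel f" and g: "sq_integrable lborel g" for a b f g
  proof -
    have "AE y in lborel. kernel_op k (\<lambda>x. a * f x + b * g x) y = a * kernel_op k f y + b * kernel_op k g y"
      using sq_kernel_section[OF k]
    proof eventually_elim
      case (elim y)
      show ?case
        using sq_integrable_mult[OF elim f] sq_integrable_mult[OF elim g]
        by (simp add: kernel_op_def distrib_left mult.left_commute[of _ a] mult.left_commute[of _ b])
    qed
    then have "l2_of (kernel_op k (\<lambda>x. a * f x + b * g x)) = l2_of (\<lambda>y. a * kernel_op k f y + b * kernel_op k g y)"
      by (subst l2_of_eq_iff) (auto intro!: sq_integrable_add sq_integrable_cmult kernel_op_bound(1) k f g)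
    moreover have "l2_op k (l2_of (\<lambda>x. a * f x + b * g x)) = l2_of (kernel_op k (\<lambda>x. a * f x + b * g x))"
      by (intro l2_op_l2_of k sq_integrable_add sq_integrable_cmult f g)
    ultimately show ?thesis
      by (simp add: l2_op_l2_of[OF k] l2_of_add l2_of_scaleR sq_integrable_cmult kernel_op_bound(1) k f g)
  qed
  fix F G :: l2 and r
  have "F + G = l2_of (\<lambda>x. 1 * fun_of F x + 1 * fun_of G x)" by (simp add: l2_of_add)
  then show "l2_op k (F + G) = l2_op k F + l2_op k G" by (simp only: lin sq_integrable_fun_of) simp
  have "r *\<^sub>R F = l2_of (\<lambda>x. r * fun_of F x + 0 * fun_of F x)" by (simp add: l2_of_scaleR)
  then show "l2_op k (r *\<^sub>R F) = r *\<^sub>R l2_op k F" by (simp only: lin sq_integrable_fun_of) simp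
  have "(norm (l2_op k F))\<^sup>2 \<le> (norm F * sqrt (kernel_norm2 k))\<^sup>2"
    using norm_l2_op[OF k, of F] by (simp add: power_mult_distrib kernel_norm2_nonneg mult.commute)
  then show "norm (l2_op k F) \<le> norm F * sqrt (kernel_norm2 k)"
    by (rule power2_le_imp_le) (simp add: kernel_norm2_nonneg)
qed

lemma norm_l2_op_diff:
  assumes k: "sq_kernel k" and k': "sq_kernel k'"
  shows "norm (l2_op k F - l2_op k' F) \<le> sqrt (kernel_norm2 (\<lambda>y z. k y z - k' y z)) * norm F"
proof -
  have sq: "sq_kernel (\<lambda>y z. k y z - k' y z)"
    using sq_integrable_diff[OF k k'] by (simp add: case_prod_beta')
  have "l2_op k F - l2_op k' F = l2_op (\<lambda>y z. k y z - k' y z) F"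
    using l2_op_lincomb[OF k k', of 1 "-1" F] by simp
  then have "(norm (l2_op k F - l2_op k' F))\<^sup>2 \<le> (sqrt (kernel_norm2 (\<lambda>y z. k y z - k' y z)) * norm F)\<^sup>2"
    using norm_l2_op[OF sq, of F] by (simp add: power_mult_distrib kernel_norm2_nonneg)
  then show ?thesis by (rule power2_le_imp_le) (simp add: kernel_norm2_nonneg)
qed

lemma sq_kernel_tensor:
  assumes f: "sq_integrable lborel f" and g: "sq_integrable lborel g"
  shows "sq_kernel (\<lambda>y z. f y * g z)"
  unfolding sq_integrable_def
proof
  have [measurable]: "f \<in> borel_measurable borel" "g \<in> borel_measurable borel"
    using f g by (auto simp: sq_integrable_def)
  show "(\<lambda>(y, z). f y * g z) \<in> borel_measurable plane" by measurable
  have "integrable plane (\<lambda>(y, z). (f y)\<^sup>2 * (g z)\<^sup>2)"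
  proof (rule lborel_pair.Fubini_integrable)
    show "integrable lborel (\<lambda>y. \<integral>z. norm (case (y, z) of (y, z) \<Rightarrow> (f y)\<^sup>2 * (g z)\<^sup>2) \<partial>lborel)"
      using f g by (simp add: sq_integrable_def)
    show "AE y in lborel. integrable lborel (\<lambda>z. case (y, z) of (y, z) \<Rightarrow> (f y)\<^sup>2 * (g z)\<^sup>2)"
      using f g by (simp add: sq_integrable_def)
  qed measurable
  then show "integrable plane (\<lambda>x. (case x of (y, z) \<Rightarrow> f y * g z)\<^sup>2)"
    by (simp add: case_prod_beta' power_mult_distrib)
qed

lemma sq_kernel_tensor_sum:
  assumes "\<And>p. p \<in> I \<Longrightarrow> sq_integrable lborel (f p)" "\<And>p. p \<in> I \<Longrightarrow> sq_integrable lborel (g p)"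
  shows "sq_kernel (\<lambda>y z. \<Sum>p\<in>I. m p * (f p y * g p z))"
proof -
  have "sq_integrable plane (\<lambda>x. \<Sum>p\<in>I. (case x of (y, z) \<Rightarrow> m p * (f p y * g p z)))"
  proof (rule sq_integrable_sum)
    fix p assume "p \<in> I"
    then show "sq_kernel (\<lambda>y z. m p * (f p y * g p z))"
      using sq_integrable_cmult[OF sq_kernel_tensor[OF assms], of p p "m p"] by (simp add: case_prod_beta')
  qed
  then show ?thesis by (simp add: case_prod_beta')
qed

lemma l2_op_tensor_sum:
  assumes f: "\<And>p. p \<in> I \<Longrightarrow> sq_integrable lborel (f p)" and g: "\<And>p. p \<in> I \<Longrightarrow> sq_integrable lborel (g p)"
  shows "l2_op (\<lambda>y z. \<Sum>p\<in>I. m p * (f p y * g p z)) F = (\<Sum>p\<in>I. (m p * (l2_of (g p) \<bullet> F)) *\<^sub>R l2_of (f p))"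
proof -
  have int: "integrable lborel (\<lambda>z. g p z * fun_of F z)" if "p \<in> I" for p
    using g[OF that] by (intro sq_integrable_mult) auto
  have ip: "(\<integral>z. g p z * fun_of F z \<partial>lborel) = l2_of (g p) \<bullet> F" if "p \<in> I" for p
    using inner_l2_of[OF g[OF that] sq_integrable_fun_of[of F]] by simp
  have "kernel_op (\<lambda>y z. \<Sum>p\<in>I. m p * (f p y * g p z)) (fun_of F) y = (\<Sum>p\<in>I. (m p * (l2_of (g p) \<bullet> F)) * f p y)" for y
  proof -
    have "kernel_op (\<lambda>y z. \<Sum>p\<in>I. m p * (f p y * g p z)) (fun_of F) y
        = (\<integral>z. (\<Sum>p\<in>I. (m p * f p y) * (g p z * fun_of F z)) \<partial>lborel)"
      by (simp add: kernel_op_def sum_distrib_right mult.assoc)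
    also have "\<dots> = (\<Sum>p\<in>I. (m p * f p y) * (\<integral>z. g p z * fun_of F z \<partial>lborel))"
      using int by (subst integral_sum) auto
    also have "\<dots> = (\<Sum>p\<in>I. (m p * (l2_of (g p) \<bullet> F)) * f p y)"
      by (intro sum.cong refl) (simp add: ip)
    finally show ?thesis .
  qed
  then have "kernel_op (\<lambda>y z. \<Sum>p\<in>I. m p * (f p y * g p z)) (fun_of F) = (\<lambda>y. \<Sum>p\<in>I. (m p * (l2_of (g p) \<bullet> F)) * f p y)"
    by (rule ext)
  then show ?thesis
    unfolding l2_op_def by (simp add: l2_of_sum f sq_integrable_cmult l2_of_scaleR)
qed

lemma AstarA_eigenspace_iff:
  assumes k: "sq_kernel k" and sym: "\<And>y z. k y z = k z y" and f: "sq_integrable lborel f"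
  shows "f \<in> AstarA_eigenspace k \<mu> \<longleftrightarrow> l2_op k (l2_op k (l2_of f)) = \<mu> *\<^sub>R l2_of f"
proof -
  note K = kernel_op_bound(1)[OF k]
  have "(\<lambda>z y. k y z) = k" using sym by (intro ext) simp
  moreover have "l2_op k (l2_op k (l2_of f)) = l2_of (kernel_op k (kernel_op k f))"
    by (simp add: l2_op_l2_of[OF k] f K)
  moreover have "l2_of (kernel_op k (kernel_op k f)) = \<mu> *\<^sub>R l2_of f \<longleftrightarrow>
      (AE z in lborel. kernel_op k (kernel_op k f) z = \<mu> * f z)"
    using l2_of_eq_iff[OF K[OF K[OF f]] sq_integrable_cmult[OF f, of \<mu>]] by (simp add: l2_of_scaleR f)
  ultimately show ?thesis using f by (simp add: AstarA_eigenspace_def)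
qed

lemma L2_dim_le:
  assumes E: "E \<subseteq> L2_real" and d: "L2_dim E d" and d': "L2_dim E d'"
  shows "d' \<le> d"
proof (rule ccontr)
  assume "\<not> d' \<le> d"
  then have lt: "d < d'" by simp
  obtain e where e: "\<And>i. i < d \<Longrightarrow> e i \<in> E"
    and span: "\<And>f. f \<in> E \<Longrightarrow> \<exists>c. AE x in lborel. f x = (\<Sum>i<d. c i * e i x)"
    using d unfolding L2_dim_def by metis
  obtain e' where e': "\<And>i. i < d' \<Longrightarrow> e' i \<in> E"
    and orth': "\<And>i j. i < d' \<Longrightarrow> j < d' \<Longrightarrow> (\<integral>x. e' i x * e' j x \<partial>lborel) = (if i = j then 1 else 0)"
    using d' unfolding L2_dim_def by metis
  define u where "u i = l2_of (e i)" for i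
  define u' where "u' i = l2_of (e' i)" for i
  have sq: "sq_integrable lborel (e i)" if "i < d" for i using e[OF that] E by auto
  have sq': "sq_integrable lborel (e' i)" if "i < d'" for i using e'[OF that] E by auto
  have o': "u' i \<bullet> u' j = (if i = j then 1 else 0)" if "i < d'" "j < d'" for i j
    using orth' that by (simp add: u'_def inner_l2_of sq')
  have sp: "\<exists>c. u' j = (\<Sum>i<d. c i *\<^sub>R u i)" if j: "j < d'" for j
  proof -
    obtain c where c: "AE x in lborel. e' j x = (\<Sum>i<d. c i * e i x)" using span[OF e'[OF j]] by blast
    have "u' j = l2_of (\<lambda>x. \<Sum>i<d. c i * e i x)"
      unfolding u'_def using c j by (subst l2_of_eq_iff) (auto intro!: sq_integrable_sum sq_integrable_cmult sq sq')
    also have "\<dots> = (\<Sum>i<d. c i *\<^sub>R u i)"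
      by (subst l2_of_sum) (auto intro!: sq_integrable_cmult sq sum.cong simp: l2_of_scaleR[OF sq] u_def)
    finally show ?thesis by blast
  qed
  obtain c where c: "\<exists>j\<le>d. c j \<noteq> 0" "\<forall>i<d. (\<Sum>j\<le>d. c j * (u i \<bullet> u' j)) = 0"
    using underdetermined_system[of d "\<lambda>i j. u i \<bullet> u' j"] by blast
  define g where "g = (\<Sum>j\<le>d. c j *\<^sub>R u' j)"
  have ug: "u i \<bullet> g = 0" if "i < d" for i using c(2) that by (simp add: g_def inner_sum_right)
  obtain j where j: "j \<le> d" "c j \<noteq> 0" using c(1) by blast
  obtain b where "u' j = (\<Sum>i<d. b i *\<^sub>R u i)" using sp[of j] j lt by auto
  then have "u' j \<bullet> g = 0" by (simp add: inner_sum_left ug)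
  moreover have "u' j \<bullet> g = (\<Sum>i\<le>d. if i = j then c j else 0)"
    unfolding g_def inner_sum_right using j lt by (intro sum.cong) (auto simp: o')
  ultimately show False using j by simp
qed

text \<open>The multiplicity of every positive value is a dimension, hence determined, and a decreasing nonnegative
sequence is determined by the multiplicities of its positive values.\<close>

lemma singular_seq_unique:
  assumes s: "is_singular_seq k s" and s': "is_singular_seq k s'"
  shows "s = s'"
proof -
  have card: "card {n. s n = t} = card {n. s' n = t}" if "t > 0" for t
  proof -
    have "AstarA_eigenspace k (t\<^sup>2) \<subseteq> L2_real" by (auto simp: AstarA_eigenspace_def)
    moreover have "L2_dim (AstarA_eigenspace k (t\<^sup>2)) (card {n. s n = t})"
      "L2_dim (AstarA_eigenspace k (t\<^sup>2)) (card {n. s' n = t})"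
      using s s' that by (auto simp: is_singular_seq_def)
    ultimately show ?thesis by (intro antisym) (erule L2_dim_le; assumption)+
  qed
  have not_less: "\<not> s' n < s n"
    if dec: "decseq s'" and dec0: "decseq s" and nn: "0 \<le> s' n" and fin: "\<And>t. t > 0 \<Longrightarrow> finite {n. s n = t}"
      and card: "\<And>t. t > 0 \<Longrightarrow> card {n. s n = t} = card {n. s' n = t}" and eq: "\<forall>i<n. s i = s' i" for s s' :: "nat \<Rightarrow> real" and n
  proof
    assume lt: "s' n < s n"
    have "{i. s' i = s n} \<subset> {i. s i = s n}"
    proof
      show "{i. s' i = s n} \<subseteq> {i. s i = s n}"
      proof safe
        fix i assume i: "s' i = s n"
        then have "i < n" using lt decseqD[OF dec, of n i] by (cases "i < n") auto
        then show "s i = s n" using eq i by simp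
      qed
      show "{i. s' i = s n} \<noteq> {i. s i = s n}"
      proof
        assume "{i. s' i = s n} = {i. s i = s n}"
        then have "n \<in> {i. s' i = s n}" by simp
        then show False using lt by simp
      qed
    qed
    moreover have "s n > 0" using lt nn by simp
    ultimately have "card {i. s' i = s n} < card {i. s i = s n}" using fin by (intro psubset_card_mono) auto
    then show False using card[OF \<open>s n > 0\<close>] by simp
  qed
  have "s n = s' n" for n
  proof (induction n rule: less_induct)
    case (less n)
    have "\<not> s' n < s n" using s s' card less by (intro not_less) (auto simp: is_singular_seq_def)
    moreover have "\<not> s n < s' n"
      using s s' card less by (intro not_less) (auto simp: is_singular_seq_def)
    ultimately show ?case by simp
  qed
  then show ?thesis by (rule ext)
qed

theorem singular_value_spectral:
  assumes k: "sq_kernel k" and sym: "\<And>y z. k y z = k z y"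
    and sa: "\<And>F G. l2_op k F \<bullet> G = F \<bullet> l2_op k G"
    and le: "spectral_seq (l2_op k) l e"
  shows "singular_value k N = \<bar>l (N - 1)\<bar>"
proof -
  note lin = bounded_linear_l2_op[OF k]
  interpret A: bounded_linear "l2_op k" by (rule lin)
  have dec: "decseq (\<lambda>n. \<bar>l n\<bar>)" and lim: "l \<longlonglongrightarrow> 0" and Ae: "\<And>n. l2_op k (e n) = l n *\<^sub>R e n"
    and orth: "\<And>i j. l i \<noteq> 0 \<Longrightarrow> e i \<bullet> e j = (if i = j then 1 else 0)"
    using le by (auto simp: spectral_seq_def)
  have "is_singular_seq k (\<lambda>n. \<bar>l n\<bar>)"
    unfolding is_singular_seq_def
  proof (intro conjI allI impI)
    fix t :: real assume t: "t > 0"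
    define S where "S = {n. \<bar>l n\<bar> = t}"
    obtain n where n: "\<bar>l n\<bar> < t" using lim t unfolding LIMSEQ_iff by force
    have "S \<subseteq> {..<n}"
    proof
      fix i assume "i \<in> S"
      then show "i \<in> {..<n}" using n decseqD[OF dec, of n i] by (cases "i < n") (auto simp: S_def)
    qed
    then show fin: "finite {n. \<bar>l n\<bar> = t}" unfolding S_def by (rule finite_subset) simp
    obtain b where b: "bij_betw b {0..<card S} S" using ex_bij_betw_nat_finite[OF fin] unfolding S_def by blast
    have bS: "b i \<in> S" if "i < card S" for i using b that by (auto simp: bij_betw_def)
    have b_inj: "b i = b j \<longleftrightarrow> i = j" if "i < card S" "j < card S" for i j
      using b that by (auto simp: bij_betw_def inj_on_def)
    have S0: "l i \<noteq> 0" and S2: "l i * l i = t\<^sup>2" if "i \<in> S" for i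
      using that t by (auto simp: S_def power2_eq_square)
    show "L2_dim (AstarA_eigenspace k (t\<^sup>2)) (card {n. \<bar>l n\<bar> = t})"
      unfolding L2_dim_def S_def[symmetric]
    proof (intro exI[of _ "\<lambda>i. fun_of (e (b i))"] conjI allI impI ballI)
      fix i assume "i < card S"
      then have "l2_op k (l2_op k (e (b i))) = t\<^sup>2 *\<^sub>R e (b i)"
        using S2[OF bS] by (simp add: Ae A.scaleR)
      then show "fun_of (e (b i)) \<in> AstarA_eigenspace k (t\<^sup>2)"
        by (subst AstarA_eigenspace_iff[OF k sym]) auto
    next
      fix i j assume "i < card S" "j < card S"
      then show "(\<integral>x. fun_of (e (b i)) x * fun_of (e (b j)) x \<partial>lborel) = (if i = j then 1 else 0)"
        using orth[OF S0[OF bS]] b_inj by (simp add: inner_l2_fun_of[symmetric])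
    next
      fix f assume f: "f \<in> AstarA_eigenspace k (t\<^sup>2)"
      then have sq: "sq_integrable lborel f" by (simp add: AstarA_eigenspace_def)
      have "l2_op k (l2_op k (l2_of f)) = t\<^sup>2 *\<^sub>R l2_of f"
        using f AstarA_eigenspace_iff[OF k sym sq] by simp
      then have "l2_of f = (\<Sum>i\<in>S. (e i \<bullet> l2_of f) *\<^sub>R e i)"
        unfolding S_def by (rule spectral_seq_square_eigenvector[OF le lin sa t])
      also have "\<dots> = (\<Sum>i<card S. (e (b i) \<bullet> l2_of f) *\<^sub>R e (b i))"
        using sum.reindex_bij_betw[OF b, of "\<lambda>i. (e i \<bullet> l2_of f) *\<^sub>R e i"] by (simp add: atLeast0LessThan)
      also have "\<dots> = l2_of (\<lambda>x. \<Sum>i<card S. (e (b i) \<bullet> l2_of f) * fun_of (e (b i)) x)"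
        by (subst l2_of_sum) (auto simp: l2_of_scaleR sq_integrable_cmult)
      finally have "AE x in lborel. f x = (\<Sum>i<card S. (e (b i) \<bullet> l2_of f) * fun_of (e (b i)) x)"
        by (subst (asm) l2_of_eq_iff) (auto intro!: sq sq_integrable_sum sq_integrable_cmult)
      then show "\<exists>c. AE x in lborel. f x = (\<Sum>i<card S. c i * fun_of (e (b i)) x)"
        by (intro exI[of _ "\<lambda>i. e (b i) \<bullet> l2_of f"])
    qed
  qed (use dec in auto)
  then have "(THE s. is_singular_seq k s) = (\<lambda>n. \<bar>l n\<bar>)"
    by (intro the_equality singular_seq_unique[of k])
  then show ?thesis by (simp add: singular_value_def)
qed

section \<open>Fourier inversion for probability laws on Euclidean space\<close>

lemma lborel_prod_integral:
  fixes f :: "'a::euclidean_space \<Rightarrow> real \<Rightarrow> 'b::{real_normed_field,banach,second_countable_topology}"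
  assumes f: "\<And>b. b \<in> Basis \<Longrightarrow> integrable lborel (f b)"
  shows "integrable lborel (\<lambda>x::'a. \<Prod>b\<in>Basis. f b (x \<bullet> b))"
    and "(\<integral>(x::'a). (\<Prod>b\<in>Basis. f b (x \<bullet> b)) \<partial>lborel) = (\<Prod>b\<in>Basis. \<integral>x. f b x \<partial>lborel)"
proof -
  interpret product_sigma_finite "\<lambda>_::'a. lborel :: real measure" ..
  have [measurable]: "f b \<in> borel_measurable borel" if "b \<in> Basis" for b
    using f[OF that] by (simp add: borel_measurable_integrable)
  have m: "(\<lambda>x::'a. \<Prod>b\<in>Basis. f b (x \<bullet> b)) \<in> borel_measurable borel" by measurable
  have T: "(\<lambda>x. \<Sum>b\<in>Basis. x b *\<^sub>R b) \<in> (\<Pi>\<^sub>M b\<in>Basis. lborel) \<rightarrow>\<^sub>M (borel :: 'a measure)" by measurable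
  have eq: "(\<Prod>b\<in>Basis. f b ((\<Sum>c\<in>Basis. x c *\<^sub>R c) \<bullet> b)) = (\<Prod>b\<in>Basis. f b (x b))" for x :: "'a \<Rightarrow> real"
    by (intro prod.cong refl) simp
  show "integrable lborel (\<lambda>x::'a. \<Prod>b\<in>Basis. f b (x \<bullet> b))"
    unfolding lborel_eq[where 'a='a] integrable_distr_eq[OF T m] eq
    by (rule product_integrable_prod) (use f in auto)
  show "(\<integral>(x::'a). (\<Prod>b\<in>Basis. f b (x \<bullet> b)) \<partial>lborel) = (\<Prod>b\<in>Basis. \<integral>x. f b x \<partial>lborel)"
    unfolding lborel_eq[where 'a='a] integral_distr[OF T m] eq
    by (rule product_integral_prod) (use f in auto)
qed

lemma gaussian_fourier_real:
  fixes \<sigma> u :: real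
  assumes \<sigma>: "\<sigma> > 0"
  shows "integrable lborel (\<lambda>t. iexp (u * t) * of_real (exp (- (\<sigma> * t)\<^sup>2 / 2)))"
    and "(\<integral>t. iexp (u * t) * of_real (exp (- (\<sigma> * t)\<^sup>2 / 2)) \<partial>lborel)
      = of_real (2 * pi * normal_density 0 \<sigma> u)"
proof -
  let ?g = "\<lambda>t. iexp (u * t) * of_real (exp (- (\<sigma> * t)\<^sup>2 / 2))"
  define f where "f v t = iexp (v * t) * of_real (exp (- t\<^sup>2 / 2))" for v t :: real
  have f_eq: "f v t = sqrt (2 * pi) *\<^sub>R (std_normal_density t *\<^sub>R iexp (v * t))" for v t
    by (simp add: f_def std_normal_density_def scaleR_conv_of_real)
  have int: "integrable lborel (\<lambda>t. std_normal_density t *\<^sub>R iexp (v * t))" for v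
    by (rule integrable_bound[of _ std_normal_density])
       (auto simp: integrable_normal_density simp del: of_real_mult)
  have "(\<integral>t. std_normal_density t *\<^sub>R iexp (v * t) \<partial>lborel) = char std_normal_distribution v" for v
    unfolding char_def by (subst integral_density) auto
  then have intf: "integrable lborel (f v)" "(\<integral>t. f v t \<partial>lborel) = of_real (sqrt (2 * pi) * exp (- v\<^sup>2 / 2))" for v
    unfolding f_eq[abs_def] using int[of v]
    by (auto simp: char_std_normal_distribution scaleR_conv_of_real)
  have shift: "f (u / \<sigma>) (0 + \<sigma> * t) = ?g t" for t
    using \<sigma> by (simp add: f_def)
  show "integrable lborel ?g"
    using lborel_integrable_real_affine[OF intf(1)[of "u / \<sigma>"], of \<sigma> 0] \<sigma> unfolding shift by simp
  have 1: "of_real (sqrt (2 * pi) * exp (- (u / \<sigma>)\<^sup>2 / 2))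
      = \<sigma> *\<^sub>R (\<integral>t. ?g t \<partial>lborel)"
    using lborel_integral_real_affine[of \<sigma> "f (u / \<sigma>)" 0] \<sigma> unfolding shift intf(2) by simp
  have 2: "sqrt (2 * pi) * exp (- (u / \<sigma>)\<^sup>2 / 2) = \<sigma> * (2 * pi * normal_density 0 \<sigma> u)"
    using \<sigma> by (simp add: normal_density_def real_sqrt_mult power_divide field_simps flip: power2_eq_square)
  have "complex_of_real (\<sigma> * (2 * pi * normal_density 0 \<sigma> u))
      = of_real \<sigma> * (\<integral>t. ?g t \<partial>lborel)"
    unfolding 2[symmetric] 1 scaleR_conv_of_real ..
  then show "(\<integral>t. ?g t \<partial>lborel)
      = of_real (2 * pi * normal_density 0 \<sigma> u)"
    unfolding of_real_mult[of \<sigma> "2 * pi * normal_density 0 \<sigma> u"]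
    by (subst (asm) mult_left_cancel) (use \<sigma> in simp_all)
qed

text \<open>The density of a centred Gaussian vector with covariance \<open>\<sigma>\<^sup>2\<close> times the identity.\<close>

definition gauss_kernel :: "real \<Rightarrow> 'a::euclidean_space \<Rightarrow> real" where
  "gauss_kernel \<sigma> x = (\<Prod>b\<in>Basis. normal_density 0 \<sigma> (x \<bullet> b))"

lemma gauss_kernel_nonneg: "0 \<le> gauss_kernel \<sigma> x"
  by (simp add: gauss_kernel_def prod_nonneg)

lemma gauss_kernel_measurable [measurable]:
  "gauss_kernel \<sigma> \<in> borel_measurable (borel :: 'a::euclidean_space measure)"
  unfolding gauss_kernel_def by measurable

lemma gauss_kernel_minus: "gauss_kernel \<sigma> (- x) = gauss_kernel \<sigma> x"
  by (simp add: gauss_kernel_def normal_density_def)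

lemma gauss_kernel_scale:
  "\<sigma> > 0 \<Longrightarrow> \<sigma> ^ DIM('a) * gauss_kernel \<sigma> (\<sigma> *\<^sub>R x) = gauss_kernel 1 (x :: 'a::euclidean_space)"
  unfolding gauss_kernel_def prod_constant[symmetric] prod.distrib[symmetric]
  by (intro prod.cong refl) (simp add: normal_density_def real_sqrt_mult power_mult_distrib)

lemma gauss_kernel_integral:
  assumes "\<sigma> > 0"
  shows "integrable lborel (gauss_kernel \<sigma> :: 'a::euclidean_space \<Rightarrow> real)"
    and "(\<integral>x. gauss_kernel \<sigma> x \<partial>(lborel :: 'a measure)) = 1"
  using lborel_prod_integral[where 'a='a, of "\<lambda>_. normal_density 0 \<sigma>"] assms
  by (simp_all add: gauss_kernel_def[abs_def])

lemma gaussian_fourier: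
  fixes x :: "'a::euclidean_space"
  assumes \<sigma>: "\<sigma> > 0"
  shows "integrable lborel (\<lambda>t::'a. iexp (t \<bullet> x) * of_real (exp (- (\<sigma> * norm t)\<^sup>2 / 2)))"
    and "(\<integral>(t::'a). iexp (t \<bullet> x) * of_real (exp (- (\<sigma> * norm t)\<^sup>2 / 2)) \<partial>lborel)
      = of_real ((2 * pi) ^ DIM('a) * gauss_kernel \<sigma> x)"
proof -
  have eq: "iexp (t \<bullet> x) * of_real (exp (- (\<sigma> * norm t)\<^sup>2 / 2))
     = (\<Prod>b\<in>Basis. iexp ((x \<bullet> b) * (t \<bullet> b)) * of_real (exp (- (\<sigma> * (t \<bullet> b))\<^sup>2 / 2)))" for t :: 'a
  proof -
    have "(norm t)\<^sup>2 = (\<Sum>b\<in>Basis. (t \<bullet> b)\<^sup>2)"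
      unfolding power2_norm_eq_inner by (subst euclidean_inner) (simp add: power2_eq_square)
    then have "- (\<sigma> * norm t)\<^sup>2 / 2 = (\<Sum>b\<in>Basis. - (\<sigma> * (t \<bullet> b))\<^sup>2 / 2)"
      by (simp add: power_mult_distrib sum_distrib_left sum_negf sum_divide_distrib)
    then have 1: "exp (- (\<sigma> * norm t)\<^sup>2 / 2) = (\<Prod>b\<in>Basis. exp (- (\<sigma> * (t \<bullet> b))\<^sup>2 / 2))"
      by (simp only: exp_sum[OF finite_Basis])
    have "\<i> * complex_of_real (t \<bullet> x) = (\<Sum>b\<in>Basis. \<i> * complex_of_real ((x \<bullet> b) * (t \<bullet> b)))"
      by (subst euclidean_inner) (simp add: sum_distrib_left mult.commute)
    then have 2: "iexp (t \<bullet> x) = (\<Prod>b\<in>Basis. iexp ((x \<bullet> b) * (t \<bullet> b)))"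
      by (simp only: exp_sum[OF finite_Basis])
    show ?thesis unfolding 1 2 by (simp add: prod.distrib)
  qed
  note I = gaussian_fourier_real[OF \<sigma>]
  show "integrable lborel (\<lambda>t::'a. iexp (t \<bullet> x) * of_real (exp (- (\<sigma> * norm t)\<^sup>2 / 2)))"
    unfolding eq by (rule lborel_prod_integral(1)) (rule I(1))
  show "(\<integral>(t::'a). iexp (t \<bullet> x) * of_real (exp (- (\<sigma> * norm t)\<^sup>2 / 2)) \<partial>lborel)
      = of_real ((2 * pi) ^ DIM('a) * gauss_kernel \<sigma> x)"
  proof -
    have "(\<integral>(t::'a). (\<Prod>b\<in>Basis. iexp ((x \<bullet> b) * (t \<bullet> b)) * of_real (exp (- (\<sigma> * (t \<bullet> b))\<^sup>2 / 2))) \<partial>lborel)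
      = (\<Prod>b\<in>Basis. \<integral>t. iexp ((x \<bullet> b) * t) * of_real (exp (- (\<sigma> * t)\<^sup>2 / 2)) \<partial>lborel)"
      by (rule lborel_prod_integral(2)) (rule I(1))
    also have "\<dots> = (\<Prod>b\<in>Basis. of_real (2 * pi * normal_density 0 \<sigma> (x \<bullet> b)))"
      by (simp only: I(2))
    also have "\<dots> = of_real ((2 * pi) ^ DIM('a) * gauss_kernel \<sigma> x)"
      by (simp add: gauss_kernel_def prod.distrib power_mult_distrib)
    finally show ?thesis unfolding eq .
  qed
qed

lemma lborel_integral_affine:
  fixes f :: "'a::euclidean_space \<Rightarrow> real"
  assumes [measurable]: "f \<in> borel_measurable borel" and \<sigma>: "\<sigma> > 0"
  shows "(\<integral>x. f x \<partial>lborel) = \<sigma> ^ DIM('a) * (\<integral>z. f (y + \<sigma> *\<^sub>R z) \<partial>lborel)"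
  using \<sigma> by (subst lborel_affine[of \<sigma> y]) (simp_all add: integral_density integral_distr)

text \<open>The law smoothed by a small Gaussian has a density that is the Fourier integral of the characteristic
function times a Gaussian. Dominated convergence gives the density as the smoothing vanishes, first tested against
continuous functions and then, through distance functions, on boxes.\<close>

theorem density_from_integrable_char:
  fixes \<mu> :: "'a::euclidean_space measure"
  defines "\<phi> \<equiv> \<lambda>t. CLINT y|\<mu>. iexp (t \<bullet> y)"
  assumes "prob_space \<mu>" and sets [measurable_cong]: "sets \<mu> = sets borel" and int: "integrable lborel \<phi>"
  shows "\<exists>\<rho>. (\<forall>x. 0 \<le> \<rho> x) \<and> continuous_on UNIV \<rho> \<and>
    (\<forall>x. \<rho> x \<le> (\<integral>t. cmod (\<phi> t) \<partial>lborel) / (2 * pi) ^ DIM('a)) \<and> \<mu> = density lborel (\<lambda>x. ennreal (\<rho> x))"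
proof -
  interpret prob_space \<mu> by fact
  interpret P: pair_sigma_finite "lborel :: 'a measure" \<mu> ..
  have [measurable]: "\<phi> \<in> borel_measurable borel" using int by (simp add: borel_measurable_integrable)
  define D where "D = (2 * pi) ^ DIM('a)"
  have D: "D > 0" by (simp add: D_def)
  define K where "K = (\<integral>t. cmod (\<phi> t) \<partial>lborel) / D"
  define \<rho>c where "\<rho>c x = (CLINT t|lborel. \<phi> t * iexp (- (t \<bullet> x))) / D" for x
  define \<rho> where "\<rho> x = Re (\<rho>c x)" for x
  define s where "s n = 1 / (real n + 1)" for n
  have s: "s n > 0" for n by (simp add: s_def)
  have s0: "s \<longlonglongrightarrow> 0" unfolding s_def by (rule LIMSEQ_inverse_real_of_nat[unfolded inverse_eq_divide of_nat_Suc add.commute[of 1]])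
  define E where "E n t = exp (- (s n * norm t)\<^sup>2 / 2)" for n and t :: 'a
  have E_meas [measurable]: "E n \<in> borel_measurable borel" for n unfolding E_def by measurable
  have E1: "0 \<le> E n t" "E n t \<le> 1" for n t by (auto simp: E_def)
  define \<rho>n where "\<rho>n n x = (\<integral>y. gauss_kernel (s n) (x - y) \<partial>\<mu>)" for n x
  have \<rho>n_nonneg: "0 \<le> \<rho>n n x" for n x by (simp add: \<rho>n_def gauss_kernel_nonneg)
  have \<rho>n_meas [measurable]: "\<rho>n n \<in> borel_measurable borel" for n
    unfolding \<rho>n_def by measurable
  have \<rho>n_eq: "of_real (\<rho>n n x) = (CLINT t|lborel. \<phi> t * iexp (- (t \<bullet> x)) * E n t) / D" for n x
  proof -
    define F where "F t y = iexp (t \<bullet> (y - x)) * complex_of_real (E n t)" for t y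
    have nF: "norm (F t y) = E n t" for t y using E1(1)[of n t] by (simp add: F_def norm_mult)
    have Fm [measurable]: "(\<lambda>(t, y). F t y) \<in> borel_measurable (lborel \<Otimes>\<^sub>M \<mu>)" unfolding F_def by measurable
    have intE: "integrable lborel (E n)"
      using integrable_norm[OF gaussian_fourier(1)[OF s[of n], of 0]] by (simp add: E_def[abs_def])
    have "integrable (lborel \<Otimes>\<^sub>M \<mu>) (\<lambda>(t, y). F t y)"
    proof (rule P.Fubini_integrable[OF Fm])
      show "integrable lborel (\<lambda>t. \<integral>y. norm (case (t, y) of (t, y) \<Rightarrow> F t y) \<partial>\<mu>)"
        using intE by (simp add: nF prob_space)
      show "AE t in lborel. integrable \<mu> (\<lambda>y. case (t, y) of (t, y) \<Rightarrow> F t y)"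
        by (auto intro!: integrable_const_bound[of _ "E n _"] simp: nF)
    qed
    then have "(CLINT y|\<mu>. (CLINT t|lborel. F t y)) = (CLINT t|lborel. (CLINT y|\<mu>. F t y))"
      by (rule P.Fubini_integral)
    moreover have "(CLINT y|\<mu>. F t y) = \<phi> t * iexp (- (t \<bullet> x)) * E n t" for t
    proof -
      have "F t y = iexp (t \<bullet> y) * (iexp (- (t \<bullet> x)) * E n t)" for y
        by (simp add: F_def inner_diff_right exp_diff exp_minus field_simps)
      then have "(CLINT y|\<mu>. F t y) = (CLINT y|\<mu>. iexp (t \<bullet> y) * (iexp (- (t \<bullet> x)) * E n t))" by simp
      also have "\<dots> = (CLINT y|\<mu>. iexp (t \<bullet> y)) * (iexp (- (t \<bullet> x)) * E n t)"
        by (rule integral_mult_left_zero)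
      finally show ?thesis by (simp add: \<phi>_def)
    qed
    moreover have "(CLINT t|lborel. F t y) = of_real (D * gauss_kernel (s n) (x - y))" for y
      using gaussian_fourier(2)[OF s[of n], of "y - x"] gauss_kernel_minus[of "s n" "x - y"]
      by (simp add: F_def E_def D_def)
    ultimately have "(CLINT y|\<mu>. of_real (D * gauss_kernel (s n) (x - y))) = (CLINT t|lborel. \<phi> t * iexp (- (t \<bullet> x)) * E n t)"
      by simp
    then have "of_real (D * \<rho>n n x) = (CLINT t|lborel. \<phi> t * iexp (- (t \<bullet> x)) * E n t)"
      by (simp add: \<rho>n_def)
    then show ?thesis using D by (simp add: field_simps)
  qed
  have norm1: "norm (\<phi> t * iexp (- (t \<bullet> x))) = cmod (\<phi> t)" for t x
    unfolding norm_mult norm_exp_i_times by simp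
  have norm2: "norm (\<phi> t * iexp (- (t \<bullet> x)) * E n t) \<le> cmod (\<phi> t)" for n t x
    unfolding norm_mult[of _ "of_real (E n t)"] norm1
    using E1[of n t] mult_left_le[of "E n t" "cmod (\<phi> t)"] by simp
  have K: "\<rho>n n x \<le> K" for n x
  proof -
    have "\<rho>n n x = norm (complex_of_real (\<rho>n n x))" using \<rho>n_nonneg by simp
    also have "\<dots> = norm (CLINT t|lborel. \<phi> t * iexp (- (t \<bullet> x)) * E n t) / D"
      unfolding \<rho>n_eq using D by (simp add: norm_divide)
    also have "norm (CLINT t|lborel. \<phi> t * iexp (- (t \<bullet> x)) * E n t) \<le> (\<integral>t. cmod (\<phi> t) \<partial>lborel)"
    proof (rule order_trans[OF integral_norm_bound], rule integral_mono, rule integrable_norm)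
      show "integrable lborel (\<lambda>t. \<phi> t * iexp (- (t \<bullet> x)) * E n t)"
        by (rule integrable_bound[OF integrable_norm[OF int]]) (use norm2 in auto)
    qed (use norm2 int in auto)
    finally show ?thesis using D by (simp add: K_def divide_right_mono)
  qed
  have K0: "0 \<le> K" using \<rho>n_nonneg K by (meson order_trans)
  have lim: "(\<lambda>n. \<rho>n n x) \<longlonglongrightarrow> \<rho> x" for x
  proof -
    have "(\<lambda>n. CLINT t|lborel. \<phi> t * iexp (- (t \<bullet> x)) * E n t) \<longlonglongrightarrow> (CLINT t|lborel. \<phi> t * iexp (- (t \<bullet> x)))"
    proof (rule integral_dominated_convergence[where w = "\<lambda>t. cmod (\<phi> t)"])
      have "(\<lambda>n. complex_of_real (E n t)) \<longlonglongrightarrow> of_real (exp (- (0 * norm t)\<^sup>2 / 2))" for t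
        unfolding E_def by (intro tendsto_intros s0) auto
      then have E1: "(\<lambda>n. complex_of_real (E n t)) \<longlonglongrightarrow> 1" for t by simp
      show "AE t in lborel. (\<lambda>n. \<phi> t * iexp (- (t \<bullet> x)) * E n t) \<longlonglongrightarrow> \<phi> t * iexp (- (t \<bullet> x))"
      proof (rule AE_I2)
        fix t
        show "(\<lambda>n. \<phi> t * iexp (- (t \<bullet> x)) * E n t) \<longlonglongrightarrow> \<phi> t * iexp (- (t \<bullet> x))"
          using tendsto_mult[OF tendsto_const[of "\<phi> t * iexp (- (t \<bullet> x))"] E1[of t]] by simp
      qed
    qed (use norm2 int in auto)
    then have "(\<lambda>n. (CLINT t|lborel. \<phi> t * iexp (- (t \<bullet> x)) * E n t) / D) \<longlonglongrightarrow> \<rho>c x"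
      unfolding \<rho>c_def using D by (intro tendsto_intros) auto
    then have "(\<lambda>n. complex_of_real (\<rho>n n x)) \<longlonglongrightarrow> \<rho>c x" unfolding \<rho>n_eq .
    then show ?thesis unfolding \<rho>_def using tendsto_Re by fastforce
  qed
  have \<rho>_nonneg: "0 \<le> \<rho> x" for x using lim[of x] \<rho>n_nonneg by (meson LIMSEQ_le_const)
  have \<rho>_le: "\<rho> x \<le> K" for x using lim[of x] K by (meson LIMSEQ_le_const2)
  have cont: "continuous_on UNIV \<rho>"
  proof -
    have "isCont \<rho>c x" for x
      unfolding continuous_at_sequentially comp_def \<rho>c_def
    proof safe
      fix X assume X: "X \<longlonglongrightarrow> x"
      have "(\<lambda>n. CLINT t|lborel. \<phi> t * iexp (- (t \<bullet> X n))) \<longlonglongrightarrow> (CLINT t|lborel. \<phi> t * iexp (- (t \<bullet> x)))"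
      proof (rule integral_dominated_convergence[where w = "\<lambda>t. cmod (\<phi> t)"])
        show "AE t in lborel. (\<lambda>n. \<phi> t * iexp (- (t \<bullet> X n))) \<longlonglongrightarrow> \<phi> t * iexp (- (t \<bullet> x))"
          by (intro AE_I2 tendsto_intros X)
      qed (use norm1 int in auto)
      then show "(\<lambda>n. (CLINT t|lborel. \<phi> t * iexp (- (t \<bullet> X n))) / D) \<longlonglongrightarrow> (CLINT t|lborel. \<phi> t * iexp (- (t \<bullet> x))) / D"
        using D by (intro tendsto_intros) auto
    qed
    then show ?thesis unfolding \<rho>_def by (intro continuous_at_imp_continuous_on ballI continuous_intros) auto
  qed
  then have [measurable]: "\<rho> \<in> borel_measurable borel" by (rule borel_measurable_continuous_onI)
  have test: "(\<integral>x. f x \<partial>\<mu>) = (\<integral>x. f x * \<rho> x \<partial>lborel)"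
    if cf: "continuous_on UNIV f" and f01: "\<And>x. 0 \<le> f x" "\<And>x. f x \<le> 1" and intf: "integrable lborel f" for f :: "'a \<Rightarrow> real"
  proof -
    have [measurable]: "f \<in> borel_measurable borel" using cf by (rule borel_measurable_continuous_onI)
    have l1: "(\<lambda>n. \<integral>x. f x * \<rho>n n x \<partial>lborel) \<longlonglongrightarrow> (\<integral>x. f x * \<rho> x \<partial>lborel)"
    proof (rule integral_dominated_convergence[where w = "\<lambda>x. f x * K"])
      show "AE x in lborel. (\<lambda>n. f x * \<rho>n n x) \<longlonglongrightarrow> f x * \<rho> x" by (intro AE_I2 tendsto_intros lim)
      show "AE x in lborel. norm (f x * \<rho>n n x) \<le> f x * K" for n
        using f01(1) \<rho>n_nonneg K by (auto simp: abs_mult intro!: mult_left_mono)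
    qed (use intf in auto)
    define J where "J n y = (\<integral>z. f (y + s n *\<^sub>R z) * gauss_kernel 1 z \<partial>lborel)" for n y
    have eq: "(\<integral>x. f x * \<rho>n n x \<partial>lborel) = (\<integral>y. J n y \<partial>\<mu>)" for n
    proof -
      define G where "G x y = f x * gauss_kernel (s n) (x - y)" for x y
      have Gm [measurable]: "(\<lambda>(x, y). G x y) \<in> borel_measurable (lborel \<Otimes>\<^sub>M \<mu>)" unfolding G_def by measurable
      have gb: "gauss_kernel (s n) z \<le> (1 / sqrt (2 * pi * (s n)\<^sup>2)) ^ DIM('a)" for z :: 'a
        unfolding gauss_kernel_def prod_constant[symmetric]
      proof (intro prod_mono conjI)
        show "normal_density 0 (s n) r \<le> 1 / sqrt (2 * pi * (s n)\<^sup>2)" for r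
          unfolding normal_density_def by (rule mult_left_le) auto
      qed simp
      have intg: "integrable \<mu> (\<lambda>y. gauss_kernel (s n) (x - y))" for x
        by (rule integrable_const_bound[of _ "(1 / sqrt (2 * pi * (s n)\<^sup>2)) ^ DIM('a)"])
           (simp_all add: abs_of_nonneg gauss_kernel_nonneg gb)
      have nn: "0 \<le> G x y" for x y by (simp add: G_def f01 gauss_kernel_nonneg)
      have inner: "(\<integral>y. G x y \<partial>\<mu>) = f x * \<rho>n n x" for x by (simp add: G_def \<rho>n_def)
      have "integrable (lborel \<Otimes>\<^sub>M \<mu>) (\<lambda>(x, y). G x y)"
      proof (rule P.Fubini_integrable[OF Gm])
        have "integrable lborel (\<lambda>x. f x * \<rho>n n x)"
          by (rule integrable_bound[of _ "\<lambda>x. f x * K"])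
             (use f01(1) \<rho>n_nonneg K0 K intf in \<open>auto simp: abs_mult intro!: mult_left_mono AE_I2\<close>)
        then show "integrable lborel (\<lambda>x. \<integral>y. norm (case (x, y) of (x, y) \<Rightarrow> G x y) \<partial>\<mu>)"
          by (simp add: nn inner)
        show "AE x in lborel. integrable \<mu> (\<lambda>y. case (x, y) of (x, y) \<Rightarrow> G x y)"
          using intg by (simp add: G_def)
      qed
      then have "(\<integral>y. (\<integral>x. G x y \<partial>lborel) \<partial>\<mu>) = (\<integral>x. (\<integral>y. G x y \<partial>\<mu>) \<partial>lborel)"
        by (rule P.Fubini_integral)
      moreover have "(\<integral>x. G x y \<partial>lborel) = J n y" for y
      proof -
        have "(\<integral>x. G x y \<partial>lborel) = s n ^ DIM('a) * (\<integral>z. f (y + s n *\<^sub>R z) * gauss_kernel (s n) (s n *\<^sub>R z) \<partial>lborel)"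
          unfolding G_def by (subst lborel_integral_affine[OF _ s[of n], of _ y]) auto
        also have "\<dots> = (\<integral>z. f (y + s n *\<^sub>R z) * (s n ^ DIM('a) * gauss_kernel (s n) (s n *\<^sub>R z)) \<partial>lborel)"
          by (subst integral_mult_right_zero[symmetric]) (simp add: mult_ac)
        finally show ?thesis by (simp add: J_def gauss_kernel_scale[OF s])
      qed
      ultimately show ?thesis by (simp add: inner)
    qed
    have J_meas: "J n \<in> borel_measurable \<mu>" for n unfolding J_def by measurable
    have bd: "norm (f w * gauss_kernel 1 z) \<le> gauss_kernel 1 z" for w z :: 'a
      using f01[of w] gauss_kernel_nonneg[of 1 z] by (simp add: abs_mult mult_left_le_one_le)
    have J1: "norm (J n y) \<le> 1" for n y
    proof -
      have "norm (J n y) \<le> (\<integral>z. gauss_kernel 1 z \<partial>(lborel :: 'a measure))"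
        unfolding J_def
      proof (rule order_trans[OF integral_norm_bound], rule integral_mono, rule integrable_norm)
        show "integrable lborel (\<lambda>z. f (y + s n *\<^sub>R z) * gauss_kernel 1 z)"
          by (rule integrable_bound[OF gauss_kernel_integral(1)[of 1, where 'a='a]])
             (use bd in \<open>simp_all add: abs_of_nonneg gauss_kernel_nonneg\<close>)
      qed (use bd gauss_kernel_integral(1)[of 1, where 'a='a] in auto)
      then show ?thesis by (simp add: gauss_kernel_integral(2))
    qed
    have Jl: "(\<lambda>n. J n y) \<longlonglongrightarrow> f y" for y
    proof -
      have "(\<lambda>n. J n y) \<longlonglongrightarrow> (\<integral>z. f y * gauss_kernel 1 z \<partial>(lborel :: 'a measure))"
        unfolding J_def
      proof (rule integral_dominated_convergence[where w = "gauss_kernel 1"])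
        show "AE z in lborel. (\<lambda>n. f (y + s n *\<^sub>R z) * gauss_kernel 1 z) \<longlonglongrightarrow> f y * gauss_kernel 1 z"
        proof (rule AE_I2)
          fix z :: 'a
          have "(\<lambda>n. y + s n *\<^sub>R z) \<longlonglongrightarrow> y + 0 *\<^sub>R z" by (intro tendsto_intros s0)
          then have "(\<lambda>n. f (y + s n *\<^sub>R z)) \<longlonglongrightarrow> f (y + 0 *\<^sub>R z)"
            by (rule continuous_on_tendsto_compose[OF cf]) auto
          then show "(\<lambda>n. f (y + s n *\<^sub>R z) * gauss_kernel 1 z) \<longlonglongrightarrow> f y * gauss_kernel 1 z"
            by (intro tendsto_intros) simp
        qed
      qed (use bd gauss_kernel_integral(1)[of 1, where 'a='a] in auto)
      then show ?thesis by (simp add: gauss_kernel_integral(2))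
    qed
    have "(\<lambda>n. \<integral>y. J n y \<partial>\<mu>) \<longlonglongrightarrow> (\<integral>y. f y \<partial>\<mu>)"
      by (rule integral_dominated_convergence[where w = "\<lambda>_. 1"]) (use J1 Jl J_meas in auto)
    then show ?thesis using l1 unfolding eq by (rule LIMSEQ_unique)
  qed
  have box: "emeasure \<mu> (box a b) = emeasure (density lborel (\<lambda>x. ennreal (\<rho> x))) (box a b)" for a b
  proof -
    define S where "S = - box a b"
    have S: "closed S" unfolding S_def by (rule closed_Compl[OF open_box])
    have "S \<noteq> {}"
      using bounded_box[of a b] not_bounded_UNIV[where 'a='a] unfolding S_def by (metis Compl_empty_eq double_compl)
    define f where "f n x = min 1 (real n * infdist x S)" for n x
    have f0: "0 \<le> f n x" "f n x \<le> 1" for n x by (auto simp: f_def infdist_nonneg)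
    have fo: "f n x \<le> indicator (box a b) x" for n x
      by (cases "x \<in> box a b") (auto simp: f_def S_def infdist_nonneg)
    have fl: "(\<lambda>n. f n x) \<longlonglongrightarrow> indicator (box a b) x" for x
    proof (cases "x \<in> box a b")
      case True
      then have d: "infdist x S > 0" using S \<open>S \<noteq> {}\<close> by (simp add: S_def infdist_pos_not_in_closed)
      then obtain N where N: "real N * infdist x S > 1" using reals_Archimedean3 by blast
      have "f n x = 1" if "n \<ge> N" for n
      proof -
        have "real N * infdist x S \<le> real n * infdist x S" using that d by (intro mult_right_mono) auto
        then have "1 \<le> real n * infdist x S" using N by linarith
        then show ?thesis by (simp add: f_def)
      qed
      then have "\<forall>\<^sub>F n in sequentially. f n x = 1" by (auto simp: eventually_sequentially)
      then show ?thesis using True by (simp add: tendsto_eventually)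
    next
      case False
      then show ?thesis by (simp add: f_def S_def)
    qed
    have fc: "continuous_on UNIV (f n)" for n unfolding f_def by (intro continuous_intros)
    have [measurable]: "f n \<in> borel_measurable borel" for n using fc by (rule borel_measurable_continuous_onI)
    have ib: "integrable lborel (indicator (box a b) :: 'a \<Rightarrow> real)"
      by (rule integrable_real_indicator) (auto simp: emeasure_lborel_box_eq)
    have fi: "integrable lborel (f n)" for n
      by (rule integrable_bound[OF ib]) (use f0 fo in auto)
    have ir: "integrable lborel (\<lambda>x. indicator (box a b) x * \<rho> x)"
    proof (rule integrable_bound[OF integrable_mult_right[OF ib, of K]])
      show "AE x in lborel. norm (indicator (box a b) x * \<rho> x) \<le> norm (K * indicator (box a b) x)"
      proof (rule AE_I2)
        fix x show "norm (indicator (box a b) x * \<rho> x) \<le> norm (K * indicator (box a b) x)"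
          using \<rho>_nonneg[of x] \<rho>_le[of x] by (auto simp: indicator_def)
      qed
    qed measurable
    have 1: "(\<lambda>n. \<integral>x. f n x \<partial>\<mu>) \<longlonglongrightarrow> (\<integral>x. indicator (box a b) x \<partial>\<mu>)"
      by (rule integral_dominated_convergence[where w = "\<lambda>_. 1"]) (use f0 fl in auto)
    have 2: "(\<lambda>n. \<integral>x. f n x * \<rho> x \<partial>lborel) \<longlonglongrightarrow> (\<integral>x. indicator (box a b) x * \<rho> x \<partial>lborel)"
    proof (rule integral_dominated_convergence[where w = "\<lambda>x. indicator (box a b) x * \<rho> x"])
      show "AE x in lborel. (\<lambda>n. f n x * \<rho> x) \<longlonglongrightarrow> indicator (box a b) x * \<rho> x"
        by (intro AE_I2 tendsto_intros fl)
      show "AE x in lborel. norm (f n x * \<rho> x) \<le> indicator (box a b) x * \<rho> x" for n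
        by (rule AE_I2) (simp add: abs_mult f0 \<rho>_nonneg mult_right_mono fo)
    qed (use ir in auto)
    have "(\<integral>x. indicator (box a b) x \<partial>\<mu>) = (\<integral>x. indicator (box a b) x * \<rho> x \<partial>lborel)"
      using 1 2 test[OF fc f0(1) f0(2) fi] LIMSEQ_unique by simp
    moreover have "emeasure (density lborel (\<lambda>x. ennreal (\<rho> x))) (box a b)
        = ennreal (\<integral>x. indicator (box a b) x * \<rho> x \<partial>lborel)"
    proof -
      have "emeasure (density lborel (\<lambda>x. ennreal (\<rho> x))) (box a b)
          = (\<integral>\<^sup>+x. ennreal (\<rho> x) * indicator (box a b) x \<partial>lborel)"
        by (rule emeasure_density) auto
      also have "\<dots> = (\<integral>\<^sup>+x. ennreal (indicator (box a b) x * \<rho> x) \<partial>lborel)"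
        by (intro nn_integral_cong) (auto simp: indicator_def)
      also have "\<dots> = ennreal (\<integral>x. indicator (box a b) x * \<rho> x \<partial>lborel)"
        by (rule nn_integral_eq_integral[OF ir]) (simp add: \<rho>_nonneg)
      finally show ?thesis .
    qed
    ultimately show ?thesis by (simp add: emeasure_eq_measure)
  qed
  have "\<mu> = density lborel (\<lambda>x. ennreal (\<rho> x))"
  proof (rule measure_eqI_generator_eq)
    let ?E = "range (\<lambda>(a, b). box a b::'a set)"
    show "Int_stable ?E" by (auto simp: Int_stable_def box_Int_box)
    show "?E \<subseteq> Pow UNIV" "sets \<mu> = sigma_sets UNIV ?E"
      "sets (density lborel (\<lambda>x. ennreal (\<rho> x))) = sigma_sets UNIV ?E"
      by (simp_all add: borel_eq_box sets)
    let ?A = "\<lambda>n::nat. box (- (real n *\<^sub>R One)) (real n *\<^sub>R One) :: 'a set"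
    show "range ?A \<subseteq> ?E" "(\<Union>i. ?A i) = UNIV" unfolding UN_box_eq_UNIV by auto
    show "emeasure \<mu> (?A i) \<noteq> \<infinity>" for i by (simp add: emeasure_eq_measure)
    show "emeasure \<mu> X = emeasure (density lborel (\<lambda>x. ennreal (\<rho> x))) X" if "X \<in> ?E" for X
      using that box by auto
  qed
  then show ?thesis using \<rho>_nonneg cont \<rho>_le unfolding K_def D_def by blast
qed

lemma nn_integral_exp_sq_real:
  assumes a: "a > 0"
  shows "(\<integral>\<^sup>+(x::real). ennreal (exp (- (a * x\<^sup>2))) \<partial>lborel) = ennreal (sqrt (pi / a))"
proof -
  define \<sigma> where "\<sigma> = sqrt (1 / (2 * a))"
  have \<sigma>: "\<sigma> > 0" "\<sigma>\<^sup>2 = 1 / (2 * a)" using a by (auto simp: \<sigma>_def)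
  have "exp (- (a * x\<^sup>2)) = sqrt (pi / a) * normal_density 0 \<sigma> x" for x
    using a by (simp add: normal_density_def \<sigma> real_sqrt_divide real_sqrt_mult)
  then have "(\<integral>\<^sup>+x. ennreal (exp (- (a * x\<^sup>2))) \<partial>lborel) = (\<integral>\<^sup>+x. ennreal (sqrt (pi / a) * normal_density 0 \<sigma> x) \<partial>lborel)"
    by simp
  also have "\<dots> = ennreal (\<integral>x. sqrt (pi / a) * normal_density 0 \<sigma> x \<partial>lborel)"
    using \<sigma>(1) a by (intro nn_integral_eq_integral) auto
  also have "\<dots> = ennreal (sqrt (pi / a))" using \<sigma>(1) by simp
  finally show ?thesis .
qed

lemma nn_integral_exp_sq_norm:
  assumes a: "a > 0"
  shows "(\<integral>\<^sup>+(x::'a::euclidean_space). ennreal (exp (- (a * (norm x)\<^sup>2))) \<partial>lborel)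
    = ennreal ((pi / a) powr (real DIM('a) / 2))"
proof -
  have "ennreal (exp (- (a * (norm x)\<^sup>2))) = (\<Prod>b\<in>Basis. ennreal (exp (- (a * (x \<bullet> b)\<^sup>2))))" for x :: 'a
  proof -
    have "(norm x)\<^sup>2 = (\<Sum>b\<in>Basis. (x \<bullet> b)\<^sup>2)"
      unfolding power2_norm_eq_inner by (subst euclidean_inner) (simp add: power2_eq_square)
    then have "- (a * (norm x)\<^sup>2) = (\<Sum>b\<in>Basis. - (a * (x \<bullet> b)\<^sup>2))"
      by (simp add: sum_distrib_left sum_negf)
    then show ?thesis by (simp add: exp_sum prod_ennreal)
  qed
  then have "(\<integral>\<^sup>+(x::'a). ennreal (exp (- (a * (norm x)\<^sup>2))) \<partial>lborel)
      = (\<Prod>b\<in>(Basis :: 'a set). \<integral>\<^sup>+x. ennreal (exp (- (a * x\<^sup>2))) \<partial>lborel)"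
    by (simp add: nn_integral_lborel_prod[where 'a='a, of "\<lambda>_ x. ennreal (exp (- (a * x\<^sup>2)))"])
  also have "\<dots> = ennreal (sqrt (pi / a) ^ DIM('a))"
    using a by (simp add: nn_integral_exp_sq_real ennreal_power)
  also have "sqrt (pi / a) ^ DIM('a) = (pi / a) powr (real DIM('a) / 2)"
    using a by (simp add: powr_half_sqrt[symmetric] powr_powr flip: powr_realpow)
  finally show ?thesis .
qed

lemma nn_integral_Gamma_scaled:
  fixes p a :: real
  assumes p: "p > 0" and a: "a > 0"
  shows "(\<integral>\<^sup>+s. ennreal (indicator {0<..} s * s powr (p - 1) * exp (- (a * s))) \<partial>lborel) = ennreal (Gamma p * a powr (- p))"
proof -
  define f where "f t = ennreal (indicator {0..} t * t powr (p - 1) / exp t)" for t :: real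
  have [measurable]: "f \<in> borel_measurable borel" unfolding f_def by measurable
  have eq: "ennreal (indicator {0<..} s * s powr (p - 1) * exp (- (a * s))) = ennreal (a powr (1 - p)) * f (0 + a * s)" for s
  proof (cases "s > 0")
    case True
    then have "a powr (1 - p) * (a * s) powr (p - 1) = s powr (p - 1)"
      using a by (simp add: powr_mult mult.assoc[symmetric] powr_add[symmetric])
    then show ?thesis using True a
      by (simp add: f_def ennreal_mult[symmetric] exp_minus field_simps)
  next
    case False
    then show ?thesis using a by (cases "s = 0") (auto simp: f_def indicator_def zero_le_mult_iff)
  qed
  have "ennreal (Gamma p) = ennreal a * (\<integral>\<^sup>+s. f (0 + a * s) \<partial>lborel)"
    using Gamma_conv_nn_integral_real[OF p] nn_integral_real_affine[of f a 0] a by (simp add: f_def)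
  then have "ennreal (a powr (1 - p)) * ennreal (Gamma p)
      = ennreal a * (\<integral>\<^sup>+s. ennreal (a powr (1 - p)) * f (0 + a * s) \<partial>lborel)"
    by (subst nn_integral_cmult) (simp_all add: mult_ac)
  then have 1: "ennreal a * (\<integral>\<^sup>+s. ennreal (a powr (1 - p)) * f (0 + a * s) \<partial>lborel) = ennreal (a * (Gamma p * a powr (- p)))"
    using a p by (simp add: ennreal_mult[symmetric] Gamma_real_nonneg powr_diff powr_minus field_simps)
  have cancel: "ennreal (1 / a) * (ennreal a * Y) = Y" for Y
    using a by (simp add: mult.assoc[symmetric] ennreal_mult[symmetric])
  have "(\<integral>\<^sup>+s. ennreal (a powr (1 - p)) * f (0 + a * s) \<partial>lborel)
      = ennreal (1 / a) * ennreal (a * (Gamma p * a powr (- p)))"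
    unfolding 1[symmetric] cancel ..
  also have "\<dots> = ennreal (Gamma p * a powr (- p))"
    using a cancel[of "ennreal (Gamma p * a powr (- p))"] by (simp add: ennreal_mult')
  finally show ?thesis unfolding eq .
qed

text \<open>Writing the power as a Gamma integral of \<open>exp(- (1 + a\<^sup>2 \<bar>x\<bar>\<^sup>2) s)\<close> makes the integral over \<open>x\<close> Gaussian.\<close>

lemma nn_integral_japanese_bracket:
  fixes p a :: real
  assumes p: "p > real DIM('a) / 2" and a: "a > 0"
  shows "(\<integral>\<^sup>+(x::'a::euclidean_space). ennreal ((1 + a\<^sup>2 * (norm x)\<^sup>2) powr (- p)) \<partial>lborel)
    = ennreal (pi powr (real DIM('a) / 2) / a ^ DIM('a) * (Gamma (p - real DIM('a) / 2) / Gamma p))"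
proof -
  let ?f = "\<lambda>(x::'a) s. ennreal (indicator {0<..} s * s powr (p - 1) * exp (- ((1 + a\<^sup>2 * (norm x)\<^sup>2) * s)))"
  define d where "d = real DIM('a) / 2"
  have d: "0 \<le> d" "d < p" and p0: "p > 0" using p by (auto simp: d_def)
  have G: "Gamma p > 0" using p0 by simp
  have [measurable]: "(\<lambda>(x::'a, s). ?f x s)
      \<in> borel_measurable (lborel \<Otimes>\<^sub>M lborel)"
    by measurable
  have "ennreal (Gamma p) * (\<integral>\<^sup>+(x::'a). ennreal ((1 + a\<^sup>2 * (norm x)\<^sup>2) powr (- p)) \<partial>lborel)
      = (\<integral>\<^sup>+(x::'a). ennreal (Gamma p * (1 + a\<^sup>2 * (norm x)\<^sup>2) powr (- p)) \<partial>lborel)"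
    using G by (subst nn_integral_cmult[symmetric]) (auto simp: ennreal_mult)
  also have "\<dots> = (\<integral>\<^sup>+(x::'a). (\<integral>\<^sup>+s. ?f x s \<partial>lborel) \<partial>lborel)"
    using p0 by (intro nn_integral_cong nn_integral_Gamma_scaled[symmetric]) (auto intro: add_pos_nonneg)
  also have "\<dots> = (\<integral>\<^sup>+s. (\<integral>\<^sup>+(x::'a). ?f x s \<partial>lborel) \<partial>lborel)"
    by (rule lborel_pair.Fubini'[symmetric]) measurable
  also have "\<dots> = (\<integral>\<^sup>+s. ennreal ((pi / a\<^sup>2) powr d) * ennreal (indicator {0<..} s * s powr (p - d - 1) * exp (- (1 * s))) \<partial>lborel)"
  proof (rule nn_integral_cong)
    fix s :: real
    show "(\<integral>\<^sup>+(x::'a). ?f x s \<partial>lborel)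
        = ennreal ((pi / a\<^sup>2) powr d) * ennreal (indicator {0<..} s * s powr (p - d - 1) * exp (- (1 * s)))"
    proof (cases "s > 0")
      case True
      have "(\<integral>\<^sup>+(x::'a). ?f x s \<partial>lborel)
          = (\<integral>\<^sup>+(x::'a). ennreal (s powr (p - 1) * exp (- s)) * ennreal (exp (- ((a\<^sup>2 * s) * (norm x)\<^sup>2))) \<partial>lborel)"
        using True by (intro nn_integral_cong) (simp add: ennreal_mult[symmetric] exp_add[symmetric] algebra_simps)
      also have "\<dots> = ennreal (s powr (p - 1) * exp (- s)) * ennreal ((pi / (a\<^sup>2 * s)) powr d)"
        using True a by (subst nn_integral_cmult) (auto simp: nn_integral_exp_sq_norm d_def)
      also have "\<dots> = ennreal ((pi / a\<^sup>2) powr d * (s powr (p - d - 1) * exp (- s)))"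
        using True a by (simp add: ennreal_mult[symmetric] powr_divide powr_mult powr_diff powr_add field_simps)
      finally show ?thesis using True by (simp add: ennreal_mult)
    qed simp
  qed
  also have "\<dots> = ennreal ((pi / a\<^sup>2) powr d) * ennreal (Gamma (p - d))"
    using nn_integral_Gamma_scaled[of "p - d" 1] d by (subst nn_integral_cmult) auto
  also have "\<dots> = ennreal ((pi / a\<^sup>2) powr d * Gamma (p - d))"
    using d by (simp add: ennreal_mult Gamma_real_nonneg)
  finally have "ennreal (1 / Gamma p) * (ennreal (Gamma p) * (\<integral>\<^sup>+(x::'a). ennreal ((1 + a\<^sup>2 * (norm x)\<^sup>2) powr (- p)) \<partial>lborel))
      = ennreal (1 / Gamma p) * ennreal ((pi / a\<^sup>2) powr d * Gamma (p - d))" by simp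
  then have "(\<integral>\<^sup>+(x::'a). ennreal ((1 + a\<^sup>2 * (norm x)\<^sup>2) powr (- p)) \<partial>lborel)
      = ennreal (1 / Gamma p * ((pi / a\<^sup>2) powr d * Gamma (p - d)))"
    using G d by (simp add: mult.assoc[symmetric] ennreal_mult[symmetric] Gamma_real_nonneg)
  also have "(pi / a\<^sup>2) powr d = pi powr d / a ^ DIM('a)"
  proof -
    have "(a\<^sup>2) powr d = (a powr 2) powr d" using a by simp
    also have "\<dots> = a powr real DIM('a)" unfolding powr_powr by (simp add: d_def)
    also have "\<dots> = a ^ DIM('a)" using a by (simp add: powr_realpow)
    finally show ?thesis using a by (simp add: powr_divide)
  qed
  finally show ?thesis by (simp add: d_def mult.commute)
qed

section \<open>Gaussian fields: integration by parts and Wick products\<close>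

abbreviation (in prob_space) short_expectation (binder "\<E>" 10) where "short_expectation X \<equiv> expectation X"

text \<open>Polynomials in Gaussian variables have all moments, and this class is closed under sums and products, so it
settles every integrability question about them.\<close>

definition (in prob_space) all_moments :: "('a \<Rightarrow> real) \<Rightarrow> bool" where
  "all_moments X \<longleftrightarrow> X \<in> borel_measurable M \<and> (\<forall>p::nat. integrable M (\<lambda>w. \<bar>X w\<bar> ^ p))"

context prob_space
begin

lemma all_moments_measurable: "all_moments X \<Longrightarrow> X \<in> borel_measurable M"
  by (simp add: all_moments_def)

lemma all_moments_integrable: "all_moments X \<Longrightarrow> integrable M X"
proof -
  assume X: "all_moments X"
  then have "integrable M (\<lambda>w. \<bar>X w\<bar> ^ 1)" unfolding all_moments_def by blast
  then have "integrable M (\<lambda>w. \<bar>X w\<bar>)" by simp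
  then show "integrable M X" by (rule integrable_abs_cancel) (rule all_moments_measurable[OF X])
qed

lemma all_moments_const: "all_moments (\<lambda>_. c)"
  by (simp add: all_moments_def)

lemma all_moments_mult:
  assumes X: "all_moments X" and Y: "all_moments Y"
  shows "all_moments (\<lambda>w. X w * Y w)"
  unfolding all_moments_def
proof (intro conjI allI)
  have [measurable]: "X \<in> borel_measurable M" "Y \<in> borel_measurable M"
    using X Y by (auto simp: all_moments_def)
  show "(\<lambda>w. X w * Y w) \<in> borel_measurable M" by measurable
  fix p :: nat
  have i: "integrable M (\<lambda>w. \<bar>X w\<bar> ^ (2 * p) + \<bar>Y w\<bar> ^ (2 * p))"
    using X Y by (intro integrable_add) (auto simp: all_moments_def)
  have "a ^ p * b ^ p \<le> a ^ (2 * p) + b ^ (2 * p)" if "0 \<le> a" "0 \<le> b" for a b :: real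
  proof -
    have "2 * (a ^ p * b ^ p) \<le> (a ^ p)\<^sup>2 + (b ^ p)\<^sup>2"
      using sum_squares_bound[of "a ^ p" "b ^ p"] by (simp add: mult.assoc)
    moreover have "0 \<le> a ^ p * b ^ p" using that by simp
    ultimately show ?thesis by (simp add: power_mult[symmetric] mult.commute)
  qed
  then show "integrable M (\<lambda>w. \<bar>X w * Y w\<bar> ^ p)"
    by (intro integrable_bound[OF i]) (auto simp: abs_mult power_mult_distrib)
qed

lemma all_moments_add:
  assumes X: "all_moments X" and Y: "all_moments Y"
  shows "all_moments (\<lambda>w. X w + Y w)"
  unfolding all_moments_def
proof (intro conjI allI)
  have [measurable]: "X \<in> borel_measurable M" "Y \<in> borel_measurable M"
    using X Y by (auto simp: all_moments_def)
  show "(\<lambda>w. X w + Y w) \<in> borel_measurable M" by measurable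
  fix p :: nat
  have i: "integrable M (\<lambda>w. 2 ^ p * (\<bar>X w\<bar> ^ p + \<bar>Y w\<bar> ^ p))"
    using X Y by (intro integrable_mult_right integrable_add) (auto simp: all_moments_def)
  have "\<bar>a + b\<bar> ^ p \<le> 2 ^ p * (\<bar>a\<bar> ^ p + \<bar>b\<bar> ^ p)" for a b :: real
  proof -
    have "\<bar>a + b\<bar> ^ p \<le> (2 * max \<bar>a\<bar> \<bar>b\<bar>) ^ p" by (intro power_mono) auto
    also have "\<dots> = 2 ^ p * (max \<bar>a\<bar> \<bar>b\<bar>) ^ p" by (simp add: power_mult_distrib)
    also have "(max \<bar>a\<bar> \<bar>b\<bar>) ^ p \<le> \<bar>a\<bar> ^ p + \<bar>b\<bar> ^ p" by (auto simp: max_def)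
    finally show ?thesis by simp
  qed
  then show "integrable M (\<lambda>w. \<bar>X w + Y w\<bar> ^ p)"
    by (intro integrable_bound[OF i]) auto
qed

lemma all_moments_cmult: "all_moments X \<Longrightarrow> all_moments (\<lambda>w. c * X w)"
  by (rule all_moments_mult[OF all_moments_const])

lemma all_moments_diff: "all_moments X \<Longrightarrow> all_moments Y \<Longrightarrow> all_moments (\<lambda>w. X w - Y w)"
  using all_moments_add[of X "\<lambda>w. - 1 * Y w"] all_moments_cmult[of Y "- 1"] by simp

lemma all_moments_power: "all_moments X \<Longrightarrow> all_moments (\<lambda>w. X w ^ n)"
  by (induction n) (auto intro: all_moments_const all_moments_mult)

lemma all_moments_sum: "(\<And>i. i \<in> I \<Longrightarrow> all_moments (X i)) \<Longrightarrow> all_moments (\<lambda>w. \<Sum>i\<in>I. X i w)"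
  by (induction I rule: infinite_finite_induct) (auto intro: all_moments_const all_moments_add)

lemmas all_moments_intros =
  all_moments_const all_moments_mult all_moments_add all_moments_diff all_moments_power all_moments_sum

lemma has_derivative_moment_at_0:
  assumes X: "all_moments X" and Y: "all_moments Y" and Z: "all_moments Z"
  shows "((\<lambda>\<epsilon>. (\<E> w. Z w * (X w + \<epsilon> * Y w) ^ n)) has_real_derivative
    (real n * (\<E> w. Z w * X w ^ (n - 1) * Y w))) (at 0)"
proof -
  define c where "c k = real (n choose k) * (\<E> w. Z w * Y w ^ k * X w ^ (n - k))" for k
  have int: "integrable M (\<lambda>w. Z w * Y w ^ k * X w ^ (n - k))" for k
    by (intro all_moments_integrable all_moments_intros X Y Z)
  have eq: "(\<E> w. Z w * (X w + \<epsilon> * Y w) ^ n) = (\<Sum>k\<le>n. c k * \<epsilon> ^ k)" for \<epsilon>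
  proof -
    have "Z w * (X w + \<epsilon> * Y w) ^ n = (\<Sum>k\<le>n. (real (n choose k) * \<epsilon> ^ k) * (Z w * Y w ^ k * X w ^ (n - k)))" for w
      unfolding add.commute[of "X w"] binomial_ring sum_distrib_left
      by (intro sum.cong refl) (simp add: power_mult_distrib mult_ac)
    then have "(\<E> w. Z w * (X w + \<epsilon> * Y w) ^ n)
        = (\<Sum>k\<le>n. (real (n choose k) * \<epsilon> ^ k) * (\<E> w. Z w * Y w ^ k * X w ^ (n - k)))"
      using int by simp
    then show ?thesis by (simp add: c_def mult_ac)
  qed
  have "((\<lambda>\<epsilon>. \<Sum>k\<le>n. c k * \<epsilon> ^ k) has_real_derivative (\<Sum>k\<le>n. c k * (real k * 0 ^ (k - 1)))) (at 0)"
    by (auto intro!: derivative_eq_intros sum.cong)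
  also have "(\<Sum>k\<le>n. c k * (real k * 0 ^ (k - 1))) = real n * (\<E> w. Z w * X w ^ (n - 1) * Y w)"
  proof (cases n)
    case (Suc m)
    have "(\<Sum>k\<le>n. c k * (real k * 0 ^ (k - 1))) = (\<Sum>k\<le>n. if k = 1 then c 1 else 0)"
      by (intro sum.cong refl) (auto simp: power_0_left)
    also have "\<dots> = c 1" using Suc by simp
    finally show ?thesis using Suc by (simp add: c_def mult_ac)
  qed simp
  finally show ?thesis unfolding eq .
qed

end

text \<open>A Gaussian field over an abstract inner product space. Linearity holds only almost surely, as for an isonormal
process, and joint normality is encoded by requiring it for each single vector.\<close>

locale gaussian_field = prob_space M for M :: "'a measure" +
  fixes W :: "'h::real_inner \<Rightarrow> 'a \<Rightarrow> real"
  assumes W_measurable [measurable]: "W f \<in> borel_measurable M"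
    and W_add: "AE w in M. W (f + g) w = W f w + W g w"
    and W_scaleR: "AE w in M. W (c *\<^sub>R f) w = c * W f w"
    and W_unit: "norm f = 1 \<Longrightarrow> distributed M lborel (W f) (\<lambda>x. ennreal (std_normal_density x))"
begin

lemma W_unit_factor:
  "\<exists>u. (f = 0 \<or> norm u = 1) \<and> (AE w in M. W f w = norm f * W u w)"
proof (cases "f = 0")
  case True
  have "AE w in M. W (0 *\<^sub>R f) w = 0 * W f w" by (rule W_scaleR)
  then show ?thesis using True by (intro exI[of _ 0]) simp
next
  case False
  have "AE w in M. W (norm f *\<^sub>R (f /\<^sub>R norm f)) w = norm f * W (f /\<^sub>R norm f) w" by (rule W_scaleR)
  then show ?thesis using False by (intro exI[of _ "f /\<^sub>R norm f"]) simp
qed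

lemma all_moments_W: "all_moments (W f)"
  unfolding all_moments_def
proof (intro conjI allI)
  fix p :: nat
  obtain u where u: "f = 0 \<or> norm u = 1" and fu: "AE w in M. W f w = norm f * W u w"
    using W_unit_factor by blast
  have "integrable M (\<lambda>w. norm f ^ p * \<bar>W u w\<bar> ^ p)"
  proof (cases "f = 0")
    case True
    then show ?thesis by (cases "p = 0") auto
  next
    case False
    then have "norm u = 1" using u by simp
    from distributed_integrable[OF W_unit[OF this], of "\<lambda>x. \<bar>x\<bar> ^ p"]
    have "integrable M (\<lambda>w. \<bar>W u w\<bar> ^ p)" using integrable_std_normal_moment_abs[of p] by simp
    then show ?thesis by simp
  qed
  moreover have "AE w in M. \<bar>W f w\<bar> ^ p = norm f ^ p * \<bar>W u w\<bar> ^ p"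
    using fu by eventually_elim (simp add: abs_mult power_mult_distrib)
  ultimately show "integrable M (\<lambda>w. \<bar>W f w\<bar> ^ p)"
    by (subst integrable_cong_AE) auto
qed measurable

definition gauss_moment :: "nat \<Rightarrow> real" where
  "gauss_moment n = (\<integral>x. std_normal_density x * x ^ n \<partial>lborel)"

lemma gauss_moment_odd: "odd n \<Longrightarrow> gauss_moment n = 0"
  unfolding gauss_moment_def using integral_std_normal_moment_odd by (auto elim!: oddE)

lemma gauss_moment_rec: "gauss_moment (2 * Suc q) = (2 * real q + 1) * gauss_moment (2 * q)"
proof -
  have 1: "fact (2 * Suc q) = (2 * (real q + 1)) * ((2 * real q + 1) * fact (2 * q))"
    by (simp add: algebra_simps)
  have 2: "(2::real) ^ Suc q * fact (Suc q) = (2 * (real q + 1)) * (2 ^ q * fact q)"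
    by (simp add: algebra_simps)
  have "2 * (real q + 1) \<noteq> 0" by simp
  then show ?thesis
    unfolding gauss_moment_def integral_std_normal_moment_even 1 2
    by (subst mult_divide_mult_cancel_left) auto
qed

lemma expectation_W_power: "(\<E> w. W f w ^ n) = norm f ^ n * gauss_moment n"
proof -
  obtain u where u: "f = 0 \<or> norm u = 1" and fu: "AE w in M. W f w = norm f * W u w"
    using W_unit_factor by blast
  have "(\<E> w. W f w ^ n) = (\<E> w. norm f ^ n * W u w ^ n)"
    by (rule integral_cong_AE) (use fu in \<open>auto simp: power_mult_distrib\<close>)
  also have "\<dots> = norm f ^ n * (\<E> w. W u w ^ n)" by simp
  also have "\<dots> = norm f ^ n * gauss_moment n"
  proof (cases "f = 0")
    case True
    have "gauss_moment 0 = 1" by (simp add: gauss_moment_def)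
    then show ?thesis using True by (cases "n = 0") (auto simp: prob_space)
  next
    case False
    then have "norm u = 1" using u by simp
    from distributed_integral[OF W_unit[OF this], of "\<lambda>x. x ^ n"]
    show ?thesis by (simp add: gauss_moment_def)
  qed
  finally show ?thesis .
qed

lemma W_add_scaleR: "AE w in M. W (f + c *\<^sub>R g) w = W f w + c * W g w"
  using W_add[of f "c *\<^sub>R g"] W_scaleR[of c g] by eventually_elim simp

lemma W_sum:
  assumes "finite I"
  shows "AE w in M. W (\<Sum>i\<in>I. c i *\<^sub>R f i) w = (\<Sum>i\<in>I. c i * W (f i) w)"
  using assms
proof (induction I)
  case empty
  show ?case using W_scaleR[of 0 0] by simp
next
  case (insert i I)
  have "AE w in M. W ((\<Sum>i\<in>I. c i *\<^sub>R f i) + c i *\<^sub>R f i) w = W (\<Sum>i\<in>I. c i *\<^sub>R f i) w + c i * W (f i) w"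
    by (rule W_add_scaleR)
  with insert.IH show ?case
    by eventually_elim (use insert.hyps in \<open>simp add: add.commute\<close>)
qed

abbreviation prodW :: "'h list \<Rightarrow> 'a \<Rightarrow> real" where
  "prodW hs w \<equiv> (\<Prod>h\<leftarrow>hs. W h w)"

text \<open>The Leibniz rule for the derivative of \<open>prodW\<close> in direction \<open>h\<close>, recursively along the list.\<close>

primrec derW :: "'h \<Rightarrow> 'h list \<Rightarrow> 'a \<Rightarrow> real" where
  "derW h [] w = 0"
| "derW h (g # gs) w = (h \<bullet> g) * prodW gs w + W g w * derW h gs w"

lemma all_moments_prodW: "all_moments (prodW hs)"
  by (induction hs) (auto intro!: all_moments_intros all_moments_W)

lemma all_moments_derW: "all_moments (derW h hs)"
  by (induction hs) (auto intro!: all_moments_intros all_moments_W all_moments_prodW)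

text \<open>The moments of \<open>W (g + \<epsilon> h)\<close> depend only on the norm; differentiating them at \<open>\<epsilon> = 0\<close> gives the identity.\<close>

lemma stein_power:
  "(\<E> w. W h w * W g w ^ n) = real n * (h \<bullet> g) * (\<E> w. W g w ^ (n - 1))"
proof (cases "odd n")
  case False
  have d1: "((\<lambda>\<epsilon>. (\<E> w. 1 * (W g w + \<epsilon> * W h w) ^ Suc n)) has_real_derivative
    (real (Suc n) * (\<E> w. 1 * W g w ^ (Suc n - 1) * W h w))) (at 0)"
    by (intro has_derivative_moment_at_0 all_moments_intros all_moments_W)
  have z: "(\<E> w. 1 * (W g w + \<epsilon> * W h w) ^ Suc n) = 0" for \<epsilon>
  proof -
    have "(\<E> w. 1 * (W g w + \<epsilon> * W h w) ^ Suc n) = (\<E> w. W (g + \<epsilon> *\<^sub>R h) w ^ Suc n)"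
      by (rule integral_cong_AE) (use W_add_scaleR[of g \<epsilon> h] in auto)
    then show ?thesis unfolding expectation_W_power using False by (simp add: gauss_moment_odd)
  qed
  have "real (Suc n) * (\<E> w. W g w ^ n * W h w) = 0"
    using DERIV_unique[OF d1[unfolded z] DERIV_const] by simp
  moreover have "real n * (\<E> w. W g w ^ (n - 1)) = 0"
    unfolding expectation_W_power using False by (cases n) (auto simp: gauss_moment_odd)
  ultimately show ?thesis by (auto simp: mult.commute)
next
  case True
  then obtain q where n: "n = 2 * q + 1" by (auto elim: oddE)
  then have Sn: "Suc n = 2 * Suc q" by simp
  have d1: "((\<lambda>\<epsilon>. (\<E> w. 1 * (W g w + \<epsilon> * W h w) ^ Suc n)) has_real_derivative
    (real (Suc n) * (\<E> w. 1 * W g w ^ (Suc n - 1) * W h w))) (at 0)"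
    by (intro has_derivative_moment_at_0 all_moments_intros all_moments_W)
  have z: "(\<E> w. 1 * (W g w + \<epsilon> * W h w) ^ Suc n)
      = (g \<bullet> g + 2 * \<epsilon> * (g \<bullet> h) + \<epsilon>\<^sup>2 * (h \<bullet> h)) ^ Suc q * gauss_moment (2 * Suc q)" for \<epsilon>
  proof -
    have "(\<E> w. 1 * (W g w + \<epsilon> * W h w) ^ Suc n) = (\<E> w. W (g + \<epsilon> *\<^sub>R h) w ^ Suc n)"
      by (rule integral_cong_AE) (use W_add_scaleR[of g \<epsilon> h] in auto)
    also have "\<dots> = norm (g + \<epsilon> *\<^sub>R h) ^ (2 * Suc q) * gauss_moment (2 * Suc q)"
      unfolding expectation_W_power Sn ..
    also have "\<dots> = ((norm (g + \<epsilon> *\<^sub>R h))\<^sup>2) ^ Suc q * gauss_moment (2 * Suc q)"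
      by (simp only: power_mult[of "norm (g + \<epsilon> *\<^sub>R h)" 2])
    also have "(norm (g + \<epsilon> *\<^sub>R h))\<^sup>2 = g \<bullet> g + 2 * \<epsilon> * (g \<bullet> h) + \<epsilon>\<^sup>2 * (h \<bullet> h)"
      unfolding power2_norm_eq_inner
      by (simp add: inner_add_left inner_add_right inner_commute[of h g] power2_eq_square algebra_simps)
    finally show ?thesis .
  qed
  have d2: "((\<lambda>\<epsilon>. (g \<bullet> g + 2 * \<epsilon> * (g \<bullet> h) + \<epsilon>\<^sup>2 * (h \<bullet> h)) ^ Suc q * gauss_moment (2 * Suc q))
      has_real_derivative (real (Suc q) * (g \<bullet> g) ^ q * (2 * (g \<bullet> h)) * gauss_moment (2 * Suc q))) (at 0)"
  proof -
    have "((\<lambda>\<epsilon>. g \<bullet> g + 2 * \<epsilon> * (g \<bullet> h) + \<epsilon>\<^sup>2 * (h \<bullet> h)) has_real_derivative (2 * (g \<bullet> h))) (at 0)"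
      by (auto intro!: derivative_eq_intros)
    from DERIV_cmult_right[OF DERIV_power[OF this, of "Suc q"], of "gauss_moment (2 * Suc q)"]
    show ?thesis by (simp add: mult_ac)
  qed
  have "real (Suc n) * (\<E> w. 1 * W g w ^ (Suc n - 1) * W h w)
      = real (Suc q) * (g \<bullet> g) ^ q * (2 * (g \<bullet> h)) * gauss_moment (2 * Suc q)"
    by (rule DERIV_unique[OF d1[unfolded z] d2])
  then have "(2 * real (Suc q)) * (\<E> w. W h w * W g w ^ n)
      = (2 * real (Suc q)) * ((g \<bullet> g) ^ q * (g \<bullet> h) * gauss_moment (2 * Suc q))"
    by (simp add: Sn n mult_ac)
  then have "(\<E> w. W h w * W g w ^ n) = (g \<bullet> g) ^ q * (g \<bullet> h) * gauss_moment (2 * Suc q)"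
    by (subst (asm) mult_left_cancel) auto
  moreover have "(\<E> w. W g w ^ (n - 1)) = (g \<bullet> g) ^ q * gauss_moment (2 * q)"
    unfolding expectation_W_power by (simp add: n power_mult power2_norm_eq_inner)
  moreover have "real n * (h \<bullet> g) * ((g \<bullet> g) ^ q * gauss_moment (2 * q))
      = (g \<bullet> g) ^ q * (g \<bullet> h) * gauss_moment (2 * Suc q)"
    unfolding gauss_moment_rec by (simp add: n inner_commute[of h g])
  ultimately show ?thesis by (simp only:)
qed

text \<open>Polarization by differentiation: replacing \<open>g\<close> by \<open>g + \<epsilon> h'\<close> in the identity for a shorter list and differentiating at
\<open>\<epsilon> = 0\<close> produces the additional factor \<open>W h'\<close>.\<close>

lemma stein_aux:
  "(\<E> w. W h w * W g w ^ n * prodW hs w)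
    = real n * (h \<bullet> g) * (\<E> w. W g w ^ (n - 1) * prodW hs w)
      + (\<E> w. W g w ^ n * derW h hs w)"
proof (induction hs arbitrary: n g)
  case Nil
  show ?case using stein_power[of h g n] by simp
next
  case (Cons h' hs)
  note am = all_moments_intros all_moments_W all_moments_prodW all_moments_derW
  have D: "((\<lambda>\<epsilon>. (\<E> w. Z w * (W g w + \<epsilon> * W h' w) ^ k)) has_real_derivative
    (real k * (\<E> w. Z w * W g w ^ (k - 1) * W h' w))) (at 0)" if "all_moments Z" for Z k
    by (intro has_derivative_moment_at_0 all_moments_W that)
  define P where "P = prodW hs"
  define Q where "Q = derW h hs"
  have P: "all_moments P" and Q: "all_moments Q" unfolding P_def Q_def by (rule am)+
  have [measurable]: "P \<in> borel_measurable M" "Q \<in> borel_measurable M"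
    using P Q by (auto intro: all_moments_measurable)
  have eq: "(\<E> w. (W h w * P w) * (W g w + \<epsilon> * W h' w) ^ Suc n)
      = real (Suc n) * (h \<bullet> g + \<epsilon> * (h \<bullet> h')) * (\<E> w. P w * (W g w + \<epsilon> * W h' w) ^ n)
        + (\<E> w. Q w * (W g w + \<epsilon> * W h' w) ^ Suc n)" for \<epsilon>
  proof -
    have *: "(\<E> w. Z w * (W g w + \<epsilon> * W h' w) ^ k) = (\<E> w. Z w * W (g + \<epsilon> *\<^sub>R h') w ^ k)"
      if "Z \<in> borel_measurable M" for Z k
      by (rule integral_cong_AE) (use that W_add_scaleR[of g \<epsilon> h'] in auto)
    have m: "(\<lambda>w. W h w * P w) \<in> borel_measurable M" "P \<in> borel_measurable M" "Q \<in> borel_measurable M"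
      by measurable
    show ?thesis
      unfolding *[OF m(1)] *[OF m(2)] *[OF m(3)]
      using Cons.IH[of "g + \<epsilon> *\<^sub>R h'" "Suc n"]
      by (simp add: P_def Q_def inner_add_right mult_ac del: power_Suc)
  qed
  have d1: "((\<lambda>\<epsilon>. (\<E> w. (W h w * P w) * (W g w + \<epsilon> * W h' w) ^ Suc n)) has_real_derivative
     real (Suc n) * (\<E> w. (W h w * P w) * W g w ^ n * W h' w)) (at 0)"
    using D[of "\<lambda>w. W h w * P w" "Suc n"] all_moments_mult[OF all_moments_W P, of h] by simp
  have d2: "((\<lambda>\<epsilon>. real (Suc n) * (h \<bullet> g + \<epsilon> * (h \<bullet> h')) * (\<E> w. P w * (W g w + \<epsilon> * W h' w) ^ n)
        + (\<E> w. Q w * (W g w + \<epsilon> * W h' w) ^ Suc n)) has_real_derivative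
      (real (Suc n) * (h \<bullet> h') * (\<E> w. P w * W g w ^ n)
        + real (Suc n) * (h \<bullet> g) * (real n * (\<E> w. P w * W g w ^ (n - 1) * W h' w)))
      + real (Suc n) * (\<E> w. Q w * W g w ^ n * W h' w)) (at 0)"
  proof (rule DERIV_add)
    show "((\<lambda>\<epsilon>. (\<E> w. Q w * (W g w + \<epsilon> * W h' w) ^ Suc n)) has_real_derivative
       real (Suc n) * (\<E> w. Q w * W g w ^ n * W h' w)) (at 0)"
      using D[OF Q, of "Suc n"] by simp
    have "((\<lambda>\<epsilon>. real (Suc n) * (h \<bullet> g + \<epsilon> * (h \<bullet> h'))) has_real_derivative real (Suc n) * (h \<bullet> h')) (at 0)"
      by (auto intro!: derivative_eq_intros)
    from DERIV_mult[OF this D[OF P, of n]]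
    show "((\<lambda>\<epsilon>. real (Suc n) * (h \<bullet> g + \<epsilon> * (h \<bullet> h')) * (\<E> w. P w * (W g w + \<epsilon> * W h' w) ^ n))
      has_real_derivative (real (Suc n) * (h \<bullet> h') * (\<E> w. P w * W g w ^ n)
        + real (Suc n) * (h \<bullet> g) * (real n * (\<E> w. P w * W g w ^ (n - 1) * W h' w)))) (at 0)"
      by (simp add: add.commute mult_ac)
  qed
  have "real (Suc n) * (\<E> w. (W h w * P w) * W g w ^ n * W h' w)
    = real (Suc n) * ((h \<bullet> h') * (\<E> w. P w * W g w ^ n)
        + (h \<bullet> g) * (real n * (\<E> w. P w * W g w ^ (n - 1) * W h' w))
        + (\<E> w. Q w * W g w ^ n * W h' w))"
    using DERIV_unique[OF d1[unfolded eq] d2] by (simp only: distrib_left mult.assoc)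
  then have main: "(\<E> w. (W h w * P w) * W g w ^ n * W h' w)
    = (h \<bullet> h') * (\<E> w. P w * W g w ^ n)
        + (h \<bullet> g) * (real n * (\<E> w. P w * W g w ^ (n - 1) * W h' w))
        + (\<E> w. Q w * W g w ^ n * W h' w)"
    by (subst (asm) mult_left_cancel) auto
  have "(\<E> w. W g w ^ n * derW h (h' # hs) w)
     = (\<E> w. (h \<bullet> h') * (P w * W g w ^ n) + Q w * W g w ^ n * W h' w)"
    by (rule arg_cong[where f = expectation]) (auto simp: P_def Q_def algebra_simps)
  also have "\<dots> = (h \<bullet> h') * (\<E> w. P w * W g w ^ n) + (\<E> w. Q w * W g w ^ n * W h' w)"
    by (subst integral_add)
       (auto intro!: all_moments_integrable am P Q integrable_mult_right)
  finally have "(\<E> w. W g w ^ n * derW h (h' # hs) w)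
     = (h \<bullet> h') * (\<E> w. P w * W g w ^ n) + (\<E> w. Q w * W g w ^ n * W h' w)" .
  moreover have "(\<E> w. W h w * W g w ^ n * prodW (h' # hs) w)
      = (\<E> w. (W h w * P w) * W g w ^ n * W h' w)"
    by (rule arg_cong[where f = expectation]) (auto simp: P_def mult_ac)
  moreover have "(\<E> w. W g w ^ (n - 1) * prodW (h' # hs) w) = (\<E> w. P w * W g w ^ (n - 1) * W h' w)"
    by (rule arg_cong[where f = expectation]) (auto simp: P_def mult_ac)
  ultimately show ?case using main by simp
qed

theorem stein: "(\<E> w. W h w * prodW hs w) = expectation (derW h hs)"
  using stein_aux[of h 0 0 hs] by simp

lemma covariance_W: "(\<E> w. W f w * W g w) = f \<bullet> g"
proof -
  have "derW f [g] = (\<lambda>_. f \<bullet> g)" by (rule ext) simp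
  then show ?thesis using stein[of f "[g]"] by (simp add: prob_space)
qed

text \<open>The double integral \<open>I\<^sub>2\<close> of the symmetrization of \<open>f \<otimes> g\<close>.\<close>

definition wick :: "'h \<Rightarrow> 'h \<Rightarrow> 'a \<Rightarrow> real" where
  "wick f g w = W f w * W g w - f \<bullet> g"

lemma all_moments_wick: "all_moments (wick f g)"
  unfolding wick_def by (intro all_moments_intros all_moments_W)

lemma wick_isometry:
  "(\<E> w. wick f g w * wick f' g' w) = (f \<bullet> f') * (g \<bullet> g') + (f \<bullet> g') * (g \<bullet> f')"
proof -
  note am = all_moments_intros all_moments_W
  have i: "integrable M (\<lambda>w. W a w * W b w)" for a b by (intro all_moments_integrable am)
  have i4: "integrable M (\<lambda>w. W f w * W g w * (W f' w * W g' w))" by (intro all_moments_integrable am)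
  have "(\<E> w. W f w * W g w * (W f' w * W g' w))
      = expectation (derW f [g, f', g'])"
    using stein[of f "[g, f', g']"] by (simp add: mult.assoc)
  also have "\<dots> = (\<E> w. (f \<bullet> g) * (W f' w * W g' w) + ((f \<bullet> f') * (W g w * W g' w) + (f \<bullet> g') * (W g w * W f' w)))"
    by (rule arg_cong[where f = expectation]) (auto simp: algebra_simps)
  also have "\<dots> = (f \<bullet> g) * (f' \<bullet> g') + ((f \<bullet> f') * (g \<bullet> g') + (f \<bullet> g') * (g \<bullet> f'))"
    by (simp add: i covariance_W)
  finally have E4: "(\<E> w. W f w * W g w * (W f' w * W g' w))
      = (f \<bullet> g) * (f' \<bullet> g') + ((f \<bullet> f') * (g \<bullet> g') + (f \<bullet> g') * (g \<bullet> f'))" .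
  have "(\<E> w. wick f g w * wick f' g' w)
      = (\<E> w. W f w * W g w * (W f' w * W g' w) - (f' \<bullet> g') * (W f w * W g w)
          - (f \<bullet> g) * (W f' w * W g' w) + (f \<bullet> g) * (f' \<bullet> g'))"
    by (rule arg_cong[where f = expectation]) (auto simp: wick_def algebra_simps)
  also have "\<dots> = (f \<bullet> f') * (g \<bullet> g') + (f \<bullet> g') * (g \<bullet> f')"
    by (simp add: i i4 E4 covariance_W prob_space)
  finally show ?thesis .
qed

lemma wick_sum_second_moment:
  assumes "finite I"
  shows "(\<E> w. (\<Sum>p\<in>I. m p * wick (f p) (g p) w)\<^sup>2)
    = (\<Sum>p\<in>I. \<Sum>q\<in>I. m p * m q * ((f p \<bullet> f q) * (g p \<bullet> g q) + (f p \<bullet> g q) * (g p \<bullet> f q)))"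
proof -
  have i: "integrable M (\<lambda>w. wick (f p) (g p) w * wick (f q) (g q) w)" for p q
    by (intro all_moments_integrable all_moments_intros all_moments_wick)
  have "(\<Sum>p\<in>I. m p * wick (f p) (g p) w)\<^sup>2
      = (\<Sum>p\<in>I. \<Sum>q\<in>I. (m p * m q) * (wick (f p) (g p) w * wick (f q) (g q) w))" for w
    by (simp add: power2_eq_square sum_product mult_ac)
  then show ?thesis by (simp add: i wick_isometry)
qed

lemma expectation_abs_wick: "(\<E> w. \<bar>wick f g w\<bar>) \<le> 2 * norm f * norm g"
proof -
  have "((\<E> w. \<bar>wick f g w\<bar>))\<^sup>2 \<le> (\<E> w. (\<bar>wick f g w\<bar>)\<^sup>2)"
    using variance_positive[of "\<lambda>w. \<bar>wick f g w\<bar>"] variance_eq[of "\<lambda>w. \<bar>wick f g w\<bar>"]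
      all_moments_integrable[OF all_moments_wick, of f g] all_moments_integrable[OF all_moments_power[OF all_moments_wick], of f g 2]
    by simp
  also have "\<dots> = (f \<bullet> f) * (g \<bullet> g) + (f \<bullet> g) * (f \<bullet> g)"
    using wick_isometry[of f g f g] by (simp add: power2_eq_square inner_commute)
  also have "\<dots> \<le> (f \<bullet> f) * (g \<bullet> g) + (f \<bullet> f) * (g \<bullet> g)"
    using Cauchy_Schwarz_ineq[of f g] by (simp add: power2_eq_square)
  also have "\<dots> \<le> (2 * norm f * norm g)\<^sup>2"
    unfolding power_mult_distrib power2_norm_eq_inner by simp
  finally show ?thesis by (rule power2_le_imp_le) (intro mult_nonneg_nonneg; simp)
qed

end

section \<open>Independence of orthogonal directions\<close>

lemma integrable_mult_bounded:
  fixes T g :: "'a \<Rightarrow> real"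
  assumes T: "integrable M T" and g: "g \<in> borel_measurable M" "\<And>w. \<bar>g w\<bar> \<le> 1"
  shows "integrable M (\<lambda>w. T w * g w)"
  by (rule integrable_bound[OF T])
     (use g T in \<open>auto simp: abs_mult mult_left_le borel_measurable_integrable\<close>)

context prob_space
begin

lemma trig_product_expectations:
  fixes T A C :: "'a \<Rightarrow> real"
  assumes T: "integrable M T" and [measurable]: "A \<in> borel_measurable M" "C \<in> borel_measurable M"
  shows "(\<E> w. T w * cos (A w) * cos (\<xi> * C w))
      = ((\<E> w. T w * cos (A w + (-\<xi>) * C w)) + (\<E> w. T w * cos (A w + \<xi> * C w))) / 2" (is ?cc)
    and "(\<E> w. T w * cos (A w) * sin (\<xi> * C w))
      = ((\<E> w. T w * sin (A w + \<xi> * C w)) - (\<E> w. T w * sin (A w + (-\<xi>) * C w))) / 2" (is ?cs)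
    and "(\<E> w. T w * sin (A w) * cos (\<xi> * C w))
      = ((\<E> w. T w * sin (A w + \<xi> * C w)) + (\<E> w. T w * sin (A w + (-\<xi>) * C w))) / 2" (is ?sc)
    and "(\<E> w. T w * sin (A w) * sin (\<xi> * C w))
      = ((\<E> w. T w * cos (A w + (-\<xi>) * C w)) - (\<E> w. T w * cos (A w + \<xi> * C w))) / 2" (is ?ss)
proof -
  have i: "integrable M (\<lambda>w. T w * f (A w + x * C w))"
    if [measurable]: "f \<in> borel_measurable borel" and "\<And>y. \<bar>f y\<bar> \<le> 1" for f :: "real \<Rightarrow> real" and x
    by (rule integrable_mult_bounded[OF T _ that(2)]) measurable
  note ic = i[of cos, simplified] and si = i[of sin, simplified]
  have "T w * cos (A w) * cos (\<xi> * C w) = (T w * cos (A w + (-\<xi>) * C w) + T w * cos (A w + \<xi> * C w)) / 2"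
    "T w * cos (A w) * sin (\<xi> * C w) = (T w * sin (A w + \<xi> * C w) - T w * sin (A w + (-\<xi>) * C w)) / 2"
    "T w * sin (A w) * cos (\<xi> * C w) = (T w * sin (A w + \<xi> * C w) + T w * sin (A w + (-\<xi>) * C w)) / 2"
    "T w * sin (A w) * sin (\<xi> * C w) = (T w * cos (A w + (-\<xi>) * C w) - T w * cos (A w + \<xi> * C w)) / 2" for w
    by (simp_all add: cos_add sin_add cos_diff sin_diff algebra_simps)
  then show ?cc ?cs ?sc ?ss
    using ic[of \<xi>] ic[of "-\<xi>"] si[of \<xi>] si[of "-\<xi>"] by (simp_all only: integral_divide_zero integral_add integral_diff)
qed

text \<open>Two nonnegative weights with equal Fourier transforms along \<open>Y\<close> have equal images under \<open>Y\<close>. The weights are raised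
by \<open>1\<close> and normalized to become probability densities, so that uniqueness of characteristic functions applies.\<close>

lemma weighted_law_unique_real:
  fixes U V Y :: "'a \<Rightarrow> real"
  assumes [measurable]: "Y \<in> borel_measurable M"
    and U: "integrable M U" "\<And>w. 0 \<le> U w" and V: "integrable M V" "\<And>w. 0 \<le> V w"
    and cos: "\<And>\<xi>. (\<E> w. U w * cos (\<xi> * Y w)) = (\<E> w. V w * cos (\<xi> * Y w))"
    and sin: "\<And>\<xi>. (\<E> w. U w * sin (\<xi> * Y w)) = (\<E> w. V w * sin (\<xi> * Y w))"
    and A [measurable]: "A \<in> sets borel"
  shows "(\<E> w. U w * indicator A (Y w)) = (\<E> w. V w * indicator A (Y w))"
proof -
  define c where "c = expectation U + 1"
  have "0 \<le> expectation U" using U(2) by (intro integral_nonneg)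
  then have c: "c > 0" by (simp add: c_def)
  have EV: "expectation V + 1 = c" using cos[of 0] by (simp add: c_def)
  define N where "N T = distr (density M (\<lambda>w. ennreal ((T w + 1) / c))) borel Y" for T :: "'a \<Rightarrow> real"
  have key: "real_distribution (N T) \<and>
      (\<forall>\<xi>. char (N T) \<xi> = Complex (((\<E> w. T w * cos (\<xi> * Y w)) + (\<E> w. cos (\<xi> * Y w))) / c)
        (((\<E> w. T w * sin (\<xi> * Y w)) + (\<E> w. sin (\<xi> * Y w))) / c)) \<and>
      measure (N T) A = ((\<E> w. T w * indicator A (Y w)) + (\<E> w. indicator A (Y w))) / c"
    if T: "integrable M T" "\<And>w. 0 \<le> T w" and ET: "expectation T + 1 = c" for T
  proof (intro conjI allI)
    have [measurable]: "T \<in> borel_measurable M" using T by (simp add: borel_measurable_integrable)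
    have pos: "0 \<le> (T w + 1) / c" for w using T(2)[of w] c by simp
    note bT = integrable_mult_bounded[OF T(1)]
    have b1: "integrable M g" if "g \<in> borel_measurable M" "\<And>w. \<bar>g w\<bar> \<le> 1" for g :: "'a \<Rightarrow> real"
      by (rule integrable_const_bound[of _ 1]) (use that in auto)
    have E: "(\<E> w. (T w + 1) / c * g w) = ((\<E> w. T w * g w) + expectation g) / c"
      if "g \<in> borel_measurable M" "\<And>w. \<bar>g w\<bar> \<le> 1" for g
      using bT[OF that] b1[OF that] by (simp add: distrib_right)
    have "emeasure (density M (\<lambda>w. ennreal ((T w + 1) / c))) (space M) = (\<integral>\<^sup>+w. ennreal ((T w + 1) / c) \<partial>M)"
      by (subst emeasure_density) (auto intro!: nn_integral_cong)
    also have "\<dots> = ennreal ((\<E> w. (T w + 1) / c))"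
      using T pos by (intro nn_integral_eq_integral) auto
    also have "\<dots> = 1" using T c ET by (simp add: prob_space)
    finally have P: "prob_space (density M (\<lambda>w. ennreal ((T w + 1) / c)))"
      by (intro prob_spaceI) simp
    interpret D: prob_space "density M (\<lambda>w. ennreal ((T w + 1) / c))" by (rule P)
    have Ym: "Y \<in> density M (\<lambda>w. ennreal ((T w + 1) / c)) \<rightarrow>\<^sub>M borel" by simp
    show "real_distribution (N T)"
      unfolding N_def by (rule D.real_distribution_distr) simp
    show "char (N T) \<xi> = Complex (((\<E> w. T w * cos (\<xi> * Y w)) + (\<E> w. cos (\<xi> * Y w))) / c)
        (((\<E> w. T w * sin (\<xi> * Y w)) + (\<E> w. sin (\<xi> * Y w))) / c)" for \<xi>
    proof -
      have "char (N T) \<xi> = (CLINT w|density M (\<lambda>w. ennreal ((T w + 1) / c)). iexp (\<xi> * Y w))"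
        unfolding char_def N_def by (rule integral_distr[OF Ym]) simp
      also have "\<dots> = (CLINT w|M. ((T w + 1) / c) *\<^sub>R iexp (\<xi> * Y w))"
        by (rule integral_density) (use pos in auto)
      finally have ch: "char (N T) \<xi> = (CLINT w|M. ((T w + 1) / c) *\<^sub>R iexp (\<xi> * Y w))" .
      have i: "integrable M (\<lambda>w. ((T w + 1) / c) *\<^sub>R iexp (\<xi> * Y w))"
        by (rule integrable_bound[of _ "\<lambda>w. (T w + 1) / c"])
           (use T in \<open>auto simp del: of_real_mult\<close>)
      have "Re (char (N T) \<xi>) = (\<E> w. (T w + 1) / c * cos (\<xi> * Y w))"
        unfolding ch integral_Re[OF i, symmetric] by (simp add: Re_exp del: of_real_mult)
      moreover have "Im (char (N T) \<xi>) = (\<E> w. (T w + 1) / c * sin (\<xi> * Y w))"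
        unfolding ch integral_Im[OF i, symmetric] by (simp add: Im_exp del: of_real_mult)
      ultimately show ?thesis
        using E[of "\<lambda>w. cos (\<xi> * Y w)"] E[of "\<lambda>w. sin (\<xi> * Y w)"] by (simp add: complex_eq_iff)
    qed
    have "measure (N T) A = (\<integral>x. indicator A x \<partial>N T)" by (simp add: N_def)
    also have "\<dots> = (\<integral>w. indicator A (Y w) \<partial>density M (\<lambda>w. ennreal ((T w + 1) / c)))"
      unfolding N_def by (rule integral_distr[OF Ym]) simp
    also have "\<dots> = (\<E> w. (T w + 1) / c * indicator A (Y w))"
      by (subst integral_density) (use pos in auto)
    also have "\<dots> = ((\<E> w. T w * indicator A (Y w)) + (\<E> w. indicator A (Y w))) / c"
      by (rule E) (auto simp: indicator_def)
    finally show "measure (N T) A = ((\<E> w. T w * indicator A (Y w)) + (\<E> w. indicator A (Y w))) / c" .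
  qed
  have "char (N U) = char (N V)"
    using key[OF U] key[OF V EV] by (intro ext) (simp add: c_def cos sin)
  then have "N U = N V" using key[OF U] key[OF V EV] by (intro Levy_uniqueness) (auto simp: c_def)
  then have "measure (N U) A = measure (N V) A" by simp
  then show ?thesis using key[OF U] key[OF V EV] c by (simp add: c_def)
qed

text \<open>Several variables are reduced to one by induction: the weights absorb the indicator of one variable, and the
hypothesis about trigonometric functions of the remaining ones is recovered from the one-dimensional lemma, applied to
positive weights \<open>1 + cos S\<close> and \<open>1 + sin S\<close>.\<close>

lemma weighted_law_unique_boxes:
  fixes Y :: "'i \<Rightarrow> 'a \<Rightarrow> real"
  assumes "finite I" and Y: "\<And>i. i \<in> I \<Longrightarrow> Y i \<in> borel_measurable M"
    and "integrable M U" "\<And>w. 0 \<le> U w" and "integrable M V" "\<And>w. 0 \<le> V w"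
    and "\<And>c. (\<E> w. U w * cos (\<Sum>i\<in>I. c i * Y i w)) = (\<E> w. V w * cos (\<Sum>i\<in>I. c i * Y i w))"
    and "\<And>c. (\<E> w. U w * sin (\<Sum>i\<in>I. c i * Y i w)) = (\<E> w. V w * sin (\<Sum>i\<in>I. c i * Y i w))"
    and A: "\<And>i. i \<in> I \<Longrightarrow> A i \<in> sets borel"
  shows "(\<E> w. U w * (\<Prod>i\<in>I. indicator (A i) (Y i w))) = (\<E> w. V w * (\<Prod>i\<in>I. indicator (A i) (Y i w)))"
  using assms
proof (induction I arbitrary: U V)
  case empty
  show ?case using empty.prems(6)[of "\<lambda>_. 0"] by simp
next
  case (insert j I)
  note U = insert.prems(2,3) and V = insert.prems(4,5) and cos_eq = insert.prems(6) and sin_eq = insert.prems(7)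
  have Yj [measurable]: "Y j \<in> borel_measurable M" using insert.prems(1) by simp
  have Aj [measurable]: "A j \<in> sets borel" using insert.prems(8) by simp
  have Ym [measurable]: "Y i \<in> borel_measurable M" if "i \<in> I" for i using insert.prems(1) that by simp
  have Um [measurable]: "U \<in> borel_measurable M" and Vm [measurable]: "V \<in> borel_measurable M"
    using U V by (auto simp: borel_measurable_integrable)
  define S where "S c w = (\<Sum>i\<in>I. c i * Y i w)" for c w
  have Sm [measurable]: "S c \<in> borel_measurable M" for c unfolding S_def by measurable
  have Sminus: "S (\<lambda>i. - c i) w = - S c w" for c w by (simp add: S_def sum_negf)
  have upd: "(\<Sum>i\<in>insert j I. (c(j := \<xi>)) i * Y i w) = S c w + \<xi> * Y j w" for c \<xi> w
  proof -
    have "(\<Sum>i\<in>I. (c(j := \<xi>)) i * Y i w) = S c w"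
      unfolding S_def using insert.hyps by (intro sum.cong) auto
    then show ?thesis using insert.hyps by (simp add: add.commute)
  qed
  have plus: "(\<E> w. U w * cos (S c w + \<xi> * Y j w)) = (\<E> w. V w * cos (S c w + \<xi> * Y j w))"
    "(\<E> w. U w * sin (S c w + \<xi> * Y j w)) = (\<E> w. V w * sin (S c w + \<xi> * Y j w))" for c \<xi>
    using cos_eq[of "c(j := \<xi>)"] sin_eq[of "c(j := \<xi>)"] unfolding upd by auto
  have base: "(\<E> w. U w * cos (\<xi> * Y j w)) = (\<E> w. V w * cos (\<xi> * Y j w))"
    "(\<E> w. U w * sin (\<xi> * Y j w)) = (\<E> w. V w * sin (\<xi> * Y j w))" for \<xi>
    using plus[of "\<lambda>_. 0" \<xi>] by (simp_all add: S_def)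
  note bd = integrable_mult_bounded
  \<comment> \<open>multiplying the weights by one of the positive factors \<open>1 + cos S\<close>, \<open>1 + sin S\<close> keeps the one-dimensional hypothesis\<close>
  note trig = trig_product_expectations[OF _ Sm Yj]
  define IA where "IA w = (indicator (A j) (Y j w) :: real)" for w
  have IA [measurable]: "IA \<in> borel_measurable M" unfolding IA_def by measurable
  have IA01: "0 \<le> IA w" "\<bar>IA w\<bar> \<le> 1" for w by (auto simp: IA_def indicator_def)
  have E0: "(\<E> w. U w * IA w) = (\<E> w. V w * IA w)"
    unfolding IA_def by (rule weighted_law_unique_real[OF Yj U V base Aj])
  have step: "(\<E> w. (U w * v w) * IA w) = (\<E> w. (V w * v w) * IA w)"
    if v [measurable]: "v \<in> borel_measurable M" and w1: "\<And>w. \<bar>v w\<bar> \<le> 1"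
      and wc: "\<And>\<xi>. (\<E> w. U w * v w * cos (\<xi> * Y j w)) = (\<E> w. V w * v w * cos (\<xi> * Y j w))"
      and ws: "\<And>\<xi>. (\<E> w. U w * v w * sin (\<xi> * Y j w)) = (\<E> w. V w * v w * sin (\<xi> * Y j w))" for v
  proof -
    have iw: "integrable M (\<lambda>w. T w * v w)" if "integrable M T" for T by (rule bd[OF that v w1])
    have i1: "integrable M (\<lambda>w. T w * g w)" "integrable M (\<lambda>w. T w * v w * g w)"
      if "integrable M T" "g \<in> borel_measurable M" "\<And>w. \<bar>g w\<bar> \<le> 1" for T g
      using bd[OF that] bd[OF iw[OF that(1)] that(2,3)] by auto
    have i: "integrable M (\<lambda>w. T w * (1 + v w))" if "integrable M T" for T
      using iw[OF that] that by (simp add: distrib_left)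
    have p: "0 \<le> T w * (1 + v w)" if "0 \<le> T w" for T :: "'a \<Rightarrow> real" and w
      using w1[of w] that by (intro mult_nonneg_nonneg) auto
    have split: "(\<E> w. T w * (1 + v w) * g w) = (\<E> w. T w * g w) + (\<E> w. T w * v w * g w)"
      if "integrable M T" "g \<in> borel_measurable M" "\<And>w. \<bar>g w\<bar> \<le> 1" for T g
      using i1[OF that] by (simp add: distrib_left distrib_right)
    have "(\<E> w. (U w * (1 + v w)) * indicator (A j) (Y j w)) = (\<E> w. (V w * (1 + v w)) * indicator (A j) (Y j w))"
    proof (rule weighted_law_unique_real[OF Yj i[OF U(1)] _ i[OF V(1)] _ _ _ Aj])
      fix \<xi>
      have m: "(\<lambda>w. cos (\<xi> * Y j w)) \<in> borel_measurable M" "(\<lambda>w. sin (\<xi> * Y j w)) \<in> borel_measurable M" by measurable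
      show "(\<E> w. U w * (1 + v w) * cos (\<xi> * Y j w)) = (\<E> w. V w * (1 + v w) * cos (\<xi> * Y j w))"
        using split[OF U(1) m(1)] split[OF V(1) m(1)] wc base by simp
      show "(\<E> w. U w * (1 + v w) * sin (\<xi> * Y j w)) = (\<E> w. V w * (1 + v w) * sin (\<xi> * Y j w))"
        using split[OF U(1) m(2)] split[OF V(1) m(2)] ws base by simp
    qed (use p U(2) V(2) in auto)
    then have "(\<E> w. U w * (1 + v w) * IA w) = (\<E> w. V w * (1 + v w) * IA w)"
      by (simp only: IA_def)
    then show ?thesis
      using split[OF U(1) IA IA01(2)] split[OF V(1) IA IA01(2)] E0 by simp
  qed
  have c1: "(\<E> w. (U w * cos (S c w)) * IA w) = (\<E> w. (V w * cos (S c w)) * IA w)" for c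
  proof (rule step)
    show "(\<lambda>w. cos (S c w)) \<in> borel_measurable M" by measurable
    show "\<bar>cos (S c w)\<bar> \<le> 1" for w by simp
  qed (simp_all only: trig[OF U(1)] trig[OF V(1)] plus)
  have s1: "(\<E> w. (U w * sin (S c w)) * IA w) = (\<E> w. (V w * sin (S c w)) * IA w)" for c
  proof (rule step)
    show "(\<lambda>w. sin (S c w)) \<in> borel_measurable M" by measurable
    show "\<bar>sin (S c w)\<bar> \<le> 1" for w by simp
  qed (simp_all only: trig[OF U(1)] trig[OF V(1)] plus)
  have "(\<E> w. (U w * IA w) * (\<Prod>i\<in>I. indicator (A i) (Y i w))) = (\<E> w. (V w * IA w) * (\<Prod>i\<in>I. indicator (A i) (Y i w)))"
  proof (rule insert.IH)
    show "integrable M (\<lambda>w. U w * IA w)" "integrable M (\<lambda>w. V w * IA w)"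
      by (intro bd U V IA IA01)+
    show "(\<E> w. U w * IA w * cos (\<Sum>i\<in>I. c i * Y i w)) = (\<E> w. V w * IA w * cos (\<Sum>i\<in>I. c i * Y i w))" for c
      using c1[of c] by (simp add: S_def mult_ac)
    show "(\<E> w. U w * IA w * sin (\<Sum>i\<in>I. c i * Y i w)) = (\<E> w. V w * IA w * sin (\<Sum>i\<in>I. c i * Y i w))" for c
      using s1[of c] by (simp add: S_def mult_ac)
  qed (use insert.prems IA01 in auto)
  then show ?case using insert.hyps by (simp add: IA_def mult_ac)
qed

end

lemma std_normal_cos_sin:
  "(\<integral>x. std_normal_density x * cos (r * x) \<partial>lborel) = exp (- r\<^sup>2 / 2)"
  "(\<integral>x. std_normal_density x * sin (r * x) \<partial>lborel) = 0"
proof -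
  interpret real_distribution std_normal_distribution by (rule real_dist_normal_dist)
  have i: "integrable std_normal_distribution (\<lambda>x. iexp (r * x))"
    by (rule integrable_const_bound[of _ 1]) (auto simp del: of_real_mult)
  have ch: "(CLINT x|std_normal_distribution. iexp (r * x)) = complex_of_real (exp (- r\<^sup>2 / 2))"
    using fun_cong[OF char_std_normal_distribution, of r] by (simp only: char_def)
  have "(\<integral>x. cos (r * x) \<partial>std_normal_distribution) = exp (- r\<^sup>2 / 2)"
    using integral_Re[OF i] unfolding ch by (simp add: Re_exp del: of_real_mult)
  moreover have "(\<integral>x. sin (r * x) \<partial>std_normal_distribution) = 0"
    using integral_Im[OF i] unfolding ch by (simp add: Im_exp del: of_real_mult)
  ultimately show "(\<integral>x. std_normal_density x * cos (r * x) \<partial>lborel) = exp (- r\<^sup>2 / 2)"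
    "(\<integral>x. std_normal_density x * sin (r * x) \<partial>lborel) = 0"
    by (auto simp: integral_density)
qed

text \<open>The square of the modulus is a double integral of \<open>exp(i l (x\<^sup>2 - y\<^sup>2))\<close> against two normal densities. Substituting
\<open>x = y + s\<close> makes the exponent linear in \<open>y\<close>, and both integrations become Gaussian.\<close>

lemma std_normal_char_square:
  "cmod (\<integral>x. std_normal_density x *\<^sub>R iexp (l * x\<^sup>2) \<partial>lborel) = (1 + 4 * l\<^sup>2) powr (- 1 / 4)"
proof -
  define u where "u = (\<integral>x. std_normal_density x *\<^sub>R iexp (l * x\<^sup>2) \<partial>lborel)"
  define F where "F s y = (std_normal_density (y + s) * std_normal_density y) *\<^sub>R iexp (l * ((y + s)\<^sup>2 - y\<^sup>2))" for s y
  have i: "integrable lborel (\<lambda>x. std_normal_density x *\<^sub>R iexp (a * x\<^sup>2))" for a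
    by (rule integrable_bound[of _ std_normal_density]) (auto simp del: of_real_mult)
  have cnju: "cnj u = (\<integral>x. std_normal_density x *\<^sub>R iexp (- l * x\<^sup>2) \<partial>lborel)"
  proof -
    have "cnj u = (\<integral>x. cnj (std_normal_density x *\<^sub>R iexp (l * x\<^sup>2)) \<partial>lborel)"
      unfolding u_def by (rule Bochner_Integration.integral_cnj[symmetric])
    also have "\<dots> = (\<integral>x. std_normal_density x *\<^sub>R iexp (- l * x\<^sup>2) \<partial>lborel)"
      by (intro integral_cong refl) (simp add: exp_cnj)
    finally show ?thesis .
  qed
  have F_eq: "F s y = (exp (- s\<^sup>2 / 4) / (2 * pi)) *\<^sub>R (iexp ((2 * l * s) * (y + s / 2)) * of_real (exp (- (sqrt 2 * (y + s / 2))\<^sup>2 / 2)))" for s y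
  proof -
    have 1: "std_normal_density (y + s) * std_normal_density y = exp (- s\<^sup>2 / 4) / (2 * pi) * exp (- (sqrt 2 * (y + s / 2))\<^sup>2 / 2)"
      unfolding std_normal_density_def
      by (simp add: power_mult_distrib exp_add[symmetric] power2_eq_square field_simps)
    have 2: "l * ((y + s)\<^sup>2 - y\<^sup>2) = (2 * l * s) * (y + s / 2)" by (simp add: power2_eq_square field_simps)
    show ?thesis unfolding F_def 1 2 by (simp add: scaleR_conv_of_real)
  qed
  have G: "integrable lborel (\<lambda>y. F s y)"
    "(\<integral>y. F s y \<partial>lborel) = of_real (exp (- (1/4 + l\<^sup>2) * s\<^sup>2) / (2 * sqrt pi))" for s
  proof -
    note gf = gaussian_fourier_real[of "sqrt 2" "2 * l * s", simplified]
    define g where "g w = iexp ((2 * l * s) * w) * of_real (exp (- (sqrt 2 * w)\<^sup>2 / 2))" for w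
    have g: "integrable lborel g" "(\<integral>w. g w \<partial>lborel) = of_real (2 * pi * normal_density 0 (sqrt 2) (2 * l * s))"
      unfolding g_def using gaussian_fourier_real[of "sqrt 2" "2 * l * s"] by auto
    have Fg: "F s y = (exp (- s\<^sup>2 / 4) / (2 * pi)) *\<^sub>R g (s / 2 + 1 * y)" for y
      unfolding F_eq g_def by (simp only: add.commute mult_1)
    have ig: "integrable lborel (\<lambda>y. g (s / 2 + 1 * y))"
      using lborel_integrable_real_affine[OF g(1), of 1 "s / 2"] by simp
    show "integrable lborel (\<lambda>y. F s y)"
      unfolding Fg by (intro integrable_scaleR_right ig)
    have "(\<integral>y. F s y \<partial>lborel) = (exp (- s\<^sup>2 / 4) / (2 * pi)) *\<^sub>R (\<integral>y. g (s / 2 + 1 * y) \<partial>lborel)"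
      unfolding Fg by (rule integral_scaleR_right)
    also have "(\<integral>y. g (s / 2 + 1 * y) \<partial>lborel) = (\<integral>w. g w \<partial>lborel)"
      using lborel_integral_real_affine[of 1 g "s / 2"] by simp
    also have "\<dots> = of_real (2 * pi * normal_density 0 (sqrt 2) (2 * l * s))" by (rule g(2))
    also have "(exp (- s\<^sup>2 / 4) / (2 * pi)) *\<^sub>R complex_of_real (2 * pi * normal_density 0 (sqrt 2) (2 * l * s))
        = of_real (exp (- s\<^sup>2 / 4) * normal_density 0 (sqrt 2) (2 * l * s))"
      by (simp add: scaleR_conv_of_real)
    also have "exp (- s\<^sup>2 / 4) * normal_density 0 (sqrt 2) (2 * l * s) = exp (- (1/4 + l\<^sup>2) * s\<^sup>2) / (2 * sqrt pi)"
    proof -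
      have "exp (- s\<^sup>2 / 4) * exp (- (2 * l * s)\<^sup>2 / 4) = exp (- (1/4 + l\<^sup>2) * s\<^sup>2)"
        unfolding exp_add[symmetric] by (simp add: power_mult_distrib field_simps)
      moreover have "sqrt (2 * pi * (sqrt 2)\<^sup>2) = 2 * sqrt pi"
        by (simp add: real_sqrt_mult)
      ultimately show ?thesis by (simp add: normal_density_def)
    qed
    finally show "(\<integral>y. F s y \<partial>lborel) = of_real (exp (- (1/4 + l\<^sup>2) * s\<^sup>2) / (2 * sqrt pi))" .
  qed
  have nF: "norm (F s y) = std_normal_density (y + s) * std_normal_density y" for s y
    by (simp add: F_def del: of_real_mult of_real_diff of_real_power)
  have q: "1/4 + l\<^sup>2 > 0" by (simp add: add_pos_nonneg)
  have gn: "has_bochner_integral lborel (\<lambda>s. exp (- a * s\<^sup>2)) (sqrt (pi / a))" if "a > 0" for a :: real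
    using nn_integral_exp_sq_real[OF that] that
    by (intro has_bochner_integral_nn_integral) auto
  have Fint: "integrable (lborel \<Otimes>\<^sub>M lborel) (\<lambda>(s, y). F s y)"
  proof (rule lborel_pair.Fubini_integrable)
    show "(\<lambda>(s, y). F s y) \<in> borel_measurable (lborel \<Otimes>\<^sub>M lborel)" unfolding F_def by measurable
    have "(\<integral>y. norm (F s y) \<partial>lborel) = exp (- (1/4) * s\<^sup>2) * (1 / (2 * sqrt pi))" for s
    proof -
      have e: "norm (F s y) = (exp (- s\<^sup>2 / 4) / (2 * pi)) * exp (- 1 * (s / 2 + 1 * y)\<^sup>2)" for y
        unfolding F_eq by (simp add: norm_mult power_mult_distrib add.commute del: of_real_mult of_real_add)
      have "(\<integral>y. exp (- 1 * (s / 2 + 1 * y)\<^sup>2) \<partial>lborel) = sqrt (pi / 1)"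
        using lborel_integral_real_affine[of 1 "\<lambda>w. exp (- 1 * w\<^sup>2)" "s / 2"] has_bochner_integral_integral_eq[OF gn[of 1]]
        by simp
      then show ?thesis unfolding e by (simp add: field_simps flip: power2_eq_square)
    qed
    then show "integrable lborel (\<lambda>s. \<integral>y. norm (case (s, y) of (s, y) \<Rightarrow> F s y) \<partial>lborel)"
      using integrable.intros[OF gn[of "1/4"]] by simp
    show "AE s in lborel. integrable lborel (\<lambda>y. case (s, y) of (s, y) \<Rightarrow> F s y)" using G(1) by simp
  qed
  have "u * cnj u = (\<integral>y. (std_normal_density y *\<^sub>R iexp (- l * y\<^sup>2)) * u \<partial>lborel)"
    unfolding cnju mult.commute[of u] by (rule integral_mult_left_zero[symmetric])
  also have "\<dots> = (\<integral>y. (\<integral>s. F s y \<partial>lborel) \<partial>lborel)"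
  proof (rule integral_cong[OF refl])
    fix y
    have "u = (\<integral>s. std_normal_density (y + 1 * s) *\<^sub>R iexp (l * (y + 1 * s)\<^sup>2) \<partial>lborel)"
      unfolding u_def using lborel_integral_real_affine[of 1 "\<lambda>x. std_normal_density x *\<^sub>R iexp (l * x\<^sup>2)" y] by simp
    then have "(std_normal_density y *\<^sub>R iexp (- l * y\<^sup>2)) * u
        = (\<integral>s. (std_normal_density y *\<^sub>R iexp (- l * y\<^sup>2)) * (std_normal_density (y + 1 * s) *\<^sub>R iexp (l * (y + 1 * s)\<^sup>2)) \<partial>lborel)"
      by (simp only: integral_mult_right_zero)
    also have "\<dots> = (\<integral>s. F s y \<partial>lborel)"
      by (intro integral_cong refl)
         (simp add: F_def scaleR_conv_of_real exp_add[symmetric] algebra_simps)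
    finally show "(std_normal_density y *\<^sub>R iexp (- l * y\<^sup>2)) * u = (\<integral>s. F s y \<partial>lborel)" .
  qed
  also have "\<dots> = (\<integral>s. (\<integral>y. F s y \<partial>lborel) \<partial>lborel)" by (rule lborel_pair.Fubini_integral[OF Fint])
  also have "\<dots> = of_real (sqrt (pi / (1/4 + l\<^sup>2)) / (2 * sqrt pi))"
    unfolding G(2) using has_bochner_integral_integral_eq[OF gn[OF q]] by simp
  also have "sqrt (pi / (1/4 + l\<^sup>2)) / (2 * sqrt pi) = 1 / sqrt (1 + 4 * l\<^sup>2)"
  proof -
    have "sqrt (1 + 4 * l\<^sup>2) = sqrt (4 * (1/4 + l\<^sup>2))" by (simp add: algebra_simps)
    also have "\<dots> = 2 * sqrt (1/4 + l\<^sup>2)" by (simp only: real_sqrt_mult real_sqrt_four)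
    finally show ?thesis by (simp add: real_sqrt_divide)
  qed
  finally have "(cmod u)\<^sup>2 = 1 / sqrt (1 + 4 * l\<^sup>2)"
    unfolding complex_norm_square[symmetric] by (simp only: of_real_eq_iff flip: of_real_power)
  also have "\<dots> = ((1 + 4 * l\<^sup>2) powr (- 1 / 4))\<^sup>2"
  proof -
    have p: "1 + 4 * l\<^sup>2 > 0" by (simp add: add_pos_nonneg)
    have "((1 + 4 * l\<^sup>2) powr (- 1 / 4))\<^sup>2 = (1 + 4 * l\<^sup>2) powr (- 1 / 4 + - 1 / 4)"
      by (simp only: power2_eq_square powr_add)
    also have "\<dots> = (1 + 4 * l\<^sup>2) powr (- (1/2))" by simp
    also have "\<dots> = 1 / sqrt (1 + 4 * l\<^sup>2)" using p by (simp only: powr_minus powr_half_sqrt less_imp_le inverse_eq_divide)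
    finally show ?thesis ..
  qed
  finally show ?thesis unfolding u_def[symmetric] by (rule power2_eq_imp_eq) auto
qed

context gaussian_field
begin

lemma expectation_cos_sin_W:
  "(\<E> w. cos (W f w)) = exp (- (norm f)\<^sup>2 / 2)" "(\<E> w. sin (W f w)) = 0"
proof -
  obtain u where u: "f = 0 \<or> norm u = 1" and fu: "AE w in M. W f w = norm f * W u w"
    using W_unit_factor by blast
  have 1: "(\<E> w. g (W f w)) = (\<E> w. g (norm f * W u w))"
    if [measurable]: "g \<in> borel_measurable borel" for g :: "real \<Rightarrow> real"
    by (rule integral_cong_AE) (use fu in auto)
  have "(\<E> w. cos (norm f * W u w)) = exp (- (norm f)\<^sup>2 / 2) \<and> (\<E> w. sin (norm f * W u w)) = 0"
  proof (cases "f = 0")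
    case False
    then have "norm u = 1" using u by simp
    from distributed_integral[OF W_unit[OF this], of "\<lambda>x. cos (norm f * x)"]
      distributed_integral[OF W_unit[OF this], of "\<lambda>x. sin (norm f * x)"]
    show ?thesis by (simp add: std_normal_cos_sin)
  qed (simp add: prob_space)
  then show "(\<E> w. cos (W f w)) = exp (- (norm f)\<^sup>2 / 2)" "(\<E> w. sin (W f w)) = 0"
    using 1[of cos] 1[of sin] by auto
qed

text \<open>Orthogonality makes the joint characteristic function a product. The indicator of a set for \<open>W e\<close> is
used as a weight for the other variables.\<close>

lemma joint_law_orthogonal:
  assumes e: "norm e = 1" and J: "finite J" and orth: "\<And>y. y \<in> J \<Longrightarrow> y \<bullet> e = 0"
  shows "distr M borel (W e) \<Otimes>\<^sub>M distr M (\<Pi>\<^sub>M y\<in>J. borel) (\<lambda>w. \<lambda>y\<in>J. W y w)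
    = distr M (borel \<Otimes>\<^sub>M (\<Pi>\<^sub>M y\<in>J. borel)) (\<lambda>w. (W e w, \<lambda>y\<in>J. W y w))"
proof -
  let ?P = "\<Pi>\<^sub>M y\<in>J. (borel :: real measure)"
  define Y where "Y w = (\<lambda>y\<in>J. W y w)" for w
  have Y [measurable]: "Y \<in> M \<rightarrow>\<^sub>M ?P" unfolding Y_def by measurable
  have bi: "integrable M g" if "g \<in> borel_measurable M" "\<And>w. \<bar>g w\<bar> \<le> 1" for g :: "'a \<Rightarrow> real"
    by (rule integrable_const_bound[of _ 1]) (use that in auto)
  define S where "S c w = (\<Sum>y\<in>J. c y * W y w)" for c w
  have Sm [measurable]: "S c \<in> borel_measurable M" for c unfolding S_def by measurable
  have joint: "(\<E> w. cos (S c w + \<xi> * W e w)) = exp (- (norm (\<Sum>y\<in>J. c y *\<^sub>R y))\<^sup>2 / 2) * exp (- \<xi>\<^sup>2 / 2)"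
    "(\<E> w. sin (S c w + \<xi> * W e w)) = 0" for c \<xi>
  proof -
    define f where "f = (\<Sum>y\<in>J. c y *\<^sub>R y)"
    have AE: "AE w in M. W (f + \<xi> *\<^sub>R e) w = S c w + \<xi> * W e w"
      using W_add_scaleR[of f \<xi> e] W_sum[OF J, of c "\<lambda>y. y"] by eventually_elim (simp add: S_def f_def)
    have "f \<bullet> e = 0" unfolding f_def inner_sum_left by (intro sum.neutral) (simp add: orth)
    then have n: "(norm (f + \<xi> *\<^sub>R e))\<^sup>2 = (norm f)\<^sup>2 + \<xi>\<^sup>2"
      using e by (simp add: norm_add_Pythagorean orthogonal_def)
    have E: "(\<E> w. g (W (f + \<xi> *\<^sub>R e) w)) = (\<E> w. g (S c w + \<xi> * W e w))"
      if [measurable]: "g \<in> borel_measurable borel" for g :: "real \<Rightarrow> real"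
      by (rule integral_cong_AE) (use AE in auto)
    show "(\<E> w. cos (S c w + \<xi> * W e w)) = exp (- (norm (\<Sum>y\<in>J. c y *\<^sub>R y))\<^sup>2 / 2) * exp (- \<xi>\<^sup>2 / 2)"
      using E[of cos] unfolding expectation_cos_sin_W n unfolding f_def by (simp add: exp_add[symmetric] diff_divide_distrib)
    show "(\<E> w. sin (S c w + \<xi> * W e w)) = 0"
      using E[of sin] unfolding expectation_cos_sin_W by simp
  qed
  have X0: "(\<E> w. cos (\<xi> * W e w)) = exp (- \<xi>\<^sup>2 / 2)" "(\<E> w. sin (\<xi> * W e w)) = 0" for \<xi>
    using joint[of "\<lambda>_. 0" \<xi>] by (simp_all add: S_def)
  have S0: "(\<E> w. cos (S c w)) = exp (- (norm (\<Sum>y\<in>J. c y *\<^sub>R y))\<^sup>2 / 2)" "(\<E> w. sin (S c w)) = 0" for c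
    using joint[of c 0] by simp_all
  have trig:
    "(\<E> w. cos (S c w) * cos (\<xi> * W e w)) = (\<E> w. cos (S c w)) * (\<E> w. cos (\<xi> * W e w))"
    "(\<E> w. cos (S c w) * sin (\<xi> * W e w)) = 0"
    "(\<E> w. sin (S c w) * cos (\<xi> * W e w)) = 0"
    "(\<E> w. sin (S c w) * sin (\<xi> * W e w)) = 0" for c \<xi>
    using trig_product_expectations[of "\<lambda>_. 1" "S c" "W e" \<xi>] joint[of c \<xi>] joint[of c "-\<xi>"]
    unfolding mult_1_left S0 X0 by simp_all
  have split: "(\<E> w. v w * indicator B (W e w)) = expectation v * (\<E> w. indicator B (W e w))"
    if B [measurable]: "B \<in> sets borel" and v [measurable]: "v \<in> borel_measurable M" and w1: "\<And>w. \<bar>v w\<bar> \<le> 1"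
      and wc: "\<And>\<xi>. (\<E> w. v w * cos (\<xi> * W e w)) = expectation v * (\<E> w. cos (\<xi> * W e w))"
      and ws: "\<And>\<xi>. (\<E> w. v w * sin (\<xi> * W e w)) = 0" for v :: "'a \<Rightarrow> real" and B
  proof -
    have iw: "integrable M v" by (rule bi[OF v w1])
    have prod: "(\<E> w. (1 + v w) * g w) = expectation g + (\<E> w. v w * g w)"
      if "g \<in> borel_measurable M" "\<And>w. \<bar>g w\<bar> \<le> 1" for g
    proof -
      have "integrable M (\<lambda>w. v w * g w)"
        by (rule bi) (use that w1 in \<open>auto simp: abs_mult intro!: mult_le_one\<close>)
      then show ?thesis using bi[OF that] by (simp add: distrib_right)
    qed
    have ge: "\<bar>expectation v\<bar> \<le> 1"
    proof -
      have "\<bar>expectation v\<bar> \<le> (\<E> w. \<bar>v w\<bar>)" by (rule integral_abs_bound)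
      also have "\<dots> \<le> (\<E> w. 1)" using iw w1 by (intro integral_mono) auto
      finally show ?thesis by (simp add: prob_space)
    qed
    have "(\<E> w. (1 + v w) * indicator B (W e w)) = (\<E> w. (1 + expectation v) * indicator B (W e w))"
    proof (rule weighted_law_unique_real[OF W_measurable _ _ _ _ _ _ B])
      show "0 \<le> 1 + v w" for w using w1[of w] by auto
      show "(\<E> w. (1 + v w) * cos (\<xi> * W e w)) = (\<E> w. (1 + expectation v) * cos (\<xi> * W e w))" for \<xi>
      proof -
        have "(\<E> w. (1 + v w) * cos (\<xi> * W e w)) = (1 + expectation v) * (\<E> w. cos (\<xi> * W e w))"
          by (subst prod) (auto simp: wc distrib_right)
        then show ?thesis by simp
      qed
      show "(\<E> w. (1 + v w) * sin (\<xi> * W e w)) = (\<E> w. (1 + expectation v) * sin (\<xi> * W e w))" for \<xi>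
        by (subst prod) (auto simp: ws X0)
    qed (use iw ge in auto)
    moreover have "(\<E> w. (1 + v w) * indicator B (W e w))
        = (\<E> w. indicator B (W e w)) + (\<E> w. v w * indicator B (W e w))"
      by (rule prod) (auto simp: indicator_def)
    moreover have "(\<E> w. (1 + expectation v) * indicator B (W e w))
        = (1 + expectation v) * (\<E> w. indicator B (W e w))" by simp
    ultimately show ?thesis by (simp only: distrib_right mult_1_left add_left_cancel)
  qed
  have box: "(\<E> w. (indicator B (W e w) :: real) * (\<Prod>y\<in>J. indicator (A y) (W y w)))
      = (\<E> w. indicator B (W e w) :: real) * (\<E> w. \<Prod>y\<in>J. indicator (A y) (W y w))"
    if B [measurable]: "B \<in> sets borel" and A: "\<And>y. y \<in> J \<Longrightarrow> A y \<in> sets borel" for A B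
  proof -
    define p where "p = (\<E> w. indicator B (W e w) :: real)"
    have iB: "integrable M (\<lambda>w. indicator B (W e w) :: real)" by (rule bi) (auto simp: indicator_def)
    have "(\<E> w. indicator B (W e w) * (\<Prod>y\<in>J. indicator (A y) (W y w)))
      = (\<E> w. p * (\<Prod>y\<in>J. indicator (A y) (W y w)))"
    proof (rule weighted_law_unique_boxes[OF J W_measurable iB])
      have c: "(\<E> w. cos (S c w) * indicator B (W e w)) = (\<E> w. cos (S c w)) * p" for c
        unfolding p_def by (rule split[OF B]) (auto simp: trig)
      have s: "(\<E> w. sin (S c w) * indicator B (W e w)) = (\<E> w. sin (S c w)) * p" for c
        unfolding p_def by (rule split[OF B]) (auto simp: trig S0)
      show "(\<E> w. indicator B (W e w) * cos (\<Sum>y\<in>J. c y * W y w)) = (\<E> w. p * cos (\<Sum>y\<in>J. c y * W y w))" for c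
        using c[of c] by (simp add: S_def[symmetric] mult.commute)
      show "(\<E> w. indicator B (W e w) * sin (\<Sum>y\<in>J. c y * W y w)) = (\<E> w. p * sin (\<Sum>y\<in>J. c y * W y w))" for c
        using s[of c] by (simp add: S_def[symmetric] mult.commute)
      show "0 \<le> p" unfolding p_def by (rule integral_nonneg) simp
    qed (use A in auto)
    then show ?thesis by (simp add: p_def)
  qed
  have prodind: "(\<Prod>y\<in>J. indicator (A y) (W y w)) = (indicator (Pi\<^sub>E J A) (Y w) :: real)" for A w
    using J by (auto simp: Y_def indicator_def PiE_def Pi_def)
  have "distr M borel (W e) \<Otimes>\<^sub>M distr M ?P Y
      = distr M (borel \<Otimes>\<^sub>M ?P) (\<lambda>w. (W e w, Y w))"
  proof (rule pair_measure_eqI)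
    interpret X: prob_space "distr M borel (W e)" by (rule prob_space_distr) simp
    interpret Yd: prob_space "distr M ?P Y" by (rule prob_space_distr) simp
    show "sigma_finite_measure (distr M borel (W e))" "sigma_finite_measure (distr M ?P Y)" ..
    show "sets (distr M borel (W e) \<Otimes>\<^sub>M distr M ?P Y)
      = sets (distr M (borel \<Otimes>\<^sub>M ?P) (\<lambda>w. (W e w, Y w)))"
      by (simp cong: sets_pair_measure_cong)
    fix B D assume "B \<in> sets (distr M borel (W e))" "D \<in> sets (distr M ?P Y)"
    then have B [measurable]: "B \<in> sets borel" and D [measurable]: "D \<in> sets ?P" by auto
    define N1 where "N1 = distr (density M (\<lambda>w. indicator B (W e w))) ?P Y"
    define N2 where "N2 = density (distr M ?P Y) (\<lambda>_. emeasure M (W e -` B \<inter> space M))"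
    have N1: "emeasure N1 C = emeasure M ((\<lambda>w. (W e w, Y w)) -` (B \<times> C) \<inter> space M)"
      if [measurable]: "C \<in> sets ?P" for C
    proof -
      have "emeasure N1 C = emeasure (density M (\<lambda>w. indicator B (W e w))) (Y -` C \<inter> space M)"
        unfolding N1_def by (subst emeasure_distr) auto
      also have "\<dots> = (\<integral>\<^sup>+w. indicator B (W e w) * indicator (Y -` C \<inter> space M) w \<partial>M)"
        by (rule emeasure_density) auto
      also have "\<dots> = (\<integral>\<^sup>+w. indicator ((\<lambda>w. (W e w, Y w)) -` (B \<times> C) \<inter> space M) w \<partial>M)"
        by (intro nn_integral_cong) (auto simp: indicator_def)
      finally show ?thesis by simp
    qed
    have N2: "emeasure N2 C = emeasure M (W e -` B \<inter> space M) * emeasure M (Y -` C \<inter> space M)"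
      if [measurable]: "C \<in> sets ?P" for C
      unfolding N2_def by (subst emeasure_density) (auto simp: nn_integral_cmult_indicator emeasure_distr)
    have "N1 = N2"
    proof (rule measure_eqI_PiM_finite[OF J])
      show "sets N1 = sets ?P" "sets N2 = sets ?P"
        by (simp_all add: N1_def N2_def)
      show "range (\<lambda>_::nat. space ?P) \<subseteq> prod_algebra J (\<lambda>_. borel)"
        using prod_algebraI_finite[OF J, of "\<lambda>_. UNIV" "\<lambda>_. borel :: real measure"] by (auto simp: space_PiM)
      show "(\<Union>i::nat. space ?P) = space ?P" by simp
      show "emeasure N1 (space ?P) \<noteq> \<infinity>" by (subst N1) auto
      fix A assume A: "\<And>y. y \<in> J \<Longrightarrow> A y \<in> sets (borel :: real measure)"
      then have PA [measurable]: "Pi\<^sub>E J A \<in> sets ?P" using J by (intro sets_PiM_I_finite) auto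
      have meas: "measure M (X -` C \<inter> space M) = (\<E> w. indicator C (X w) :: real)"
        if "X \<in> M \<rightarrow>\<^sub>M N" "C \<in> sets N" for X :: "'a \<Rightarrow> 'z" and C N
      proof -
        have "(\<E> w. indicator C (X w) :: real) = expectation (indicator (X -` C \<inter> space M))"
          by (intro integral_cong refl) (auto simp: indicator_def)
        then show ?thesis using measurable_sets[OF that] by simp
      qed
      have "measure M ((\<lambda>w. (W e w, Y w)) -` (B \<times> Pi\<^sub>E J A) \<inter> space M)
          = (\<E> w. indicator (B \<times> Pi\<^sub>E J A) (W e w, Y w) :: real)"
        by (rule meas[of _ "borel \<Otimes>\<^sub>M ?P"]) auto
      also have "\<dots> = (\<E> w. indicator B (W e w) * (\<Prod>y\<in>J. indicator (A y) (W y w)))"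
        unfolding prodind by (simp add: indicator_times)
      also have "\<dots> = measure M (W e -` B \<inter> space M) * measure M (Y -` (Pi\<^sub>E J A) \<inter> space M)"
      proof -
        have "(\<E> w. (indicator B (W e w) :: real) * (\<Prod>y\<in>J. indicator (A y) (W y w)))
          = (\<E> w. indicator B (W e w) :: real) * (\<E> w. \<Prod>y\<in>J. indicator (A y) (W y w))"
          by (rule box[OF B]) (rule A)
        then show ?thesis using meas[OF W_measurable B, of e] meas[OF Y PA] unfolding prodind by simp
      qed
      finally show "emeasure N1 (Pi\<^sub>E J A) = emeasure N2 (Pi\<^sub>E J A)"
        unfolding N1[OF PA] N2[OF PA] by (simp add: emeasure_eq_measure ennreal_mult)
    qed
    then have "emeasure N1 D = emeasure N2 D" by simp
    then show "emeasure (distr M borel (W e)) B * emeasure (distr M ?P Y) D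
        = emeasure (distr M (borel \<Otimes>\<^sub>M ?P) (\<lambda>w. (W e w, Y w))) (B \<times> D)"
      unfolding N1[OF D] N2[OF D] by (simp add: emeasure_distr)
  qed
  then show ?thesis unfolding Y_def .
qed

text \<open>By independence the factor of the square splits off, with an arbitrary function \<open>q\<close> of orthogonal variables left over.\<close>

lemma char_orthogonal_square:
  assumes e: "norm e = 1" and J: "finite J" and orth: "\<And>y. y \<in> J \<Longrightarrow> y \<bullet> e = 0"
    and q [measurable]: "q \<in> borel_measurable (\<Pi>\<^sub>M y\<in>J. borel)"
  shows "cmod (CLINT w|M. iexp (l * (W e w)\<^sup>2 + q (\<lambda>y\<in>J. W y w)))
    = (1 + 4 * l\<^sup>2) powr (- 1 / 4) * cmod (CLINT w|M. iexp (q (\<lambda>y\<in>J. W y w)))"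
proof -
  define Y where "Y w = (\<lambda>y\<in>J. W y w)" for w
  have Y [measurable]: "Y \<in> M \<rightarrow>\<^sub>M (\<Pi>\<^sub>M y\<in>J. borel)" unfolding Y_def by measurable
  define P1 where "P1 = distr M borel (W e)"
  define P2 where "P2 = distr M (\<Pi>\<^sub>M y\<in>J. borel) Y"
  have [measurable_cong]: "sets P1 = sets borel" "sets P2 = sets (\<Pi>\<^sub>M y\<in>J. borel)"
    by (simp_all add: P1_def P2_def)
  interpret P1: prob_space P1 unfolding P1_def by (rule prob_space_distr) simp
  interpret P2: prob_space P2 unfolding P2_def by (rule prob_space_distr) simp
  interpret P: pair_prob_space P1 P2 ..
  have law: "P1 \<Otimes>\<^sub>M P2 = distr M (borel \<Otimes>\<^sub>M (\<Pi>\<^sub>M y\<in>J. borel)) (\<lambda>w. (W e w, Y w))"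
    unfolding P1_def P2_def Y_def by (rule joint_law_orthogonal[OF e J orth])
  have "(CLINT w|M. iexp (l * (W e w)\<^sup>2 + q (Y w)))
      = (CLINT x|distr M (borel \<Otimes>\<^sub>M (\<Pi>\<^sub>M y\<in>J. borel)) (\<lambda>w. (W e w, Y w)). iexp (l * (fst x)\<^sup>2 + q (snd x)))"
    by (subst integral_distr) auto
  also have "\<dots> = (CLINT x|P1 \<Otimes>\<^sub>M P2. iexp (l * (fst x)\<^sup>2 + q (snd x)))" unfolding law ..
  also have "\<dots> = (CLINT x|P1. CLINT v|P2. iexp (l * x\<^sup>2 + q v))"
  proof -
    have "integrable (P1 \<Otimes>\<^sub>M P2) (\<lambda>x. iexp (l * (fst x)\<^sup>2 + q (snd x)))"
      by (rule P.integrable_const_bound[of _ 1]) (auto simp del: of_real_add of_real_mult)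
    from P.integral_fst'[OF this] show ?thesis by simp
  qed
  also have "\<dots> = (CLINT x|P1. iexp (l * x\<^sup>2) * (CLINT v|P2. iexp (q v)))"
    by (simp add: distrib_left exp_add)
  also have "\<dots> = (CLINT x|P1. iexp (l * x\<^sup>2)) * (CLINT v|P2. iexp (q v))" by simp
  also have "(CLINT v|P2. iexp (q v)) = (CLINT w|M. iexp (q (Y w)))"
    unfolding P2_def by (subst integral_distr) auto
  also have "(CLINT x|P1. iexp (l * x\<^sup>2)) = (CLINT w|M. iexp (l * (W e w)\<^sup>2))"
    unfolding P1_def by (subst integral_distr) auto
  also have "(CLINT w|M. iexp (l * (W e w)\<^sup>2)) = (\<integral>x. std_normal_density x *\<^sub>R iexp (l * x\<^sup>2) \<partial>lborel)"
  proof -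
    have D: "distr M lborel (W e) = density lborel (\<lambda>x. ennreal (std_normal_density x))"
      using W_unit[OF e] by (simp add: distributed_def)
    have "(CLINT w|M. iexp (l * (W e w)\<^sup>2)) = (CLINT x|distr M lborel (W e). iexp (l * x\<^sup>2))"
      by (subst integral_distr) auto
    also have "\<dots> = (\<integral>x. std_normal_density x *\<^sub>R iexp (l * x\<^sup>2) \<partial>lborel)"
      unfolding D by (rule integral_density) auto
    finally show ?thesis .
  qed
  finally show ?thesis
    unfolding Y_def norm_mult std_normal_char_square[symmetric] by (simp only: norm_mult)
qed

lemma char_orthogonal_squares:
  fixes e :: "nat \<Rightarrow> 'h" and l :: "nat \<Rightarrow> real"
  assumes "\<And>i j. i < N \<Longrightarrow> j < N \<Longrightarrow> e i \<bullet> e j = (if i = j then 1 else 0)"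
    and J: "finite J" and "\<And>y i. y \<in> J \<Longrightarrow> i < N \<Longrightarrow> y \<bullet> e i = 0"
    and q: "q \<in> borel_measurable (\<Pi>\<^sub>M y\<in>J. borel)"
  shows "cmod (CLINT w|M. iexp ((\<Sum>i<N. l i * (W (e i) w)\<^sup>2) + q (\<lambda>y\<in>J. W y w)))
    \<le> (\<Prod>i<N. (1 + 4 * (l i)\<^sup>2) powr (- 1 / 4))"
  using assms
proof (induction N)
  case 0
  have [measurable]: "(\<lambda>w. q (\<lambda>y\<in>J. W y w)) \<in> borel_measurable M"
    by (rule measurable_compose[OF _ q]) measurable
  have "cmod (CLINT w|M. iexp (q (\<lambda>y\<in>J. W y w))) \<le> (\<E> w. cmod (iexp (q (\<lambda>y\<in>J. W y w))))"
    by (rule integral_norm_bound)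
  also have "\<dots> = 1" by (simp add: prob_space)
  finally show ?case by (simp only: lessThan_0 sum.empty prod.empty add_0)
next
  case (Suc N)
  define J' where "J' = e ` {..<N} \<union> J"
  define q' where "q' v = (\<Sum>i<N. l i * (v (e i))\<^sup>2) + q (restrict v J)" for v
  have J': "finite J'" using Suc.prems(2) by (simp add: J'_def)
  have orth: "y \<bullet> e N = 0" if "y \<in> J'" for y
    using that Suc.prems(1,3) by (auto simp: J'_def)
  have eN: "norm (e N) = 1" using Suc.prems(1)[of N N] by (simp add: norm_eq_sqrt_inner)
  have q': "q' \<in> borel_measurable (\<Pi>\<^sub>M y\<in>J'. borel)"
  proof -
    have 1: "(\<lambda>v. v (e i)) \<in> borel_measurable (\<Pi>\<^sub>M y\<in>J'. borel)" if "i < N" for i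
      by (rule measurable_component_singleton) (use that in \<open>simp add: J'_def\<close>)
    have 2: "(\<lambda>v. q (restrict v J)) \<in> borel_measurable (\<Pi>\<^sub>M y\<in>J'. borel)"
      by (rule measurable_compose[OF measurable_restrict_subset Suc.prems(4)]) (simp add: J'_def)
    show ?thesis unfolding q'_def using 1 2 by measurable
  qed
  have eq: "q' (\<lambda>y\<in>J'. W y w) = (\<Sum>i<N. l i * (W (e i) w)\<^sup>2) + q (\<lambda>y\<in>J. W y w)" for w
  proof -
    have "restrict (\<lambda>y\<in>J'. W y w) J = (\<lambda>y\<in>J. W y w)" by (auto simp: J'_def restrict_def)
    then show ?thesis by (simp add: q'_def J'_def)
  qed
  have "cmod (CLINT w|M. iexp ((\<Sum>i<Suc N. l i * (W (e i) w)\<^sup>2) + q (\<lambda>y\<in>J. W y w)))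
      = cmod (CLINT w|M. iexp (l N * (W (e N) w)\<^sup>2 + q' (\<lambda>y\<in>J'. W y w)))"
    unfolding eq by (simp add: add_ac)
  also have "\<dots> = (1 + 4 * (l N)\<^sup>2) powr (- 1 / 4) * cmod (CLINT w|M. iexp (q' (\<lambda>y\<in>J'. W y w)))"
    by (rule char_orthogonal_square[OF eN J' orth q'])
  also have "\<dots> \<le> (1 + 4 * (l N)\<^sup>2) powr (- 1 / 4) * (\<Prod>i<N. (1 + 4 * (l i)\<^sup>2) powr (- 1 / 4))"
    unfolding eq using Suc.prems by (intro mult_left_mono Suc.IH) auto
  also have "\<dots> = (\<Prod>i<Suc N. (1 + 4 * (l i)\<^sup>2) powr (- 1 / 4))" by (simp add: mult.commute)
  finally show ?case .
qed

end

section \<open>Characteristic functions in the second chaos\<close>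

lemma norm_iexp_diff_le: "cmod (iexp x - iexp y) \<le> \<bar>x - y\<bar>"
proof -
  have "iexp x - iexp y = iexp y * (iexp (x - y) - 1)"
    by (simp add: algebra_simps exp_add[symmetric])
  then have "cmod (iexp x - iexp y) = cmod (iexp (x - y) - 1)" by (simp add: norm_mult del: of_real_diff)
  also have "\<dots> \<le> \<bar>x - y\<bar>" using iexp_approx1[of "x - y" 0] by simp
  finally show ?thesis .
qed

context gaussian_field
begin

lemma wick_commute: "wick f g w = wick g f w"
  by (simp add: wick_def inner_commute mult.commute)

lemma wick_sum_right:
  assumes "finite I"
  shows "AE w in M. wick h (\<Sum>p\<in>I. c p *\<^sub>R g p) w = (\<Sum>p\<in>I. c p * wick h (g p) w)"
  using W_sum[OF assms, of c g]
  by eventually_elim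
     (simp add: wick_def inner_sum_right sum_distrib_left sum_subtractf right_diff_distrib mult.left_commute)

lemma wick_sum_left:
  assumes "finite I"
  shows "AE w in M. wick (\<Sum>p\<in>I. c p *\<^sub>R f p) h w = (\<Sum>p\<in>I. c p * wick (f p) h w)"
  using wick_sum_right[OF assms, of h c f] by (simp add: wick_commute[of _ h])

lemma wick_diff_right: "AE w in M. wick h (f - c *\<^sub>R g) w = wick h f w - c * wick h g w"
  using W_add_scaleR[of f "- c" g]
proof eventually_elim
  case (elim w)
  then have e: "W (f - c *\<^sub>R g) w = W f w - c * W g w" by simp
  show ?case unfolding wick_def e by (simp add: inner_diff_right algebra_simps)
qed

text \<open>\<open>P\<close> projects away from the span of the \<open>e j\<close>. The difference collects all terms in which some factor is
one of the \<open>e j\<close>; those with two such factors have been counted twice.\<close>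

lemma wick_projection:
  fixes e :: "nat \<Rightarrow> 'h"
  assumes orth: "\<And>i j. i < N \<Longrightarrow> j < N \<Longrightarrow> e i \<bullet> e j = (if i = j then 1 else 0)"
  defines "P x \<equiv> x - (\<Sum>j<N. (e j \<bullet> x) *\<^sub>R e j)"
  shows "AE w in M. wick f g w - wick (P f) (P g) w
    = (\<Sum>j<N. (e j \<bullet> f) * wick (e j) g w) + (\<Sum>j<N. (e j \<bullet> g) * wick f (e j) w)
      - (\<Sum>i<N. \<Sum>j<N. ((e i \<bullet> f) * (e j \<bullet> g)) * wick (e i) (e j) w)"
proof -
  have WP: "AE w in M. W (P x) w = W x w - (\<Sum>j<N. (e j \<bullet> x) * W (e j) w)" for x
    using W_add_scaleR[of x "- 1" "\<Sum>j<N. (e j \<bullet> x) *\<^sub>R e j"] W_sum[OF finite_lessThan, of "\<lambda>j. e j \<bullet> x" e N]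
    by eventually_elim (auto simp: P_def)
  define c where "c = (\<Sum>j<N. (e j \<bullet> f) * (e j \<bullet> g))"
  have dd: "(\<Sum>i<N. \<Sum>j<N. ((e i \<bullet> f) * (e j \<bullet> g)) * (e i \<bullet> e j)) = c"
  proof -
    have "(\<Sum>j<N. ((e i \<bullet> f) * (e j \<bullet> g)) * (e i \<bullet> e j)) = (e i \<bullet> f) * (e i \<bullet> g)" if "i < N" for i
    proof -
      have "(\<Sum>j<N. ((e i \<bullet> f) * (e j \<bullet> g)) * (e i \<bullet> e j)) = (\<Sum>j<N. if i = j then (e i \<bullet> f) * (e i \<bullet> g) else 0)"
        using that by (intro sum.cong refl) (auto simp: orth)
      then show ?thesis using that by simp
    qed
    then show ?thesis by (simp add: c_def)
  qed
  have PP: "P f \<bullet> P g = f \<bullet> g - c"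
  proof -
    have eP: "e i \<bullet> P g = 0" if "i < N" for i
    proof -
      have "(\<Sum>j<N. (e j \<bullet> g) * (e i \<bullet> e j)) = (\<Sum>j<N. if i = j then e i \<bullet> g else 0)"
        using that by (intro sum.cong refl) (auto simp: orth)
      then show ?thesis using that by (simp add: P_def inner_diff_right inner_sum_right)
    qed
    have "P f \<bullet> P g = f \<bullet> P g - (\<Sum>j<N. (e j \<bullet> f) * (e j \<bullet> P g))"
      unfolding P_def[of f] by (simp only: inner_diff_left inner_sum_left inner_scaleR_left)
    also have "(\<Sum>j<N. (e j \<bullet> f) * (e j \<bullet> P g)) = 0" by (intro sum.neutral) (simp add: eP)
    also have "f \<bullet> P g = f \<bullet> g - c"
      by (simp add: P_def c_def inner_diff_right inner_sum_right inner_commute[of f "e _"] mult.commute)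
    finally show ?thesis by simp
  qed
  show ?thesis
    using WP[of f] WP[of g]
  proof eventually_elim
    case (elim w)
    define s where "s = (\<Sum>j<N. (e j \<bullet> f) * W (e j) w)"
    define t where "t = (\<Sum>j<N. (e j \<bullet> g) * W (e j) w)"
    have 1: "(\<Sum>j<N. (e j \<bullet> f) * wick (e j) g w) = s * W g w - c"
      by (simp add: wick_def s_def c_def right_diff_distrib sum_subtractf sum_distrib_right mult.assoc)
    have 2: "(\<Sum>j<N. (e j \<bullet> g) * wick f (e j) w) = W f w * t - c"
      by (simp add: wick_def t_def c_def right_diff_distrib sum_subtractf sum_distrib_left inner_commute[of f] mult_ac)
    have 3: "(\<Sum>i<N. \<Sum>j<N. ((e i \<bullet> f) * (e j \<bullet> g)) * wick (e i) (e j) w) = s * t - c"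
    proof -
      have "(\<Sum>i<N. \<Sum>j<N. ((e i \<bullet> f) * (e j \<bullet> g)) * wick (e i) (e j) w)
        = (\<Sum>i<N. \<Sum>j<N. ((e i \<bullet> f) * W (e i) w) * ((e j \<bullet> g) * W (e j) w))
          - (\<Sum>i<N. \<Sum>j<N. ((e i \<bullet> f) * (e j \<bullet> g)) * (e i \<bullet> e j))"
        by (simp add: wick_def right_diff_distrib sum_subtractf mult_ac)
      then show ?thesis unfolding dd s_def t_def sum_product .
    qed
    show ?case
      unfolding 1 2 3 unfolding wick_def PP elim s_def[symmetric] t_def[symmetric] by (simp add: algebra_simps)
  qed
qed

text \<open>\<open>K1\<close> and \<open>K2\<close> say that the operators of the tensor sums and their adjoints converge at \<open>e j\<close> to \<open>l j e j\<close>. The projected sum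
\<open>Q'\<close> depends only on variables orthogonal to the \<open>e j\<close>, so \<open>char_orthogonal_squares\<close> applies to \<open>Q' + T\<close>; the error \<open>D\<close> tends to
\<open>0\<close> in mean by the convergence at the finitely many \<open>e j\<close>.\<close>

theorem char_bound_second_chaos:
  fixes e :: "nat \<Rightarrow> 'h" and l :: "nat \<Rightarrow> real" and I :: "nat \<Rightarrow> 'i set"
    and m :: "nat \<Rightarrow> 'i \<Rightarrow> real" and f g :: "nat \<Rightarrow> 'i \<Rightarrow> 'h"
  assumes orth: "\<And>i j. i < N \<Longrightarrow> j < N \<Longrightarrow> e i \<bullet> e j = (if i = j then 1 else 0)"
    and fin: "\<And>k. finite (I k)"
    and K1: "\<And>j. j < N \<Longrightarrow> (\<lambda>k. \<Sum>p\<in>I k. (m k p * (g k p \<bullet> e j)) *\<^sub>R f k p) \<longlonglongrightarrow> l j *\<^sub>R e j"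
    and K2: "\<And>j. j < N \<Longrightarrow> (\<lambda>k. \<Sum>p\<in>I k. (m k p * (f k p \<bullet> e j)) *\<^sub>R g k p) \<longlonglongrightarrow> l j *\<^sub>R e j"
    and Q: "integrable M Q"
    and conv: "(\<lambda>k. (\<E> w. \<bar>Q w - (\<Sum>p\<in>I k. m k p * wick (f k p) (g k p) w)\<bar>)) \<longlonglongrightarrow> 0"
  shows "cmod (CLINT w|M. iexp (Q w)) \<le> (\<Prod>j<N. (1 + 4 * (l j)\<^sup>2) powr (- 1 / 4))"
proof -
  let ?B = "\<Prod>j<N. (1 + 4 * (l j)\<^sup>2) powr (- 1 / 4)"
  define P where "P = (\<lambda>x. x - (\<Sum>j<N. (e j \<bullet> x) *\<^sub>R e j))"
  have PO: "P x \<bullet> e i = 0" if "i < N" for x i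
  proof -
    have "(\<Sum>j<N. (e j \<bullet> x) * (e j \<bullet> e i)) = (\<Sum>j<N. if j = i then e i \<bullet> x else 0)"
      using that by (intro sum.cong refl) (auto simp: orth)
    then show ?thesis using that by (simp add: P_def inner_diff_left inner_sum_left inner_commute[of x])
  qed
  note am = all_moments_intros all_moments_wick all_moments_W
  define a where "a k j = (\<Sum>p\<in>I k. (m k p * (f k p \<bullet> e j)) *\<^sub>R g k p)" for k j
  define b where "b k j = (\<Sum>p\<in>I k. (m k p * (g k p \<bullet> e j)) *\<^sub>R f k p)" for k j
  define Qk where "Qk k w = (\<Sum>p\<in>I k. m k p * wick (f k p) (g k p) w)" for k w
  define Q' where "Q' k w = (\<Sum>p\<in>I k. m k p * wick (P (f k p)) (P (g k p)) w)" for k w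
  define T where "T w = (\<Sum>j<N. l j * wick (e j) (e j) w)" for w
  define \<delta> where "\<delta> k i j = e i \<bullet> b k j - (if i = j then l j else 0)" for k i j
  define D where "D k w = (\<Sum>j<N. wick (e j) (a k j - l j *\<^sub>R e j) w) + (\<Sum>j<N. wick (e j) (b k j - l j *\<^sub>R e j) w)
     - (\<Sum>i<N. \<Sum>j<N. \<delta> k i j * wick (e i) (e j) w)" for k w
  have decomp: "AE w in M. Qk k w - (Q' k w + T w) = D k w" for k
  proof -
    have A1: "AE w in M. \<forall>p\<in>I k. wick (f k p) (g k p) w - wick (P (f k p)) (P (g k p)) w
      = (\<Sum>j<N. (e j \<bullet> f k p) * wick (e j) (g k p) w) + (\<Sum>j<N. (e j \<bullet> g k p) * wick (f k p) (e j) w)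
      - (\<Sum>i<N. \<Sum>j<N. ((e i \<bullet> f k p) * (e j \<bullet> g k p)) * wick (e i) (e j) w)"
      unfolding P_def by (rule AE_finite_allI[OF fin]) (rule wick_projection[OF orth])
    have A2: "AE w in M. \<forall>j\<in>{..<N}. wick (e j) (a k j) w = (\<Sum>p\<in>I k. (m k p * (f k p \<bullet> e j)) * wick (e j) (g k p) w)"
      unfolding a_def by (rule AE_finite_allI) (auto intro: wick_sum_right fin)
    have A3: "AE w in M. \<forall>j\<in>{..<N}. wick (b k j) (e j) w = (\<Sum>p\<in>I k. (m k p * (g k p \<bullet> e j)) * wick (f k p) (e j) w)"
      unfolding b_def by (rule AE_finite_allI) (auto intro: wick_sum_left fin)
    have A4: "AE w in M. \<forall>j\<in>{..<N}. wick (e j) (a k j - l j *\<^sub>R e j) w = wick (e j) (a k j) w - l j * wick (e j) (e j) w"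
      by (rule AE_finite_allI) (auto intro: wick_diff_right)
    have A5: "AE w in M. \<forall>j\<in>{..<N}. wick (e j) (b k j - l j *\<^sub>R e j) w = wick (e j) (b k j) w - l j * wick (e j) (e j) w"
      by (rule AE_finite_allI) (auto intro: wick_diff_right)
    show ?thesis
      using A1 A2 A3 A4 A5
    proof eventually_elim
      case (elim w)
      have "Qk k w - Q' k w = (\<Sum>p\<in>I k. m k p * (wick (f k p) (g k p) w - wick (P (f k p)) (P (g k p)) w))"
        by (simp add: Qk_def Q'_def right_diff_distrib sum_subtractf)
      also have "\<dots> = (\<Sum>p\<in>I k. (\<Sum>j<N. (m k p * (f k p \<bullet> e j)) * wick (e j) (g k p) w)
          + (\<Sum>j<N. (m k p * (g k p \<bullet> e j)) * wick (f k p) (e j) w)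
          - (\<Sum>i<N. \<Sum>j<N. ((m k p * (g k p \<bullet> e j)) * (e i \<bullet> f k p)) * wick (e i) (e j) w))"
        using elim(1) by (intro sum.cong refl)
          (simp add: right_diff_distrib distrib_left sum_distrib_left inner_commute[of _ "e _"] mult_ac)
      also have "\<dots> = (\<Sum>j<N. wick (e j) (a k j) w) + (\<Sum>j<N. wick (b k j) (e j) w)
          - (\<Sum>i<N. \<Sum>j<N. (e i \<bullet> b k j) * wick (e i) (e j) w)"
      proof -
        have 1: "(\<Sum>p\<in>I k. \<Sum>j<N. (m k p * (f k p \<bullet> e j)) * wick (e j) (g k p) w) = (\<Sum>j<N. wick (e j) (a k j) w)"
          using elim(2) by (subst sum.swap) simp
        have 2: "(\<Sum>p\<in>I k. \<Sum>j<N. (m k p * (g k p \<bullet> e j)) * wick (f k p) (e j) w) = (\<Sum>j<N. wick (b k j) (e j) w)"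
          using elim(3) by (subst sum.swap) simp
        have "(\<Sum>p\<in>I k. \<Sum>i<N. \<Sum>j<N. ((m k p * (g k p \<bullet> e j)) * (e i \<bullet> f k p)) * wick (e i) (e j) w)
            = (\<Sum>i<N. \<Sum>p\<in>I k. \<Sum>j<N. ((m k p * (g k p \<bullet> e j)) * (e i \<bullet> f k p)) * wick (e i) (e j) w)"
          by (rule sum.swap)
        also have "\<dots> = (\<Sum>i<N. \<Sum>j<N. \<Sum>p\<in>I k. ((m k p * (g k p \<bullet> e j)) * (e i \<bullet> f k p)) * wick (e i) (e j) w)"
          by (intro sum.cong refl sum.swap)
        also have "\<dots> = (\<Sum>i<N. \<Sum>j<N. (e i \<bullet> b k j) * wick (e i) (e j) w)"
          by (simp add: b_def inner_sum_right sum_distrib_right)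
        finally show ?thesis unfolding sum_subtractf sum.distrib 1 2 by simp
      qed
      finally have R: "Qk k w - Q' k w = (\<Sum>j<N. wick (e j) (a k j) w) + (\<Sum>j<N. wick (b k j) (e j) w)
          - (\<Sum>i<N. \<Sum>j<N. (e i \<bullet> b k j) * wick (e i) (e j) w)" .
      have d1: "(\<Sum>j<N. wick (e j) (a k j - l j *\<^sub>R e j) w) = (\<Sum>j<N. wick (e j) (a k j) w) - T w"
        using elim(4) by (simp add: sum_subtractf T_def)
      have d2: "(\<Sum>j<N. wick (e j) (b k j - l j *\<^sub>R e j) w) = (\<Sum>j<N. wick (b k j) (e j) w) - T w"
        using elim(5) by (simp add: sum_subtractf T_def wick_commute[of "b k _"])
      have d3: "(\<Sum>i<N. \<Sum>j<N. \<delta> k i j * wick (e i) (e j) w)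
          = (\<Sum>i<N. \<Sum>j<N. (e i \<bullet> b k j) * wick (e i) (e j) w) - T w"
      proof -
        have "(\<Sum>j<N. (if i = j then l j else 0) * wick (e i) (e j) w) = l i * wick (e i) (e i) w" if "i < N" for i
          using that by (simp add: if_distrib[of "\<lambda>x. x * _"] cong: if_cong)
        then show ?thesis by (simp add: \<delta>_def left_diff_distrib sum_subtractf T_def)
      qed
      show ?case unfolding D_def d1 d2 d3 using R by simp
    qed
  qed
  have Dint: "integrable M (D k)" for k
    unfolding D_def by (intro all_moments_integrable am)
  have iw: "integrable M (\<lambda>w. \<bar>wick x y w\<bar>)" for x y
    by (intro integrable_abs all_moments_integrable am)
  have Dlim: "(\<lambda>k. (\<E> w. \<bar>D k w\<bar>)) \<longlonglongrightarrow> 0"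
  proof -
    define B where "B k = (\<Sum>j<N. 2 * norm (e j) * norm (a k j - l j *\<^sub>R e j)) + (\<Sum>j<N. 2 * norm (e j) * norm (b k j - l j *\<^sub>R e j))
      + (\<Sum>i<N. \<Sum>j<N. \<bar>\<delta> k i j\<bar> * (2 * norm (e i) * norm (e j)))" for k
    have "(\<E> w. \<bar>D k w\<bar>) \<le> B k" for k
    proof -
      have "\<bar>D k w\<bar> \<le> (\<Sum>j<N. \<bar>wick (e j) (a k j - l j *\<^sub>R e j) w\<bar>) + (\<Sum>j<N. \<bar>wick (e j) (b k j - l j *\<^sub>R e j) w\<bar>)
        + (\<Sum>i<N. \<Sum>j<N. \<bar>\<delta> k i j\<bar> * \<bar>wick (e i) (e j) w\<bar>)" for w
      proof -
        have "\<bar>\<Sum>i<N. \<Sum>j<N. \<delta> k i j * wick (e i) (e j) w\<bar>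
          \<le> (\<Sum>i<N. \<Sum>j<N. \<bar>\<delta> k i j\<bar> * \<bar>wick (e i) (e j) w\<bar>)"
          by (intro order_trans[OF sum_abs] sum_mono order_trans[OF sum_abs]) (simp add: abs_mult)
        moreover have "\<bar>\<Sum>j<N. wick (e j) (a k j - l j *\<^sub>R e j) w\<bar> \<le> (\<Sum>j<N. \<bar>wick (e j) (a k j - l j *\<^sub>R e j) w\<bar>)"
          "\<bar>\<Sum>j<N. wick (e j) (b k j - l j *\<^sub>R e j) w\<bar> \<le> (\<Sum>j<N. \<bar>wick (e j) (b k j - l j *\<^sub>R e j) w\<bar>)"
          by (rule sum_abs)+
        ultimately show ?thesis unfolding D_def by linarith
      qed
      then have "(\<E> w. \<bar>D k w\<bar>) \<le> (\<E> w. (\<Sum>j<N. \<bar>wick (e j) (a k j - l j *\<^sub>R e j) w\<bar>)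
          + (\<Sum>j<N. \<bar>wick (e j) (b k j - l j *\<^sub>R e j) w\<bar>)
          + (\<Sum>i<N. \<Sum>j<N. \<bar>\<delta> k i j\<bar> * \<bar>wick (e i) (e j) w\<bar>))"
        using Dint[of k] iw by (intro integral_mono) (auto intro!: integrable_add integrable_sum)
      also have "\<dots> = (\<Sum>j<N. (\<E> w. \<bar>wick (e j) (a k j - l j *\<^sub>R e j) w\<bar>))
          + (\<Sum>j<N. (\<E> w. \<bar>wick (e j) (b k j - l j *\<^sub>R e j) w\<bar>))
          + (\<Sum>i<N. \<Sum>j<N. \<bar>\<delta> k i j\<bar> * (\<E> w. \<bar>wick (e i) (e j) w\<bar>))"
        using iw by simp
      also have "\<dots> \<le> B k"
        unfolding B_def by (intro add_mono sum_mono mult_left_mono expectation_abs_wick) auto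
      finally show ?thesis .
    qed
    moreover have "B \<longlonglongrightarrow> (\<Sum>j<N. 2 * norm (e j) * 0) + (\<Sum>j<N. 2 * norm (e j) * 0)
        + (\<Sum>i<N. \<Sum>j<N. \<bar>0\<bar> * (2 * norm (e i) * norm (e j)))"
      unfolding B_def
    proof (intro tendsto_add tendsto_sum tendsto_mult tendsto_const tendsto_rabs)
      fix j assume "j \<in> {..<N}"
      then have j: "j < N" by simp
      have "(\<lambda>k. norm (a k j - l j *\<^sub>R e j)) \<longlonglongrightarrow> norm (l j *\<^sub>R e j - l j *\<^sub>R e j)"
        unfolding a_def by (intro tendsto_intros K2 j)
      then show "(\<lambda>k. norm (a k j - l j *\<^sub>R e j)) \<longlonglongrightarrow> 0" by simp
      have "(\<lambda>k. norm (b k j - l j *\<^sub>R e j)) \<longlonglongrightarrow> norm (l j *\<^sub>R e j - l j *\<^sub>R e j)"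
        unfolding b_def by (intro tendsto_intros K1 j)
      then show "(\<lambda>k. norm (b k j - l j *\<^sub>R e j)) \<longlonglongrightarrow> 0" by simp
      fix i assume i: "i \<in> {..<N}"
      have "(\<lambda>k. \<delta> k i j) \<longlonglongrightarrow> e i \<bullet> (l j *\<^sub>R e j) - (if i = j then l j else 0)"
        unfolding \<delta>_def b_def by (intro tendsto_intros K1 j)
      then show "(\<lambda>k. \<delta> k i j) \<longlonglongrightarrow> 0"
        using i j by (cases "i = j") (simp_all add: orth)
    qed
    then have "B \<longlonglongrightarrow> 0" by simp
    ultimately show ?thesis
      by (intro tendsto_sandwich[OF _ _ tendsto_const \<open>B \<longlonglongrightarrow> 0\<close>]) (auto intro!: always_eventually)
  qed
  have main: "cmod (CLINT w|M. iexp (Q' k w + T w)) \<le> ?B" for k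
  proof -
    define J where "J = (\<lambda>p. P (f k p)) ` I k \<union> (\<lambda>p. P (g k p)) ` I k"
    define q where "q v = (\<Sum>p\<in>I k. m k p * (v (P (f k p)) * v (P (g k p))))" for v :: "'h \<Rightarrow> real"
    define c where "c = - (\<Sum>p\<in>I k. m k p * (P (f k p) \<bullet> P (g k p))) - (\<Sum>j<N. l j * (e j \<bullet> e j))"
    have eq: "Q' k w + T w = ((\<Sum>i<N. l i * (W (e i) w)\<^sup>2) + q (\<lambda>y\<in>J. W y w)) + c" for w
    proof -
      have "q (\<lambda>y\<in>J. W y w) = (\<Sum>p\<in>I k. m k p * (W (P (f k p)) w * W (P (g k p)) w))"
        unfolding q_def by (intro sum.cong refl) (auto simp: J_def)
      then show ?thesis
        by (simp add: Q'_def T_def wick_def c_def right_diff_distrib sum_subtractf power2_eq_square)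
    qed
    have "cmod (CLINT w|M. iexp (Q' k w + T w)) = cmod (CLINT w|M. iexp ((\<Sum>i<N. l i * (W (e i) w)\<^sup>2) + q (\<lambda>y\<in>J. W y w)))"
    proof -
      have "iexp (x + c) = iexp x * iexp c" for x by (simp add: distrib_left exp_add)
      then have "(CLINT w|M. iexp (Q' k w + T w)) = (CLINT w|M. iexp ((\<Sum>i<N. l i * (W (e i) w)\<^sup>2) + q (\<lambda>y\<in>J. W y w))) * iexp c"
        unfolding eq by (simp only: integral_mult_left_zero)
      then show ?thesis by (simp only: norm_mult norm_exp_i_times mult_1_right)
    qed
    also have "\<dots> \<le> ?B"
    proof (rule char_orthogonal_squares[OF orth])
      show "finite J" using fin by (simp add: J_def)
      show "y \<bullet> e i = 0" if "y \<in> J" "i < N" for y i using that PO by (auto simp: J_def)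
      have 1: "(\<lambda>v. v y) \<in> borel_measurable (\<Pi>\<^sub>M y\<in>J. borel)" if "y \<in> J" for y :: 'h
        by (rule measurable_component_singleton) (use that in simp)
      show "q \<in> borel_measurable (\<Pi>\<^sub>M y\<in>J. borel)"
        unfolding q_def
        by (intro borel_measurable_sum borel_measurable_times borel_measurable_const 1) (auto simp: J_def)
    qed auto
    finally show ?thesis .
  qed
  have Qm: "Q \<in> borel_measurable M" using Q by (simp add: borel_measurable_integrable)
  have amQ: "all_moments (\<lambda>w. Q' k w + T w)" "all_moments (Qk k)" for k
    unfolding Q'_def T_def Qk_def by (intro am)+
  have ii: "integrable M (\<lambda>w. iexp (X w))" if "X \<in> borel_measurable M" for X :: "'a \<Rightarrow> real"
    by (rule integrable_const_bound[of _ 1]) (use that in auto)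
  have bound: "cmod (CLINT w|M. iexp (Q w)) \<le> ?B
      + ((\<E> w. \<bar>Q w - Qk k w\<bar>) + (\<E> w. \<bar>D k w\<bar>))" for k
  proof -
    have i1: "integrable M (\<lambda>w. \<bar>Q w - Qk k w\<bar>)"
      using Q all_moments_integrable[OF amQ(2)[of k]] by auto
    have X: "(CLINT w|M. iexp (Q w)) - (CLINT w|M. iexp (Q' k w + T w)) = (CLINT w|M. iexp (Q w) - iexp (Q' k w + T w))"
      by (rule integral_diff[symmetric]) (intro ii Qm all_moments_measurable amQ)+
    have "cmod ((CLINT w|M. iexp (Q w)) - (CLINT w|M. iexp (Q' k w + T w)))
        \<le> (\<E> w. cmod (iexp (Q w) - iexp (Q' k w + T w)))"
      unfolding X by (rule integral_norm_bound)
    also have "\<dots> \<le> (\<E> w. \<bar>Q w - Qk k w\<bar> + \<bar>D k w\<bar>)"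
    proof (rule integral_mono_AE)
      show "integrable M (\<lambda>w. cmod (iexp (Q w) - iexp (Q' k w + T w)))"
        by (intro integrable_norm integrable_diff ii Qm all_moments_measurable amQ)
      show "integrable M (\<lambda>w. \<bar>Q w - Qk k w\<bar> + \<bar>D k w\<bar>)" using i1 Dint[of k] by auto
      show "AE w in M. cmod (iexp (Q w) - iexp (Q' k w + T w)) \<le> \<bar>Q w - Qk k w\<bar> + \<bar>D k w\<bar>"
        using decomp[of k]
      proof eventually_elim
        case (elim w)
        show ?case using norm_iexp_diff_le[of "Q w" "Q' k w + T w"] elim by linarith
      qed
    qed
    also have "\<dots> = (\<E> w. \<bar>Q w - Qk k w\<bar>) + (\<E> w. \<bar>D k w\<bar>)"
      using i1 Dint[of k] by simp
    finally have "cmod ((CLINT w|M. iexp (Q w)) - (CLINT w|M. iexp (Q' k w + T w)))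
      \<le> (\<E> w. \<bar>Q w - Qk k w\<bar>) + (\<E> w. \<bar>D k w\<bar>)" .
    then show ?thesis
      using main[of k] norm_triangle_sub[of "CLINT w|M. iexp (Q w)" "CLINT w|M. iexp (Q' k w + T w)"] by linarith
  qed
  have "(\<lambda>k. ?B
      + ((\<E> w. \<bar>Q w - Qk k w\<bar>) + (\<E> w. \<bar>D k w\<bar>)))
    \<longlonglongrightarrow> ?B + (0 + 0)"
    using conv unfolding Qk_def[symmetric] by (intro tendsto_intros Dlim)
  then show ?thesis
    by (intro LIMSEQ_le_const[of _ "?B"]) (use bound in auto)
qed

end

section \<open>Closability of the derivative on polynomials\<close>

context gaussian_field
begin

text \<open>Polynomials in the field, as lists of coefficients and factors.\<close>

definition polyW :: "(real \<times> 'h list) list \<Rightarrow> 'a \<Rightarrow> real" where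
  "polyW p w = (\<Sum>(c, hs)\<leftarrow>p. c * prodW hs w)"

primrec dmono :: "'h \<Rightarrow> 'h list \<Rightarrow> (real \<times> 'h list) list" where
  "dmono h [] = []"
| "dmono h (g # gs) = (h \<bullet> g, gs) # map (\<lambda>(c, xs). (c, g # xs)) (dmono h gs)"

definition dpoly :: "'h \<Rightarrow> (real \<times> 'h list) list \<Rightarrow> (real \<times> 'h list) list" where
  "dpoly h p = concat (map (\<lambda>(c, hs). map (\<lambda>(b, xs). (c * b, xs)) (dmono h hs)) p)"

lemma polyW_simps [simp]:
  "polyW [] w = 0" "polyW ((c, hs) # p) w = c * prodW hs w + polyW p w"
  "polyW (p @ q) w = polyW p w + polyW q w"
  by (simp_all add: polyW_def)

lemma polyW_scale: "polyW (map (\<lambda>(b, xs). (c * b, xs)) p) w = c * polyW p w"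
  by (induction p) (auto simp: algebra_simps)

lemma polyW_dmono: "polyW (dmono h hs) w = derW h hs w"
proof (induction hs)
  case (Cons g gs)
  have "polyW (map (\<lambda>(c, xs). (c, g # xs)) p) w = W g w * polyW p w" for p
    by (induction p) (auto simp: algebra_simps)
  then show ?case using Cons by simp
qed simp

lemma polyW_dpoly_simps [simp]:
  "polyW (dpoly h []) w = 0" "polyW (dpoly h ((c, hs) # p)) w = c * derW h hs w + polyW (dpoly h p) w"
  by (simp_all add: dpoly_def polyW_scale polyW_dmono)

lemma all_moments_polyW: "all_moments (polyW p)"
proof (induction p)
  case (Cons a p)
  obtain c hs where "a = (c, hs)" by (cases a)
  then show ?case using Cons by (auto intro!: all_moments_intros all_moments_prodW)
qed (auto intro: all_moments_const)

lemma derW_append: "derW h (xs @ ys) w = derW h xs w * prodW ys w + prodW xs w * derW h ys w"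
  by (induction xs) (auto simp: algebra_simps)

lemma expectation_axpy:
  "all_moments X \<Longrightarrow> all_moments Y \<Longrightarrow>
    (\<E> w. c * X w + Y w) = c * expectation X + expectation Y"
  by (simp add: all_moments_integrable)

text \<open>The derivative is the adjoint, on polynomials, of \<open>q \<mapsto> q W h - D\<^sub>h q\<close>.\<close>

lemma integration_by_parts:
  "(\<E> w. polyW (dpoly h p) w * polyW q w)
    = (\<E> w. polyW p w * (polyW q w * W h w - polyW (dpoly h q) w))"
proof -
  note am = all_moments_intros all_moments_W all_moments_prodW all_moments_derW all_moments_polyW
  have mono: "(\<E> w. derW h xs w * prodW ys w) = (\<E> w. prodW xs w * (prodW ys w * W h w - derW h ys w))" for xs ys
  proof -
    have i: "integrable M (\<lambda>w. derW h xs w * prodW ys w)" "integrable M (\<lambda>w. prodW xs w * derW h ys w)"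
      "integrable M (\<lambda>w. W h w * prodW (xs @ ys) w)"
      by (intro all_moments_integrable am)+
    have "(\<E> w. W h w * prodW (xs @ ys) w) = expectation (derW h (xs @ ys))" by (rule stein)
    also have "\<dots> = (\<E> w. derW h xs w * prodW ys w) + (\<E> w. prodW xs w * derW h ys w)"
      unfolding derW_append using i by simp
    finally have "(\<E> w. derW h xs w * prodW ys w)
      = (\<E> w. W h w * prodW (xs @ ys) w - prodW xs w * derW h ys w)"
      using i by simp
    also have "\<dots> = (\<E> w. prodW xs w * (prodW ys w * W h w - derW h ys w))"
      by (intro integral_cong refl) (simp add: algebra_simps)
    finally show ?thesis .
  qed
  have monop: "(\<E> w. derW h xs w * polyW q w) = (\<E> w. prodW xs w * (polyW q w * W h w - polyW (dpoly h q) w))" for xs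
  proof (induction q)
    case (Cons a q)
    obtain c ys where a: "a = (c, ys)" by (cases a)
    have "(\<E> w. derW h xs w * polyW (a # q) w)
        = (\<E> w. c * (derW h xs w * prodW ys w) + derW h xs w * polyW q w)"
      unfolding a by (intro integral_cong refl) (simp add: algebra_simps)
    also have "\<dots> = c * (\<E> w. derW h xs w * prodW ys w) + (\<E> w. derW h xs w * polyW q w)"
      by (rule expectation_axpy) (intro am)+
    also have "\<dots> = c * (\<E> w. prodW xs w * (prodW ys w * W h w - derW h ys w))
        + (\<E> w. prodW xs w * (polyW q w * W h w - polyW (dpoly h q) w))"
      unfolding mono Cons.IH ..
    also have "\<dots> = (\<E> w. c * (prodW xs w * (prodW ys w * W h w - derW h ys w))
        + prodW xs w * (polyW q w * W h w - polyW (dpoly h q) w))"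
      by (rule expectation_axpy[symmetric]) (intro am)+
    also have "\<dots> = (\<E> w. prodW xs w * (polyW (a # q) w * W h w - polyW (dpoly h (a # q)) w))"
      unfolding a by (intro integral_cong refl) (simp add: algebra_simps)
    finally show ?case .
  qed simp
  show ?thesis
  proof (induction p)
    case (Cons a p)
    obtain c xs where a: "a = (c, xs)" by (cases a)
    define G where "G w = polyW q w * W h w - polyW (dpoly h q) w" for w
    have G: "all_moments G" unfolding G_def by (intro am)
    have "(\<E> w. polyW (dpoly h (a # p)) w * polyW q w)
        = (\<E> w. c * (derW h xs w * polyW q w) + polyW (dpoly h p) w * polyW q w)"
      unfolding a by (intro integral_cong refl) (simp add: algebra_simps)
    also have "\<dots> = c * (\<E> w. derW h xs w * polyW q w) + (\<E> w. polyW (dpoly h p) w * polyW q w)"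
      by (rule expectation_axpy) (intro am)+
    also have "\<dots> = c * (\<E> w. prodW xs w * G w) + (\<E> w. polyW p w * G w)"
      unfolding monop Cons.IH G_def ..
    also have "\<dots> = (\<E> w. c * (prodW xs w * G w) + polyW p w * G w)"
      by (rule expectation_axpy[symmetric]) (intro am G)+
    also have "\<dots> = (\<E> w. polyW (a # p) w * (polyW q w * W h w - polyW (dpoly h q) w))"
      unfolding a G_def by (intro integral_cong refl) (simp add: algebra_simps)
    finally show ?case .
  qed simp
qed

lemma all_moments_sq_integrable: "all_moments X \<Longrightarrow> sq_integrable M X"
  using all_moments_measurable all_moments_integrable[OF all_moments_power[of X 2]] by (auto simp: sq_integrable_def)

lemma expectation_mult_tendsto:
  assumes X: "\<And>n. sq_integrable M (X n)" and Y: "sq_integrable M Y" and Z: "sq_integrable M Z"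
    and lim: "(\<lambda>n. (\<E> w. (X n w - Y w)\<^sup>2)) \<longlonglongrightarrow> 0"
  shows "(\<lambda>n. (\<E> w. X n w * Z w)) \<longlonglongrightarrow> (\<E> w. Y w * Z w)"
proof -
  have bnd: "((\<E> w. X n w * Z w) - (\<E> w. Y w * Z w))\<^sup>2
      \<le> (\<E> w. (X n w - Y w)\<^sup>2) * (\<E> w. (Z w)\<^sup>2)" for n
    using square_integral_mult_le[OF sq_integrable_diff[OF X[of n] Y] Z] sq_integrable_mult[OF X[of n] Z] sq_integrable_mult[OF Y Z]
    by (simp add: left_diff_distrib)
  have up: "(\<lambda>n. (\<E> w. (X n w - Y w)\<^sup>2) * (\<E> w. (Z w)\<^sup>2)) \<longlonglongrightarrow> 0"
    using tendsto_mult[OF lim tendsto_const] by simp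
  have "(\<lambda>n. ((\<E> w. X n w * Z w) - (\<E> w. Y w * Z w))\<^sup>2) \<longlonglongrightarrow> 0"
    by (rule tendsto_sandwich[OF always_eventually always_eventually tendsto_const up]) (simp, use bnd in blast)
  then have "(\<lambda>n. sqrt (((\<E> w. X n w * Z w) - (\<E> w. Y w * Z w))\<^sup>2)) \<longlonglongrightarrow> sqrt 0"
    by (rule tendsto_real_sqrt)
  then show ?thesis by (simp add: tendsto_rabs_zero_iff LIM_zero_iff)
qed

text \<open>Integration by parts identifies the limits of \<open>D\<^sub>h p\<close> and \<open>D\<^sub>h q\<close> when tested against polynomials. This
test suffices because \<open>Q - Y k\<close> is itself a limit of polynomials: testing it against them bounds its norm by the
Cauchy modulus of \<open>Y\<close>.\<close>

theorem derivative_closable: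
  assumes F: "sq_integrable M F" and Q: "sq_integrable M Q"
    and pF: "(\<lambda>n. (\<E> w. (polyW (p n) w - F w)\<^sup>2)) \<longlonglongrightarrow> 0"
    and pQ: "(\<lambda>n. (\<E> w. (polyW (dpoly h (p n)) w - Q w)\<^sup>2)) \<longlonglongrightarrow> 0"
    and qF: "(\<lambda>n. (\<E> w. (polyW (q n) w - F w)\<^sup>2)) \<longlonglongrightarrow> 0"
    and cau: "\<And>\<epsilon>. \<epsilon> > 0 \<Longrightarrow> \<exists>K. \<forall>k\<ge>K. \<forall>l\<ge>K. (\<E> w. (polyW (dpoly h (q l)) w - polyW (dpoly h (q k)) w)\<^sup>2) \<le> \<epsilon>"
  shows "(\<lambda>n. (\<E> w. (polyW (dpoly h (q n)) w - Q w)\<^sup>2)) \<longlonglongrightarrow> 0"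
proof -
  note sqp = all_moments_sq_integrable[OF all_moments_polyW]
  note am = all_moments_intros all_moments_W all_moments_polyW
  define Y where "Y k = polyW (dpoly h (q k))" for k
  have Y: "sq_integrable M (Y k)" for k unfolding Y_def by (rule sqp)
  have weak: "(\<lambda>l. (\<E> w. Y l w * polyW r w)) \<longlonglongrightarrow> (\<E> w. Q w * polyW r w)" for r
  proof -
    define G where "G w = polyW r w * W h w - polyW (dpoly h r) w" for w
    have G: "sq_integrable M G" unfolding G_def by (intro all_moments_sq_integrable am)
    have 1: "(\<lambda>n. (\<E> w. polyW (dpoly h (p n)) w * polyW r w)) \<longlonglongrightarrow> (\<E> w. Q w * polyW r w)"
      by (rule expectation_mult_tendsto[OF sqp Q sqp pQ])
    have 2: "(\<lambda>n. (\<E> w. polyW (p n) w * G w)) \<longlonglongrightarrow> (\<E> w. F w * G w)"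
      by (rule expectation_mult_tendsto[OF sqp F G pF])
    have 3: "(\<lambda>n. (\<E> w. polyW (q n) w * G w)) \<longlonglongrightarrow> (\<E> w. F w * G w)"
      by (rule expectation_mult_tendsto[OF sqp F G qF])
    have "(\<E> w. Q w * polyW r w) = (\<E> w. F w * G w)"
      using LIMSEQ_unique[OF 1 2[unfolded G_def integration_by_parts[symmetric]]] by (simp only: G_def)
    then show ?thesis using 3 unfolding G_def integration_by_parts[symmetric] Y_def by simp
  qed
  have bound: "(\<E> w. (Y k w - Q w)\<^sup>2) \<le> \<epsilon>"
    if K: "\<forall>k\<ge>K. \<forall>l\<ge>K. (\<E> w. (Y l w - Y k w)\<^sup>2) \<le> \<epsilon>" and k: "k \<ge> K" for K k \<epsilon>
  proof -
    define V where "V w = Q w - Y k w" for w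
    have V: "sq_integrable M V" unfolding V_def by (rule sq_integrable_diff[OF Q Y])
    have test: "((\<E> w. V w * polyW r w))\<^sup>2 \<le> \<epsilon> * (\<E> w. (polyW r w)\<^sup>2)" for r
    proof -
      have "(\<lambda>l. ((\<E> w. Y l w * polyW r w) - (\<E> w. Y k w * polyW r w))\<^sup>2)
          \<longlonglongrightarrow> ((\<E> w. Q w * polyW r w) - (\<E> w. Y k w * polyW r w))\<^sup>2"
        by (intro tendsto_intros weak)
      moreover have "((\<E> w. Y l w * polyW r w) - (\<E> w. Y k w * polyW r w))\<^sup>2
          \<le> \<epsilon> * (\<E> w. (polyW r w)\<^sup>2)" if l: "l \<ge> K" for l
      proof -
        have "((\<E> w. Y l w * polyW r w) - (\<E> w. Y k w * polyW r w))\<^sup>2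
            = ((\<E> w. (Y l w - Y k w) * polyW r w))\<^sup>2"
          using sq_integrable_mult[OF Y sqp] by (simp add: left_diff_distrib)
        also have "\<dots> \<le> (\<E> w. (Y l w - Y k w)\<^sup>2) * (\<E> w. (polyW r w)\<^sup>2)"
          by (rule square_integral_mult_le[OF sq_integrable_diff[OF Y Y] sqp])
        also have "\<dots> \<le> \<epsilon> * (\<E> w. (polyW r w)\<^sup>2)"
          using K k l by (intro mult_right_mono) auto
        finally show ?thesis .
      qed
      ultimately have "((\<E> w. Q w * polyW r w) - (\<E> w. Y k w * polyW r w))\<^sup>2
          \<le> \<epsilon> * (\<E> w. (polyW r w)\<^sup>2)"
        by (intro LIMSEQ_le_const2) auto
      then show ?thesis
        using sq_integrable_mult[OF Q sqp[of r]] sq_integrable_mult[OF Y sqp[of r]] by (simp add: V_def left_diff_distrib)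
    qed
    \<comment> \<open>polynomials that converge to \<open>V\<close>, so that \<open>V\<close> may be tested against itself\<close>
    define r where "r n = dpoly h (p n) @ map (\<lambda>(b, xs). (- 1 * b, xs)) (dpoly h (q k))" for n
    have r: "polyW (r n) w = polyW (dpoly h (p n)) w - Y k w" for n w
      unfolding r_def polyW_simps polyW_scale by (simp add: Y_def)
    have rV: "(\<lambda>n. (\<E> w. (polyW (r n) w - V w)\<^sup>2)) \<longlonglongrightarrow> 0"
      using pQ by (simp add: r V_def)
    define v where "v = (\<E> w. (V w)\<^sup>2)"
    have l1: "(\<lambda>n. (\<E> w. polyW (r n) w * V w)) \<longlonglongrightarrow> v"
      using expectation_mult_tendsto[OF sqp V V rV] by (simp add: v_def power2_eq_square)
    have l2: "(\<lambda>n. (\<E> w. (polyW (r n) w)\<^sup>2)) \<longlonglongrightarrow> v"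
    proof -
      have "(\<E> w. (polyW (r n) w)\<^sup>2)
          = (\<E> w. (polyW (r n) w - V w)\<^sup>2) + 2 * (\<E> w. polyW (r n) w * V w) - v" for n
      proof -
        note i = sq_integrable_mult[OF sqp[of "r n"] V] sqp[of "r n"] V sq_integrable_diff[OF sqp[of "r n"] V]
        have "(\<E> w. (polyW (r n) w)\<^sup>2)
          = (\<E> w. (polyW (r n) w - V w)\<^sup>2 + 2 * (polyW (r n) w * V w) - (V w)\<^sup>2)"
          by (intro integral_cong refl) (simp add: power2_eq_square algebra_simps)
        also have "\<dots> = (\<E> w. (polyW (r n) w - V w)\<^sup>2) + 2 * (\<E> w. polyW (r n) w * V w) - v"
          using i by (simp add: v_def sq_integrable_def)
        finally show ?thesis .
      qed
      moreover have "(\<lambda>n. (\<E> w. (polyW (r n) w - V w)\<^sup>2) + 2 * (\<E> w. polyW (r n) w * V w) - v) \<longlonglongrightarrow> 0 + 2 * v - v"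
        by (intro tendsto_intros rV l1)
      ultimately show ?thesis by simp
    qed
    have "(\<lambda>n. ((\<E> w. polyW (r n) w * V w))\<^sup>2) \<longlonglongrightarrow> v\<^sup>2" by (intro tendsto_intros l1)
    moreover have "(\<lambda>n. \<epsilon> * (\<E> w. (polyW (r n) w)\<^sup>2)) \<longlonglongrightarrow> \<epsilon> * v" by (intro tendsto_intros l2)
    ultimately have "v\<^sup>2 \<le> \<epsilon> * v"
      by (rule LIMSEQ_le) (use test in \<open>auto simp: mult.commute[of "V _"]\<close>)
    moreover have "0 \<le> v" by (simp add: v_def)
    moreover have "0 \<le> \<epsilon>"
    proof -
      have "0 \<le> (\<E> w. (Y k w - Y k w)\<^sup>2)" by simp
      then show ?thesis using K k by force
    qed
    ultimately have "v \<le> \<epsilon>" by (cases "v = 0") (auto simp: power2_eq_square)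
    then show ?thesis by (simp add: v_def V_def power2_commute)
  qed
  show ?thesis
    unfolding Y_def[symmetric]
  proof (rule LIMSEQ_I)
    fix \<epsilon> :: real assume "0 < \<epsilon>"
    then obtain K where K: "\<forall>k\<ge>K. \<forall>l\<ge>K. (\<E> w. (Y l w - Y k w)\<^sup>2) \<le> \<epsilon> / 2"
      using cau[of "\<epsilon> / 2"] unfolding Y_def by auto
    have "norm ((\<E> w. (Y k w - Q w)\<^sup>2) - 0) < \<epsilon>" if "k \<ge> K" for k
      using bound[OF K that] \<open>0 < \<epsilon>\<close> by simp
    then show "\<exists>no. \<forall>n\<ge>no. norm ((\<E> w. (Y n w - Q w)\<^sup>2) - 0) < \<epsilon>" by blast
  qed
qed

end

section \<open>Nondegeneracy of the quadratic forms\<close>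

lemma integrable_unit_indicator [simp]: "integrable lborel (indicator {0..1} :: real \<Rightarrow> real)"
  by (rule integrable_real_indicator) auto

lemma pos_pow_measurable [measurable]: "pos_pow b \<in> borel_measurable borel"
  unfolding pos_pow_def[abs_def] by measurable

lemma pos_pow_nonneg [simp]: "0 \<le> pos_pow b x"
  by (simp add: pos_pow_def)

text \<open>The fractional integral of a truncated power is a truncated linear function; this is what makes
triangles available in the range.\<close>

lemma pos_pow_beta_integral:
  assumes b: "0 < b" "b < 1"
  shows "integrable lborel (\<lambda>y. pos_pow b (s - y) * (max 0 (y - r)) powr b)"
    and "(\<integral>y. pos_pow b (s - y) * (max 0 (y - r)) powr b \<partial>lborel) = max 0 (s - r) * Beta (1 + b) (1 - b)"
proof -
  define f where "f y = pos_pow b (s - y) * (max 0 (y - r)) powr b" for y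
  define g where "g t = indicator {0..1} t * (t powr b * (1 - t) powr (- b))" for t :: real
  have "integrable lborel f \<and> (\<integral>y. f y \<partial>lborel) = max 0 (s - r) * Beta (1 + b) (1 - b)"
  proof (cases "s \<le> r")
    case True
    then have "f = (\<lambda>_. 0)" by (intro ext) (auto simp: f_def pos_pow_def)
    then show ?thesis using True by simp
  next
    case False
    have g: "integrable lborel g"
      using integrable_Beta[of "1 + b" "1 - b"] b by (simp add: g_def[abs_def] set_integrable_def)
    have "set_lebesgue_integral lborel {0..1} (\<lambda>t. t powr b * (1 - t) powr (- b)) = Beta (1 + b) (1 - b)"
      using set_borel_integral_eq_integral(2)[of "{0..1}" "\<lambda>t. t powr (1 + b - 1) * (1 - t) powr (1 - b - 1)"]
        integrable_Beta[of "1 + b" "1 - b"] has_integral_Beta_real[of "1 + b" "1 - b"] b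
      by (simp add: integral_unique)
    then have gi: "(\<integral>t. g t \<partial>lborel) = Beta (1 + b) (1 - b)"
      by (simp add: g_def[abs_def] set_lebesgue_integral_def)
    have fg: "f (r + (s - r) * t) = g t" for t
    proof (cases "0 < t \<and> t < 1")
      case True
      have e1: "s - (r + (s - r) * t) = (s - r) * (1 - t)" by (simp add: algebra_simps)
      have p: "0 < (s - r) * (1 - t)" "0 < (s - r) * t" using True False by auto
      have c1: "(s - r) powr (- b) * (s - r) powr b = 1" using False by (simp add: powr_add[symmetric])
      have "f (r + (s - r) * t) = ((s - r) * (1 - t)) powr (- b) * ((s - r) * t) powr b"
        unfolding f_def e1 using p by (simp add: pos_pow_def)
      also have "\<dots> = ((s - r) powr (- b) * (s - r) powr b) * (t powr b * (1 - t) powr (- b))"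
        using True False by (simp add: powr_mult)
      also have "\<dots> = g t" unfolding c1 using True by (simp add: g_def)
      finally show ?thesis .
    next
      case F: False
      have e1: "s - (r + (s - r) * t) = (s - r) * (1 - t)" by (simp add: algebra_simps)
      consider "t < 0" | "t = 0" | "t = 1" | "t > 1" using F by linarith
      then show ?thesis
      proof cases
        case 1
        then have "(s - r) * t < 0" using False by (simp add: mult_pos_neg)
        then show ?thesis using 1 by (simp add: f_def g_def max_def)
      next
        case 4
        then have "(s - r) * (1 - t) < 0" using False by (simp add: mult_pos_neg)
        then show ?thesis using 4 by (simp add: f_def g_def pos_pow_def e1)
      qed (auto simp: f_def g_def pos_pow_def)
    qed
    have "integrable lborel f"
      using lborel_integrable_real_affine_iff[of "s - r" f r] g False unfolding fg by simp
    moreover have "(\<integral>y. f y \<partial>lborel) = \<bar>s - r\<bar> *\<^sub>R (\<integral>t. g t \<partial>lborel)"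
      using lborel_integral_real_affine[of "s - r" f r] False unfolding fg by simp
    ultimately show ?thesis using False gi by simp
  qed
  then show "integrable lborel (\<lambda>y. pos_pow b (s - y) * (max 0 (y - r)) powr b)"
    "(\<integral>y. pos_pow b (s - y) * (max 0 (y - r)) powr b \<partial>lborel) = max 0 (s - r) * Beta (1 + b) (1 - b)"
    by (simp_all add: f_def[abs_def])
qed

lemma pos_pow_beta_integral_mirror:
  assumes b: "0 < b" "b < 1"
  shows "integrable lborel (\<lambda>s. pos_pow b (s - r) * (max 0 (x - s)) powr b)"
    and "(\<integral>s. pos_pow b (s - r) * (max 0 (x - s)) powr b \<partial>lborel) = max 0 (x - r) * Beta (1 + b) (1 - b)"
proof -
  define f where "f s = pos_pow b (s - r) * (max 0 (x - s)) powr b" for s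
  have e: "f (0 + (-1) * y) = pos_pow b (- r - y) * (max 0 (y - - x)) powr b" for y
  proof -
    have 1: "0 + (-1) * y - r = - r - y" "x - (0 + (-1) * y) = y - - x" by auto
    show ?thesis unfolding f_def 1 ..
  qed
  show "integrable lborel (\<lambda>s. pos_pow b (s - r) * (max 0 (x - s)) powr b)"
    using lborel_integrable_real_affine_iff[of "-1" f 0] pos_pow_beta_integral(1)[OF b, of "- r" "- x"]
    unfolding e by (simp add: f_def[abs_def])
  show "(\<integral>s. pos_pow b (s - r) * (max 0 (x - s)) powr b \<partial>lborel) = max 0 (x - r) * Beta (1 + b) (1 - b)"
    using lborel_integral_real_affine[of "-1" f 0] pos_pow_beta_integral(2)[OF b, of "- r" "- x"]
    unfolding e by (simp add: f_def[abs_def] algebra_simps)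
qed

lemma pos_pow_integrable_atMost:
  assumes b: "0 < b" "b < 1"
  shows "integrable lborel (\<lambda>v. indicator {..c} v * pos_pow b v)"
proof -
  have "integrable lborel (\<lambda>v. pos_pow b (v - 0) * (max 0 ((\<bar>c\<bar> + 1) - v)) powr b)"
    by (rule pos_pow_beta_integral_mirror(1)[OF b])
  then show ?thesis
  proof (rule integrable_bound)
    show "AE v in lborel. norm (indicator {..c} v * pos_pow b v) \<le> norm (pos_pow b (v - 0) * (max 0 ((\<bar>c\<bar> + 1) - v)) powr b)"
    proof (rule AE_I2)
      fix v :: real
      have "1 \<le> (max 0 ((\<bar>c\<bar> + 1) - v)) powr b" if "v \<le> c"
        using that b by (intro ge_one_powr_ge_zero) auto
      then show "norm (indicator {..c} v * pos_pow b v) \<le> norm (pos_pow b (v - 0) * (max 0 ((\<bar>c\<bar> + 1) - v)) powr b)"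
        using mult_left_mono[of 1 "(max 0 ((\<bar>c\<bar> + 1) - v)) powr b" "pos_pow b v"]
        by (cases "v \<le> c") (auto simp: abs_mult)
    qed
  qed measurable
qed

lemma pos_pow_section_integrable:
  assumes b: "0 < b" "b < 1"
  shows "integrable lborel (\<lambda>s. indicator {0..1} s * pos_pow b (s - y))"
    and "integrable lborel (\<lambda>z. indicator {0..1} z * pos_pow b (s - z))"
proof -
  have "integrable lborel (\<lambda>s. indicator {..1 - y} (- y + 1 * s) * pos_pow b (- y + 1 * s))"
    using lborel_integrable_real_affine[OF pos_pow_integrable_atMost[OF b, of "1 - y"], of 1 "- y"] by simp
  then show "integrable lborel (\<lambda>s. indicator {0..1} s * pos_pow b (s - y))"
    by (rule integrable_bound) (auto simp: indicator_def)
  have "integrable lborel (\<lambda>z. indicator {..s} (s + (-1) * z) * pos_pow b (s + (-1) * z))"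
    using lborel_integrable_real_affine[OF pos_pow_integrable_atMost[OF b, of s], of "-1" s] by simp
  then show "integrable lborel (\<lambda>z. indicator {0..1} z * pos_pow b (s - z))"
    by (rule integrable_bound) (auto simp: indicator_def)
qed

definition unit_mass :: "real \<Rightarrow> real" where
  "unit_mass b = (\<integral>v. indicator {..1} v * pos_pow b v \<partial>lborel)"

lemma pos_pow_section_mass:
  assumes b: "0 < b" "b < 1" and s: "s \<le> 1"
  shows "(\<integral>z. indicator {0..1} z * pos_pow b (s - z) \<partial>lborel) \<le> unit_mass b"
proof -
  have i: "integrable lborel (\<lambda>z. indicator {..1} (s + (-1) * z) * pos_pow b (s + (-1) * z))"
    using lborel_integrable_real_affine[OF pos_pow_integrable_atMost[OF b, of 1], of "-1" s] by simp
  have "unit_mass b = (\<integral>z. indicator {..1} (s + (-1) * z) * pos_pow b (s + (-1) * z) \<partial>lborel)"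
    unfolding unit_mass_def using lborel_integral_real_affine[of "-1" "\<lambda>v. indicator {..1} v * pos_pow b v" s] by simp
  moreover have "(\<integral>z. indicator {0..1} z * pos_pow b (s - z) \<partial>lborel)
      \<le> (\<integral>z. indicator {..1} (s + (-1) * z) * pos_pow b (s + (-1) * z) \<partial>lborel)"
    by (rule integral_mono[OF pos_pow_section_integrable(2)[OF b] i]) (use s in \<open>auto simp: indicator_def\<close>)
  ultimately show ?thesis by simp
qed

text \<open>Two fractional integrations against \<open>g1\<close> and \<open>g2\<close> may be interchanged.\<close>

lemma pos_pow_fubini:
  assumes b: "0 < b" "b < 1"
    and g1: "integrable lborel g1" "\<And>s. g1 s \<noteq> 0 \<Longrightarrow> s \<le> 1"
    and g2 [measurable]: "g2 \<in> borel_measurable borel" and C: "\<And>z. \<bar>g2 z\<bar> \<le> C * indicator {0..1} z"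
  shows "(\<integral>z. (\<integral>s. g1 s * pos_pow b (s - z) \<partial>lborel) * g2 z \<partial>lborel)
      = (\<integral>s. g1 s * (\<integral>z. pos_pow b (s - z) * g2 z \<partial>lborel) \<partial>lborel)"
proof -
  have [measurable]: "g1 \<in> borel_measurable borel" using g1 by (simp add: borel_measurable_integrable)
  have C0: "0 \<le> C" using C[of 0] by (simp add: order_trans[OF abs_ge_zero])
  define G where "G s z = g1 s * pos_pow b (s - z) * g2 z" for s z
  have Gm [measurable]: "(\<lambda>(s, z). G s z) \<in> borel_measurable (lborel \<Otimes>\<^sub>M lborel)" unfolding G_def by measurable
  have nG: "norm (G s z) \<le> norm (C * \<bar>g1 s\<bar> * (indicator {0..1} z * pos_pow b (s - z)))" for s z
  proof -
    have "norm (G s z) = \<bar>g1 s\<bar> * pos_pow b (s - z) * \<bar>g2 z\<bar>" by (simp add: G_def abs_mult)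
    also have "\<dots> \<le> \<bar>g1 s\<bar> * pos_pow b (s - z) * (C * indicator {0..1} z)"
      by (intro mult_left_mono C) auto
    finally show ?thesis using C0 by (simp add: mult_ac abs_mult)
  qed
  have Gi: "integrable lborel (\<lambda>z. G s z)" for s
    by (rule integrable_bound[OF integrable_mult_right[OF pos_pow_section_integrable(2)[OF b, of s], of "C * \<bar>g1 s\<bar>"]])
       (use nG in \<open>auto simp: G_def\<close>)
  have bnd: "(\<integral>z. norm (G s z) \<partial>lborel) \<le> \<bar>g1 s\<bar> * (C * unit_mass b)" for s
  proof (cases "s \<le> 1")
    case True
    have "(\<integral>z. norm (G s z) \<partial>lborel) \<le> (\<integral>z. C * \<bar>g1 s\<bar> * (indicator {0..1} z * pos_pow b (s - z)) \<partial>lborel)"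
      by (rule integral_mono[OF integrable_norm[OF Gi] integrable_mult_right[OF pos_pow_section_integrable(2)[OF b]]])
         (use nG C0 in \<open>simp add: abs_mult\<close>)
    also have "\<dots> = C * \<bar>g1 s\<bar> * (\<integral>z. indicator {0..1} z * pos_pow b (s - z) \<partial>lborel)" by simp
    also have "\<dots> \<le> C * \<bar>g1 s\<bar> * unit_mass b"
      using pos_pow_section_mass[OF b True] C0 by (intro mult_left_mono) auto
    finally show ?thesis by (simp add: mult_ac)
  next
    case False
    then have "g1 s = 0" using g1(2) by blast
    then show ?thesis by (simp add: G_def)
  qed
  have "integrable (lborel \<Otimes>\<^sub>M lborel) (\<lambda>(s, z). G s z)"
  proof (rule lborel_pair.Fubini_integrable[OF Gm])
    have "integrable lborel (\<lambda>s. \<bar>g1 s\<bar> * (C * unit_mass b))" using g1 by auto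
    then show "integrable lborel (\<lambda>s. \<integral>z. norm (case (s, z) of (s, z) \<Rightarrow> G s z) \<partial>lborel)"
    proof (rule integrable_bound)
      show "AE s in lborel. norm (\<integral>z. norm (case (s, z) of (s, z) \<Rightarrow> G s z) \<partial>lborel) \<le> norm (\<bar>g1 s\<bar> * (C * unit_mass b))"
      proof (rule AE_I2)
        fix s
        have "0 \<le> (\<integral>z. norm (G s z) \<partial>lborel)" by simp
        then show "norm (\<integral>z. norm (case (s, z) of (s, z) \<Rightarrow> G s z) \<partial>lborel) \<le> norm (\<bar>g1 s\<bar> * (C * unit_mass b))"
          using bnd[of s] by simp
      qed
    qed measurable
    show "AE s in lborel. integrable lborel (\<lambda>z. case (s, z) of (s, z) \<Rightarrow> G s z)" using Gi by simp
  qed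
  then have "(\<integral>z. (\<integral>s. G s z \<partial>lborel) \<partial>lborel) = (\<integral>s. (\<integral>z. G s z \<partial>lborel) \<partial>lborel)"
    by (rule lborel_pair.Fubini_integral)
  moreover have "(\<integral>s. G s z \<partial>lborel) = (\<integral>s. g1 s * pos_pow b (s - z) \<partial>lborel) * g2 z" for z
    unfolding G_def by (rule integral_mult_left_zero)
  moreover have "(\<integral>z. G s z \<partial>lborel) = g1 s * (\<integral>z. pos_pow b (s - z) * g2 z \<partial>lborel)" for s
    unfolding G_def mult.assoc by (rule integral_mult_right_zero)
  ultimately show ?thesis by (simp only:)
qed

text \<open>A class of functions that contains the test functions and is closed under linear combinations.\<close>

definition admissible :: "(real \<Rightarrow> real) \<Rightarrow> bool" where
  "admissible h \<longleftrightarrow> continuous_on UNIV h \<and> (\<forall>r. h r \<noteq> 0 \<longrightarrow> 0 < r \<and> r < 1)"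

lemma test_function_admissible: "test_function h \<Longrightarrow> admissible h"
proof -
  assume h: "test_function h"
  then have "(deriv ^^ 0) h differentiable_on UNIV" unfolding test_function_def by blast
  then have "continuous_on UNIV h" by (simp add: differentiable_imp_continuous_on)
  moreover have "0 < r \<and> r < 1" if "h r \<noteq> 0" for r
  proof -
    have "r \<in> closure {x. h x \<noteq> 0}" using that closure_subset[of "{x. h x \<noteq> 0}"] by auto
    then show ?thesis using h unfolding test_function_def by auto
  qed
  ultimately show ?thesis by (simp add: admissible_def)
qed

lemma admissible_sum: "(\<And>i. i \<in> I \<Longrightarrow> admissible (h i)) \<Longrightarrow> admissible (\<lambda>r. \<Sum>i\<in>I. u i * h i r)"
  unfolding admissible_def
proof (intro conjI allI impI)
  assume h: "\<And>i. i \<in> I \<Longrightarrow> continuous_on UNIV (h i) \<and> (\<forall>r. h i r \<noteq> 0 \<longrightarrow> 0 < r \<and> r < 1)"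
  show "continuous_on UNIV (\<lambda>r. \<Sum>i\<in>I. u i * h i r)" using h by (intro continuous_intros) auto
  fix r assume "(\<Sum>i\<in>I. u i * h i r) \<noteq> 0"
  then obtain i where "i \<in> I" "u i * h i r \<noteq> 0" by (meson sum.neutral)
  then show "0 < r" "r < 1" using h[of i] by auto
qed

lemma admissible_bound:
  assumes "admissible h"
  shows "\<exists>C. \<forall>r. \<bar>h r\<bar> \<le> C * indicator {0..1} r"
proof -
  have "compact (h ` {0..1})"
    using assms by (intro compact_continuous_image) (auto simp: admissible_def intro: continuous_on_subset)
  then have "bounded (h ` {0..1})" by (rule compact_imp_bounded)
  then obtain C where C': "\<forall>x\<in>h ` {0..1}. norm x \<le> C" unfolding bounded_iff by blast
  then have C: "\<bar>h r\<bar> \<le> C" if "r \<in> {0..1}" for r using that by auto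
  have "\<bar>h r\<bar> \<le> C * indicator {0..1} r" for r
    using C[of r] assms by (cases "r \<in> {0..1}") (auto simp: admissible_def)
  then show ?thesis by blast
qed

lemma admissible_measurable [measurable_dest]: "admissible h \<Longrightarrow> h \<in> borel_measurable borel"
  by (simp add: admissible_def borel_measurable_continuous_onI)

lemma unit_bounded_sq_integrable:
  fixes f :: "real \<Rightarrow> real"
  assumes f: "f \<in> borel_measurable borel" and C: "\<And>z. \<bar>f z\<bar> \<le> C * indicator {0..1} z"
  shows "sq_integrable lborel f"
proof -
  have "integrable lborel (\<lambda>r::real. C\<^sup>2 * indicator {0..1} r)" by simp
  then have "integrable lborel (\<lambda>r. (f r)\<^sup>2)"
  proof (rule integrable_bound)
    have "(f r)\<^sup>2 \<le> C\<^sup>2 * indicator {0..1} r" for r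
      using power_mono[OF C[of r], of 2] by (cases "r \<in> {0..1}") auto
    then show "AE r in lborel. norm ((f r)\<^sup>2) \<le> norm (C\<^sup>2 * indicator {0..1} r :: real)"
      by (intro AE_I2) (simp add: abs_mult)
  qed (use f in measurable)
  then show ?thesis using f by (simp add: sq_integrable_def)
qed

lemma admissible_sq_integrable:
  assumes h: "admissible h" shows "sq_integrable lborel h"
proof -
  obtain C where "\<And>r. \<bar>h r\<bar> \<le> C * indicator {0..1} r" using admissible_bound[OF h] by blast
  then show ?thesis by (rule unit_bounded_sq_integrable[OF admissible_measurable[OF h]])
qed

lemma hermite_beta_bounds: "1/2 < H \<Longrightarrow> H < 1 \<Longrightarrow> 0 < hermite_beta H \<and> hermite_beta H < 1"
  by (simp add: hermite_beta_def hermite_alpha_def hermite_H0_def field_simps)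

lemma a_fun_eq:
  assumes "admissible h"
  shows "a_fun H h s = (\<integral>r. pos_pow (hermite_beta H) (s - r) * h r \<partial>lborel)"
  unfolding a_fun_def set_lebesgue_integral_def
proof (intro integral_cong refl)
  fix r
  show "indicator {0..s} r *\<^sub>R (h r * (s - r) powr (- hermite_beta H)) = pos_pow (hermite_beta H) (s - r) * h r"
    using assms by (cases "h r = 0") (auto simp: admissible_def pos_pow_def indicator_def)
qed

lemma a_fun_measurable [measurable]:
  assumes "admissible h" shows "a_fun H h \<in> borel_measurable borel"
proof -
  have [measurable]: "h \<in> borel_measurable borel" using assms by (rule admissible_measurable)
  have "(\<lambda>s. \<integral>r. pos_pow (hermite_beta H) (s - r) * h r \<partial>lborel) \<in> borel_measurable borel" by measurable
  then show ?thesis using a_fun_eq[OF assms] by (simp cong: measurable_cong)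
qed

lemma a_fun_shift:
  assumes h: "admissible h" and s: "s \<le> 1"
  shows "a_fun H h s = (\<integral>v. indicator {..1} v * pos_pow (hermite_beta H) v * h (s - v) \<partial>lborel)"
proof -
  have "a_fun H h s = (\<integral>v. pos_pow (hermite_beta H) (s - (s + (-1) * v)) * h (s + (-1) * v) \<partial>lborel)"
    unfolding a_fun_eq[OF h]
    using lborel_integral_real_affine[of "-1" "\<lambda>r. pos_pow (hermite_beta H) (s - r) * h r" s] by simp
  also have "\<dots> = (\<integral>v. indicator {..1} v * pos_pow (hermite_beta H) v * h (s - v) \<partial>lborel)"
  proof (intro integral_cong refl)
    fix v
    have "v \<le> 1" if "h (s - v) \<noteq> 0"
    proof -
      have "0 < s - v" using h that unfolding admissible_def by blast
      then show ?thesis using s by linarith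
    qed
    then show "pos_pow (hermite_beta H) (s - (s + (-1) * v)) * h (s + (-1) * v)
        = indicator {..1} v * pos_pow (hermite_beta H) v * h (s - v)"
      by (cases "h (s - v) = 0") (auto simp: indicator_def)
  qed
  finally show ?thesis .
qed

text \<open>After the substitution \<open>v = s - r\<close> the singularity no longer depends on \<open>s\<close>, and dominated convergence applies.\<close>

lemma a_fun_bounded_continuous:
  assumes h: "admissible h" and H: "1/2 < H" "H < 1"
  shows "continuous_on {..1} (a_fun H h)" and "\<exists>C. \<forall>s\<le>1. \<bar>a_fun H h s\<bar> \<le> C"
proof -
  let ?b = "hermite_beta H"
  have b: "0 < ?b" "?b < 1" using hermite_beta_bounds[OF H] by auto
  have [measurable]: "h \<in> borel_measurable borel" using h by (rule admissible_measurable)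
  have hc: "continuous_on UNIV h" using h by (simp add: admissible_def)
  obtain C where C: "\<And>r. \<bar>h r\<bar> \<le> C * indicator {0..1} r" using admissible_bound[OF h] by blast
  have C0: "0 \<le> C" using C[of 0] by (simp add: order_trans[OF abs_ge_zero])
  have C1: "\<bar>h r\<bar> \<le> C" for r using C[of r] C0 by (cases "r \<in> {0..1}") auto
  have wi: "integrable lborel (\<lambda>v. (indicator {..1} v * pos_pow ?b v) * C)"
    using pos_pow_integrable_atMost[OF b, of 1] by simp
  have bd: "norm (indicator {..1} v * pos_pow ?b v * h r) \<le> (indicator {..1} v * pos_pow ?b v) * C" for v r
    by (simp add: abs_mult C1 mult_left_mono)
  show "continuous_on {..1} (a_fun H h)"
    unfolding continuous_on_sequentially comp_def
  proof (intro allI ballI impI, elim conjE)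
    fix x :: "nat \<Rightarrow> real" and s assume s: "s \<in> {..1}" and x1: "\<forall>n. x n \<in> {..1}" and x: "x \<longlonglongrightarrow> s"
    have "(\<lambda>n. \<integral>v. indicator {..1} v * pos_pow ?b v * h (x n - v) \<partial>lborel)
        \<longlonglongrightarrow> (\<integral>v. indicator {..1} v * pos_pow ?b v * h (s - v) \<partial>lborel)"
    proof (rule integral_dominated_convergence[where w = "\<lambda>v. (indicator {..1} v * pos_pow ?b v) * C"])
      show "AE v in lborel. (\<lambda>n. indicator {..1} v * pos_pow ?b v * h (x n - v)) \<longlonglongrightarrow> indicator {..1} v * pos_pow ?b v * h (s - v)"
      proof (rule AE_I2)
        fix v
        have "(\<lambda>n. h (x n - v)) \<longlonglongrightarrow> h (s - v)"
          by (rule continuous_on_tendsto_compose[OF hc]) (auto intro!: tendsto_intros x)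
        then show "(\<lambda>n. indicator {..1} v * pos_pow ?b v * h (x n - v)) \<longlonglongrightarrow> indicator {..1} v * pos_pow ?b v * h (s - v)"
          by (intro tendsto_intros)
      qed
    qed (use wi bd in auto)
    then show "(\<lambda>n. a_fun H h (x n)) \<longlonglongrightarrow> a_fun H h s"
      using a_fun_shift[OF h] x1 s by simp
  qed
  have "\<bar>a_fun H h s\<bar> \<le> (\<integral>v. (indicator {..1} v * pos_pow ?b v) * C \<partial>lborel)" if "s \<le> 1" for s
  proof -
    have "\<bar>a_fun H h s\<bar> \<le> (\<integral>v. norm (indicator {..1} v * pos_pow ?b v * h (s - v)) \<partial>lborel)"
      unfolding a_fun_shift[OF h that] real_norm_def[symmetric] by (rule integral_norm_bound)
    also have "\<dots> \<le> (\<integral>v. (indicator {..1} v * pos_pow ?b v) * C \<partial>lborel)"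
    proof (rule integral_mono[OF integrable_norm wi bd])
      show "integrable lborel (\<lambda>v. indicator {..1} v * pos_pow ?b v * h (s - v))"
        by (rule integrable_bound[OF wi])
           (use bd in \<open>auto intro!: AE_I2 order_trans[OF _ abs_ge_self]\<close>)
    qed
    finally show ?thesis .
  qed
  then show "\<exists>C. \<forall>s\<le>1. \<bar>a_fun H h s\<bar> \<le> C" by blast
qed

text \<open>A triangle of height and half width \<open>w\<close> around \<open>x\<close>: a second difference of truncated linear functions.\<close>

definition tri :: "real \<Rightarrow> real \<Rightarrow> real \<Rightarrow> real" where
  "tri w x r = max 0 (w - \<bar>r - x\<bar>)"

lemma tri_eq: "0 < w \<Longrightarrow> tri w x r = max 0 (r - (x - w)) - 2 * max 0 (r - x) + max 0 (r - (x + w))"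
  by (auto simp: tri_def max_def abs_if)

lemma tri_eq_mirror: "0 < w \<Longrightarrow> tri w x r = max 0 (x - w - r) - 2 * max 0 (x - r) + max 0 (x + w - r)"
  by (auto simp: tri_def max_def abs_if)

lemma tri_integral_nonzero:
  fixes g :: "real \<Rightarrow> real"
  assumes g: "continuous_on {p..q} g" and "p < q" and nn: "\<And>s. s \<in> {p..q} \<Longrightarrow> 0 \<le> g s"
    and supp: "\<And>s. s \<notin> {p..q} \<Longrightarrow> g s = 0" and x: "x \<in> {p..q}" "g x \<noteq> 0"
  shows "(\<integral>s. g s \<partial>lborel) \<noteq> 0"
proof -
  have int: "set_integrable lborel {p..q} g" using borel_integrable_atLeastAtMost'[OF g] .
  have eq: "(\<integral>s. g s \<partial>lborel) = (LINT s:{p..q}|lborel. g s)"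
    unfolding set_lebesgue_integral_def using supp
    by (intro integral_cong refl) (auto simp: indicator_def)
  have "integral {p..q} g \<noteq> 0"
  proof
    assume "integral {p..q} g = 0"
    then have "\<forall>s\<in>{p..q}. g s = 0"
      using integral_eq_0_iff[of p q g] g \<open>p < q\<close> nn by auto
    then show False using x by auto
  qed
  then show ?thesis unfolding eq using set_borel_integral_eq_integral(2)[OF int] by simp
qed

lemma sign_interval:
  fixes g :: "real \<Rightarrow> real"
  assumes g: "continuous_on {0<..<1} g" and s: "0 < s" "s < 1" "g s \<noteq> 0"
  shows "\<exists>p q. 0 < p \<and> p < q \<and> q < 1 \<and> (\<forall>r\<in>{p..q}. 0 < sgn (g s) * g r)"
proof -
  have c: "continuous (at s) (\<lambda>r. sgn (g s) * g r)"
    using g s by (intro continuous_intros) (simp add: continuous_on_eq_continuous_at)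
  have "0 < sgn (g s) * g s" using s by (simp add: sgn_if)
  then have "\<forall>\<^sub>F r in at s. 0 < sgn (g s) * g r"
    using c unfolding continuous_at by (rule order_tendstoD(1)[rotated])
  then obtain d where d: "d > 0" "\<And>r. r \<noteq> s \<Longrightarrow> dist r s < d \<Longrightarrow> 0 < sgn (g s) * g r"
    unfolding eventually_at by auto
  have d': "0 < sgn (g s) * g r" if "dist r s < d" for r
    using d(2)[of r] that \<open>0 < sgn (g s) * g s\<close> by (cases "r = s") auto
  define e where "e = min (d/2) (min (s/2) ((1 - s)/2))"
  have "e \<le> d / 2" "e \<le> s / 2" "e \<le> (1 - s) / 2" unfolding e_def by linarith+
  moreover have "0 < e" using d s by (simp add: e_def)
  moreover have "(1 - s) / 2 < 1 - s" using s by (simp add: field_simps)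
  ultimately have e: "0 < e" "e < d" "e < s" "e < 1 - s" using d(1) s(1) by linarith+
  show ?thesis
    by (rule exI[of _ "s - e"], rule exI[of _ "s + e"]) (use e d' in \<open>auto simp: dist_real_def abs_less_iff\<close>)
qed

text \<open>If \<open>a\<^sub>h\<close> vanished, integrating it against truncated powers would show, by duality, that \<open>h\<close> is orthogonal to
all truncated linear functions, hence to all triangles; a triangle on which \<open>h\<close> keeps its sign contradicts this.\<close>

lemma a_fun_nonzero:
  assumes h: "admissible h" "h r0 \<noteq> 0" and H: "1/2 < H" "H < 1"
  shows "\<exists>s. 0 < s \<and> s < 1 \<and> a_fun H h s \<noteq> 0"
proof (rule ccontr)
  let ?b = "hermite_beta H"
  have b: "0 < ?b" "?b < 1" using hermite_beta_bounds[OF H] by auto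
  assume "\<not> ?thesis"
  then have a0: "a_fun H h s = 0" if "0 < s" "s < 1" for s using that by blast
  have [measurable]: "h \<in> borel_measurable borel" using h by (intro admissible_measurable)
  have am [measurable]: "a_fun H h \<in> borel_measurable borel" using h(1) by (rule a_fun_measurable)
  obtain C where C: "\<And>r. \<bar>h r\<bar> \<le> C * indicator {0..1} r" using admissible_bound[OF h(1)] by blast
  have aneg: "a_fun H h s = 0" if "s \<le> 0" for s
  proof -
    have "pos_pow ?b (s - r) * h r = 0" for r
      using h(1) that by (cases "h r = 0") (auto simp: admissible_def pos_pow_def)
    then show ?thesis unfolding a_fun_eq[OF h(1)] by (simp only: integral_zero)
  qed
  have B: "Beta (1 + ?b) (1 - ?b) > 0" using b by (simp add: Beta_def Gamma_real_pos)
  have hi: "integrable lborel (\<lambda>r. h r * max 0 (x - r))" for x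
  proof -
    have "integrable lborel (\<lambda>r::real. C * \<bar>x\<bar> * indicator {0..1} r :: real)" by simp
    then show ?thesis
    proof (rule integrable_bound)
      show "AE r in lborel. norm (h r * max 0 (x - r)) \<le> norm (C * \<bar>x\<bar> * indicator {0..1} r :: real)"
      proof (rule AE_I2)
        fix r
        have "\<bar>h r\<bar> * max 0 (x - r) \<le> (C * indicator {0..1} r) * \<bar>x\<bar>"
        proof (cases "r \<in> {0..1}")
          case True
          then show ?thesis by (intro mult_mono C) (use C[of r] in auto)
        next
          case False
          then have "h r = 0" using C[of r] by simp
          then show ?thesis using False by simp
        qed
        then show "norm (h r * max 0 (x - r)) \<le> norm (C * \<bar>x\<bar> * indicator {0..1} r :: real)"
          using C[of 0] by (simp add: abs_mult mult_ac)
      qed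
    qed measurable
  qed
  have psi: "(\<integral>r. h r * max 0 (x - r) \<partial>lborel) = 0" if x: "x \<le> 1" for x
  proof -
    define g1 where "g1 s = indicator {0..1} s * (max 0 (x - s)) powr ?b" for s
    have g1i: "integrable lborel g1"
    proof (rule integrable_bound[of _ "\<lambda>s. \<bar>x\<bar> powr ?b * indicator {0..1} s :: real"])
      show "AE s in lborel. norm (g1 s) \<le> norm (\<bar>x\<bar> powr ?b * indicator {0..1} s :: real)"
        by (rule AE_I2) (use b in \<open>auto simp: g1_def indicator_def intro!: powr_mono2\<close>)
      show "g1 \<in> borel_measurable lborel" unfolding g1_def by measurable
    qed simp
    have "(\<integral>r. (\<integral>s. g1 s * pos_pow ?b (s - r) \<partial>lborel) * h r \<partial>lborel)
        = (\<integral>s. g1 s * (\<integral>r. pos_pow ?b (s - r) * h r \<partial>lborel) \<partial>lborel)"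
      by (rule pos_pow_fubini[OF b g1i _ _ C]) (auto simp: g1_def indicator_def split: if_splits)
    also have "\<dots> = (\<integral>(s::real). 0 \<partial>lborel)"
    proof (intro integral_cong refl)
      fix s
      show "g1 s * (\<integral>r. pos_pow ?b (s - r) * h r \<partial>lborel) = 0"
        unfolding a_fun_eq[OF h(1), symmetric]
        using a0[of s] aneg[of s] x by (cases "s \<le> 0"; cases "s < 1") (auto simp: g1_def)
    qed
    finally have "(\<integral>r. (\<integral>s. g1 s * pos_pow ?b (s - r) \<partial>lborel) * h r \<partial>lborel) = 0" by simp
    moreover have "(\<integral>s. g1 s * pos_pow ?b (s - r) \<partial>lborel) * h r = Beta (1 + ?b) (1 - ?b) * (h r * max 0 (x - r))" for r
    proof (cases "h r = 0")
      case False
      then have r: "0 < r" using h(1) by (simp add: admissible_def)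
      have "(\<integral>s. g1 s * pos_pow ?b (s - r) \<partial>lborel) = (\<integral>s. pos_pow ?b (s - r) * (max 0 (x - s)) powr ?b \<partial>lborel)"
        by (intro integral_cong refl) (use r x in \<open>auto simp: g1_def indicator_def pos_pow_def\<close>)
      then show ?thesis by (simp add: pos_pow_beta_integral_mirror(2)[OF b])
    qed simp
    ultimately show ?thesis using B by simp
  qed
  have r0: "0 < r0" "r0 < 1" using h by (auto simp: admissible_def)
  have hc: "continuous_on UNIV h" using h(1) by (simp add: admissible_def)
  obtain p q where pq: "0 < p" "p < q" "q < 1" and sg: "\<And>r. r \<in> {p..q} \<Longrightarrow> 0 < sgn (h r0) * h r"
    using sign_interval[OF continuous_on_subset[OF hc] r0 h(2)] by auto
  define w where "w = (q - p) / 2"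
  define x where "x = (p + q) / 2"
  have w: "0 < w" "x - w = p" "x + w = q" using pq by (auto simp: w_def x_def field_simps)
  have "(\<integral>r. h r * tri w x r \<partial>lborel)
      = (\<integral>r. h r * max 0 (p - r) - 2 * (h r * max 0 (x - r)) + h r * max 0 (q - r) \<partial>lborel)"
    using w(2,3) by (intro integral_cong refl) (simp only: tri_eq_mirror[OF w(1)] ring_distribs mult.left_commute)
  also have "\<dots> = 0" using hi psi pq by (simp add: x_def)
  finally have 0: "(\<integral>r. h r * tri w x r \<partial>lborel) = 0" .
  have "(\<integral>r. sgn (h r0) * h r * tri w x r \<partial>lborel) \<noteq> 0"
  proof (rule tri_integral_nonzero[where p = p and q = q and x = x])
    show "continuous_on {p..q} (\<lambda>r. sgn (h r0) * h r * tri w x r)"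
      unfolding tri_def by (intro continuous_intros continuous_on_subset[OF hc]) auto
    show "0 \<le> sgn (h r0) * h r * tri w x r" if "r \<in> {p..q}" for r
      using sg[OF that] by (simp add: tri_def)
    show "sgn (h r0) * h r * tri w x r = 0" if "r \<notin> {p..q}" for r
      using that w by (auto simp: tri_def)
    show "x \<in> {p..q}" using w by auto
    then show "sgn (h r0) * h x * tri w x x \<noteq> 0" using sg[of x] w by (auto simp: tri_def)
  qed (use pq in auto)
  then show False using 0 by (simp add: mult.assoc)
qed

lemma k_fun_eq:
  "k_fun H c h y z = c * (\<integral>s. (indicator {0..1} s * a_fun H h s * pos_pow (hermite_beta H) (s - y)) * pos_pow (hermite_beta H) (s - z) \<partial>lborel)"
  by (simp add: k_fun_def set_lebesgue_integral_def mult.assoc)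

text \<open>Interchanging the integrals diagonalizes the form: it is weighted by \<open>a\<^sub>h\<close> in the variable \<open>s\<close>.\<close>

lemma k_fun_form:
  assumes h: "admissible h" and H: "1/2 < H" "H < 1" and k: "sq_kernel (k_fun H c h)"
    and f [measurable]: "f \<in> borel_measurable borel" and C: "\<And>z. \<bar>f z\<bar> \<le> C * indicator {0..1} z"
  shows "l2_op (k_fun H c h) (l2_of f) \<bullet> l2_of f
    = c * (\<integral>s. indicator {0..1} s * a_fun H h s * (\<integral>z. pos_pow (hermite_beta H) (s - z) * f z \<partial>lborel)\<^sup>2 \<partial>lborel)"
proof -
  let ?b = "hermite_beta H"
  have b: "0 < ?b" "?b < 1" using hermite_beta_bounds[OF H] by auto
  have [measurable]: "a_fun H h \<in> borel_measurable borel" using h by (rule a_fun_measurable)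
  obtain A where A: "\<And>s. s \<le> 1 \<Longrightarrow> \<bar>a_fun H h s\<bar> \<le> A" using a_fun_bounded_continuous(2)[OF h H] by blast
  have A0: "0 \<le> A" using A[of 0] by simp
  have C0: "0 \<le> C" using C[of 0] by simp
  define T where "T s = (\<integral>z. pos_pow ?b (s - z) * f z \<partial>lborel)" for s
  have [measurable]: "T \<in> borel_measurable borel" unfolding T_def by measurable
  have Tb: "\<bar>T s\<bar> \<le> C * unit_mass ?b" if s: "s \<le> 1" for s
  proof -
    have bd: "norm (pos_pow ?b (s - z) * f z) \<le> C * (indicator {0..1} z * pos_pow ?b (s - z))" for z
      using mult_left_mono[OF C[of z], of "pos_pow ?b (s - z)"] by (simp add: abs_mult mult_ac)
    have i: "integrable lborel (\<lambda>z. C * (indicator {0..1} z * pos_pow ?b (s - z)))"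
      using pos_pow_section_integrable(2)[OF b, of s] by simp
    have "\<bar>T s\<bar> \<le> (\<integral>z. norm (pos_pow ?b (s - z) * f z) \<partial>lborel)"
      unfolding T_def real_norm_def[symmetric] by (rule integral_norm_bound)
    also have "\<dots> \<le> (\<integral>z. C * (indicator {0..1} z * pos_pow ?b (s - z)) \<partial>lborel)"
    proof (rule integral_mono[OF integrable_norm i bd])
      show "integrable lborel (\<lambda>z. pos_pow ?b (s - z) * f z)"
        by (rule integrable_bound[OF i]) (use bd in \<open>auto intro!: AE_I2 order_trans[OF _ abs_ge_self]\<close>)
    qed
    also have "\<dots> \<le> C * unit_mass ?b"
      using pos_pow_section_mass[OF b s] C0 by (simp add: mult_left_mono)
    finally show ?thesis .
  qed
  have fsq: "sq_integrable lborel f" by (rule unit_bounded_sq_integrable[OF f C])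
  have op: "kernel_op (k_fun H c h) f y = c * (\<integral>s. (indicator {0..1} s * a_fun H h s * T s) * pos_pow ?b (s - y) \<partial>lborel)" for y
  proof -
    define g1 where "g1 s = indicator {0..1} s * a_fun H h s * pos_pow ?b (s - y)" for s
    have g1: "integrable lborel g1"
    proof (rule integrable_bound[of _ "\<lambda>s. A * (indicator {0..1} s * pos_pow ?b (s - y))"])
      show "integrable lborel (\<lambda>s. A * (indicator {0..1} s * pos_pow ?b (s - y)))"
        using pos_pow_section_integrable(1)[OF b, of y] by simp
      show "g1 \<in> borel_measurable lborel" unfolding g1_def by measurable
      show "AE s in lborel. norm (g1 s) \<le> norm (A * (indicator {0..1} s * pos_pow ?b (s - y)))"
        by (rule AE_I2) (use A A0 in \<open>auto simp: g1_def abs_mult indicator_def intro!: mult_right_mono\<close>)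
    qed
    have "kernel_op (k_fun H c h) f y = (\<integral>z. c * ((\<integral>s. g1 s * pos_pow ?b (s - z) \<partial>lborel) * f z) \<partial>lborel)"
      unfolding kernel_op_def k_fun_eq g1_def by (simp only: mult.assoc)
    also have "\<dots> = c * (\<integral>z. (\<integral>s. g1 s * pos_pow ?b (s - z) \<partial>lborel) * f z \<partial>lborel)" by simp
    also have "(\<integral>z. (\<integral>s. g1 s * pos_pow ?b (s - z) \<partial>lborel) * f z \<partial>lborel) = (\<integral>s. g1 s * T s \<partial>lborel)"
      unfolding T_def by (rule pos_pow_fubini[OF b g1 _ f C]) (auto simp: g1_def indicator_def split: if_splits)
    also have "\<dots> = (\<integral>s. (indicator {0..1} s * a_fun H h s * T s) * pos_pow ?b (s - y) \<partial>lborel)"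
      by (intro integral_cong refl) (simp add: g1_def mult_ac)
    finally show ?thesis .
  qed
  define g where "g s = indicator {0..1} s * a_fun H h s * T s" for s
  have g: "integrable lborel g"
  proof (rule integrable_bound[of _ "\<lambda>s. A * (C * unit_mass ?b) * indicator {0..1} s :: real"])
    show "AE s in lborel. norm (g s) \<le> norm (A * (C * unit_mass ?b) * indicator {0..1} s :: real)"
    proof (rule AE_I2)
      fix s
      have "\<bar>a_fun H h s\<bar> * \<bar>T s\<bar> \<le> A * (C * unit_mass ?b)" if "s \<le> 1"
        using A[OF that] Tb[OF that] A0 by (intro mult_mono) auto
      then have "\<bar>g s\<bar> \<le> A * (C * unit_mass ?b) * indicator {0..1} s"
        by (cases "s \<in> {0..1}") (simp_all add: g_def abs_mult)
      then show "norm (g s) \<le> norm (A * (C * unit_mass ?b) * indicator {0..1} s :: real)"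
        unfolding real_norm_def by (rule order_trans[OF _ abs_ge_self])
    qed
    show "g \<in> borel_measurable lborel" unfolding g_def by measurable
  qed simp
  have "l2_op (k_fun H c h) (l2_of f) \<bullet> l2_of f = (\<integral>y. kernel_op (k_fun H c h) f y * f y \<partial>lborel)"
    unfolding l2_op_l2_of[OF k fsq] by (rule inner_l2_of[OF kernel_op_bound(1)[OF k fsq] fsq])
  also have "\<dots> = (\<integral>y. c * ((\<integral>s. g s * pos_pow ?b (s - y) \<partial>lborel) * f y) \<partial>lborel)"
    unfolding op g_def by (simp only: mult.assoc)
  also have "\<dots> = c * (\<integral>y. (\<integral>s. g s * pos_pow ?b (s - y) \<partial>lborel) * f y \<partial>lborel)" by simp
  also have "(\<integral>y. (\<integral>s. g s * pos_pow ?b (s - y) \<partial>lborel) * f y \<partial>lborel) = (\<integral>s. g s * T s \<partial>lborel)"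
    unfolding T_def by (rule pos_pow_fubini[OF b g _ f C]) (auto simp: g_def indicator_def split: if_splits)
  also have "\<dots> = (\<integral>s. indicator {0..1} s * a_fun H h s * (T s)\<^sup>2 \<partial>lborel)"
    by (intro integral_cong refl) (simp add: g_def power2_eq_square mult_ac)
  finally show ?thesis unfolding T_def .
qed

text \<open>On an interval where \<open>a\<^sub>h\<close> has one sign, \<open>n + 1\<close> functions are chosen whose fractional integrals are triangles
with disjoint supports. A nontrivial combination has a nonzero image, so its form is a strictly signed integral.\<close>

theorem k_fun_form_definite:
  assumes h: "admissible h" "h r0 \<noteq> 0" and H: "1/2 < H" "H < 1" and c: "0 < c" and k: "sq_kernel (k_fun H c h)"
  shows "\<exists>F :: nat \<Rightarrow> l2. \<forall>\<gamma>. (\<exists>j\<le>n. \<gamma> j \<noteq> 0) \<longrightarrow>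
    l2_op (k_fun H c h) (\<Sum>j\<le>n. \<gamma> j *\<^sub>R F j) \<bullet> (\<Sum>j\<le>n. \<gamma> j *\<^sub>R F j) \<noteq> 0"
proof -
  let ?b = "hermite_beta H"
  have b: "0 < ?b" "?b < 1" using hermite_beta_bounds[OF H] by auto
  define B where "B = Beta (1 + ?b) (1 - ?b)"
  have B: "B > 0" using b by (simp add: B_def Beta_def Gamma_real_pos)
  obtain s0 where s0: "0 < s0" "s0 < 1" "a_fun H h s0 \<noteq> 0" using a_fun_nonzero[OF h H] by blast
  have ac: "continuous_on {..1} (a_fun H h)" by (rule a_fun_bounded_continuous(1)[OF h(1) H])
  have "continuous_on {0<..<1} (a_fun H h)" by (rule continuous_on_subset[OF ac]) auto
  then obtain p q where pq: "0 < p" "p < q" "q < 1" and sg: "\<And>r. r \<in> {p..q} \<Longrightarrow> 0 < sgn (a_fun H h s0) * a_fun H h r"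
    using sign_interval[of "a_fun H h" s0] s0 by blast
  define \<sigma> where "\<sigma> = sgn (a_fun H h s0)"
  \<comment> \<open>centres \<open>x i\<close> and common half width \<open>w\<close> of \<open>n + 1\<close> triangles that tile the interval\<close>
  define w where "w = (q - p) / (2 * (real n + 1))"
  define x where "x i = p + (2 * real i + 1) * w" for i :: nat
  have w: "0 < w" using pq by (simp add: w_def)
  have xq: "x i + w \<le> q" if "i \<le> n" for i
  proof -
    have "x i + w = p + (2 * (real i + 1)) * w" by (simp add: x_def algebra_simps)
    also have "\<dots> \<le> p + (2 * (real n + 1)) * w" using that w by (intro add_left_mono mult_right_mono) auto
    also have "\<dots> = q" by (simp add: w_def)
    finally show ?thesis .
  qed
  have xp: "p \<le> x i - w" for i using w by (simp add: x_def algebra_simps)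
  define f where "f i y = indicator {..<1} y *
      ((max 0 (y - (x i - w))) powr ?b - 2 * (max 0 (y - x i)) powr ?b + (max 0 (y - (x i + w))) powr ?b)" for i y
  have fm [measurable]: "f i \<in> borel_measurable borel" for i unfolding f_def by measurable
  have fC: "\<bar>f i y\<bar> \<le> 4 * indicator {0..1} y" if i: "i \<le> n" for i y
  proof (cases "y \<in> {0..<1}")
    case True
    have le: "(max 0 (y - u)) powr ?b \<le> 1" if "0 \<le> u" for u
      using True that b by (intro powr_le1) auto
    have "(max 0 (y - (x i - w))) powr ?b \<le> 1" "(max 0 (y - x i)) powr ?b \<le> 1" "(max 0 (y - (x i + w))) powr ?b \<le> 1"
      using xp[of i] pq w by (intro le; linarith)+
    moreover have "0 \<le> (max 0 (y - u)) powr ?b" for u by simp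
    ultimately have "\<bar>(max 0 (y - (x i - w))) powr ?b - 2 * (max 0 (y - x i)) powr ?b + (max 0 (y - (x i + w))) powr ?b\<bar> \<le> 4"
      by (smt (verit))
    then show ?thesis using True by (simp add: f_def)
  next
    case False
    have "f i y = 0"
    proof (cases "y < 0")
      case True
      then have "y - (x i - w) < 0" "y - x i < 0" "y - (x i + w) < 0" using xp[of i] pq w by linarith+
      then show ?thesis by (simp add: f_def max_def)
    next
      case F: False
      then show ?thesis using False by (simp add: f_def)
    qed
    then show ?thesis by (simp add: indicator_def)
  qed
  have Tf: "(\<integral>z. pos_pow ?b (s - z) * f i z \<partial>lborel) = B * tri w (x i) s"
    "integrable lborel (\<lambda>z. pos_pow ?b (s - z) * f i z)" if s: "s \<le> 1" for i s
  proof -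
    note I = pos_pow_beta_integral[OF b, of s]
    have eq: "pos_pow ?b (s - z) * f i z = pos_pow ?b (s - z) * (max 0 (z - (x i - w))) powr ?b
        - 2 * (pos_pow ?b (s - z) * (max 0 (z - x i)) powr ?b) + pos_pow ?b (s - z) * (max 0 (z - (x i + w))) powr ?b" for z
      using s by (cases "z < s") (auto simp: f_def pos_pow_def algebra_simps)
    show "integrable lborel (\<lambda>z. pos_pow ?b (s - z) * f i z)" unfolding eq using I(1) by simp
    show "(\<integral>z. pos_pow ?b (s - z) * f i z \<partial>lborel) = B * tri w (x i) s"
    proof -
      have "(\<integral>z. pos_pow ?b (s - z) * f i z \<partial>lborel) = B * max 0 (s - (x i - w)) - 2 * (B * max 0 (s - x i)) + B * max 0 (s - (x i + w))"
        unfolding eq using I by (simp only: integral_add integral_diff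
          integrable_diff integrable_mult_right integral_mult_right_zero B_def mult.commute)
      then show ?thesis by (simp only: tri_eq[OF w]) (simp add: ring_distribs)
    qed
  qed
  have fsq: "sq_integrable lborel (f i)" if "i \<le> n" for i
    by (rule unit_bounded_sq_integrable[OF fm fC[OF that]])
  show ?thesis
  proof (rule exI[of _ "\<lambda>i. l2_of (f i)"], intro allI impI)
    fix \<gamma> :: "nat \<Rightarrow> real" assume "\<exists>j\<le>n. \<gamma> j \<noteq> 0"
    then obtain j where j: "j \<le> n" "\<gamma> j \<noteq> 0" by blast
    define F where "F y = (\<Sum>i\<le>n. \<gamma> i * f i y)" for y
    define \<phi> where "\<phi> s = (\<Sum>i\<le>n. \<gamma> i * tri w (x i) s)" for s
    have Fl: "(\<Sum>i\<le>n. \<gamma> i *\<^sub>R l2_of (f i)) = l2_of F"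
      unfolding F_def by (subst l2_of_sum) (auto simp: l2_of_scaleR fsq sq_integrable_cmult intro!: sum.cong)
    have Fm: "F \<in> borel_measurable borel" unfolding F_def by measurable
    have FC: "\<bar>F y\<bar> \<le> (\<Sum>i\<le>n. \<bar>\<gamma> i\<bar> * 4) * indicator {0..1} y" for y
    proof -
      have "\<bar>F y\<bar> \<le> (\<Sum>i\<le>n. \<bar>\<gamma> i\<bar> * \<bar>f i y\<bar>)" unfolding F_def by (rule order_trans[OF sum_abs]) (simp add: abs_mult)
      also have "\<dots> \<le> (\<Sum>i\<le>n. \<bar>\<gamma> i\<bar> * (4 * indicator {0..1} y))" by (intro sum_mono mult_left_mono fC) auto
      also have "\<dots> = (\<Sum>i\<le>n. \<bar>\<gamma> i\<bar> * 4) * indicator {0..1} y" by (simp only: sum_distrib_right mult.assoc)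
      finally show ?thesis .
    qed
    have TF: "(\<integral>z. pos_pow ?b (s - z) * F z \<partial>lborel) = B * \<phi> s" if s: "s \<le> 1" for s
    proof -
      have "(\<integral>z. pos_pow ?b (s - z) * F z \<partial>lborel) = (\<integral>z. (\<Sum>i\<le>n. \<gamma> i * (pos_pow ?b (s - z) * f i z)) \<partial>lborel)"
        by (intro integral_cong refl) (simp add: F_def sum_distrib_left mult_ac)
      also have "\<dots> = (\<Sum>i\<le>n. \<gamma> i * (B * tri w (x i) s))" using Tf[OF s] by simp
      finally show ?thesis by (simp add: \<phi>_def sum_distrib_left mult_ac)
    qed
    have form: "l2_op (k_fun H c h) (l2_of F) \<bullet> l2_of F
        = c * (\<integral>s. indicator {0..1} s * a_fun H h s * (\<integral>z. pos_pow ?b (s - z) * F z \<partial>lborel)\<^sup>2 \<partial>lborel)"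
      by (rule k_fun_form[OF h(1) H k Fm FC])
    have \<phi>0: "\<phi> s = 0" if "s \<notin> {p..q}" for s
      unfolding \<phi>_def
    proof (intro sum.neutral ballI)
      fix i assume i: "i \<in> {..n}"
      have "w < \<bar>s - x i\<bar>" using that xp[of i] xq[of i] i by auto
      then show "\<gamma> i * tri w (x i) s = 0" by (simp add: tri_def)
    qed
    have \<phi>j: "\<phi> (x j) = \<gamma> j * w"
    proof -
      have "tri w (x i) (x j) = (if i = j then w else 0)" for i
      proof (cases "i = j")
        case False
        then have "1 \<le> \<bar>real j - real i\<bar>" by linarith
        then have "w \<le> \<bar>real j - real i\<bar> * (2 * w)" using w mult_right_mono[of 1 "\<bar>real j - real i\<bar>" "2 * w"] by simp
        also have "\<dots> = \<bar>(real j - real i) * (2 * w)\<bar>" using w by (simp add: abs_mult)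
        also have "(real j - real i) * (2 * w) = x j - x i" by (simp add: x_def algebra_simps)
        finally show ?thesis using False by (simp add: tri_def)
      qed (use w in \<open>simp add: tri_def\<close>)
      then have "\<phi> (x j) = (\<Sum>i\<le>n. \<gamma> i * (if i = j then w else 0))" by (simp only: \<phi>_def)
      then show ?thesis using j(1) by (simp add: if_distrib cong: if_cong)
    qed
    have eq: "indicator {0..1} s * a_fun H h s * (\<integral>z. pos_pow ?b (s - z) * F z \<partial>lborel)\<^sup>2
       = B\<^sup>2 * (a_fun H h s * (\<phi> s)\<^sup>2)" for s
    proof (cases "s \<in> {p..q}")
      case True
      then show ?thesis using pq TF[of s] by (simp add: power_mult_distrib mult_ac)
    next
      case False
      then show ?thesis using \<phi>0[OF False] TF[of s] by (cases "s \<le> 1") auto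
    qed
    have "(\<integral>s. \<sigma> * a_fun H h s * (\<phi> s)\<^sup>2 \<partial>lborel) \<noteq> 0"
    proof (rule tri_integral_nonzero[where p = p and q = q and x = "x j"])
      show "continuous_on {p..q} (\<lambda>s. \<sigma> * a_fun H h s * (\<phi> s)\<^sup>2)"
        unfolding \<phi>_def tri_def using pq by (intro continuous_intros continuous_on_subset[OF ac]) auto
      show "0 \<le> \<sigma> * a_fun H h s * (\<phi> s)\<^sup>2" if "s \<in> {p..q}" for s
        using sg[OF that] unfolding \<sigma>_def by (intro mult_nonneg_nonneg[OF less_imp_le]) auto
      show "\<sigma> * a_fun H h s * (\<phi> s)\<^sup>2 = 0" if "s \<notin> {p..q}" for s using \<phi>0[OF that] by simp
      show xj: "x j \<in> {p..q}" using xp[of j] xq[OF j(1)] w by auto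
      show "\<sigma> * a_fun H h (x j) * (\<phi> (x j))\<^sup>2 \<noteq> 0" using sg[OF xj] j w unfolding \<sigma>_def \<phi>j by auto
    qed (use pq in auto)
    then have "(\<integral>s. a_fun H h s * (\<phi> s)\<^sup>2 \<partial>lborel) \<noteq> 0" by (simp add: mult.assoc)
    then show "l2_op (k_fun H c h) (\<Sum>j\<le>n. \<gamma> j *\<^sub>R l2_of (f j)) \<bullet> (\<Sum>j\<le>n. \<gamma> j *\<^sub>R l2_of (f j)) \<noteq> 0"
      unfolding Fl form eq using c B by simp
  qed
qed

section \<open>Kernels as limits of tensor sums\<close>

lemma kernel_norm2_transpose:
  assumes k: "sq_kernel k"
  shows "sq_kernel (\<lambda>y z. k z y)" and "kernel_norm2 (\<lambda>y z. k z y) = kernel_norm2 k"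
proof -
  have km: "(\<lambda>(y, z). k y z) \<in> borel_measurable plane" by (rule sq_kernel_measurable[OF k])
  have m: "(\<lambda>(y, z). k z y) \<in> borel_measurable plane"
    using measurable_compose[OF measurable_pair_swap' km] by (simp add: case_prod_beta')
  have i: "integrable plane (\<lambda>x. (case x of (y, z) \<Rightarrow> k y z)\<^sup>2)" using k by (simp add: sq_integrable_def)
  have "integrable plane (\<lambda>(y, z). (k z y)\<^sup>2)" using lborel_pair.integrable_product_swap[OF i] by simp
  then show "sq_kernel (\<lambda>y z. k z y)" using m by (simp add: sq_integrable_def case_prod_beta')
  show "kernel_norm2 (\<lambda>y z. k z y) = kernel_norm2 k"
    using lborel_pair.integral_product_swap[OF borel_measurable_integrable[OF i]]
    by (simp add: kernel_norm2_def case_prod_beta')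
qed

lemma sq_kernel_diff:
  "sq_kernel k \<Longrightarrow> sq_kernel k' \<Longrightarrow> sq_kernel (\<lambda>y z. k y z - k' y z)"
  using sq_integrable_diff[of plane "\<lambda>(y, z). k y z" "\<lambda>(y, z). k' y z"] by (simp add: case_prod_beta')

lemma sq_kernel_cmult: "sq_kernel k \<Longrightarrow> sq_kernel (\<lambda>y z. a * k y z)"
  using sq_integrable_cmult[of plane "\<lambda>(y, z). k y z" a] by (simp add: case_prod_beta')

lemma sq_kernel_sum: "(\<And>t. t \<in> I \<Longrightarrow> sq_kernel (\<kappa> t)) \<Longrightarrow> sq_kernel (\<lambda>y z. \<Sum>t\<in>I. \<kappa> t y z)"
  using sq_integrable_sum[of I plane "\<lambda>t (y, z). \<kappa> t y z"] by (simp add: case_prod_beta')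

lemma kernel_norm2_sum_le:
  assumes k: "\<And>t. t \<in> I \<Longrightarrow> sq_kernel (\<kappa> t)"
  shows "kernel_norm2 (\<lambda>y z. \<Sum>t\<in>I. \<kappa> t y z) \<le> real (card I) * (\<Sum>t\<in>I. kernel_norm2 (\<kappa> t))"
proof -
  have i: "integrable plane (\<lambda>x. (case x of (y, z) \<Rightarrow> \<kappa> t y z)\<^sup>2)" if "t \<in> I" for t
    using k[OF that] by (simp add: sq_integrable_def)
  have "kernel_norm2 (\<lambda>y z. \<Sum>t\<in>I. \<kappa> t y z)
      \<le> (\<integral>x. real (card I) * (\<Sum>t\<in>I. (case x of (y, z) \<Rightarrow> \<kappa> t y z)\<^sup>2) \<partial>plane)"
    unfolding kernel_norm2_def
  proof (rule integral_mono)
    show "integrable plane (\<lambda>x. (case x of (y, z) \<Rightarrow> \<Sum>t\<in>I. \<kappa> t y z)\<^sup>2)"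
    proof -
      have "sq_kernel (\<lambda>y z. \<Sum>t\<in>I. \<kappa> t y z)" by (rule sq_kernel_sum) (rule k)
      then show ?thesis by (simp add: sq_integrable_def)
    qed
    show "integrable plane (\<lambda>x. real (card I) * (\<Sum>t\<in>I. (case x of (y, z) \<Rightarrow> \<kappa> t y z)\<^sup>2))"
      using i by simp
    fix x :: "real \<times> real"
    show "(case x of (y, z) \<Rightarrow> \<Sum>t\<in>I. \<kappa> t y z)\<^sup>2 \<le> real (card I) * (\<Sum>t\<in>I. (case x of (y, z) \<Rightarrow> \<kappa> t y z)\<^sup>2)"
      using sum_squared_le_sum_of_squares[of "\<lambda>t. \<kappa> t (fst x) (snd x)" I] by (simp add: case_prod_beta' mult.commute)
  qed
  also have "\<dots> = real (card I) * (\<Sum>t\<in>I. kernel_norm2 (\<kappa> t))"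
    unfolding kernel_norm2_def using i by simp
  finally show ?thesis .
qed

lemma kernel_norm2_triangle:
  assumes k: "sq_kernel k" and k': "sq_kernel k'" and l: "sq_kernel l"
  shows "kernel_norm2 (\<lambda>y z. k y z - k' y z)
    \<le> 2 * (kernel_norm2 (\<lambda>y z. k y z - l y z) + kernel_norm2 (\<lambda>y z. k' y z - l y z))"
proof -
  define \<kappa> where "\<kappa> b = (\<lambda>y z. if b then k y z - l y z else (-1) * (k' y z - l y z))" for b
  have \<kappa>: "\<kappa> True = (\<lambda>y z. k y z - l y z)" "\<kappa> False = (\<lambda>y z. (-1) * (k' y z - l y z))"
    by (auto simp: \<kappa>_def fun_eq_iff)
  have sq: "sq_kernel (\<kappa> b)" for b
    using sq_kernel_diff[OF k l] sq_kernel_cmult[OF sq_kernel_diff[OF k' l], of "-1"]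
    by (cases b) (simp_all only: \<kappa>)
  have "(\<lambda>y z. k y z - k' y z) = (\<lambda>y z. \<Sum>b\<in>UNIV. \<kappa> b y z)"
    by (simp add: UNIV_bool \<kappa> fun_eq_iff)
  moreover have "kernel_norm2 (\<kappa> False) = kernel_norm2 (\<lambda>y z. k' y z - l y z)"
    by (simp add: \<kappa> kernel_norm2_def case_prod_beta' power2_commute)
  ultimately show ?thesis using kernel_norm2_sum_le[of UNIV \<kappa>] sq
    by (simp add: UNIV_bool \<kappa>(1) add.commute)
qed

lemma l2_op_selfadjoint:
  assumes k: "sq_kernel k" and sym: "\<And>y z. k y z = k z y"
  shows "l2_op k F \<bullet> G = F \<bullet> l2_op k G"
proof -
  let ?f = "fun_of F" and ?g = "fun_of G"
  have "sq_kernel (\<lambda>y z. ?g y * ?f z)" by (rule sq_kernel_tensor) simp_all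
  from sq_integrable_mult[OF k this]
  have i: "integrable plane (\<lambda>(y, z). k y z * (?g y * ?f z))" by (simp add: case_prod_beta')
  have "l2_op k F \<bullet> G = (\<integral>y. kernel_op k ?f y * ?g y \<partial>lborel)"
    using inner_l2_of[OF kernel_op_bound(1)[OF k sq_integrable_fun_of[of F]] sq_integrable_fun_of[of G]]
    by (simp add: l2_op_def)
  also have "\<dots> = (\<integral>y. (\<integral>z. k y z * (?g y * ?f z) \<partial>lborel) \<partial>lborel)"
    unfolding kernel_op_def
    by (intro integral_cong refl, subst integral_mult_left_zero[symmetric]) (simp only: mult_ac)
  also have "\<dots> = (\<integral>z. (\<integral>y. k y z * (?g y * ?f z) \<partial>lborel) \<partial>lborel)"
    using lborel_pair.Fubini_integral[of "\<lambda>y z. k y z * (?g y * ?f z)"] i by simp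
  also have "\<dots> = (\<integral>z. ?f z * kernel_op k ?g z \<partial>lborel)"
    unfolding kernel_op_def
    by (intro integral_cong refl, subst integral_mult_right_zero[symmetric]) (simp only: mult_ac sym)
  also have "\<dots> = F \<bullet> l2_op k G"
    using inner_l2_of[OF sq_integrable_fun_of[of F] kernel_op_bound(1)[OF k sq_integrable_fun_of[of G]]]
    by (simp add: l2_op_def)
  finally show ?thesis .
qed

lemma l2_op_tendsto:
  assumes k: "sq_kernel k" and g: "\<And>n. sq_kernel (g n)"
    and lim: "(\<lambda>n. kernel_norm2 (\<lambda>y z. g n y z - k y z)) \<longlonglongrightarrow> 0"
  shows "(\<lambda>n. l2_op (g n) F) \<longlonglongrightarrow> l2_op k F"
proof -
  have "(\<lambda>n. sqrt (kernel_norm2 (\<lambda>y z. g n y z - k y z)) * norm F) \<longlonglongrightarrow> sqrt 0 * norm F"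
    by (intro tendsto_intros lim)
  then have 0: "(\<lambda>n. sqrt (kernel_norm2 (\<lambda>y z. g n y z - k y z)) * norm F) \<longlonglongrightarrow> 0" by simp
  have "(\<lambda>n. l2_op (g n) F - l2_op k F) \<longlonglongrightarrow> 0"
    by (rule Lim_null_comparison[OF _ 0]) (rule always_eventually, rule allI, rule norm_l2_op_diff[OF g k])
  then show ?thesis by (simp add: LIM_zero_iff)
qed

lemma l2_op_finite_rank_approx:
  fixes I :: "nat \<Rightarrow> 'i set"
  assumes k: "sq_kernel k" and fin: "\<And>n. finite (I n)"
    and f: "\<And>n p. p \<in> I n \<Longrightarrow> sq_integrable lborel (f n p)" and g: "\<And>n p. p \<in> I n \<Longrightarrow> sq_integrable lborel (g n p)"
    and lim: "(\<lambda>n. kernel_norm2 (\<lambda>y z. (\<Sum>p\<in>I n. m n p * (f n p y * g n p z)) - k y z)) \<longlonglongrightarrow> 0"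
  shows "finite_rank_approx (l2_op k)"
  unfolding finite_rank_approx_def
proof (intro allI impI)
  fix e :: real assume e: "e > 0"
  let ?G = "\<lambda>n y z. \<Sum>p\<in>I n. m n p * (f n p y * g n p z)"
  have G: "sq_kernel (?G n)" for n by (rule sq_kernel_tensor_sum) (use f g in auto)
  have "\<forall>\<^sub>F n in sequentially. kernel_norm2 (\<lambda>y z. ?G n y z - k y z) < e\<^sup>2"
    using order_tendstoD(2)[OF lim, of "e\<^sup>2"] e by simp
  then obtain n where "kernel_norm2 (\<lambda>y z. ?G n y z - k y z) < e\<^sup>2"
    by (auto simp: eventually_sequentially)
  then have n: "sqrt (kernel_norm2 (\<lambda>y z. ?G n y z - k y z)) \<le> e"
    using e by (intro real_le_lsqrt) (auto simp: kernel_norm2_nonneg)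
  obtain b where b: "bij_betw b {..<card (I n)} (I n)"
    using ex_bij_betw_nat_finite[OF fin[of n]] by (auto simp: atLeast0LessThan)
  show "\<exists>(N::nat) u v. \<forall>x. norm (l2_op k x - (\<Sum>i<N. (u i \<bullet> x) *\<^sub>R v i)) \<le> e * norm x"
  proof (intro exI allI)
    fix x
    have "(\<Sum>i<card (I n). (m n (b i) *\<^sub>R l2_of (g n (b i)) \<bullet> x) *\<^sub>R l2_of (f n (b i)))
        = (\<Sum>p\<in>I n. (m n p *\<^sub>R l2_of (g n p) \<bullet> x) *\<^sub>R l2_of (f n p))"
      by (rule sum.reindex_bij_betw[OF b])
    also have "\<dots> = l2_op (?G n) x" by (subst l2_op_tensor_sum) (use f g in auto)
    finally have eq: "(\<Sum>i<card (I n). (m n (b i) *\<^sub>R l2_of (g n (b i)) \<bullet> x) *\<^sub>R l2_of (f n (b i))) = l2_op (?G n) x" .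
    have "norm (l2_op k x - l2_op (?G n) x) \<le> sqrt (kernel_norm2 (\<lambda>y z. ?G n y z - k y z)) * norm x"
      using norm_l2_op_diff[OF G k, of n x] by (simp add: norm_minus_commute)
    also have "\<dots> \<le> e * norm x" by (intro mult_right_mono n) simp
    finally show "norm (l2_op k x - (\<Sum>i<card (I n). (m n (b i) *\<^sub>R l2_of (g n (b i)) \<bullet> x) *\<^sub>R l2_of (f n (b i)))) \<le> e * norm x"
      unfolding eq .
  qed
qed

lemma tensor_inner:
  assumes "sq_integrable lborel f" "sq_integrable lborel g" "sq_integrable lborel f'" "sq_integrable lborel g'"
  shows "integrable plane (\<lambda>(y, z). (f y * g z) * (f' y * g' z))"
    and "(\<integral>(y, z). (f y * g z) * (f' y * g' z) \<partial>plane) = (l2_of f \<bullet> l2_of f') * (l2_of g \<bullet> l2_of g')"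
proof -
  show i: "integrable plane (\<lambda>(y, z). (f y * g z) * (f' y * g' z))"
    using sq_integrable_mult[OF sq_kernel_tensor[OF assms(1,2)] sq_kernel_tensor[OF assms(3,4)]]
    by (simp add: case_prod_beta')
  have "(\<integral>(y, z). (f y * g z) * (f' y * g' z) \<partial>plane) = (\<integral>y. (\<integral>z. (f y * f' y) * (g z * g' z) \<partial>lborel) \<partial>lborel)"
    using lborel_pair.integral_fst'[OF i] by (simp add: mult_ac)
  then show "(\<integral>(y, z). (f y * g z) * (f' y * g' z) \<partial>plane) = (l2_of f \<bullet> l2_of f') * (l2_of g \<bullet> l2_of g')"
    using assms by (simp add: inner_l2_of)
qed

lemma integral_double_sum:
  fixes f :: "'i \<Rightarrow> 'j \<Rightarrow> 'x \<Rightarrow> real"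
  assumes f: "\<And>i j. i \<in> I \<Longrightarrow> j \<in> J \<Longrightarrow> integrable \<mu> (f i j)"
  shows "(\<integral>x. (\<Sum>i\<in>I. \<Sum>j\<in>J. c i j * f i j x) \<partial>\<mu>) = (\<Sum>i\<in>I. \<Sum>j\<in>J. c i j * (\<integral>x. f i j x \<partial>\<mu>))"
proof -
  have "(\<integral>x. (\<Sum>i\<in>I. \<Sum>j\<in>J. c i j * f i j x) \<partial>\<mu>) = (\<Sum>i\<in>I. \<integral>x. (\<Sum>j\<in>J. c i j * f i j x) \<partial>\<mu>)"
    by (rule integral_sum) (intro integrable_sum integrable_mult_right f)
  also have "\<dots> = (\<Sum>i\<in>I. \<Sum>j\<in>J. \<integral>x. c i j * f i j x \<partial>\<mu>)"
    by (intro sum.cong refl integral_sum integrable_mult_right f)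
  finally show ?thesis by simp
qed

lemma tensor_sum_inner:
  assumes f: "\<And>p. p \<in> I \<Longrightarrow> sq_integrable lborel (f p)" "\<And>p. p \<in> I \<Longrightarrow> sq_integrable lborel (g p)"
    and f': "\<And>p. p \<in> I \<Longrightarrow> sq_integrable lborel (f' p)" "\<And>p. p \<in> I \<Longrightarrow> sq_integrable lborel (g' p)"
  shows "(\<integral>(y, z). (\<Sum>p\<in>I. m p * (f p y * g p z)) * (\<Sum>p\<in>I. m p * (f' p y * g' p z)) \<partial>plane)
    = (\<Sum>p\<in>I. \<Sum>q\<in>I. m p * m q * ((l2_of (f p) \<bullet> l2_of (f' q)) * (l2_of (g p) \<bullet> l2_of (g' q))))"
proof -
  have "(\<integral>(y, z). (\<Sum>p\<in>I. m p * (f p y * g p z)) * (\<Sum>p\<in>I. m p * (f' p y * g' p z)) \<partial>plane)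
      = (\<integral>x. (\<Sum>p\<in>I. \<Sum>q\<in>I. (m p * m q) * (case x of (y, z) \<Rightarrow> (f p y * g p z) * (f' q y * g' q z))) \<partial>plane)"
    by (intro integral_cong refl) (simp add: case_prod_beta' sum_product mult_ac)
  also have "\<dots> = (\<Sum>p\<in>I. \<Sum>q\<in>I. (m p * m q) * (\<integral>(y, z). (f p y * g p z) * (f' q y * g' q z) \<partial>plane))"
    by (intro integral_double_sum tensor_inner(1) f f')
  also have "\<dots> = (\<Sum>p\<in>I. \<Sum>q\<in>I. (m p * m q) * ((l2_of (f p) \<bullet> l2_of (f' q)) * (l2_of (g p) \<bullet> l2_of (g' q))))"
    by (intro sum.cong refl) (simp add: tensor_inner(2) f f')
  finally show ?thesis .
qed


text \<open>The second moment is the norm of the symmetrized kernel, doubled: the sum of the Hilbert--Schmidt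
norm and of the pairing with the transposed kernel, which the former dominates.\<close>

lemma wick_sum_le_kernel_norm2:
  fixes M :: "'a measure" and W :: "l2 \<Rightarrow> 'a \<Rightarrow> real"
  assumes gf: "gaussian_field M W" and I: "finite I"
    and f: "\<And>p. p \<in> I \<Longrightarrow> sq_integrable lborel (f p)" and g: "\<And>p. p \<in> I \<Longrightarrow> sq_integrable lborel (g p)"
  shows "(\<integral>w. (\<Sum>p\<in>I. m p * gaussian_field.wick W (l2_of (f p)) (l2_of (g p)) w)\<^sup>2 \<partial>M)
    \<le> 2 * kernel_norm2 (\<lambda>y z. \<Sum>p\<in>I. m p * (f p y * g p z))"
proof -
  let ?k = "\<lambda>y z. \<Sum>p\<in>I. m p * (f p y * g p z)"
  have k: "sq_kernel ?k" by (rule sq_kernel_tensor_sum) (use f g in auto)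
  note kt = kernel_norm2_transpose[OF k]
  have kt_eq: "(\<lambda>y z. ?k z y) = (\<lambda>y z. \<Sum>p\<in>I. m p * (g p y * f p z))" by (simp add: mult_ac)
  have "kernel_norm2 ?k = (\<integral>(y, z). ?k y z * ?k y z \<partial>plane)"
    unfolding kernel_norm2_def by (simp only: case_prod_beta' power2_eq_square)
  also have "\<dots> = (\<Sum>p\<in>I. \<Sum>q\<in>I. m p * m q * ((l2_of (f p) \<bullet> l2_of (f q)) * (l2_of (g p) \<bullet> l2_of (g q))))"
    by (rule tensor_sum_inner) (use f g in auto)
  finally have 1: "(\<Sum>p\<in>I. \<Sum>q\<in>I. m p * m q * ((l2_of (f p) \<bullet> l2_of (f q)) * (l2_of (g p) \<bullet> l2_of (g q)))) = kernel_norm2 ?k" ..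
  have "(\<Sum>p\<in>I. \<Sum>q\<in>I. m p * m q * ((l2_of (f p) \<bullet> l2_of (g q)) * (l2_of (g p) \<bullet> l2_of (f q))))
      = (\<integral>(y, z). ?k y z * (\<Sum>p\<in>I. m p * (g p y * f p z)) \<partial>plane)"
    by (rule tensor_sum_inner[symmetric]) (use f g in auto)
  also have "\<dots> = (\<integral>x. (case x of (y, z) \<Rightarrow> ?k y z) * (case x of (y, z) \<Rightarrow> ?k z y) \<partial>plane)"
    by (simp only: case_prod_beta' mult.commute)
  also have "\<dots> \<le> (\<integral>x. ((case x of (y, z) \<Rightarrow> ?k y z)\<^sup>2 + (case x of (y, z) \<Rightarrow> ?k z y)\<^sup>2) / 2 \<partial>plane)"
  proof (rule integral_mono)
    show "integrable plane (\<lambda>x. (case x of (y, z) \<Rightarrow> ?k y z) * (case x of (y, z) \<Rightarrow> ?k z y))"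
      by (rule sq_integrable_mult[OF k kt(1)])
    show "integrable plane (\<lambda>x. ((case x of (y, z) \<Rightarrow> ?k y z)\<^sup>2 + (case x of (y, z) \<Rightarrow> ?k z y)\<^sup>2) / 2)"
      using k kt(1) by (auto simp: sq_integrable_def)
    have "a * b \<le> (a\<^sup>2 + b\<^sup>2) / 2" for a b :: real using sum_squares_bound[of a b] by (simp add: power2_eq_square)
    then show "(case x of (y, z) \<Rightarrow> ?k y z) * (case x of (y, z) \<Rightarrow> ?k z y)
      \<le> ((case x of (y, z) \<Rightarrow> ?k y z)\<^sup>2 + (case x of (y, z) \<Rightarrow> ?k z y)\<^sup>2) / 2" for x .
  qed
  also have "\<dots> = (kernel_norm2 ?k + kernel_norm2 (\<lambda>y z. ?k z y)) / 2"
    unfolding kernel_norm2_def using k kt(1) by (simp add: sq_integrable_def)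
  finally have 3: "(\<Sum>p\<in>I. \<Sum>q\<in>I. m p * m q * ((l2_of (f p) \<bullet> l2_of (g q)) * (l2_of (g p) \<bullet> l2_of (f q)))) \<le> kernel_norm2 ?k"
    unfolding kt(2) by simp
  show ?thesis
    unfolding gaussian_field.wick_sum_second_moment[OF gf I] distrib_left sum.distrib 1 using 3 by simp
qed

section \<open>Contraction of the Hermite kernel\<close>

text \<open>Coordinates outside \<open>{..<3}\<close> have the default value of extensional functions, as points of \<open>leb_pow 3\<close> require.\<close>

definition vec3 :: "real \<Rightarrow> real \<Rightarrow> real \<Rightarrow> nat \<Rightarrow> real" where
  "vec3 x y z = ((\<lambda>_. undefined)(0 := x, 1 := y, 2 := z))"

lemma vec3_simps [simp]: "vec3 x y z 0 = x" "vec3 x y z (Suc 0) = y" "vec3 x y z 2 = z"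
  by (simp_all add: vec3_def)

lemma lessThan_3: "{..<3::nat} = {0, Suc 0, 2}"
  by auto

lemma vec3_measurable [measurable]:
  assumes [measurable]: "a \<in> borel_measurable N" "b \<in> borel_measurable N" "d \<in> borel_measurable N"
  shows "(\<lambda>x. vec3 (a x) (b x) (d x)) \<in> measurable N (leb_pow 3)"
  unfolding leb_pow_def lessThan_3
proof (rule measurable_PiM_single')
  fix i assume "i \<in> {0, Suc 0, 2}"
  then show "(\<lambda>x. vec3 (a x) (b x) (d x) i) \<in> measurable N lborel" by auto
next
  show "(\<lambda>x. vec3 (a x) (b x) (d x)) \<in> space N \<rightarrow> (\<Pi>\<^sub>E i\<in>{0, Suc 0, 2}. space lborel)"
    by (auto simp: PiE_def extensional_def vec3_def)
qed

lemma nn_integral_leb_pow_3: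
  assumes [measurable]: "G \<in> borel_measurable (leb_pow 3)"
  shows "(\<integral>\<^sup>+x. G x \<partial>leb_pow 3) = (\<integral>\<^sup>+z. \<integral>\<^sup>+y. \<integral>\<^sup>+x. G (vec3 x y z) \<partial>lborel \<partial>lborel \<partial>lborel)"
proof -
  interpret P: product_sigma_finite "\<lambda>_::nat. lborel :: real measure" ..
  have S: "{..<3::nat} = insert 2 (insert 1 (insert 0 {}))" by auto
  have G: "G \<in> borel_measurable (Pi\<^sub>M (insert 2 (insert 1 (insert 0 {}))) (\<lambda>_. lborel))"
    using assms unfolding leb_pow_def S .
  have G2: "(\<lambda>x. G (x(2 := z))) \<in> borel_measurable (Pi\<^sub>M (insert 1 (insert 0 {})) (\<lambda>_. lborel))" for z
    by (rule measurable_compose[OF _ G]) (rule measurable_fun_upd[where J = "insert 1 (insert 0 {})"]; auto)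
  have G1: "(\<lambda>x. G (x(1 := y, 2 := z))) \<in> borel_measurable (Pi\<^sub>M (insert 0 {}) (\<lambda>_. lborel))" for y z
    by (rule measurable_compose[OF _ G2]) (rule measurable_fun_upd[where J = "insert 0 {}"]; auto)
  show ?thesis
    unfolding leb_pow_def S vec3_def
    by (subst P.product_nn_integral_insert_rev[OF _ _ G], simp, simp,
        subst P.product_nn_integral_insert_rev[OF _ _ G2], simp, simp,
        subst P.product_nn_integral_insert_rev[OF _ _ G1], simp, simp,
        simp add: P.nn_integral_empty)
qed

text \<open>\<open>slot t r y z\<close> puts \<open>r\<close> into coordinate \<open>t\<close> and \<open>y\<close>, \<open>z\<close> into the other two.\<close>

definition slot :: "nat \<Rightarrow> real \<Rightarrow> real \<Rightarrow> real \<Rightarrow> nat \<Rightarrow> real" where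
  "slot t r y z = (if t = 0 then vec3 r y z else if t = 1 then vec3 y r z else vec3 y z r)"

definition left_slot :: "nat \<Rightarrow> nat" where "left_slot t = (if t = 0 then 1 else 0)"
definition right_slot :: "nat \<Rightarrow> nat" where "right_slot t = (if t = 2 then 1 else 2)"

lemma prod_slot:
  assumes "t < 3"
  shows "(\<Prod>j<3. \<phi> j (slot t r y z j)) = \<phi> t r * (\<phi> (left_slot t) y * \<phi> (right_slot t) z)"
proof -
  have "t = 0 \<or> t = 1 \<or> t = 2" using assms by auto
  then show ?thesis
    by (auto simp: slot_def left_slot_def right_slot_def numeral_3_eq_3 numeral_2_eq_2 vec3_def mult_ac)
qed

lemma slot_measurable [measurable]:
  assumes [measurable]: "a \<in> borel_measurable N" "b \<in> borel_measurable N" "d \<in> borel_measurable N"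
  shows "(\<lambda>x. slot t (a x) (b x) (d x)) \<in> measurable N (leb_pow 3)"
  unfolding slot_def by (cases "t = 0"; cases "t = 1") simp_all

lemma nn_integral_swap:
  assumes "(\<lambda>(x, y). f x y) \<in> borel_measurable (lborel \<Otimes>\<^sub>M (lborel :: real measure))"
  shows "(\<integral>\<^sup>+y. \<integral>\<^sup>+x. f x y \<partial>(lborel :: real measure) \<partial>lborel) = (\<integral>\<^sup>+x. \<integral>\<^sup>+y. f x y \<partial>lborel \<partial>lborel)"
  using lborel_pair.Fubini'[OF assms] .

text \<open>Tonelli's theorem, once for each position of \<open>r\<close>.\<close>

lemma nn_integral_slot:
  assumes G [measurable]: "G \<in> borel_measurable (leb_pow 3)" and t: "t < 3"
  shows "(\<integral>\<^sup>+y. \<integral>\<^sup>+z. \<integral>\<^sup>+r. G (slot t r y z) \<partial>lborel \<partial>lborel \<partial>lborel) = (\<integral>\<^sup>+x. G x \<partial>leb_pow 3)"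
proof -
  have v: "(\<integral>\<^sup>+x. G x \<partial>leb_pow 3) = (\<integral>\<^sup>+z. \<integral>\<^sup>+y. \<integral>\<^sup>+x. G (vec3 x y z) \<partial>lborel \<partial>lborel \<partial>lborel)"
    by (rule nn_integral_leb_pow_3[OF G])
  consider "t = 0" | "t = 1" | "t = 2" using t by linarith
  then show ?thesis
  proof cases
    case 1
    have "(\<integral>\<^sup>+z. \<integral>\<^sup>+y. \<integral>\<^sup>+r. G (vec3 r y z) \<partial>lborel \<partial>lborel \<partial>lborel)
        = (\<integral>\<^sup>+y. \<integral>\<^sup>+z. \<integral>\<^sup>+r. G (vec3 r y z) \<partial>lborel \<partial>lborel \<partial>lborel)"
      by (rule nn_integral_swap) measurable
    then show ?thesis unfolding v 1 slot_def by simp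
  next
    case 2
    have "(\<integral>\<^sup>+z. \<integral>\<^sup>+r. \<integral>\<^sup>+y. G (vec3 y r z) \<partial>lborel \<partial>lborel \<partial>lborel)
        = (\<integral>\<^sup>+z. \<integral>\<^sup>+y. \<integral>\<^sup>+r. G (vec3 y r z) \<partial>lborel \<partial>lborel \<partial>lborel)"
      by (intro nn_integral_cong nn_integral_swap) measurable
    also have "\<dots> = (\<integral>\<^sup>+y. \<integral>\<^sup>+z. \<integral>\<^sup>+r. G (vec3 y r z) \<partial>lborel \<partial>lborel \<partial>lborel)"
      by (rule nn_integral_swap) measurable
    finally show ?thesis unfolding v 2 slot_def by simp
  next
    case 3
    have "(\<integral>\<^sup>+r. \<integral>\<^sup>+z. \<integral>\<^sup>+y. G (vec3 y z r) \<partial>lborel \<partial>lborel \<partial>lborel)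
        = (\<integral>\<^sup>+r. \<integral>\<^sup>+y. \<integral>\<^sup>+z. G (vec3 y z r) \<partial>lborel \<partial>lborel \<partial>lborel)"
      by (intro nn_integral_cong nn_integral_swap) measurable
    also have "\<dots> = (\<integral>\<^sup>+y. \<integral>\<^sup>+r. \<integral>\<^sup>+z. G (vec3 y z r) \<partial>lborel \<partial>lborel \<partial>lborel)"
      by (rule nn_integral_swap) measurable
    also have "\<dots> = (\<integral>\<^sup>+y. \<integral>\<^sup>+z. \<integral>\<^sup>+r. G (vec3 y z r) \<partial>lborel \<partial>lborel \<partial>lborel)"
      by (intro nn_integral_cong nn_integral_swap) measurable
    finally show ?thesis unfolding v 3 slot_def by simp
  qed
qed

text \<open>One of the two singular factors is always at most \<open>\<bar>y - z\<bar> powr (- b)\<close>, so off the diagonal the product is no worse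
than a single factor.\<close>

lemma pos_pow_pair_integrable:
  assumes b: "0 < b" "b < 1" and "y \<noteq> z"
  shows "integrable lborel (\<lambda>s. indicator {0..1} s * (pos_pow b (s - y) * pos_pow b (s - z)))"
proof (rule integrable_bound)
  let ?D = "\<bar>y - z\<bar> powr (- b)"
  have *: "pos_pow b (s - y) * pos_pow b (s - z) \<le> ?D * (pos_pow b (s - y) + pos_pow b (s - z))" for s
  proof (cases "0 < s - y \<and> 0 < s - z")
    case True
    have le: "pos_pow b (s - v) \<le> ?D" if "\<bar>y - z\<bar> \<le> s - v" for v
      using powr_mono2'[of "- b" "\<bar>y - z\<bar>" "s - v"] that b \<open>y \<noteq> z\<close> by (simp add: pos_pow_def)
    show ?thesis
    proof (cases "y < z")
      case True
      then have "\<bar>y - z\<bar> \<le> s - y" using \<open>0 < s - y \<and> 0 < s - z\<close> by simp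
      then have "pos_pow b (s - y) * pos_pow b (s - z) \<le> ?D * pos_pow b (s - z)"
        by (intro mult_right_mono le) simp_all
      also have "\<dots> \<le> ?D * (pos_pow b (s - y) + pos_pow b (s - z))" by (intro mult_left_mono) simp_all
      finally show ?thesis .
    next
      case False
      then have "\<bar>y - z\<bar> \<le> s - z" using \<open>0 < s - y \<and> 0 < s - z\<close> by simp
      then have "pos_pow b (s - y) * pos_pow b (s - z) \<le> pos_pow b (s - y) * ?D"
        by (intro mult_left_mono le) simp_all
      also have "\<dots> \<le> ?D * (pos_pow b (s - y) + pos_pow b (s - z))" by (simp add: distrib_left mult.commute)
      finally show ?thesis .
    qed
  next
    case False
    then have "pos_pow b (s - y) * pos_pow b (s - z) = 0" by (auto simp: pos_pow_def)
    moreover have "0 \<le> ?D * (pos_pow b (s - y) + pos_pow b (s - z))" by simp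
    ultimately show ?thesis by linarith
  qed
  show "integrable lborel (\<lambda>s. ?D * (indicator {0..1} s * pos_pow b (s - y) + indicator {0..1} s * pos_pow b (s - z)))"
    using pos_pow_section_integrable(1)[OF b] by simp
  show "AE s in lborel. norm (indicator {0..1} s * (pos_pow b (s - y) * pos_pow b (s - z)))
      \<le> norm (?D * (indicator {0..1} s * pos_pow b (s - y) + indicator {0..1} s * pos_pow b (s - z)))"
    by (rule AE_I2) (use * in \<open>simp add: indicator_def\<close>)
qed measurable

lemma hermite_kernel_slot:
  assumes "t < 3"
  shows "hermite_kernel H c (slot t r y z) = c * (\<integral>s. indicator {0..1} s *
    (pos_pow (hermite_beta H) (s - y) * pos_pow (hermite_beta H) (s - z)) * pos_pow (hermite_beta H) (s - r) \<partial>lborel)"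
  unfolding hermite_kernel_def set_lebesgue_integral_def prod_slot[OF assms, of "\<lambda>_ x. pos_pow (hermite_beta H) (s - x)" for s]
  by (simp add: mult_ac)

text \<open>Off the diagonal, integrating one variable of the Hermite kernel against \<open>h\<close> gives \<open>k_fun\<close>; the diagonal is a null set.\<close>

lemma hermite_kernel_derivative:
  assumes h: "admissible h" and H: "1/2 < H" "H < 1" and t: "t < 3" and yz: "y \<noteq> z"
  shows "(\<integral>r. h r * hermite_kernel H c (slot t r y z) \<partial>lborel) = k_fun H c h y z"
proof -
  let ?b = "hermite_beta H"
  have b: "0 < ?b" "?b < 1" using hermite_beta_bounds[OF H] by auto
  obtain C where C: "\<And>r. \<bar>h r\<bar> \<le> C * indicator {0..1} r" using admissible_bound[OF h] by blast
  define g1 where "g1 s = indicator {0..1} s * (pos_pow ?b (s - y) * pos_pow ?b (s - z))" for s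
  have g1: "integrable lborel g1" unfolding g1_def by (rule pos_pow_pair_integrable[OF b yz])
  have "(\<integral>r. h r * hermite_kernel H c (slot t r y z) \<partial>lborel)
      = (\<integral>r. c * ((\<integral>s. g1 s * pos_pow ?b (s - r) \<partial>lborel) * h r) \<partial>lborel)"
    unfolding hermite_kernel_slot[OF t] g1_def by (simp only: mult_ac)
  also have "\<dots> = c * (\<integral>r. (\<integral>s. g1 s * pos_pow ?b (s - r) \<partial>lborel) * h r \<partial>lborel)" by simp
  also have "(\<integral>r. (\<integral>s. g1 s * pos_pow ?b (s - r) \<partial>lborel) * h r \<partial>lborel)
      = (\<integral>s. g1 s * (\<integral>r. pos_pow ?b (s - r) * h r \<partial>lborel) \<partial>lborel)"
    by (rule pos_pow_fubini[OF b g1 _ admissible_measurable[OF h] C]) (auto simp: g1_def indicator_def split: if_splits)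
  also have "c * \<dots> = k_fun H c h y z"
    unfolding a_fun_eq[OF h, symmetric] k_fun_eq g1_def by (simp only: mult_ac)
  finally show ?thesis .
qed

lemma k_fun_sym: "k_fun H c h y z = k_fun H c h z y"
  unfolding k_fun_def by (simp only: mult_ac)

lemma k_fun_measurable:
  assumes h: "admissible h"
  shows "(\<lambda>(y, z). k_fun H c h y z) \<in> borel_measurable plane"
proof -
  have [measurable]: "a_fun H h \<in> borel_measurable borel" by (rule a_fun_measurable[OF h])
  show ?thesis unfolding k_fun_eq by measurable
qed

text \<open>Contracting slot \<open>t\<close> of an elementary kernel with \<open>h\<close>.\<close>

definition slot_kernel ::
  "(real \<Rightarrow> real) \<Rightarrow> nat \<Rightarrow> (nat \<Rightarrow> real set) \<Rightarrow> ((nat \<Rightarrow> nat) \<Rightarrow> real) \<Rightarrow> nat \<Rightarrow> real \<Rightarrow> real \<Rightarrow> real" where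
  "slot_kernel h n A a t y z = (\<Sum>\<iota>\<in>distinct_indices 3 n.
     (a \<iota> * (\<integral>r. h r * indicator (A (\<iota> t)) r \<partial>lborel)) * (indicator (A (\<iota> (left_slot t))) y * indicator (A (\<iota> (right_slot t))) z))"

lemma finite_distinct_indices: "finite (distinct_indices q n)"
  unfolding distinct_indices_def by (rule finite_subset[of _ "{..<q} \<rightarrow>\<^sub>E {..<n}"]) (auto intro: finite_PiE)

lemma elem_family_sq_integrable:
  assumes A: "elem_family n A" and i: "i < n"
  shows "sq_integrable lborel (indicator (A i) :: real \<Rightarrow> real)"
proof -
  have "integrable lborel (indicator (A i) :: real \<Rightarrow> real)"
    by (rule integrable_real_indicator) (use A i in \<open>auto simp: elem_family_def\<close>)
  then show ?thesis by (simp add: sq_integrable_def power2_eq_square flip: indicator_inter_arith)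
qed

lemma distinct_indices_less: "\<iota> \<in> distinct_indices q n \<Longrightarrow> t < q \<Longrightarrow> \<iota> t < n"
  unfolding distinct_indices_def by (auto simp: PiE_def Pi_def)

lemma slot_kernel_sq:
  assumes A: "elem_family n A" and t: "t < 3"
  shows "sq_kernel (slot_kernel h n A a t)"
  unfolding slot_kernel_def
  by (rule sq_kernel_tensor_sum; rule elem_family_sq_integrable[OF A]; erule distinct_indices_less)
     (use t in \<open>auto simp: left_slot_def right_slot_def\<close>)

lemma elem_fun_slot:
  assumes "t < 3"
  shows "elem_fun 3 n A a (slot t r y z) = (\<Sum>\<iota>\<in>distinct_indices 3 n.
    a \<iota> * (indicator (A (\<iota> t)) r * (indicator (A (\<iota> (left_slot t))) y * indicator (A (\<iota> (right_slot t))) z)))"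
  unfolding elem_fun_def by (simp only: prod_slot[OF assms, of "\<lambda>j. indicator (A (\<iota> j))" for \<iota>])

lemma slot_kernel_eq:
  assumes A: "elem_family n A" and t: "t < 3" and h: "sq_integrable lborel h"
  shows "integrable lborel (\<lambda>r. h r * elem_fun 3 n A a (slot t r y z))"
    and "(\<integral>r. h r * elem_fun 3 n A a (slot t r y z) \<partial>lborel) = slot_kernel h n A a t y z"
proof -
  have i: "integrable lborel (\<lambda>r. h r * indicator (A (\<iota> t)) r)" if "\<iota> \<in> distinct_indices 3 n" for \<iota>
    by (intro sq_integrable_mult h elem_family_sq_integrable[OF A] distinct_indices_less[OF that t])
  have eq: "h r * elem_fun 3 n A a (slot t r y z) = (\<Sum>\<iota>\<in>distinct_indices 3 n.
      (a \<iota> * (indicator (A (\<iota> (left_slot t))) y * indicator (A (\<iota> (right_slot t))) z)) * (h r * indicator (A (\<iota> t)) r))" for r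
    unfolding elem_fun_slot[OF t] sum_distrib_left by (intro sum.cong refl) (simp only: mult_ac)
  show "integrable lborel (\<lambda>r. h r * elem_fun 3 n A a (slot t r y z))"
    unfolding eq using i by (intro integrable_sum integrable_mult_right)
  show "(\<integral>r. h r * elem_fun 3 n A a (slot t r y z) \<partial>lborel) = slot_kernel h n A a t y z"
    unfolding eq slot_kernel_def
    by (subst integral_sum, rule integrable_mult_right, erule i)
       (simp only: integral_mult_right_zero, simp only: mult_ac)
qed

lemma elem_fun_measurable:
  assumes A: "elem_family n A"
  shows "elem_fun 3 n A a \<in> borel_measurable (leb_pow 3)"
  unfolding elem_fun_def
proof (intro borel_measurable_sum borel_measurable_times borel_measurable_const borel_measurable_prod)
  fix \<iota> j assume \<iota>: "\<iota> \<in> distinct_indices 3 n" and j: "j \<in> {..<3::nat}"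
  have "\<iota> j < n" using distinct_indices_less[OF \<iota>, of j] j by simp
  then have [measurable]: "A (\<iota> j) \<in> sets borel" using A by (simp add: elem_family_def)
  have "(\<lambda>x. x j) \<in> measurable (leb_pow 3) lborel" unfolding leb_pow_def by (rule measurable_component_singleton[OF j])
  then show "(\<lambda>x. indicator (A (\<iota> j)) (x j)) \<in> borel_measurable (leb_pow 3)"
    by (rule measurable_compose) simp
qed

text \<open>The contraction with \<open>h\<close> is a bounded map from kernels of three variables to kernels of two, by the Cauchy--Schwarz
inequality in the contracted variable. Square-integrability of \<open>k_fun\<close> is a by-product.\<close>

lemma slot_kernel_error:
  assumes A: "elem_family n A" and t: "t < 3" and h: "admissible h" and H: "1/2 < H" "H < 1"
    and f [measurable]: "hermite_kernel H c \<in> borel_measurable (leb_pow 3)"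
    and E: "(\<integral>\<^sup>+x. ennreal ((elem_fun 3 n A a x - hermite_kernel H c x)\<^sup>2) \<partial>leb_pow 3) = ennreal \<epsilon>" "0 \<le> \<epsilon>"
  shows "sq_kernel (\<lambda>y z. slot_kernel h n A a t y z - k_fun H c h y z)"
    and "kernel_norm2 (\<lambda>y z. slot_kernel h n A a t y z - k_fun H c h y z) \<le> (\<integral>r. (h r)\<^sup>2 \<partial>lborel) * \<epsilon>"
proof -
  define G where "G x = elem_fun 3 n A a x - hermite_kernel H c x" for x
  have Gm [measurable]: "G \<in> borel_measurable (leb_pow 3)"
    unfolding G_def using elem_fun_measurable[OF A] by measurable
  have hs: "sq_integrable lborel h" by (rule admissible_sq_integrable[OF h])
  let ?J = "\<lambda>y z. \<integral>\<^sup>+r. ennreal ((G (slot t r y z))\<^sup>2) \<partial>lborel"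
  let ?k = "\<lambda>y z. slot_kernel h n A a t y z - k_fun H c h y z"
  let ?h = "\<integral>r. (h r)\<^sup>2 \<partial>lborel"
  have J: "(\<integral>\<^sup>+y. \<integral>\<^sup>+z. ?J y z \<partial>lborel \<partial>lborel) = ennreal \<epsilon>"
  proof -
    have "(\<lambda>x. ennreal ((G x)\<^sup>2)) \<in> borel_measurable (leb_pow 3)" by measurable
    from nn_integral_slot[OF this t] show ?thesis using E(1) by (simp only: G_def)
  qed
  have Jm [measurable]: "(\<lambda>(y, z). ?J y z) \<in> borel_measurable plane" by measurable
  have pt: "ennreal ((?k y z)\<^sup>2) \<le> ennreal ?h * ?J y z" if yz: "z \<noteq> y" and fin: "?J y z \<noteq> \<infinity>" for y z
  proof -
    have Gs: "sq_integrable lborel (\<lambda>r. G (slot t r y z))"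
      unfolding sq_integrable_iff_nn_integral using fin by (auto simp: less_top)
    have i: "integrable lborel (\<lambda>r. h r * G (slot t r y z))" by (rule sq_integrable_mult[OF hs Gs])
    note e = slot_kernel_eq[OF A t hs, of a y z]
    have "(\<integral>r. h r * G (slot t r y z) \<partial>lborel)
        = (\<integral>r. h r * elem_fun 3 n A a (slot t r y z) \<partial>lborel) - (\<integral>r. h r * hermite_kernel H c (slot t r y z) \<partial>lborel)"
    proof -
      have "integrable lborel (\<lambda>r. h r * elem_fun 3 n A a (slot t r y z) - h r * G (slot t r y z))"
        by (rule integrable_diff[OF e(1) i])
      then have "integrable lborel (\<lambda>r. h r * hermite_kernel H c (slot t r y z))"
        by (simp add: G_def right_diff_distrib)
      then show ?thesis using e(1) by (simp add: G_def right_diff_distrib)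
    qed
    also have "\<dots> = ?k y z" using e(2) hermite_kernel_derivative[OF h H t, of y z c] yz by simp
    finally have "(?k y z)\<^sup>2 \<le> ?h * (\<integral>r. (G (slot t r y z))\<^sup>2 \<partial>lborel)"
      using square_integral_mult_le[OF hs Gs] by simp
    then have "ennreal ((?k y z)\<^sup>2) \<le> ennreal ?h * ennreal (\<integral>r. (G (slot t r y z))\<^sup>2 \<partial>lborel)"
      by (simp add: ennreal_mult[symmetric])
    also have "ennreal (\<integral>r. (G (slot t r y z))\<^sup>2 \<partial>lborel) = ?J y z"
      using Gs by (intro nn_integral_eq_integral[symmetric]) (auto simp: sq_integrable_def)
    finally show ?thesis .
  qed
  have fin1: "AE y in lborel. (\<integral>\<^sup>+z. ?J y z \<partial>lborel) \<noteq> \<infinity>"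
    by (rule nn_integral_PInf_AE) (use J in auto)
  have ne: "AE z in lborel. z \<noteq> y" for y :: real by (rule AE_lborel_singleton)
  have main: "(\<integral>\<^sup>+y. \<integral>\<^sup>+z. ennreal ((?k y z)\<^sup>2) \<partial>lborel \<partial>lborel) \<le> ennreal (?h * \<epsilon>)"
  proof -
    have "(\<integral>\<^sup>+y. \<integral>\<^sup>+z. ennreal ((?k y z)\<^sup>2) \<partial>lborel \<partial>lborel) \<le> (\<integral>\<^sup>+y. \<integral>\<^sup>+z. ennreal ?h * ?J y z \<partial>lborel \<partial>lborel)"
    proof (rule nn_integral_mono_AE, use fin1 in eventually_elim)
      fix y assume y: "(\<integral>\<^sup>+z. ?J y z \<partial>lborel) \<noteq> \<infinity>"
      have "AE z in lborel. ?J y z \<noteq> \<infinity>" by (rule nn_integral_PInf_AE) (use y in auto)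
      with ne[of y] have "AE z in lborel. ennreal ((?k y z)\<^sup>2) \<le> ennreal ?h * ?J y z"
        by eventually_elim (rule pt)
      then show "(\<integral>\<^sup>+z. ennreal ((?k y z)\<^sup>2) \<partial>lborel) \<le> (\<integral>\<^sup>+z. ennreal ?h * ?J y z \<partial>lborel)"
        by (rule nn_integral_mono_AE)
    qed
    also have "\<dots> = ennreal ?h * ennreal \<epsilon>"
      by (simp add: nn_integral_cmult J)
    also have "\<dots> = ennreal (?h * \<epsilon>)" using E(2) by (simp add: ennreal_mult)
    finally show ?thesis .
  qed
  have km: "(\<lambda>(y, z). ?k y z) \<in> borel_measurable plane"
    using sq_kernel_measurable[OF slot_kernel_sq[OF A t, of h a]] k_fun_measurable[OF h, of H c]
    by (simp add: case_prod_beta')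
  have "(\<integral>\<^sup>+x. ennreal ((case x of (y, z) \<Rightarrow> ?k y z)\<^sup>2) \<partial>plane) = (\<integral>\<^sup>+y. \<integral>\<^sup>+z. ennreal ((?k y z)\<^sup>2) \<partial>lborel \<partial>lborel)"
    using km by (subst lborel.nn_integral_fst[symmetric]) auto
  then show sq: "sq_kernel ?k"
    unfolding sq_integrable_iff_nn_integral using km le_less_trans[OF main] by simp
  show "kernel_norm2 ?k \<le> ?h * \<epsilon>"
    using main E(2) unfolding kernel_norm2_nn[OF sq, symmetric] by (subst (asm) ennreal_le_iff) auto
qed

section \<open>Isonormal processes as Gaussian fields\<close>

lemma (in prob_space) centered_gaussian_sq_integrable:
  assumes "centered_gaussian M X"
  shows "sq_integrable M X"
proof -
  have X: "X \<in> borel_measurable M" using assms by (simp add: centered_gaussian_def)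
  have "integrable M (\<lambda>w. (X w)\<^sup>2)"
  proof (cases "\<exists>\<sigma>>0. distributed M lborel X (\<lambda>x. ennreal (normal_density 0 \<sigma> x))")
    case True
    then obtain \<sigma> where \<sigma>: "\<sigma> > 0" "distributed M lborel X (\<lambda>x. ennreal (normal_density 0 \<sigma> x))" by blast
    have "integrable lborel (\<lambda>x. normal_density 0 \<sigma> x * x\<^sup>2)" using integrable_normal_moment[OF \<sigma>(1), of 0 2] by simp
    then show ?thesis using distributed_integrable[OF \<sigma>(2), of "\<lambda>x. x\<^sup>2"] by simp
  next
    case False
    then have "AE w in M. X w = 0" using assms unfolding centered_gaussian_def by blast
    then have "AE w in M. 0 = (X w)\<^sup>2" by eventually_elim simp
    then show ?thesis using X by (subst integrable_cong_AE[where g = "\<lambda>_. 0"]) auto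
  qed
  then show ?thesis using X by (simp add: sq_integrable_def)
qed

lemma L2_tendsto_shift:
  assumes "L2_tendsto \<mu> f g"
  shows "\<exists>k. \<forall>n. (\<integral>\<^sup>+x. ennreal ((f (n + k) x - g x)\<^sup>2) \<partial>\<mu>) < \<infinity>"
proof -
  have "\<forall>\<^sub>F n in sequentially. (\<integral>\<^sup>+x. ennreal ((f n x - g x)\<^sup>2) \<partial>\<mu>) < \<infinity>"
    using assms unfolding L2_tendsto_def by (rule order_tendstoD) simp
  then show ?thesis unfolding eventually_sequentially by (metis le_add2)
qed

lemma L2_tendsto_integral:
  assumes "L2_tendsto \<mu> f g" and "\<And>n. sq_integrable \<mu> (f n)" and "sq_integrable \<mu> g"
  shows "(\<lambda>n. \<integral>x. (f n x - g x)\<^sup>2 \<partial>\<mu>) \<longlonglongrightarrow> 0"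
proof -
  have eq: "(\<integral>\<^sup>+x. ennreal ((f n x - g x)\<^sup>2) \<partial>\<mu>) = ennreal (\<integral>x. (f n x - g x)\<^sup>2 \<partial>\<mu>)" for n
    using sq_integrable_diff[OF assms(2)[of n] assms(3)] by (intro nn_integral_eq_integral) (auto simp: sq_integrable_def)
  have "(\<lambda>n. ennreal (\<integral>x. (f n x - g x)\<^sup>2 \<partial>\<mu>)) \<longlonglongrightarrow> ennreal 0"
    using assms(1) by (simp add: L2_tendsto_def eq)
  then show ?thesis by (subst (asm) tendsto_ennreal_iff) auto
qed

text \<open>The process is indexed by functions; choosing a representative of each class of \<open>l2\<close> gives a field \<open>W\<close> over a Hilbert space.\<close>

locale isonormal_process = prob_space M for M :: "'a measure" +
  fixes B :: "(real \<Rightarrow> real) \<Rightarrow> 'a \<Rightarrow> real"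
  assumes isonormal: "isonormal M B"
begin

lemma B_measurable: "sq_integrable lborel h \<Longrightarrow> B h \<in> borel_measurable M"
  using isonormal by (simp add: isonormal_def)

lemma B_covariance:
  "sq_integrable lborel h \<Longrightarrow> sq_integrable lborel g \<Longrightarrow> (\<E> w. B h w * B g w) = (\<integral>x. h x * g x \<partial>lborel)"
  using isonormal by (simp add: isonormal_def)

lemma B_lincomb_gaussian:
  assumes "\<And>i. i < n \<Longrightarrow> sq_integrable lborel (h i)"
  shows "centered_gaussian M (\<lambda>w. \<Sum>i<(n::nat). c i * B (h i) w)"
  using isonormal assms by (simp add: isonormal_def)

lemma B_gaussian: "sq_integrable lborel h \<Longrightarrow> centered_gaussian M (B h)"
  using B_lincomb_gaussian[of 1 "\<lambda>_. h" "\<lambda>_. 1"] by (simp cong: if_cong)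

lemma B_sq_integrable: "sq_integrable lborel h \<Longrightarrow> sq_integrable M (B h)"
  by (intro centered_gaussian_sq_integrable B_gaussian)

text \<open>The covariance identity makes the process linear: the second moment of the left-hand side is the squared norm of the combination.\<close>

lemma B_lincomb_zero:
  assumes h: "\<And>i. i < n \<Longrightarrow> sq_integrable lborel (h i)" and 0: "AE x in lborel. (\<Sum>i<(n::nat). c i * h i x) = 0"
  shows "AE w in M. (\<Sum>i<n. c i * B (h i) w) = 0"
proof -
  let ?X = "\<lambda>w. \<Sum>i<n. c i * B (h i) w"
  have i: "integrable lborel (\<lambda>x. h i x * h j x)" if "i < n" "j < n" for i j by (intro sq_integrable_mult h that)
  have iB: "integrable M (\<lambda>w. B (h i) w * B (h j) w)" if "i < n" "j < n" for i j
    by (intro sq_integrable_mult B_sq_integrable h that)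
  have sq: "sq_integrable M ?X" by (intro sq_integrable_sum sq_integrable_cmult B_sq_integrable h) simp
  have "(\<E> w. (?X w)\<^sup>2) = (\<E> w. \<Sum>i<n. \<Sum>j<n. (c i * c j) * (B (h i) w * B (h j) w))"
    by (simp add: power2_eq_square sum_product mult_ac)
  also have "\<dots> = (\<Sum>i<n. \<Sum>j<n. (c i * c j) * (\<integral>x. h i x * h j x \<partial>lborel))"
  proof -
    have "(\<E> w. \<Sum>i<n. \<Sum>j<n. (c i * c j) * (B (h i) w * B (h j) w))
        = (\<Sum>i<n. \<Sum>j<n. (c i * c j) * (\<E> w. B (h i) w * B (h j) w))"
      by (rule integral_double_sum) (auto intro: iB)
    also have "\<dots> = (\<Sum>i<n. \<Sum>j<n. (c i * c j) * (\<integral>x. h i x * h j x \<partial>lborel))"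
      by (intro sum.cong refl) (simp add: B_covariance h)
    finally show ?thesis .
  qed
  also have "\<dots> = (\<integral>x. (\<Sum>i<n. \<Sum>j<n. (c i * c j) * (h i x * h j x)) \<partial>lborel)"
    by (rule integral_double_sum[symmetric]) (auto intro: i)
  also have "\<dots> = (\<integral>x. (\<Sum>i<n. c i * h i x)\<^sup>2 \<partial>lborel)"
    by (simp add: power2_eq_square sum_product mult_ac)
  also have "\<dots> = (\<integral>(x::real). 0 \<partial>lborel)"
  proof (rule integral_cong_AE)
    have "\<And>i. i < n \<Longrightarrow> h i \<in> borel_measurable lborel" using h by (simp add: sq_integrable_def)
    then show "(\<lambda>x. (\<Sum>i<n. c i * h i x)\<^sup>2) \<in> borel_measurable lborel" by measurable
    show "AE x in lborel. (\<Sum>i<n. c i * h i x)\<^sup>2 = 0" using 0 by eventually_elim simp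
  qed simp
  finally have "(\<E> w. (?X w)\<^sup>2) = 0" by simp
  then have "AE w in M. (?X w)\<^sup>2 = 0"
    using integral_nonneg_eq_0_iff_AE[of M "\<lambda>w. (?X w)\<^sup>2"] sq by (simp add: sq_integrable_def)
  then show ?thesis by eventually_elim simp
qed

lemma B_cong_AE:
  assumes "sq_integrable lborel f" "sq_integrable lborel g" "AE x in lborel. f x = g x"
  shows "AE w in M. B f w = B g w"
proof -
  have "AE w in M. (\<Sum>i<(2::nat). (if i = 0 then 1 else -1) * B (if i = 0 then f else g) w) = 0"
    by (rule B_lincomb_zero) (use assms in \<open>auto simp: numeral_2_eq_2\<close>)
  then show ?thesis by (simp add: numeral_2_eq_2)
qed

abbreviation W :: "l2 \<Rightarrow> 'a \<Rightarrow> real" where "W F \<equiv> B (fun_of F)"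

lemma B_eq_W: "sq_integrable lborel f \<Longrightarrow> AE w in M. B f w = W (l2_of f) w"
  by (rule B_cong_AE) (use fun_of_l2_of[of f] in auto)

lemma W_unit_normal:
  assumes "norm F = 1"
  shows "distributed M lborel (W F) (\<lambda>x. ennreal (std_normal_density x))"
proof -
  have "F \<bullet> F = 1" using assms by (simp add: dot_square_norm)
  then have E: "(\<E> w. (W F w)\<^sup>2) = 1"
    by (simp add: power2_eq_square B_covariance inner_l2_fun_of[symmetric])
  have cg: "centered_gaussian M (W F)" by (rule B_gaussian) simp
  then have [measurable]: "W F \<in> borel_measurable M" by (simp add: centered_gaussian_def)
  have "\<not> (AE w in M. W F w = 0)"
  proof
    assume "AE w in M. W F w = 0"
    then have "(\<E> w. (W F w)\<^sup>2) = (\<E> w. 0)"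
      by (intro integral_cong_AE) auto
    then show False using E by simp
  qed
  then obtain \<sigma> where \<sigma>: "\<sigma> > 0" "distributed M lborel (W F) (\<lambda>x. ennreal (normal_density 0 \<sigma> x))"
    using cg unfolding centered_gaussian_def by blast
  have "\<sigma>\<^sup>2 = 1"
    using normal_distributed_variance[OF \<sigma>] normal_distributed_expectation[OF \<sigma>] E by simp
  then have "\<sigma> = 1" using \<sigma>(1) by (simp add: power2_eq_1_iff)
  then show ?thesis using \<sigma>(2) by simp
qed

sublocale gaussian_field M "\<lambda>F. B (fun_of F)"
proof unfold_locales
  fix f g :: l2 and c :: real
  show "W f \<in> borel_measurable M" by (rule B_measurable) simp
  show "AE w in M. W (f + g) w = W f w + W g w"
  proof -
    have "f + g = l2_of (\<lambda>x. fun_of f x + fun_of g x)" by (simp add: l2_of_add)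
    then have "AE x in lborel. fun_of (f + g) x = fun_of f x + fun_of g x"
      using fun_of_l2_of[of "\<lambda>x. fun_of f x + fun_of g x"] by (simp add: sq_integrable_add)
    then have "AE w in M. (\<Sum>i<(3::nat). (if i = 0 then 1 else -1) * B (if i = 0 then fun_of (f + g) else if i = 1 then fun_of f else fun_of g) w) = 0"
      by (intro B_lincomb_zero) (auto simp: numeral_3_eq_3)
    then show ?thesis by eventually_elim (simp add: numeral_3_eq_3)
  qed
  show "AE w in M. W (c *\<^sub>R f) w = c * W f w"
  proof -
    have "c *\<^sub>R f = l2_of (\<lambda>x. c * fun_of f x)" by (simp add: l2_of_scaleR)
    then have "AE x in lborel. fun_of (c *\<^sub>R f) x = c * fun_of f x"
      using fun_of_l2_of[of "\<lambda>x. c * fun_of f x"] by (simp add: sq_integrable_cmult)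
    then have "AE w in M. (\<Sum>i<(2::nat). (if i = 0 then 1 else - c) * B (if i = 0 then fun_of (c *\<^sub>R f) else fun_of f) w) = 0"
      by (intro B_lincomb_zero) (auto simp: numeral_2_eq_2)
    then show ?thesis by eventually_elim (simp add: numeral_2_eq_2)
  qed
  show "norm f = 1 \<Longrightarrow> distributed M lborel (W f) (\<lambda>x. ennreal (std_normal_density x))" by (rule W_unit_normal)
qed

lemma derW_index:
  "derW h gs w = (\<Sum>j<length gs. (\<Prod>l\<in>{..<length gs} - {j}. W (gs ! l) w) * (h \<bullet> gs ! j))"
proof (induction gs)
  case (Cons g gs)
  have r0: "{..<Suc n} - {0} = Suc ` {..<n}" for n by (auto simp: image_iff less_Suc_eq_0_disj)
  have r1: "{..<Suc n} - {Suc j} = insert 0 (Suc ` ({..<n} - {j}))" for n j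
    by (auto simp: image_iff less_Suc_eq_0_disj)
  have p: "prodW gs w = (\<Prod>l<length gs. W (gs ! l) w)"
    by (simp add: prod.list_conv_set_nth atLeast0LessThan)
  have "(\<Sum>j<Suc (length gs). (\<Prod>l\<in>{..<Suc (length gs)} - {j}. W ((g # gs) ! l) w) * (h \<bullet> (g # gs) ! j))
      = (\<Prod>l<length gs. W (gs ! l) w) * (h \<bullet> g)
        + (\<Sum>j<length gs. (W g w * (\<Prod>l\<in>{..<length gs} - {j}. W (gs ! l) w)) * (h \<bullet> gs ! j))"
    unfolding sum.lessThan_Suc_shift r0 r1
    by (simp add: prod.reindex prod.insert)
  then show ?case by (simp add: Cons p sum_distrib_left mult_ac)
qed simp

lemma prodW_AE:
  assumes "\<And>i. i < n \<Longrightarrow> sq_integrable lborel (hs i)"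
  shows "AE w in M. \<forall>i<(n::nat). B (hs i) w = W (l2_of (hs i)) w"
  unfolding AE_all_countable[symmetric]
  using assms B_eq_W by (simp add: AE_all_countable)

definition l2_poly :: "poly_functional \<Rightarrow> (real \<times> l2 list) list" where
  "l2_poly p = map (\<lambda>(c, hs). (c, map l2_of hs)) p"

definition l2_functional :: "poly_functional \<Rightarrow> bool" where
  "l2_functional p \<longleftrightarrow> (\<forall>(c, hs) \<in> set p. set hs \<subseteq> L2_real)"

lemma l2_functional_simps [simp]:
  "l2_functional []" "l2_functional ((c, hs) # p) \<longleftrightarrow> (\<forall>g\<in>set hs. sq_integrable lborel g) \<and> l2_functional p"
  by (auto simp: l2_functional_def)

lemma poly_fun_eq:
  "l2_functional p \<Longrightarrow> AE w in M. poly_fun B p w = polyW (l2_poly p) w"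
proof (induction p)
  case (Cons a p)
  obtain c hs where a: "a = (c, hs)" by (cases a)
  have "\<forall>g\<in>set hs. sq_integrable lborel g \<Longrightarrow> AE w in M. (\<Prod>h\<leftarrow>hs. B h w) = prodW (map l2_of hs) w"
  proof (induction hs)
    case (Cons g hs)
    have "AE w in M. B g w = W (l2_of g) w" by (rule B_eq_W) (use Cons.prems in simp)
    moreover have "AE w in M. (\<Prod>h\<leftarrow>hs. B h w) = prodW (map l2_of hs) w" using Cons by simp
    ultimately show ?case by eventually_elim simp
  qed simp
  moreover have "AE w in M. poly_fun B p w = polyW (l2_poly p) w" using Cons a by simp
  ultimately have "AE w in M. (\<Prod>h\<leftarrow>hs. B h w) = prodW (map l2_of hs) w \<and> poly_fun B p w = polyW (l2_poly p) w"
    using Cons.prems a by simp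
  then show ?case by eventually_elim (simp add: a poly_fun_def l2_poly_def)
qed (simp add: poly_fun_def l2_poly_def)

lemma poly_deriv_simps:
  "poly_deriv B [] (w, r) = 0"
  "poly_deriv B ((c, hs) # p) (w, r)
    = c * (\<Sum>j<length hs. (\<Prod>l\<in>{..<length hs} - {j}. B (hs ! l) w) * (hs ! j) r) + poly_deriv B p (w, r)"
  by (simp_all add: poly_deriv_def)

lemma poly_deriv_measurable:
  "l2_functional p \<Longrightarrow> poly_deriv B p \<in> borel_measurable (M \<Otimes>\<^sub>M lborel)"
proof (induction p)
  case Nil
  then show ?case by (simp add: poly_deriv_def)
next
  case (Cons a p)
  obtain c hs where a: "a = (c, hs)" by (cases a)
  have [measurable]: "poly_deriv B p \<in> borel_measurable (M \<Otimes>\<^sub>M lborel)" using Cons a by simp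
  have m: "hs ! j \<in> borel_measurable lborel" "B (hs ! j) \<in> borel_measurable M" if "j < length hs" for j
    using Cons.prems that by (auto simp: a sq_integrable_def intro!: B_measurable)
  have "(\<lambda>x. c * (\<Sum>j<length hs. (\<Prod>l\<in>{..<length hs} - {j}. B (hs ! l) (fst x)) * (hs ! j) (snd x)) + poly_deriv B p x)
    \<in> borel_measurable (M \<Otimes>\<^sub>M lborel)"
    by (intro borel_measurable_add borel_measurable_times borel_measurable_const borel_measurable_sum borel_measurable_prod
        measurable_compose[OF measurable_fst m(2)] measurable_compose[OF measurable_snd m(1)] \<open>poly_deriv B p \<in> _\<close>) auto
  moreover have "poly_deriv B (a # p) = (\<lambda>x. c * (\<Sum>j<length hs. (\<Prod>l\<in>{..<length hs} - {j}. B (hs ! l) (fst x)) * (hs ! j) (snd x)) + poly_deriv B p x)"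
    by (rule ext) (auto simp: a poly_deriv_simps split: prod.splits)
  ultimately show ?case by simp
qed

lemma poly_deriv_direction:
  assumes h: "sq_integrable lborel h"
  shows "l2_functional p \<Longrightarrow> AE w in M. integrable lborel (\<lambda>r. h r * poly_deriv B p (w, r)) \<and>
    (\<integral>r. h r * poly_deriv B p (w, r) \<partial>lborel) = polyW (dpoly (l2_of h) (l2_poly p)) w"
proof (induction p)
  case Nil
  then show ?case by (simp add: poly_deriv_simps l2_poly_def)
next
  case (Cons a p)
  obtain c hs where a: "a = (c, hs)" by (cases a)
  have hs: "sq_integrable lborel (hs ! j)" if "j < length hs" for j using Cons.prems a that by simp
  have i: "integrable lborel (\<lambda>r. h r * (hs ! j) r)" if "j < length hs" for j by (rule sq_integrable_mult[OF h hs[OF that]])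
  have "AE w in M. \<forall>j<length hs. B (hs ! j) w = W (l2_of (hs ! j)) w" using prodW_AE[of "length hs" "\<lambda>j. hs ! j"] hs by simp
  moreover have "AE w in M. integrable lborel (\<lambda>r. h r * poly_deriv B p (w, r)) \<and>
    (\<integral>r. h r * poly_deriv B p (w, r) \<partial>lborel) = polyW (dpoly (l2_of h) (l2_poly p)) w" using Cons a by simp
  ultimately show ?case
  proof eventually_elim
    case (elim w)
    let ?P = "\<lambda>j. \<Prod>l\<in>{..<length hs} - {j}. B (hs ! l) w"
    have eq: "h r * poly_deriv B (a # p) (w, r)
        = (\<Sum>j<length hs. (c * ?P j) * (h r * (hs ! j) r)) + h r * poly_deriv B p (w, r)" for r
      by (simp add: a poly_deriv_simps distrib_left sum_distrib_left mult_ac)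
    have i1: "integrable lborel (\<lambda>r. \<Sum>j<length hs. (c * ?P j) * (h r * (hs ! j) r))"
      using i by (intro integrable_sum integrable_mult_right) simp
    have "(\<integral>r. (\<Sum>j<length hs. (c * ?P j) * (h r * (hs ! j) r)) \<partial>lborel)
        = (\<Sum>j<length hs. (c * ?P j) * (l2_of h \<bullet> l2_of (hs ! j)))"
      using i h hs by (subst integral_sum) (auto simp: inner_l2_of)
    also have "\<dots> = c * derW (l2_of h) (map l2_of hs) w"
    proof -
      have "?P j = (\<Prod>l\<in>{..<length hs} - {j}. W (map l2_of hs ! l) w)" for j
        using elim(1) by (intro prod.cong) auto
      then show ?thesis unfolding derW_index by (simp add: sum_distrib_left mult_ac)
    qed
    finally show ?case
      unfolding eq using i1 elim(2) by (simp add: a l2_poly_def)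
  qed
qed

end

section \<open>The directional derivative as a second chaos element\<close>

lemma L2_tendsto_reindex: "L2_tendsto \<mu> f g \<Longrightarrow> L2_tendsto \<mu> (\<lambda>n. f (n + k)) g"
  unfolding L2_tendsto_def by (rule LIMSEQ_ignore_initial_segment)

lemma dir_deriv_eq:
  assumes "admissible h"
  shows "dir_deriv DF h w = (\<integral>r. h r * DF (w, r) \<partial>lborel)"
  unfolding dir_deriv_def set_lebesgue_integral_def
proof (intro integral_cong refl)
  fix r show "indicator {0..1} r *\<^sub>R (h r * DF (w, r)) = h r * DF (w, r)"
    using assms by (cases "h r = 0") (auto simp: admissible_def)
qed

lemma distinct_indices_list: "\<exists>L. set L = distinct_indices q n \<and> distinct L"
  using finite_distinct_list[OF finite_distinct_indices] .

definition index_list :: "nat \<Rightarrow> (nat \<Rightarrow> nat) list" where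
  "index_list n = (SOME L. set L = distinct_indices 3 n \<and> distinct L)"

lemma index_list: "set (index_list n) = distinct_indices 3 n" "distinct (index_list n)"
  using someI_ex[OF distinct_indices_list[of 3 n]] by (auto simp: index_list_def)

definition elem_poly :: "nat \<Rightarrow> (nat \<Rightarrow> real set) \<Rightarrow> ((nat \<Rightarrow> nat) \<Rightarrow> real) \<Rightarrow> (real \<times> l2 list) list" where
  "elem_poly n A a = map (\<lambda>\<iota>. (a \<iota>, map (\<lambda>j. l2_of (indicator (A (\<iota> j)))) [0, 1, 2])) (index_list n)"

text \<open>The derivative of a product of three factors has three terms, one for each slot; so the Wick products are indexed
by the index map and the slot that is differentiated.\<close>

definition chaos_index :: "nat \<Rightarrow> ((nat \<Rightarrow> nat) \<times> nat) set" where
  "chaos_index n = distinct_indices 3 n \<times> {..<3}"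

lemma finite_chaos_index: "finite (chaos_index n)"
  by (simp add: chaos_index_def finite_distinct_indices)

definition chaos_coeff :: "(real \<Rightarrow> real) \<Rightarrow> (nat \<Rightarrow> real set) \<Rightarrow> ((nat \<Rightarrow> nat) \<Rightarrow> real) \<Rightarrow> (nat \<Rightarrow> nat) \<times> nat \<Rightarrow> real" where
  "chaos_coeff h A a = (\<lambda>(\<iota>, t). a \<iota> * (\<integral>r. h r * indicator (A (\<iota> t)) r \<partial>lborel))"

definition chaos_left :: "(nat \<Rightarrow> real set) \<Rightarrow> (nat \<Rightarrow> nat) \<times> nat \<Rightarrow> real \<Rightarrow> real" where
  "chaos_left A = (\<lambda>(\<iota>, t). indicator (A (\<iota> (left_slot t))))"

definition chaos_right :: "(nat \<Rightarrow> real set) \<Rightarrow> (nat \<Rightarrow> nat) \<times> nat \<Rightarrow> real \<Rightarrow> real" where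
  "chaos_right A = (\<lambda>(\<iota>, t). indicator (A (\<iota> (right_slot t))))"

lemma chaos_sq_integrable:
  assumes A: "elem_family n A" and p: "p \<in> chaos_index n"
  shows "sq_integrable lborel (chaos_left A p)" "sq_integrable lborel (chaos_right A p)"
  using p by (auto simp: chaos_left_def chaos_right_def chaos_index_def left_slot_def right_slot_def
      intro!: elem_family_sq_integrable[OF A] elim!: distinct_indices_less)

definition chaos_kernel where
  "chaos_kernel h n A a y z = (\<Sum>p\<in>chaos_index n. chaos_coeff h A a p * (chaos_left A p y * chaos_right A p z))"

lemma chaos_kernel_eq: "chaos_kernel h n A a y z = (\<Sum>t<3. slot_kernel h n A a t y z)"
  unfolding chaos_kernel_def chaos_index_def slot_kernel_def sum.cartesian_product[symmetric]
    chaos_coeff_def chaos_left_def chaos_right_def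
  by (subst sum.swap) (simp add: sum.cartesian_product')

lemma chaos_kernel_sq: "elem_family n A \<Longrightarrow> sq_kernel (chaos_kernel h n A a)"
  unfolding chaos_kernel_def by (rule sq_kernel_tensor_sum) (auto dest: chaos_sq_integrable)

text \<open>The three slots contribute one copy of \<open>k_fun\<close> each, by symmetry of the Hermite kernel. The factor \<open>9\<close> combines the bound for
a sum of three terms with the sum of three equal errors.\<close>

lemma chaos_kernel_error:
  assumes A: "elem_family n A" and h: "admissible h" and H: "1/2 < H" "H < 1"
    and f: "hermite_kernel H c \<in> borel_measurable (leb_pow 3)"
    and E: "(\<integral>\<^sup>+x. ennreal ((elem_fun 3 n A a x - hermite_kernel H c x)\<^sup>2) \<partial>leb_pow 3) = ennreal \<epsilon>" "0 \<le> \<epsilon>"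
  shows "sq_kernel (k_fun H c h)"
    and "kernel_norm2 (\<lambda>y z. chaos_kernel h n A a y z - 3 * k_fun H c h y z) \<le> 9 * (\<integral>r. (h r)\<^sup>2 \<partial>lborel) * \<epsilon>"
proof -
  note err = slot_kernel_error[OF A _ h H f E]
  \<comment> \<open>\<open>k_fun\<close> is an elementary kernel minus the error\<close>
  have "sq_kernel (\<lambda>y z. slot_kernel h n A a 0 y z - (slot_kernel h n A a 0 y z - k_fun H c h y z))"
    by (intro sq_kernel_diff slot_kernel_sq[OF A] err(1)) simp_all
  then show "sq_kernel (k_fun H c h)" by simp
  define \<kappa> where "\<kappa> t y z = slot_kernel h n A a t y z - k_fun H c h y z" for t y z
  have \<kappa>: "sq_kernel (\<kappa> t)" "kernel_norm2 (\<kappa> t) \<le> (\<integral>r. (h r)\<^sup>2 \<partial>lborel) * \<epsilon>" if "t \<in> {..<3}" for t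
    using err[of t] that by (simp_all add: \<kappa>_def[abs_def])
  have "chaos_kernel h n A a y z - 3 * k_fun H c h y z = (\<Sum>t\<in>{..<3}. \<kappa> t y z)" for y z
    by (simp add: chaos_kernel_eq \<kappa>_def sum_subtractf)
  then have "kernel_norm2 (\<lambda>y z. chaos_kernel h n A a y z - 3 * k_fun H c h y z) = kernel_norm2 (\<lambda>y z. \<Sum>t\<in>{..<3}. \<kappa> t y z)"
    by (simp only:)
  also have "\<dots> \<le> real (card {..<3::nat}) * (\<Sum>t\<in>{..<3}. kernel_norm2 (\<kappa> t))"
    by (rule kernel_norm2_sum_le[OF \<kappa>(1)])
  also have "\<dots> \<le> real (card {..<3::nat}) * (\<Sum>t<(3::nat). (\<integral>r. (h r)\<^sup>2 \<partial>lborel) * \<epsilon>)"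
    by (rule mult_left_mono[OF sum_mono[OF \<kappa>(2)]]) simp_all
  also have "\<dots> = 9 * (\<integral>r. (h r)\<^sup>2 \<partial>lborel) * \<epsilon>" by simp
  finally show "kernel_norm2 (\<lambda>y z. chaos_kernel h n A a y z - 3 * k_fun H c h y z) \<le> 9 * (\<integral>r. (h r)\<^sup>2 \<partial>lborel) * \<epsilon>" .
qed

context isonormal_process
begin

lemma section_inner_bound:
  assumes h: "sq_integrable lborel h" and \<psi>: "sq_integrable (M \<Otimes>\<^sub>M lborel) \<psi>"
  shows "AE w in M. integrable lborel (\<lambda>r. h r * \<psi> (w, r))"
    and "sq_integrable M (\<lambda>w. \<integral>r. h r * \<psi> (w, r) \<partial>lborel)"
    and "(\<integral>\<^sup>+w. ennreal ((\<integral>r. h r * \<psi> (w, r) \<partial>lborel)\<^sup>2) \<partial>M)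
      \<le> ennreal (\<integral>r. (h r)\<^sup>2 \<partial>lborel) * (\<integral>\<^sup>+x. ennreal ((\<psi> x)\<^sup>2) \<partial>(M \<Otimes>\<^sub>M lborel))"
proof -
  let ?N = "\<integral>\<^sup>+x. ennreal ((\<psi> x)\<^sup>2) \<partial>(M \<Otimes>\<^sub>M lborel)"
  let ?n = "\<integral>r. (h r)\<^sup>2 \<partial>lborel"
  have [measurable]: "h \<in> borel_measurable borel" using h by (simp add: sq_integrable_def)
  have \<psi>m [measurable]: "\<psi> \<in> borel_measurable (M \<Otimes>\<^sub>M lborel)" using \<psi> by (simp add: sq_integrable_def)
  let ?J = "\<lambda>w. \<integral>\<^sup>+r. ennreal ((\<psi> (w, r))\<^sup>2) \<partial>lborel"
  let ?Q = "\<lambda>w. \<integral>r. h r * \<psi> (w, r) \<partial>lborel"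
  have J: "(\<integral>\<^sup>+w. ?J w \<partial>M) = ?N"
    by (rule lborel.nn_integral_fst) measurable
  have fin: "?N < \<infinity>" using \<psi> by (simp add: sq_integrable_iff_nn_integral)
  have "AE w in M. ?J w \<noteq> \<infinity>" by (rule nn_integral_PInf_AE) (use J fin in auto)
  then have sec: "AE w in M. sq_integrable lborel (\<lambda>r. \<psi> (w, r))"
  proof (rule AE_mp, intro AE_I2 impI)
    fix w assume "w \<in> space M" "?J w \<noteq> \<infinity>"
    then show "sq_integrable lborel (\<lambda>r. \<psi> (w, r))" by (simp add: sq_integrable_iff_nn_integral less_top)
  qed
  then show "AE w in M. integrable lborel (\<lambda>r. h r * \<psi> (w, r))"
    by eventually_elim (rule sq_integrable_mult[OF h])
  have Qm: "?Q \<in> borel_measurable M" by measurable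
  have "(\<integral>\<^sup>+w. ennreal ((?Q w)\<^sup>2) \<partial>M) \<le> (\<integral>\<^sup>+w. ennreal ?n * ?J w \<partial>M)"
  proof (rule nn_integral_mono_AE, use sec in eventually_elim)
    fix w assume s: "sq_integrable lborel (\<lambda>r. \<psi> (w, r))"
    have "ennreal ((?Q w)\<^sup>2) \<le> ennreal ?n * ennreal (\<integral>r. (\<psi> (w, r))\<^sup>2 \<partial>lborel)"
      using square_integral_mult_le[OF h s] by (simp add: ennreal_mult[symmetric])
    also have "ennreal (\<integral>r. (\<psi> (w, r))\<^sup>2 \<partial>lborel) = ?J w"
      using s by (intro nn_integral_eq_integral[symmetric]) (auto simp: sq_integrable_def)
    finally show "ennreal ((?Q w)\<^sup>2) \<le> ennreal ?n * ?J w" .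
  qed
  also have "\<dots> = ennreal ?n * ?N"
    unfolding J[symmetric] by (rule nn_integral_cmult) measurable
  finally show bound: "(\<integral>\<^sup>+w. ennreal ((?Q w)\<^sup>2) \<partial>M)
      \<le> ennreal ?n * ?N" .
  have "\<dots> < \<infinity>" using fin by (simp add: ennreal_mult_less_top)
  then show "sq_integrable M ?Q"
    unfolding sq_integrable_iff_nn_integral using Qm le_less_trans[OF bound] by blast
qed

lemma dir_deriv_sq_integrable:
  assumes "admissible h" and "sq_integrable (M \<Otimes>\<^sub>M lborel) DF"
  shows "sq_integrable M (dir_deriv DF h)"
  unfolding dir_deriv_eq[OF assms(1), abs_def]
  by (rule section_inner_bound(2)[OF admissible_sq_integrable[OF assms(1)] assms(2)])

lemma dir_deriv_tendsto:
  assumes h: "admissible h" and DF: "sq_integrable (M \<Otimes>\<^sub>M lborel) DF"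
    and p: "\<And>n. l2_functional (p n)" and lim: "L2_tendsto (M \<Otimes>\<^sub>M lborel) (\<lambda>n. poly_deriv B (p n)) DF"
    and fin: "\<And>n. (\<integral>\<^sup>+x. ennreal ((poly_deriv B (p n) x - DF x)\<^sup>2) \<partial>(M \<Otimes>\<^sub>M lborel)) < \<infinity>"
  shows "(\<lambda>n. (\<E> w. (polyW (dpoly (l2_of h) (l2_poly (p n))) w - dir_deriv DF h w)\<^sup>2)) \<longlonglongrightarrow> 0"
proof (rule L2_tendsto_integral[OF _ all_moments_sq_integrable[OF all_moments_polyW] dir_deriv_sq_integrable[OF h DF]])
  let ?E = "\<lambda>n. \<integral>\<^sup>+x. ennreal ((poly_deriv B (p n) x - DF x)\<^sup>2) \<partial>(M \<Otimes>\<^sub>M lborel)"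
  let ?h = "ennreal (\<integral>r. (h r)\<^sup>2 \<partial>lborel)"
  have hs: "sq_integrable lborel h" by (rule admissible_sq_integrable[OF h])
  have le: "(\<integral>\<^sup>+w. ennreal ((polyW (dpoly (l2_of h) (l2_poly (p n))) w - dir_deriv DF h w)\<^sup>2) \<partial>M) \<le> ?h * ?E n" for n
  proof -
    define \<psi> where "\<psi> x = poly_deriv B (p n) x - DF x" for x
    have \<psi>: "sq_integrable (M \<Otimes>\<^sub>M lborel) \<psi>"
      unfolding sq_integrable_iff_nn_integral \<psi>_def
      using fin[of n] borel_measurable_diff[OF poly_deriv_measurable[OF p, of n], of DF] DF by (simp add: sq_integrable_def)
    have "AE w in M. polyW (dpoly (l2_of h) (l2_poly (p n))) w - dir_deriv DF h w = (\<integral>r. h r * \<psi> (w, r) \<partial>lborel)"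
      using poly_deriv_direction[OF hs p[of n]] section_inner_bound(1)[OF hs DF]
      by eventually_elim (simp add: \<psi>_def right_diff_distrib dir_deriv_eq[OF h])
    then have "(\<integral>\<^sup>+w. ennreal ((polyW (dpoly (l2_of h) (l2_poly (p n))) w - dir_deriv DF h w)\<^sup>2) \<partial>M)
        = (\<integral>\<^sup>+w. ennreal ((\<integral>r. h r * \<psi> (w, r) \<partial>lborel)\<^sup>2) \<partial>M)"
      by (intro nn_integral_cong_AE) (auto elim: eventually_mono)
    also have "\<dots> \<le> ?h * (\<integral>\<^sup>+x. ennreal ((\<psi> x)\<^sup>2) \<partial>(M \<Otimes>\<^sub>M lborel))" by (rule section_inner_bound(3)[OF hs \<psi>])
    finally show ?thesis by (simp only: \<psi>_def)
  qed
  have "(\<lambda>n. ?h * ?E n) \<longlonglongrightarrow> ?h * 0"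
    using lim by (intro tendsto_mult_ennreal tendsto_const) (auto simp: L2_tendsto_def)
  then have 0: "(\<lambda>n. ?h * ?E n) \<longlonglongrightarrow> 0" by simp
  show "L2_tendsto M (\<lambda>n. polyW (dpoly (l2_of h) (l2_poly (p n)))) (dir_deriv DF h)"
    unfolding L2_tendsto_def
    by (rule tendsto_sandwich[OF _ _ tendsto_const 0]) (auto intro!: always_eventually le)
qed

lemma polyW_map_sum:
  assumes "distinct L"
  shows "polyW (map (\<lambda>\<iota>. (a \<iota>, G \<iota>)) L) w = (\<Sum>\<iota>\<in>set L. a \<iota> * prodW (G \<iota>) w)"
    and "polyW (dpoly h (map (\<lambda>\<iota>. (a \<iota>, G \<iota>)) L)) w = (\<Sum>\<iota>\<in>set L. a \<iota> * derW h (G \<iota>) w)"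
  using assms by (induction L) auto

lemma elem_integral_eq:
  assumes A: "elem_family n A"
  shows "AE w in M. elem_integral B 3 n A a w = polyW (elem_poly n A a) w"
proof -
  have "AE w in M. \<forall>i<n. B (indicator (A i)) w = W (l2_of (indicator (A i))) w"
    by (rule prodW_AE) (rule elem_family_sq_integrable[OF A])
  then show ?thesis
  proof eventually_elim
    case (elim w)
    have "(\<Prod>j<3. B (indicator (A (\<iota> j))) w) = prodW (map (\<lambda>j. l2_of (indicator (A (\<iota> j)))) [0, 1, 2]) w"
      if \<iota>: "\<iota> \<in> distinct_indices 3 n" for \<iota>
      using elim distinct_indices_less[OF \<iota>, of 0] distinct_indices_less[OF \<iota>, of 1] distinct_indices_less[OF \<iota>, of 2]
      by (simp add: numeral_3_eq_3 numeral_2_eq_2 mult_ac)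
    then show ?case
      unfolding elem_integral_def elem_poly_def polyW_map_sum(1)[OF index_list(2)] index_list(1)
      by (intro sum.cong refl) simp
  qed
qed

text \<open>Disjointness of the sets makes the two remaining factors orthogonal, so their product is already a Wick product.\<close>

lemma elem_poly_deriv:
  assumes A: "elem_family n A" and h: "sq_integrable lborel h"
  shows "polyW (dpoly (l2_of h) (elem_poly n A a)) w
    = (\<Sum>p\<in>chaos_index n. chaos_coeff h A a p * wick (l2_of (chaos_left A p)) (l2_of (chaos_right A p)) w)"
proof -
  have der: "a \<iota> * derW (l2_of h) (map (\<lambda>j. l2_of (indicator (A (\<iota> j)))) [0, 1, 2]) w
      = (\<Sum>t<3. chaos_coeff h A a (\<iota>, t) * wick (l2_of (chaos_left A (\<iota>, t))) (l2_of (chaos_right A (\<iota>, t))) w)"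
    if \<iota>: "\<iota> \<in> distinct_indices 3 n" for \<iota>
  proof -
    define x where "x j = l2_of (indicator (A (\<iota> j)) :: real \<Rightarrow> real)" for j
    have sq: "sq_integrable lborel (indicator (A (\<iota> j)) :: real \<Rightarrow> real)" if "j < 3" for j
      by (rule elem_family_sq_integrable[OF A distinct_indices_less[OF \<iota> that]])
    have coeff: "chaos_coeff h A a (\<iota>, t) = a \<iota> * (l2_of h \<bullet> x t)" if "t < 3" for t
      unfolding x_def chaos_coeff_def using inner_l2_of[OF h sq[OF that]] by simp
    have orth: "x i \<bullet> x j = 0" if ij: "i < 3" "j < 3" "i \<noteq> j" for i j
    proof -
      have "\<iota> i \<noteq> \<iota> j" using \<iota> ij by (auto simp: distinct_indices_def inj_on_def)
      then have "A (\<iota> i) \<inter> A (\<iota> j) = {}"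
        using A distinct_indices_less[OF \<iota> ij(1)] distinct_indices_less[OF \<iota> ij(2)]
        by (auto simp: elem_family_def disjoint_family_on_def)
      then have "indicator (A (\<iota> i)) r * indicator (A (\<iota> j)) r = (0::real)" for r by (auto simp: indicator_def)
      then show ?thesis unfolding x_def inner_l2_of[OF sq[OF ij(1)] sq[OF ij(2)]] by (simp only: integral_zero)
    qed
    have w: "wick (l2_of (chaos_left A (\<iota>, t))) (l2_of (chaos_right A (\<iota>, t))) w
        = W (x (left_slot t)) w * W (x (right_slot t)) w" if "t < 3" for t
    proof -
      have "x (left_slot t) \<bullet> x (right_slot t) = 0" by (rule orth) (use that in \<open>auto simp: left_slot_def right_slot_def\<close>)
      then show ?thesis unfolding wick_def chaos_left_def chaos_right_def x_def prod.case by simp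
    qed
    have "derW (l2_of h) [x 0, x 1, x 2] w = (\<Sum>t<3. (l2_of h \<bullet> x t) * (W (x (left_slot t)) w * W (x (right_slot t)) w))"
      by (simp add: lessThan_3 left_slot_def right_slot_def algebra_simps)
    then have "a \<iota> * derW (l2_of h) [x 0, x 1, x 2] w
        = (\<Sum>t<3. (a \<iota> * (l2_of h \<bullet> x t)) * (W (x (left_slot t)) w * W (x (right_slot t)) w))"
      by (simp only: sum_distrib_left mult.assoc)
    also have "\<dots> = (\<Sum>t<3. chaos_coeff h A a (\<iota>, t) * wick (l2_of (chaos_left A (\<iota>, t))) (l2_of (chaos_right A (\<iota>, t))) w)"
      by (intro sum.cong refl) (simp only: coeff w lessThan_iff)
    finally show ?thesis by (simp only: x_def list.map)
  qed
  show ?thesis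
    unfolding elem_poly_def polyW_map_sum(2)[OF index_list(2)] index_list(1) chaos_index_def sum.cartesian_product'
    by (intro sum.cong refl der)
qed

lemma wick_sum_diff_le:
  fixes f g :: "'i \<Rightarrow> real \<Rightarrow> real" and f' g' :: "'j \<Rightarrow> real \<Rightarrow> real"
  assumes fin: "finite I" "finite J"
    and f: "\<And>p. p \<in> I \<Longrightarrow> sq_integrable lborel (f p)" "\<And>p. p \<in> I \<Longrightarrow> sq_integrable lborel (g p)"
    and f': "\<And>p. p \<in> J \<Longrightarrow> sq_integrable lborel (f' p)" "\<And>p. p \<in> J \<Longrightarrow> sq_integrable lborel (g' p)"
  shows "(\<E> w. ((\<Sum>p\<in>I. m p * wick (l2_of (f p)) (l2_of (g p)) w) - (\<Sum>p\<in>J. m' p * wick (l2_of (f' p)) (l2_of (g' p)) w))\<^sup>2)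
    \<le> 2 * kernel_norm2 (\<lambda>y z. (\<Sum>p\<in>I. m p * (f p y * g p z)) - (\<Sum>p\<in>J. m' p * (f' p y * g' p z)))"
proof -
  define mm where "mm = case_sum m (\<lambda>q. - m' q)"
  define ff where "ff = case_sum f f'"
  define gg where "gg = case_sum g g'"
  have 1: "(\<Sum>p\<in>I <+> J. mm p * wick (l2_of (ff p)) (l2_of (gg p)) w)
      = (\<Sum>p\<in>I. m p * wick (l2_of (f p)) (l2_of (g p)) w) - (\<Sum>p\<in>J. m' p * wick (l2_of (f' p)) (l2_of (g' p)) w)" for w
    using fin by (simp add: sum.Plus mm_def ff_def gg_def comp_def sum_negf)
  have 2: "(\<Sum>p\<in>I <+> J. mm p * (ff p y * gg p z))
      = (\<Sum>p\<in>I. m p * (f p y * g p z)) - (\<Sum>p\<in>J. m' p * (f' p y * g' p z))" for y z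
    using fin by (simp add: sum.Plus mm_def ff_def gg_def comp_def sum_negf)
  have "(\<E> w. (\<Sum>p\<in>I <+> J. mm p * wick (l2_of (ff p)) (l2_of (gg p)) w)\<^sup>2)
    \<le> 2 * kernel_norm2 (\<lambda>y z. \<Sum>p\<in>I <+> J. mm p * (ff p y * gg p z))"
    by (rule wick_sum_le_kernel_norm2[OF gaussian_field_axioms])
       (use fin f f' in \<open>auto simp: ff_def gg_def\<close>)
  then show ?thesis unfolding 1 2 .
qed

text \<open>The beginning of the sequence is dropped so that all errors are finite and can be written as real numbers \<open>r\<close>.\<close>

lemma elementary_approximation:
  assumes wi: "is_wiener_ito M B 3 f F"
  shows "\<exists>n A a r. (\<forall>k. elem_family (n k) (A k)) \<and>
    (\<forall>k. (\<integral>\<^sup>+x. ennreal ((elem_fun 3 (n k) (A k) (a k) x - f x)\<^sup>2) \<partial>leb_pow 3) = ennreal (r k) \<and> 0 \<le> r k) \<and>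
    r \<longlonglongrightarrow> 0 \<and> (\<lambda>k. (\<E> w. (polyW (elem_poly (n k) (A k) (a k)) w - F w)\<^sup>2)) \<longlonglongrightarrow> 0"
proof -
  obtain n A a where A: "\<And>k. elem_family (n k) (A k)"
    and L: "L2_tendsto (leb_pow 3) (\<lambda>k. elem_fun 3 (n k) (A k) (a k)) f"
    and LM: "L2_tendsto M (\<lambda>k. elem_integral B 3 (n k) (A k) (a k)) F" and F: "sq_integrable M F"
    using wi unfolding is_wiener_ito_def by blast
  let ?E = "\<lambda>k. \<integral>\<^sup>+x. ennreal ((elem_fun 3 (n k) (A k) (a k) x - f x)\<^sup>2) \<partial>leb_pow 3"
  obtain K where K: "\<And>k. ?E (k + K) < \<infinity>" using L2_tendsto_shift[OF L] by blast
  define r where "r k = enn2real (?E (k + K))" for k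
  have r: "?E (k + K) = ennreal (r k)" for k unfolding r_def using K[of k] by (simp add: less_top)
  have r0: "0 \<le> r k" for k by (simp add: r_def)
  have "(\<lambda>k. ennreal (r k)) \<longlonglongrightarrow> ennreal 0"
    using L2_tendsto_reindex[OF L, of K] unfolding L2_tendsto_def r by simp
  then have rlim: "r \<longlonglongrightarrow> 0" by (subst (asm) tendsto_ennreal_iff) (auto simp: r0)
  have "(\<integral>\<^sup>+w. ennreal ((elem_integral B 3 (n k) (A k) (a k) w - F w)\<^sup>2) \<partial>M)
      = (\<integral>\<^sup>+w. ennreal ((polyW (elem_poly (n k) (A k) (a k)) w - F w)\<^sup>2) \<partial>M)" for k
    using elem_integral_eq[OF A[of k], of "a k"] by (intro nn_integral_cong_AE) (auto elim: eventually_mono)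
  then have "L2_tendsto M (\<lambda>k. polyW (elem_poly (n k) (A k) (a k))) F" using LM unfolding L2_tendsto_def by simp
  from L2_tendsto_integral[OF L2_tendsto_reindex[OF this, of K] all_moments_sq_integrable[OF all_moments_polyW] F]
  have "(\<lambda>k. (\<E> w. (polyW (elem_poly (n (k + K)) (A (k + K)) (a (k + K))) w - F w)\<^sup>2)) \<longlonglongrightarrow> 0" .
  then show ?thesis using A r r0 rlim
    by (intro exI[of _ "\<lambda>k. n (k + K)"] exI[of _ "\<lambda>k. A (k + K)"] exI[of _ "\<lambda>k. a (k + K)"] exI[of _ r] conjI allI)
qed

lemma chaos_kernel_tendsto:
  assumes A: "\<And>k. elem_family (n k) (A k)" and h: "admissible h" and H: "1/2 < H" "H < 1"
    and f: "hermite_kernel H c \<in> borel_measurable (leb_pow 3)"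
    and E: "\<And>k. (\<integral>\<^sup>+x. ennreal ((elem_fun 3 (n k) (A k) (a k) x - hermite_kernel H c x)\<^sup>2) \<partial>leb_pow 3) = ennreal (r k)"
      "\<And>k. 0 \<le> r k" and r: "r \<longlonglongrightarrow> 0"
  shows "(\<lambda>k. kernel_norm2 (\<lambda>y z. chaos_kernel h (n k) (A k) (a k) y z - 3 * k_fun H c h y z)) \<longlonglongrightarrow> 0"
proof (rule tendsto_sandwich[OF _ _ tendsto_const])
  show "(\<lambda>k. 9 * (\<integral>r. (h r)\<^sup>2 \<partial>lborel) * r k) \<longlonglongrightarrow> 0" using tendsto_mult_right_zero[OF r] .
  show "\<forall>\<^sub>F k in sequentially. kernel_norm2 (\<lambda>y z. chaos_kernel h (n k) (A k) (a k) y z - 3 * k_fun H c h y z) \<le> 9 * (\<integral>r. (h r)\<^sup>2 \<partial>lborel) * r k"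
    by (intro always_eventually allI) (rule chaos_kernel_error(2)[OF A h H f E])
qed (simp add: kernel_norm2_nonneg)

lemma l2_op_chaos_kernel:
  assumes A: "elem_family n A"
  shows "l2_op (chaos_kernel h n A a) F
      = (\<Sum>p\<in>chaos_index n. (chaos_coeff h A a p * (l2_of (chaos_right A p) \<bullet> F)) *\<^sub>R l2_of (chaos_left A p))"
    and "l2_op (\<lambda>y z. chaos_kernel h n A a z y) F
      = (\<Sum>p\<in>chaos_index n. (chaos_coeff h A a p * (l2_of (chaos_left A p) \<bullet> F)) *\<^sub>R l2_of (chaos_right A p))"
proof -
  note sq = chaos_sq_integrable[OF A]
  show "l2_op (chaos_kernel h n A a) F
      = (\<Sum>p\<in>chaos_index n. (chaos_coeff h A a p * (l2_of (chaos_right A p) \<bullet> F)) *\<^sub>R l2_of (chaos_left A p))"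
    using l2_op_tensor_sum[of "chaos_index n" "chaos_left A" "chaos_right A" "chaos_coeff h A a" F] sq
    unfolding chaos_kernel_def[abs_def] by simp
  have "(\<lambda>y z. chaos_kernel h n A a z y) = (\<lambda>y z. \<Sum>p\<in>chaos_index n. chaos_coeff h A a p * (chaos_right A p y * chaos_left A p z))"
    by (simp add: chaos_kernel_def mult.commute mult.left_commute)
  then show "l2_op (\<lambda>y z. chaos_kernel h n A a z y) F
      = (\<Sum>p\<in>chaos_index n. (chaos_coeff h A a p * (l2_of (chaos_left A p) \<bullet> F)) *\<^sub>R l2_of (chaos_right A p))"
    using l2_op_tensor_sum[of "chaos_index n" "chaos_right A" "chaos_left A" "chaos_coeff h A a" F] sq by simp
qed

lemma l2_op_cmult: "sq_kernel k \<Longrightarrow> l2_op (\<lambda>y z. a * k y z) F = a *\<^sub>R l2_op k F"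
  using l2_op_lincomb[of k k a 0 F] by simp

lemma hermite_operator:
  assumes H: "1/2 < H" "H < 1" and wi: "is_wiener_ito M B 3 (hermite_kernel H c) F" and h: "admissible h"
  shows "sq_kernel (k_fun H c h)" and "finite_rank_approx (l2_op (k_fun H c h))"
    and "\<exists>l e. spectral_seq (l2_op (k_fun H c h)) l e"
    and "spectral_seq (l2_op (k_fun H c h)) l e \<Longrightarrow> singular_value (k_fun H c h) N = \<bar>l (N - 1)\<bar>"
proof -
  have f: "hermite_kernel H c \<in> borel_measurable (leb_pow 3)" using wi by (simp add: is_wiener_ito_def sq_integrable_def)
  obtain n A a r where A: "\<And>k. elem_family (n k) (A k)"
    and E: "\<And>k. (\<integral>\<^sup>+x. ennreal ((elem_fun 3 (n k) (A k) (a k) x - hermite_kernel H c x)\<^sup>2) \<partial>leb_pow 3) = ennreal (r k)"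
      "\<And>k. 0 \<le> r k" and r: "r \<longlonglongrightarrow> 0"
    using elementary_approximation[OF wi] by blast
  show k: "sq_kernel (k_fun H c h)" by (rule chaos_kernel_error(1)[OF A h H f E])
  have k3: "sq_kernel (\<lambda>y z. 3 * k_fun H c h y z)" by (rule sq_kernel_cmult[OF k])
  have fr3: "finite_rank_approx (l2_op (\<lambda>y z. 3 * k_fun H c h y z))"
    by (rule l2_op_finite_rank_approx[OF k3 finite_chaos_index chaos_sq_integrable[OF A] chaos_kernel_tendsto[OF A h H f E r, unfolded chaos_kernel_def]])
  \<comment> \<open>the elementary kernels approximate \<open>3 k\<^sub>h\<close>, so their operators have to be divided by \<open>3\<close>\<close>
  show fr: "finite_rank_approx (l2_op (k_fun H c h))"
    unfolding finite_rank_approx_def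
  proof (intro allI impI)
    fix \<epsilon> :: real assume "\<epsilon> > 0"
    then obtain n :: nat and u v where "\<And>x. norm (l2_op (\<lambda>y z. 3 * k_fun H c h y z) x - (\<Sum>i<n. (u i \<bullet> x) *\<^sub>R v i)) \<le> (3 * \<epsilon>) * norm x"
      using fr3[unfolded finite_rank_approx_def, rule_format, of "3 * \<epsilon>"] by auto
    then have *: "norm (3 *\<^sub>R l2_op (k_fun H c h) x - (\<Sum>i<n. (u i \<bullet> x) *\<^sub>R v i)) \<le> (3 * \<epsilon>) * norm x" for x
      by (simp add: l2_op_cmult[OF k])
    have "norm (l2_op (k_fun H c h) x - (\<Sum>i<n. (u i \<bullet> x) *\<^sub>R ((1/3) *\<^sub>R v i))) \<le> \<epsilon> * norm x" for x
    proof -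
      have "l2_op (k_fun H c h) x - (\<Sum>i<n. (u i \<bullet> x) *\<^sub>R ((1/3) *\<^sub>R v i))
          = (1/3) *\<^sub>R (3 *\<^sub>R l2_op (k_fun H c h) x - (\<Sum>i<n. (u i \<bullet> x) *\<^sub>R v i))"
        by (simp add: scaleR_diff_right scaleR_sum_right mult.commute)
      then show ?thesis using *[of x] by simp
    qed
    then show "\<exists>(n::nat) u v. \<forall>x. norm (l2_op (k_fun H c h) x - (\<Sum>i<n. (u i \<bullet> x) *\<^sub>R v i)) \<le> \<epsilon> * norm x"
      by (intro exI[of _ n] exI[of _ u] exI[of _ "\<lambda>i. (1/3) *\<^sub>R v i"] allI)
  qed
  have sa: "l2_op (k_fun H c h) G \<bullet> G' = G \<bullet> l2_op (k_fun H c h) G'" for G G'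
    by (rule l2_op_selfadjoint[OF k k_fun_sym])
  show "\<exists>l e. spectral_seq (l2_op (k_fun H c h)) l e"
    by (rule spectral_seq_exists[OF bounded_linear_l2_op[OF k] sa fr])
  show "singular_value (k_fun H c h) N = \<bar>l (N - 1)\<bar>" if "spectral_seq (l2_op (k_fun H c h)) l e"
    by (rule singular_value_spectral[OF k k_fun_sym sa that])
qed

text \<open>Linearity is immediate for the elementary kernels and passes to the limit.\<close>

lemma hermite_operator_linear:
  assumes H: "1/2 < H" "H < 1" and wi: "is_wiener_ito M B 3 (hermite_kernel H c) F"
    and h: "\<And>i. i \<in> I \<Longrightarrow> admissible (h i)"
  shows "l2_op (k_fun H c (\<lambda>r. \<Sum>i\<in>I. u i * h i r)) G = (\<Sum>i\<in>I. u i *\<^sub>R l2_op (k_fun H c (h i)) G)"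
proof -
  have f: "hermite_kernel H c \<in> borel_measurable (leb_pow 3)" using wi by (simp add: is_wiener_ito_def sq_integrable_def)
  obtain n A a r where A: "\<And>k. elem_family (n k) (A k)"
    and E: "\<And>k. (\<integral>\<^sup>+x. ennreal ((elem_fun 3 (n k) (A k) (a k) x - hermite_kernel H c x)\<^sup>2) \<partial>leb_pow 3) = ennreal (r k)"
      "\<And>k. 0 \<le> r k" and r: "r \<longlonglongrightarrow> 0"
    using elementary_approximation[OF wi] by blast
  let ?hu = "\<lambda>r. \<Sum>i\<in>I. u i * h i r"
  have lim: "(\<lambda>k. l2_op (chaos_kernel g (n k) (A k) (a k)) G) \<longlonglongrightarrow> 3 *\<^sub>R l2_op (k_fun H c g) G" if g: "admissible g" for g
  proof -
    have k: "sq_kernel (k_fun H c g)" by (rule hermite_operator(1)[OF H wi g])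
    show ?thesis
      using l2_op_tendsto[OF sq_kernel_cmult[OF k] chaos_kernel_sq[OF A] chaos_kernel_tendsto[OF A g H f E r], of G]
      by (simp add: l2_op_cmult[OF k])
  qed
  have coeff: "chaos_coeff ?hu (A k) (a k) p = (\<Sum>i\<in>I. u i * chaos_coeff (h i) (A k) (a k) p)" if p: "p \<in> chaos_index (n k)" for k p
  proof -
    obtain \<iota> t where p': "p = (\<iota>, t)" by (cases p)
    have \<iota>: "\<iota> \<in> distinct_indices 3 (n k)" "t < 3" using p by (auto simp: p' chaos_index_def)
    have i: "integrable lborel (\<lambda>r. h i r * indicator (A k (\<iota> t)) r)" if "i \<in> I" for i
      by (intro sq_integrable_mult admissible_sq_integrable h that elem_family_sq_integrable[OF A] distinct_indices_less[OF \<iota>])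
    have "(\<integral>r. ?hu r * indicator (A k (\<iota> t)) r \<partial>lborel) = (\<integral>r. (\<Sum>i\<in>I. u i * (h i r * indicator (A k (\<iota> t)) r)) \<partial>lborel)"
      by (simp only: sum_distrib_right mult.assoc)
    also have "\<dots> = (\<Sum>i\<in>I. (\<integral>r. u i * (h i r * indicator (A k (\<iota> t)) r) \<partial>lborel))"
      by (intro integral_sum integrable_mult_right i)
    finally show ?thesis by (simp add: p' chaos_coeff_def sum_distrib_left mult_ac)
  qed
  have "l2_op (chaos_kernel ?hu (n k) (A k) (a k)) G = (\<Sum>i\<in>I. u i *\<^sub>R l2_op (chaos_kernel (h i) (n k) (A k) (a k)) G)" for k
  proof -
    have "l2_op (chaos_kernel ?hu (n k) (A k) (a k)) G
      = (\<Sum>p\<in>chaos_index (n k). (\<Sum>i\<in>I. (u i * (chaos_coeff (h i) (A k) (a k) p * (l2_of (chaos_right (A k) p) \<bullet> G))) *\<^sub>R l2_of (chaos_left (A k) p)))"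
      unfolding l2_op_chaos_kernel(1)[OF A]
      by (intro sum.cong refl) (simp add: coeff sum_distrib_right scaleR_sum_left mult.assoc)
    also have "\<dots> = (\<Sum>i\<in>I. \<Sum>p\<in>chaos_index (n k). (u i * (chaos_coeff (h i) (A k) (a k) p * (l2_of (chaos_right (A k) p) \<bullet> G))) *\<^sub>R l2_of (chaos_left (A k) p))"
      by (rule sum.swap)
    finally show ?thesis unfolding l2_op_chaos_kernel(1)[OF A] by (simp add: scaleR_sum_right)
  qed
  then have "(\<lambda>k. l2_op (chaos_kernel ?hu (n k) (A k) (a k)) G) \<longlonglongrightarrow> (\<Sum>i\<in>I. u i *\<^sub>R (3 *\<^sub>R l2_op (k_fun H c (h i)) G))"
    by (simp only:) (intro tendsto_intros lim h)
  from LIMSEQ_unique[OF lim[OF admissible_sum[OF h]] this]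
  have "3 *\<^sub>R l2_op (k_fun H c ?hu) G = 3 *\<^sub>R (\<Sum>i\<in>I. u i *\<^sub>R l2_op (k_fun H c (h i)) G)"
    by (simp add: scaleR_sum_right mult.commute)
  then show ?thesis by simp
qed

text \<open>The derivatives \<open>Y\<close> of the elementary integrals converge to \<open>D\<^sub>h F\<close>, and their kernels to \<open>3 k\<^sub>h\<close>; the second chaos
bound applies with the eigenvalues \<open>3 \<theta> l j\<close>.\<close>

theorem dir_deriv_char_bound:
  assumes H: "1/2 < H" "H < 1" and wi: "is_wiener_ito M B 3 (hermite_kernel H c) F"
    and md: "is_malliavin_deriv M B F DF" and h: "admissible h"
    and le: "spectral_seq (l2_op (k_fun H c h)) l e" and nz: "\<And>j. j < N \<Longrightarrow> l j \<noteq> 0"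
  shows "cmod (CLINT w|M. iexp (\<theta> * dir_deriv DF h w)) \<le> (\<Prod>j<N. (1 + 36 * \<theta>\<^sup>2 * (l j)\<^sup>2) powr (- 1 / 4))"
proof -
  have f: "hermite_kernel H c \<in> borel_measurable (leb_pow 3)" using wi by (simp add: is_wiener_ito_def sq_integrable_def)
  have F: "sq_integrable M F" and DF: "sq_integrable (M \<Otimes>\<^sub>M lborel) DF" using md by (simp_all add: is_malliavin_deriv_def)
  have hs: "sq_integrable lborel h" by (rule admissible_sq_integrable[OF h])
  obtain n A a r where A: "\<And>k. elem_family (n k) (A k)"
    and E: "\<And>k. (\<integral>\<^sup>+x. ennreal ((elem_fun 3 (n k) (A k) (a k) x - hermite_kernel H c x)\<^sup>2) \<partial>leb_pow 3) = ennreal (r k)"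
      "\<And>k. 0 \<le> r k" and r: "r \<longlonglongrightarrow> 0"
    and qF: "(\<lambda>k. (\<E> w. (polyW (elem_poly (n k) (A k) (a k)) w - F w)\<^sup>2)) \<longlonglongrightarrow> 0"
    using elementary_approximation[OF wi] by blast
  obtain p' where p': "\<And>k. l2_functional (p' k)" "L2_tendsto M (\<lambda>k. poly_fun B (p' k)) F"
      "L2_tendsto (M \<Otimes>\<^sub>M lborel) (\<lambda>k. poly_deriv B (p' k)) DF"
    using md unfolding is_malliavin_deriv_def l2_functional_def by blast
  obtain K where K: "\<And>k. (\<integral>\<^sup>+x. ennreal ((poly_deriv B (p' (k + K)) x - DF x)\<^sup>2) \<partial>(M \<Otimes>\<^sub>M lborel)) < \<infinity>"
    using L2_tendsto_shift[OF p'(3)] by blast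
  define p where "p k = p' (k + K)" for k
  have pl: "l2_functional (p k)" for k by (simp add: p_def p'(1))
  have "(\<integral>\<^sup>+w. ennreal ((poly_fun B (p k) w - F w)\<^sup>2) \<partial>M) = (\<integral>\<^sup>+w. ennreal ((polyW (l2_poly (p k)) w - F w)\<^sup>2) \<partial>M)" for k
    using poly_fun_eq[OF pl[of k]] by (intro nn_integral_cong_AE) (auto elim: eventually_mono)
  then have "L2_tendsto M (\<lambda>k. polyW (l2_poly (p k))) F"
    using L2_tendsto_reindex[OF p'(2), of K] unfolding L2_tendsto_def p_def[symmetric] by simp
  then have pF: "(\<lambda>k. (\<E> w. (polyW (l2_poly (p k)) w - F w)\<^sup>2)) \<longlonglongrightarrow> 0"
    by (rule L2_tendsto_integral[OF _ all_moments_sq_integrable[OF all_moments_polyW] F])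
  have pQ: "(\<lambda>k. (\<E> w. (polyW (dpoly (l2_of h) (l2_poly (p k))) w - dir_deriv DF h w)\<^sup>2)) \<longlonglongrightarrow> 0"
    by (rule dir_deriv_tendsto[OF h DF pl]) (use L2_tendsto_reindex[OF p'(3), of K] K in \<open>simp_all add: p_def\<close>)
  have Q: "sq_integrable M (dir_deriv DF h)" by (rule dir_deriv_sq_integrable[OF h DF])
  have k: "sq_kernel (k_fun H c h)" by (rule hermite_operator(1)[OF H wi h])
  have k3: "sq_kernel (\<lambda>y z. 3 * k_fun H c h y z)" by (rule sq_kernel_cmult[OF k])
  let ?G = "\<lambda>k. chaos_kernel h (n k) (A k) (a k)"
  let ?d = "\<lambda>k. kernel_norm2 (\<lambda>y z. ?G k y z - 3 * k_fun H c h y z)"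
  let ?Y = "\<lambda>k. polyW (dpoly (l2_of h) (elem_poly (n k) (A k) (a k)))"
  have d: "?d \<longlonglongrightarrow> 0" by (rule chaos_kernel_tendsto[OF A h H f E r])
  have Y: "?Y k w = (\<Sum>p\<in>chaos_index (n k). chaos_coeff h (A k) (a k) p * wick (l2_of (chaos_left (A k) p)) (l2_of (chaos_right (A k) p)) w)" for k w
    by (rule elem_poly_deriv[OF A hs])
  have YY: "(\<E> w. (?Y k w - ?Y j w)\<^sup>2) \<le> 4 * (?d k + ?d j)" for k j
  proof -
    have "(\<E> w. (?Y k w - ?Y j w)\<^sup>2) \<le> 2 * kernel_norm2 (\<lambda>y z. ?G k y z - ?G j y z)"
      unfolding Y chaos_kernel_def
      by (rule wick_sum_diff_le[OF finite_chaos_index finite_chaos_index chaos_sq_integrable[OF A] chaos_sq_integrable[OF A]])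
    also have "kernel_norm2 (\<lambda>y z. ?G k y z - ?G j y z) \<le> 2 * (?d k + ?d j)"
      by (rule kernel_norm2_triangle[OF chaos_kernel_sq[OF A] chaos_kernel_sq[OF A] k3])
    finally show ?thesis by simp
  qed
  have lim: "(\<lambda>k. (\<E> w. (?Y k w - dir_deriv DF h w)\<^sup>2)) \<longlonglongrightarrow> 0"
  proof (rule derivative_closable[OF F Q pF pQ qF])
    fix \<epsilon> :: real assume \<epsilon>: "\<epsilon> > 0"
    then have "\<forall>\<^sub>F k in sequentially. ?d k < \<epsilon> / 8" using order_tendstoD(2)[OF d, of "\<epsilon> / 8"] by simp
    then obtain K where dK: "\<And>k. k \<ge> K \<Longrightarrow> ?d k < \<epsilon> / 8" unfolding eventually_sequentially by blast
    have arith: "x \<le> \<epsilon>" if "x \<le> 4 * (b + b')" "b < \<epsilon> / 8" "b' < \<epsilon> / 8" for x b b' :: real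
    proof -
      have "x \<le> 4 * b + 4 * b'" using that(1) by (simp only: distrib_left)
      also have "\<dots> \<le> \<epsilon> / 2 + \<epsilon> / 2" using that(2,3) by (intro add_mono) simp_all
      finally show ?thesis by simp
    qed
    have "(\<E> w. (?Y l w - ?Y k w)\<^sup>2) \<le> \<epsilon>" if "k \<ge> K" "l \<ge> K" for k l
      by (rule arith[OF YY dK[OF that(2)] dK[OF that(1)]])
    then show "\<exists>K. \<forall>k\<ge>K. \<forall>l\<ge>K. (\<E> w. (?Y l w - ?Y k w)\<^sup>2) \<le> \<epsilon>" by blast
  qed
  let ?S = "\<lambda>k w. \<Sum>p\<in>chaos_index (n k). (\<theta> * chaos_coeff h (A k) (a k) p) * wick (l2_of (chaos_left (A k) p)) (l2_of (chaos_right (A k) p)) w"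
  let ?R = "\<lambda>k. sqrt ((\<E> w. (?Y k w - dir_deriv DF h w)\<^sup>2))"
  have conv: "(\<lambda>k. (\<E> w. \<bar>\<theta> * dir_deriv DF h w - ?S k w\<bar>)) \<longlonglongrightarrow> 0"
  proof (rule tendsto_sandwich[OF _ _ tendsto_const])
    have "(\<lambda>k. \<bar>\<theta>\<bar> * ?R k) \<longlonglongrightarrow> \<bar>\<theta>\<bar> * sqrt 0"
      by (intro tendsto_intros lim)
    then show "(\<lambda>k. \<bar>\<theta>\<bar> * ?R k) \<longlonglongrightarrow> 0" by simp
    have "(\<E> w. \<bar>\<theta> * dir_deriv DF h w - ?S k w\<bar>)
        \<le> \<bar>\<theta>\<bar> * ?R k" for k
    proof -
      define X where "X w = \<bar>?Y k w - dir_deriv DF h w\<bar>" for w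
      have Xs: "sq_integrable M (\<lambda>w. ?Y k w - dir_deriv DF h w)"
        by (rule sq_integrable_diff[OF all_moments_sq_integrable[OF all_moments_polyW] Q])
      then have X: "sq_integrable M X" by (auto simp: sq_integrable_def X_def[abs_def])
      have "(expectation X)\<^sup>2 \<le> (\<E> w. (X w)\<^sup>2)"
        using square_integral_mult_le[OF X, of "\<lambda>_. 1"] by (simp add: sq_integrable_def prob_space)
      then have XE: "expectation X \<le> ?R k"
        by (intro real_le_rsqrt) (simp add: X_def)
      have "\<bar>\<theta> * dir_deriv DF h w - ?S k w\<bar>
          = \<bar>\<theta>\<bar> * X w" for w
      proof -
        have "?S k w = \<theta> * ?Y k w"
          unfolding Y sum_distrib_left by (simp only: mult.assoc)
        then show ?thesis by (simp only: X_def right_diff_distrib[symmetric] abs_mult abs_minus_commute)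
      qed
      then show ?thesis using XE by (simp add: mult_left_mono)
    qed
    then show "\<forall>\<^sub>F k in sequentially. (\<E> w. \<bar>\<theta> * dir_deriv DF h w - ?S k w\<bar>)
        \<le> \<bar>\<theta>\<bar> * ?R k" by (intro always_eventually allI)
  qed simp
  have Ae: "l2_op (k_fun H c h) (e j) = l j *\<^sub>R e j" for j using le by (simp add: spectral_seq_def)
  have orth: "e i \<bullet> e j = (if i = j then 1 else 0)" if "i < N" for i j
    using le nz[OF that] unfolding spectral_seq_def by blast
  have "cmod (CLINT w|M. iexp (\<theta> * dir_deriv DF h w)) \<le> (\<Prod>j<N. (1 + 4 * (\<theta> * 3 * l j)\<^sup>2) powr (- 1 / 4))"
  proof (rule char_bound_second_chaos[where e = e and l = "\<lambda>j. \<theta> * 3 * l j" and I = "\<lambda>k. chaos_index (n k)"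
        and m = "\<lambda>k p. \<theta> * chaos_coeff h (A k) (a k) p" and f = "\<lambda>k p. l2_of (chaos_left (A k) p)" and g = "\<lambda>k p. l2_of (chaos_right (A k) p)"])
    show "finite (chaos_index (n k))" for k by (rule finite_chaos_index)
    show "e i \<bullet> e j = (if i = j then 1 else 0)" if "i < N" "j < N" for i j by (rule orth[OF that(1)])
    show "integrable M (\<lambda>w. \<theta> * dir_deriv DF h w)"
      using sq_integrable_mult[OF Q, of "\<lambda>_. 1"] by (simp add: sq_integrable_def)
    fix j assume "j < N"
    have "(\<lambda>k. \<theta> *\<^sub>R l2_op (?G k) (e j)) \<longlonglongrightarrow> \<theta> *\<^sub>R l2_op (\<lambda>y z. 3 * k_fun H c h y z) (e j)"
      by (intro tendsto_intros l2_op_tendsto[OF k3 chaos_kernel_sq[OF A] d])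
    then show "(\<lambda>k. \<Sum>p\<in>chaos_index (n k). (\<theta> * chaos_coeff h (A k) (a k) p * (l2_of (chaos_right (A k) p) \<bullet> e j)) *\<^sub>R l2_of (chaos_left (A k) p)) \<longlonglongrightarrow> (\<theta> * 3 * l j) *\<^sub>R e j"
      unfolding l2_op_chaos_kernel(1)[OF A] l2_op_cmult[OF k] Ae by (simp add: scaleR_sum_right mult.assoc)
    have dt: "(\<lambda>k. kernel_norm2 (\<lambda>y z. ?G k z y - 3 * k_fun H c h y z)) \<longlonglongrightarrow> 0"
    proof -
      have "kernel_norm2 (\<lambda>y z. ?G k z y - 3 * k_fun H c h y z) = ?d k" for k
      proof -
        have "(\<lambda>y z. ?G k z y - 3 * k_fun H c h y z) = (\<lambda>y z. ?G k z y - 3 * k_fun H c h z y)"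
          by (intro ext) (simp only: k_fun_sym[of H c h])
        then show ?thesis using kernel_norm2_transpose(2)[OF sq_kernel_diff[OF chaos_kernel_sq[OF A] k3], of h k "a k"]
          by simp
      qed
      then show ?thesis using d by simp
    qed
    have "(\<lambda>k. \<theta> *\<^sub>R l2_op (\<lambda>y z. ?G k z y) (e j)) \<longlonglongrightarrow> \<theta> *\<^sub>R l2_op (\<lambda>y z. 3 * k_fun H c h y z) (e j)"
      by (intro tendsto_intros l2_op_tendsto[OF k3 kernel_norm2_transpose(1)[OF chaos_kernel_sq[OF A]] dt])
    then show "(\<lambda>k. \<Sum>p\<in>chaos_index (n k). (\<theta> * chaos_coeff h (A k) (a k) p * (l2_of (chaos_left (A k) p) \<bullet> e j)) *\<^sub>R l2_of (chaos_right (A k) p)) \<longlonglongrightarrow> (\<theta> * 3 * l j) *\<^sub>R e j"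
      unfolding l2_op_chaos_kernel(2)[OF A] l2_op_cmult[OF k] Ae by (simp add: scaleR_sum_right mult.assoc)
  qed (rule conv)
  also have "\<dots> = (\<Prod>j<N. (1 + 36 * \<theta>\<^sup>2 * (l j)\<^sup>2) powr (- 1 / 4))"
    by (simp add: power_mult_distrib mult_ac)
  finally show ?thesis .
qed

end

section \<open>Density of the derivative vector\<close>

lemma orthonormal_combination_nonzero:
  fixes h :: "'m::finite \<Rightarrow> real \<Rightarrow> real" and u :: "real ^ 'm"
  assumes h: "\<And>i. admissible (h i)"
    and o: "\<And>i j. (LINT r:{0<..<1}|lborel. h i r * h j r) = (if i = j then 1 else 0)" and u: "u \<noteq> 0"
  shows "\<exists>r. (\<Sum>i\<in>UNIV. u $ i * h i r) \<noteq> 0"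
proof (rule ccontr)
  assume "\<not> ?thesis"
  then have z: "(\<Sum>i\<in>UNIV. u $ i * h i r) = 0" for r by blast
  obtain j where j: "u $ j \<noteq> 0" using u by (auto simp: vec_eq_iff)
  have i: "set_integrable lborel {0<..<1} (\<lambda>r. h i r * h j r)" for i
    by (rule set_integrable_subset[of _ UNIV])
       (use sq_integrable_mult[OF admissible_sq_integrable[OF h] admissible_sq_integrable[OF h]] in \<open>auto simp: set_integrable_def\<close>)
  have "0 = (LINT r:{0<..<1}|lborel. (\<Sum>i\<in>UNIV. u $ i * h i r) * h j r)" by (simp add: z)
  also have "\<dots> = (LINT r:{0<..<1}|lborel. (\<Sum>i\<in>UNIV. u $ i * (h i r * h j r)))"
    by (simp only: sum_distrib_right mult.assoc)
  also have "\<dots> = (\<Sum>i\<in>UNIV. u $ i * (LINT r:{0<..<1}|lborel. h i r * h j r))"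
  proof -
    have "(LINT r:{0<..<1}|lborel. (\<Sum>i\<in>UNIV. u $ i * (h i r * h j r)))
        = (\<integral>r. (\<Sum>i\<in>UNIV. u $ i * (indicator {0<..<1} r *\<^sub>R (h i r * h j r))) \<partial>lborel)"
      unfolding set_lebesgue_integral_def by (simp add: sum_distrib_left mult_ac)
    also have "\<dots> = (\<Sum>i\<in>UNIV. \<integral>r. u $ i * (indicator {0<..<1} r *\<^sub>R (h i r * h j r)) \<partial>lborel)"
      by (intro integral_sum integrable_mult_right i[unfolded set_integrable_def])
    finally show ?thesis unfolding set_lebesgue_integral_def by (simp only: integral_mult_right_zero)
  qed
  also have "\<dots> = u $ j" by (simp add: o if_distrib cong: if_cong)
  finally show False using j by simp
qed

lemma borel_measurable_vec_lambda:
  fixes f :: "'m::finite \<Rightarrow> 'a \<Rightarrow> real"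
  assumes "\<And>i. f i \<in> borel_measurable N"
  shows "(\<lambda>x. \<chi> i. f i x) \<in> borel_measurable N"
  using assms by (subst borel_measurable_euclidean_space) (auto simp: Basis_vec_def inner_axis)

context isonormal_process
begin

text \<open>Continuity comes from Weyl's inequality, since the operator depends linearly on \<open>u\<close>; positivity from the definite
form and the linear independence of the \<open>h i\<close>.\<close>

lemma hermite_singular_value:
  fixes h :: "'m::finite \<Rightarrow> real \<Rightarrow> real"
  assumes H: "1/2 < H" "H < 1" and c: "0 < c" and wi: "is_wiener_ito M B 3 (hermite_kernel H c) F"
    and h: "\<And>i. admissible (h i)"
    and o: "\<And>i j. (LINT r:{0<..<1}|lborel. h i r * h j r) = (if i = j then 1 else 0)"
  defines "s N u \<equiv> singular_value (k_fun H c (\<lambda>r. \<Sum>i\<in>UNIV. u $ i * h i r)) N"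
  shows "continuous_on UNIV (s N)" and "u \<noteq> 0 \<Longrightarrow> 0 < s N u"
proof -
  let ?h = "\<lambda>u r. \<Sum>i\<in>UNIV. u $ i * h i r"
  let ?A = "\<lambda>u. l2_op (k_fun H c (?h u))"
  have hu: "admissible (?h u)" for u by (rule admissible_sum) (rule h)
  note op = hermite_operator[OF H wi]
  define b where "b i = sqrt (kernel_norm2 (k_fun H c (h i)))" for i
  have b0: "0 \<le> b i" for i by (simp add: b_def kernel_norm2_nonneg)
  define d where "d u v = (\<Sum>i\<in>UNIV. \<bar>u $ i - v $ i\<bar> * b i)" for u v :: "real ^ 'm"
  have d0: "0 \<le> d u v" for u v unfolding d_def by (intro sum_nonneg mult_nonneg_nonneg b0) simp
  have b: "norm (l2_op (k_fun H c (h i)) G) \<le> b i * norm G" for i G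
  proof -
    have "(norm (l2_op (k_fun H c (h i)) G))\<^sup>2 \<le> (b i * norm G)\<^sup>2"
      using norm_l2_op[OF op(1)[OF h], of i G] by (simp add: b_def power_mult_distrib kernel_norm2_nonneg)
    then show ?thesis by (rule power2_le_imp_le) (simp add: b0)
  qed
  have diff: "norm (?A u G - ?A v G) \<le> d u v * norm G" for u v G
  proof -
    have "?A u G - ?A v G = (\<Sum>i\<in>UNIV. (u $ i - v $ i) *\<^sub>R l2_op (k_fun H c (h i)) G)"
      by (simp add: hermite_operator_linear[OF H wi h] scaleR_diff_left sum_subtractf)
    also have "norm \<dots> \<le> (\<Sum>i\<in>UNIV. \<bar>u $ i - v $ i\<bar> * (b i * norm G))"
      by (rule sum_norm_le) (simp add: mult_left_mono b)
    finally show ?thesis by (simp add: d_def sum_distrib_right mult.assoc)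
  qed
  have le: "s N u \<le> s N v + d u v" for u v
  proof -
    obtain l e where l: "spectral_seq (?A u) l e" using op(3)[OF hu] by blast
    obtain l' e' where l': "spectral_seq (?A v) l' e'" using op(3)[OF hu] by blast
    have "\<bar>l (N - 1)\<bar> \<le> \<bar>l' (N - 1)\<bar> + d u v"
      by (rule spectral_seq_perturbation[OF l bounded_linear_l2_op[OF op(1)[OF hu]] l' diff d0])
    then show ?thesis unfolding s_def op(4)[OF hu l] op(4)[OF hu l'] .
  qed
  have sym: "d v u = d u v" for u v by (simp add: d_def abs_minus_commute)
  show "continuous_on UNIV (s N)"
    unfolding continuous_on_def
  proof (intro ballI)
    fix u :: "real ^ 'm"
    have "((\<lambda>v. d v u) \<longlongrightarrow> d u u) (at u within UNIV)" unfolding d_def by (intro tendsto_intros)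
    then have 0: "((\<lambda>v. d v u) \<longlongrightarrow> 0) (at u within UNIV)" by (simp add: d_def)
    have "((\<lambda>v. s N v - s N u) \<longlongrightarrow> 0) (at u within UNIV)"
    proof (rule Lim_null_comparison[OF _ 0], rule always_eventually, rule allI)
      fix v show "norm (s N v - s N u) \<le> d v u" using le[of v u] le[of u v] sym[of u v] by (simp add: abs_le_iff)
    qed
    then show "(s N \<longlongrightarrow> s N u) (at u within UNIV)" by (simp add: LIM_zero_iff)
  qed
  show "0 < s N u" if u: "u \<noteq> 0"
  proof -
    obtain r0 where r0: "?h u r0 \<noteq> 0" using orthonormal_combination_nonzero[OF h o u] by blast
    obtain l e where l: "spectral_seq (?A u) l e" using op(3)[OF hu] by blast
    obtain f :: "nat \<Rightarrow> l2" where f: "\<forall>\<gamma>. (\<exists>j\<le>N - 1. \<gamma> j \<noteq> 0) \<longrightarrow>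
        ?A u (\<Sum>j\<le>N - 1. \<gamma> j *\<^sub>R f j) \<bullet> (\<Sum>j\<le>N - 1. \<gamma> j *\<^sub>R f j) \<noteq> 0"
      using k_fun_form_definite[OF hu r0 H c op(1)[OF hu], of "N - 1"] by blast
    have "l (N - 1) \<noteq> 0" by (rule spectral_seq_nonzero[OF l, of "N - 1" f]) (use f in blast)
    then show ?thesis unfolding s_def op(4)[OF hu l] by simp
  qed
qed

lemma dir_deriv_sum:
  assumes DF: "sq_integrable (M \<Otimes>\<^sub>M lborel) DF" and h: "\<And>i. i \<in> I \<Longrightarrow> admissible (h i)" and I: "finite I"
  shows "AE w in M. (\<Sum>i\<in>I. u i * dir_deriv DF (h i) w) = dir_deriv DF (\<lambda>r. \<Sum>i\<in>I. u i * h i r) w"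
proof -
  have "AE w in M. \<forall>i\<in>I. integrable lborel (\<lambda>r. h i r * DF (w, r))"
    by (intro AE_finite_allI I section_inner_bound(1)[OF admissible_sq_integrable[OF h] DF])
  then show ?thesis
  proof eventually_elim
    case (elim w)
    have g: "admissible (\<lambda>r. \<Sum>i\<in>I. u i * h i r)" by (rule admissible_sum) (rule h)
    have "dir_deriv DF (\<lambda>r. \<Sum>i\<in>I. u i * h i r) w = (\<integral>r. (\<Sum>i\<in>I. u i * (h i r * DF (w, r))) \<partial>lborel)"
      unfolding dir_deriv_eq[OF g] by (simp only: sum_distrib_right mult.assoc)
    also have "\<dots> = (\<Sum>i\<in>I. \<integral>r. u i * (h i r * DF (w, r)) \<partial>lborel)"
      by (intro integral_sum integrable_mult_right) (use elim in blast)
    also have "\<dots> = (\<Sum>i\<in>I. u i * dir_deriv DF (h i) w)"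
      by (intro sum.cong refl) (simp add: dir_deriv_eq[OF h])
    finally show ?case by simp
  qed
qed

text \<open>In polar form \<open>t = \<bar>t\<bar> u\<close> the inner product is \<open>\<bar>t\<bar>\<close> times the derivative in the single direction \<open>h\<^sub>u\<close>.\<close>

lemma char_vector_bound:
  fixes h :: "'m::finite \<Rightarrow> real \<Rightarrow> real" and t :: "real ^ 'm"
  assumes H: "1/2 < H" "H < 1" and wi: "is_wiener_ito M B 3 (hermite_kernel H c) F"
    and md: "is_malliavin_deriv M B F DF" and h: "\<And>i. admissible (h i)"
    and s0: "0 < s0"
    and s: "\<And>u :: real ^ 'm. norm u = 1 \<Longrightarrow> s0 \<le> singular_value (k_fun H c (\<lambda>r. \<Sum>i\<in>UNIV. u $ i * h i r)) N"
  shows "cmod (CLINT w|M. iexp (t \<bullet> (\<chi> i. dir_deriv DF (h i) w))) \<le> (1 + (6 * s0)\<^sup>2 * (norm t)\<^sup>2) powr (- (real N / 4))"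
proof -
  have DF: "sq_integrable (M \<Otimes>\<^sub>M lborel) DF" using md by (simp add: is_malliavin_deriv_def)
  obtain u :: "real ^ 'm" where u: "norm u = 1" "t = norm t *\<^sub>R u"
  proof (cases "t = 0")
    case True
    then show ?thesis using that[of "axis undefined 1"] by (simp add: norm_axis_1)
  next
    case False
    then show ?thesis using that[of "t /\<^sub>R norm t"] by simp
  qed
  define g where "g r = (\<Sum>i\<in>UNIV. u $ i * h i r)" for r
  have g: "admissible g" unfolding g_def[abs_def] by (rule admissible_sum) (rule h)
  note op = hermite_operator[OF H wi g]
  obtain l e where l: "spectral_seq (l2_op (k_fun H c g)) l e" using op(3) by blast
  have dec: "decseq (\<lambda>n. \<bar>l n\<bar>)" using l by (simp add: spectral_seq_def)
  have ls: "s0 \<le> \<bar>l j\<bar>" if "j < N" for j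
  proof -
    have "s0 \<le> \<bar>l (N - 1)\<bar>" using s[OF u(1)] op(4)[OF l, of N] by (simp add: g_def[abs_def])
    also have "\<dots> \<le> \<bar>l j\<bar>" by (rule decseqD[OF dec]) (use that in simp)
    finally show ?thesis .
  qed
  have "AE w in M. (\<Sum>i\<in>UNIV. u $ i * dir_deriv DF (h i) w) = dir_deriv DF g w"
    unfolding g_def[abs_def] by (rule dir_deriv_sum[OF DF h]) simp
  then have "AE w in M. t \<bullet> (\<chi> i. dir_deriv DF (h i) w) = norm t * dir_deriv DF g w"
  proof eventually_elim
    case (elim w)
    have "t \<bullet> (\<chi> i. dir_deriv DF (h i) w) = norm t * (\<Sum>i\<in>UNIV. u $ i * dir_deriv DF (h i) w)"
      by (subst u(2)) (simp add: inner_vec_def sum_distrib_left mult.assoc)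
    then show ?case by (simp only: elim)
  qed
  then have "(CLINT w|M. iexp (t \<bullet> (\<chi> i. dir_deriv DF (h i) w))) = (CLINT w|M. iexp (norm t * dir_deriv DF g w))"
  proof (intro integral_cong_AE)
    have [measurable]: "dir_deriv DF f \<in> borel_measurable M" if "admissible f" for f
      using dir_deriv_sq_integrable[OF that DF] by (simp add: sq_integrable_def)
    have [measurable]: "(\<lambda>w. \<chi> i. dir_deriv DF (h i) w) \<in> borel_measurable M"
      by (rule borel_measurable_vec_lambda) (simp add: h)
    show "(\<lambda>w. iexp (t \<bullet> (\<chi> i. dir_deriv DF (h i) w))) \<in> borel_measurable M" by measurable
    show "(\<lambda>w. iexp (norm t * dir_deriv DF g w)) \<in> borel_measurable M" using g by measurable
  qed (auto elim: eventually_mono)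
  also have "cmod \<dots> \<le> (\<Prod>j<N. (1 + 36 * (norm t)\<^sup>2 * (l j)\<^sup>2) powr (- 1 / 4))"
    by (rule dir_deriv_char_bound[OF H wi md g l]) (use ls s0 in force)
  also have "\<dots> \<le> (\<Prod>j<N. (1 + (6 * s0)\<^sup>2 * (norm t)\<^sup>2) powr (- 1 / 4))"
  proof (rule prod_mono, rule conjI)
    fix j assume "j \<in> {..<N}"
    then have "s0\<^sup>2 \<le> \<bar>l j\<bar>\<^sup>2" by (intro power_mono ls) (use s0 in auto)
    then have "(6 * s0)\<^sup>2 * (norm t)\<^sup>2 \<le> 36 * (norm t)\<^sup>2 * (l j)\<^sup>2"
      using mult_right_mono[of "s0\<^sup>2" "(l j)\<^sup>2" "(norm t)\<^sup>2"] by (simp add: power_mult_distrib mult.commute)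
    then show "(1 + 36 * (norm t)\<^sup>2 * (l j)\<^sup>2) powr (- 1 / 4) \<le> (1 + (6 * s0)\<^sup>2 * (norm t)\<^sup>2) powr (- 1 / 4)"
      by (intro powr_mono2') (auto intro: add_pos_nonneg)
  qed simp
  also have "\<dots> = (1 + (6 * s0)\<^sup>2 * (norm t)\<^sup>2) powr (- (real N / 4))"
  proof -
    have "0 < 1 + (6 * s0)\<^sup>2 * (norm t)\<^sup>2" by (intro add_pos_nonneg) auto
    then show ?thesis by (simp add: powr_powr[symmetric] powr_realpow[symmetric] powr_powr)
  qed
  finally show ?thesis .
qed

end

lemma char_integral_bound:
  fixes \<phi> :: "'a::euclidean_space \<Rightarrow> complex"
  assumes [measurable]: "\<phi> \<in> borel_measurable borel" and p: "p > real DIM('a) / 2" and a: "a > 0"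
    and \<phi>: "\<And>t. cmod (\<phi> t) \<le> (1 + a\<^sup>2 * (norm t)\<^sup>2) powr (- p)"
  shows "integrable lborel \<phi>"
    and "(\<integral>t. cmod (\<phi> t) \<partial>lborel) \<le> pi powr (real DIM('a) / 2) / a ^ DIM('a) * (Gamma (p - real DIM('a) / 2) / Gamma p)"
proof -
  let ?K = "pi powr (real DIM('a) / 2) / a ^ DIM('a) * (Gamma (p - real DIM('a) / 2) / Gamma p)"
  have K0: "0 \<le> ?K" using p a by (intro mult_nonneg_nonneg divide_nonneg_nonneg Gamma_real_nonneg) auto
  have "(\<integral>\<^sup>+t. ennreal (cmod (\<phi> t)) \<partial>lborel) \<le> (\<integral>\<^sup>+(t::'a). ennreal ((1 + a\<^sup>2 * (norm t)\<^sup>2) powr (- p)) \<partial>lborel)"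
    by (intro nn_integral_mono ennreal_leI \<phi>)
  also have "\<dots> = ennreal ?K" by (rule nn_integral_japanese_bracket[OF p a])
  finally have le: "(\<integral>\<^sup>+t. ennreal (cmod (\<phi> t)) \<partial>lborel) \<le> ennreal ?K" .
  show i: "integrable lborel \<phi>"
    unfolding integrable_iff_bounded using le_less_trans[OF le] by auto
  have "ennreal (\<integral>t. cmod (\<phi> t) \<partial>lborel) \<le> ennreal ?K"
    using le nn_integral_eq_integral[OF integrable_norm[OF i]] by simp
  then show "(\<integral>t. cmod (\<phi> t) \<partial>lborel) \<le> ?K" using K0 by (subst (asm) ennreal_le_iff) auto
qed

theorem proposition4p1:
  fixes M :: "'a measure"
    and B :: "(real \<Rightarrow> real) \<Rightarrow> 'a \<Rightarrow> real"
    and H c :: real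
    and F :: "'a \<Rightarrow> real"
    and DF :: "'a \<times> real \<Rightarrow> real"
    and h :: "'m::finite \<Rightarrow> real \<Rightarrow> real"
  assumes "prob_space M"
    and "isonormal M B"
    and "1/2 < H" and "H < 1"
    and "0 < c"
    and "is_wiener_ito M B 3 (hermite_kernel H c) F"
    and "(\<integral>\<omega>. (F \<omega>)\<^sup>2 \<partial>M) = 1"
    and "is_malliavin_deriv M B F DF"
    and "\<And>i. test_function (h i)"
    and "\<And>i j. (LINT r:{0<..<1}|lborel. h i r * h j r) = (if i = j then 1 else 0)"
  shows "\<exists>\<rho> :: real ^ 'm \<Rightarrow> real.
           (\<forall>x. 0 \<le> \<rho> x) \<and> continuous_on UNIV \<rho> \<and> bounded (range \<rho>) \<and>
           distributed M lborel (\<lambda>\<omega>. \<chi> i. dir_deriv DF (h i) \<omega>) (\<lambda>x. ennreal (\<rho> x)) \<and>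
           (\<forall>N::nat. 2 * CARD('m) < N \<longrightarrow>
              (\<exists>c\<^sub>m\<^sub>N :: real.
                 (\<exists>u \<in> sphere (0 :: real ^ 'm) 1.
                    c\<^sub>m\<^sub>N = singular_value (k_fun H c (\<lambda>r. \<Sum>i\<in>UNIV. u $ i * h i r)) N) \<and>
                 (\<forall>u \<in> sphere (0 :: real ^ 'm) 1.
                    c\<^sub>m\<^sub>N \<le> singular_value (k_fun H c (\<lambda>r. \<Sum>i\<in>UNIV. u $ i * h i r)) N) \<and>
                 0 < c\<^sub>m\<^sub>N \<and>
                 (SUP x. \<bar>\<rho> x\<bar>) \<le>
                   pi powr (real CARD('m) / 2) / ((2 * pi) ^ CARD('m) * (6 * c\<^sub>m\<^sub>N) ^ CARD('m)) *
                   (Gamma (real N / 4 - real CARD('m) / 2) / Gamma (real N / 4))))"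
proof -
  interpret isonormal_process M B using assms(1,2) by (simp add: isonormal_process_def isonormal_process_axioms_def)
  note H = assms(3,4) and c = assms(5) and wi = assms(6) and md = assms(8) and ort = assms(10)
  have h: "admissible (h i)" for i by (rule test_function_admissible[OF assms(9)])
  have DF: "sq_integrable (M \<Otimes>\<^sub>M lborel) DF" using md by (simp add: is_malliavin_deriv_def)
  define s where "s N u = singular_value (k_fun H c (\<lambda>r. \<Sum>i\<in>UNIV. u $ i * h i r)) N" for N :: nat and u :: "real ^ 'm"
  have sc: "continuous_on UNIV (s N)" and spos: "u \<noteq> 0 \<Longrightarrow> 0 < s N u" for N :: nat and u :: "real ^ 'm"
    using hermite_singular_value[OF H c wi h ort, where N = N] unfolding s_def[abs_def] by blast+
  have min: "\<exists>u\<in>sphere (0 :: real ^ 'm) 1. \<forall>v\<in>sphere 0 1. s N u \<le> s N v" for N :: nat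
    by (rule continuous_attains_inf) (auto intro!: continuous_on_subset[OF sc] exI[of _ "axis undefined 1"])
  define X where "X w = (\<chi> i. dir_deriv DF (h i) w)" for w
  have [measurable]: "dir_deriv DF (h i) \<in> borel_measurable M" for i
    using dir_deriv_sq_integrable[OF h DF] by (simp add: sq_integrable_def)
  have X [measurable]: "X \<in> borel_measurable M"
    unfolding X_def by (rule borel_measurable_vec_lambda) measurable
  define \<mu> where "\<mu> = distr M borel X"
  interpret \<mu>: prob_space \<mu> unfolding \<mu>_def by (rule prob_space_distr) measurable
  have sets_\<mu> [measurable_cong, simp]: "sets \<mu> = sets borel" by (simp add: \<mu>_def)
  define \<phi> where "\<phi> t = (CLINT y|\<mu>. iexp (t \<bullet> y))" for t :: "real ^ 'm"
  have \<phi>m: "\<phi> \<in> borel_measurable borel" unfolding \<phi>_def by measurable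
  have \<phi>X: "\<phi> t = (CLINT w|M. iexp (t \<bullet> X w))" for t
    unfolding \<phi>_def \<mu>_def by (rule integral_distr) measurable
  have key: "\<exists>u\<in>sphere 0 1. (\<forall>v\<in>sphere 0 1. s N u \<le> s N v) \<and> 0 < s N u \<and> integrable lborel \<phi> \<and>
      (\<integral>t. cmod (\<phi> t) \<partial>lborel) \<le> pi powr (real CARD('m) / 2) / (6 * s N u) ^ CARD('m) * (Gamma (real N / 4 - real CARD('m) / 2) / Gamma (real N / 4))"
    if N: "2 * CARD('m) < N" for N :: nat
  proof -
    obtain u where u: "u \<in> sphere 0 1" "\<forall>v\<in>sphere 0 1. s N u \<le> s N v" using min by blast
    have pos: "0 < s N u" by (rule spos) (use u(1) in auto)
    have bd: "cmod (\<phi> t) \<le> (1 + (6 * s N u)\<^sup>2 * (norm t)\<^sup>2) powr (- (real N / 4))" for t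
      unfolding \<phi>X X_def by (rule char_vector_bound[OF H wi md h pos]) (use u(2) in \<open>simp add: s_def\<close>)
    have "real N / 4 > real DIM(real ^ 'm) / 2" using N by simp
    from char_integral_bound[OF \<phi>m this _ bd] pos u show ?thesis by (intro bexI[of _ u]) auto
  qed
  \<comment> \<open>the smallest admissible \<open>N\<close> gives one density; the bound for every other \<open>N\<close> concerns the same one\<close>
  have "integrable lborel \<phi>" using key[of "2 * CARD('m) + 1"] by auto
  then obtain \<rho> where \<rho>0: "\<And>x. 0 \<le> \<rho> x" and \<rho>c: "continuous_on UNIV \<rho>"
    and \<rho>b: "\<And>x. \<rho> x \<le> (\<integral>t. cmod (\<phi> t) \<partial>lborel) / (2 * pi) ^ CARD('m)" and \<mu>\<rho>: "\<mu> = density lborel (\<lambda>x. ennreal (\<rho> x))"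
    using density_from_integrable_char[OF \<mu>.prob_space_axioms sets_\<mu>] unfolding \<phi>_def by auto
  have [measurable]: "\<rho> \<in> borel_measurable borel" by (rule borel_measurable_continuous_onI[OF \<rho>c])
  have dist: "distributed M lborel X (\<lambda>x. ennreal (\<rho> x))"
    unfolding distributed_def
  proof (intro conjI)
    have "distr M lborel X = distr M borel X" by (rule distr_cong) simp_all
    then show "distr M lborel X = density lborel (\<lambda>x. ennreal (\<rho> x))" using \<mu>\<rho> by (simp add: \<mu>_def)
  qed measurable
  have bdd: "bounded (range \<rho>)"
    unfolding bounded_iff using \<rho>0 \<rho>b by (intro exI[of _ "(\<integral>t. cmod (\<phi> t) \<partial>lborel) / (2 * pi) ^ CARD('m)"]) auto
  have final: "\<exists>c\<^sub>m\<^sub>N :: real.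
                 (\<exists>u \<in> sphere (0 :: real ^ 'm) 1.
                    c\<^sub>m\<^sub>N = singular_value (k_fun H c (\<lambda>r. \<Sum>i\<in>UNIV. u $ i * h i r)) N) \<and>
                 (\<forall>u \<in> sphere (0 :: real ^ 'm) 1.
                    c\<^sub>m\<^sub>N \<le> singular_value (k_fun H c (\<lambda>r. \<Sum>i\<in>UNIV. u $ i * h i r)) N) \<and>
                 0 < c\<^sub>m\<^sub>N \<and>
                 (SUP x. \<bar>\<rho> x\<bar>) \<le>
                   pi powr (real CARD('m) / 2) / ((2 * pi) ^ CARD('m) * (6 * c\<^sub>m\<^sub>N) ^ CARD('m)) *
                   (Gamma (real N / 4 - real CARD('m) / 2) / Gamma (real N / 4))" if N: "2 * CARD('m) < N" for N :: nat
  proof -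
    let ?G = "Gamma (real N / 4 - real CARD('m) / 2) / Gamma (real N / 4)"
    obtain u where u: "u \<in> sphere 0 1" "\<forall>v\<in>sphere 0 1. s N u \<le> s N v" "0 < s N u"
      and I: "(\<integral>t. cmod (\<phi> t) \<partial>lborel) \<le> pi powr (real CARD('m) / 2) / (6 * s N u) ^ CARD('m) * ?G"
      using key[OF N] by blast
    have "(SUP x. \<bar>\<rho> x\<bar>) \<le> (\<integral>t. cmod (\<phi> t) \<partial>lborel) / (2 * pi) ^ CARD('m)"
      by (rule cSUP_least) (use \<rho>0 \<rho>b in auto)
    also have "\<dots> \<le> (pi powr (real CARD('m) / 2) / (6 * s N u) ^ CARD('m) * ?G) / (2 * pi) ^ CARD('m)"
      by (intro divide_right_mono I) simp
    also have "\<dots> = pi powr (real CARD('m) / 2) / ((2 * pi) ^ CARD('m) * (6 * s N u) ^ CARD('m)) * ?G" by (simp add: mult_ac)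
    finally show ?thesis using u by (intro exI[of _ "s N u"] conjI) (auto simp: s_def)
  qed
  show ?thesis
    by (intro exI[of _ \<rho>] conjI allI impI final dist[unfolded X_def[abs_def]]) (use \<rho>0 \<rho>c bdd in auto)
qed

end
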